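(* Let $F(\lambda,t)$ be a real-analytic $d\times d$ matrix-valued function (of two real variables near the origin), Hermitian for real $(\lambda,t)$, with $$F(0,0)=0,\qquad \partial_\lambda F(0,0)>0 .$$ Then there exist real-analytic functions $\lambda_1(t),\dots,\lambda_d(t)$ with $\lambda_k(0)=0$ such that, in a neighborhood of the origin, $$\det F(\lambda,t)=0\quad\Longleftrightarrow\quad \lambda\in\{\lambda_1(t),\dots,\lambda_d(t)\}.$$ Moreover, with the derivatives $\partial_\lambda F$ and $\partial_tF$ evaluated at the origin: (a) for all sufficiently small $t>0$, the number of positive branches equals the negative inertia of $F(0,t)$: $$\#\{k:\lambda_k(t)>0\}=n_-\big(F(0,t)\big);$$ (b) the rates $\{p_k\}\subset\mathbb N$ occurring among the branches $\lambda_k\sim c_k\,t^{p_k}$ are, with multiplicity, the rates occurring among the eigenvalues of $F(0,t)$; (c) the slopes $\lambda_1'(0),\dots,\lambda_d'(0)$ are, with multiplicity, the eigenvalues of $$-(\partial_\lambda F)^{-1/2}\,\partial_tF\,(\partial_\lambda F)^{-1/2},$$ or, equivalently, the roots $\rho$ of $\det(\rho\,\partial_\lambda F+\partial_tF)=0$.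
   Context: Matrices have complex entries. For a Hermitian matrix $H$, $H>0$ means positive definite, and $n_-(H)$ is the number of negative eigenvalues of $H$ counted with multiplicity. The rate of a (not identically zero) function $g(t)$ is the exponent $p$ in $g(t)\sim c\,t^p$, $c\neq0$, as $t\to0^+$; the eigenvalues of the Hermitian real-analytic one-parameter family $F(0,t)$ are labeled as real-analytic functions of $t$. *)

theory Defs
  imports
    "HOL-Analysis.Derivative"
    "HOL-Analysis.Infinite_Sum"
    "HOL-Library.Landau_Symbols"
    "HOL-Computational_Algebra.Polynomial"
    "Jordan_Normal_Form.Schur_Decomposition"
begin

section \<open>Real-analytic functions\<close>

definition real_analytic_at :: "(real \<Rightarrow> 'a::real_normed_vector) \<Rightarrow> real \<Rightarrow> bool" where
  "real_analytic_at f x0 \<longleftrightarrow>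
     (\<exists>r>0. \<exists>a :: nat \<Rightarrow> 'a. \<forall>x. \<bar>x - x0\<bar> < r \<longrightarrow>
        (\<lambda>n. (x - x0) ^ n *\<^sub>R a n) sums f x)"

text \<open>The double series is summed unconditionally over all pairs of exponents.\<close>

definition real_analytic2_at :: "(real \<Rightarrow> real \<Rightarrow> 'a::real_normed_vector) \<Rightarrow> real \<Rightarrow> real \<Rightarrow> bool" where
  "real_analytic2_at f x0 y0 \<longleftrightarrow>
     (\<exists>r>0. \<exists>a :: nat \<Rightarrow> nat \<Rightarrow> 'a. \<forall>x y. \<bar>x - x0\<bar> < r \<longrightarrow> \<bar>y - y0\<bar> < r \<longrightarrow>
        ((\<lambda>(m, n). ((x - x0) ^ m * (y - y0) ^ n) *\<^sub>R a m n) has_sum f x y) UNIV)"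

definition has_rate :: "(real \<Rightarrow> real) \<Rightarrow> nat \<Rightarrow> bool" where
  "has_rate g p \<longleftrightarrow> (\<exists>c. c \<noteq> 0 \<and> g \<sim>[at_right 0] (\<lambda>t. c * t ^ p))"

section \<open>Complex matrices\<close>

definition hermitian_mat :: "complex mat \<Rightarrow> bool" where
  "hermitian_mat A \<longleftrightarrow> square_mat A \<and> mat_adjoint A = A"

definition pos_def_mat :: "complex mat \<Rightarrow> bool" where
  "pos_def_mat A \<longleftrightarrow> hermitian_mat A \<and>
     (\<forall>v \<in> carrier_vec (dim_row A). v \<noteq> 0\<^sub>v (dim_row A) \<longrightarrow> 0 < Re ((A *\<^sub>v v) \<bullet>c v))"

definition eigenvalue_mset :: "complex mat \<Rightarrow> complex multiset" where
  "eigenvalue_mset A = proots (char_poly A)"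

definition neg_inertia :: "complex mat \<Rightarrow> nat" where
  "neg_inertia H = size {# z \<in># eigenvalue_mset H. z \<in> \<real> \<and> Re z < 0 #}"

text \<open>For positive definite \<open>A\<close> this is \<open>A\<close> to the power \<open>-1/2\<close>: the positive definite
  square root of the inverse of \<open>A\<close>.\<close>

definition inv_sqrt_mat :: "complex mat \<Rightarrow> complex mat" where
  "inv_sqrt_mat A = (THE R. R \<in> carrier_mat (dim_row A) (dim_row A) \<and>
     pos_def_mat R \<and> inverts_mat A (R * R))"

definition mat_deriv :: "(real \<Rightarrow> complex mat) \<Rightarrow> real \<Rightarrow> complex mat" where
  "mat_deriv G s = mat (dim_row (G s)) (dim_col (G s))
     (\<lambda>(i, j). vector_derivative (\<lambda>x. G x $$ (i, j)) (at s))"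

definition mat_partial1 :: "(real \<Rightarrow> real \<Rightarrow> complex mat) \<Rightarrow> real \<Rightarrow> real \<Rightarrow> complex mat" where
  "mat_partial1 F x t = mat_deriv (\<lambda>y. F y t) x"

definition mat_partial2 :: "(real \<Rightarrow> real \<Rightarrow> complex mat) \<Rightarrow> real \<Rightarrow> real \<Rightarrow> complex mat" where
  "mat_partial2 F x t = mat_deriv (F x) t"

text \<open>The polynomial \<open>det (\<rho> A + B)\<close> in the indeterminate \<open>\<rho>\<close>.\<close>

definition pencil_poly :: "complex mat \<Rightarrow> complex mat \<Rightarrow> complex poly" where
  "pencil_poly A B = det ([:0, 1:] \<cdot>\<^sub>m map_mat (\<lambda>a. [:a:]) A + map_mat (\<lambda>b. [:b:]) B)"

text \<open>The functions \<open>mu 1, \<dots>, mu d\<close> label, near \<open>0\<close>, the eigenvalues (with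
  multiplicity) of the family \<open>H\<close> as real-analytic functions of the parameter.\<close>

definition analytic_eigenvalue_labeling ::
    "nat \<Rightarrow> (real \<Rightarrow> complex mat) \<Rightarrow> (nat \<Rightarrow> real \<Rightarrow> real) \<Rightarrow> bool" where
  "analytic_eigenvalue_labeling d H mu \<longleftrightarrow>
     (\<forall>k\<in>{1..d}. \<forall>\<^sub>F t in nhds 0. real_analytic_at (mu k) t) \<and>
     (\<forall>\<^sub>F t in nhds 0.
        eigenvalue_mset (H t) = {# complex_of_real (mu k t). k \<in># mset_set {1..d} #})"

end

theory Submission
  imports Defs "HOL-Complex_Analysis.Complex_Analysis"
begin

text \<open>Extend \<open>F\<close> holomorphically to complex arguments. Conjugation by \<open>(\<partial>\<^sub>\<lambda> F)\<close> to the
  power \<open>-1/2\<close> preserves inertia and reduces to \<open>\<partial>\<^sub>\<lambda> F(0,0) = 1\<close>. Then \<open>F\<close> increases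
  with \<open>\<lambda>\<close>, and the branches are characterised by the inertia of \<open>F(\<lambda>,t)\<close>: its negative (positive)
  index is the number of branches above (below) \<open>\<lambda>\<close>.

  Branches exist by induction on \<open>d\<close>. Let \<open>l(t)\<close> be the zero of the trace of \<open>F(\<cdot>,t)\<close>. If
  \<open>F(l(t),t)\<close> is identically zero, all branches equal \<open>l\<close>. Otherwise let \<open>p\<close> be its order of
  vanishing at \<open>t = 0\<close>; the blow-up \<open>F(l(t) + t\<^sup>p \<mu>, t) / t\<^sup>p\<close> has at \<open>t = 0\<close> the limit
  \<open>\<mu> - D\<close> with \<open>D\<close> Hermitian, nonzero and trace-free, so not scalar. At each eigenvalue of \<open>D\<close>
  a Schur complement splits off a family of smaller size.

  Part (a) is the counting property at \<open>\<lambda> = 0\<close>. For (b), \<open>F(\<lambda>,t)\<close> lies between \<open>F(0,t) + \<alpha>\<lambda>\<close>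
  and \<open>F(0,t) + \<beta>\<lambda>\<close> for \<open>\<lambda> > 0\<close> and some \<open>\<alpha>, \<beta> > 0\<close>, so at \<open>\<lambda> = \<plusminus> C t\<^sup>q\<close> the
  branches and the eigenvalues of \<open>F(0,t)\<close> of rate below \<open>q\<close> are equally many. For (c), the inertia of
  \<open>F(ct,t) / t\<close> is compared with that of its limit \<open>c + \<partial>\<^sub>t F(0,0)\<close>.\<close>

text \<open>Solving det F = 0 for \<lambda> yields in general only Puiseux series; analyticity has
  to come from Hermitian symmetry. The induction therefore carries no equation, but two counts at
  every real point near the origin: the branches strictly above and strictly below \<open>x\<close>.
  Both are invariant under congruence, which eigenvalues are not, so they pass through a Schur
  complement; together they leave the nullity, which recovers the zero set of the determinant.

  A blow-up describes F only where \<lambda> - l(t) is at most R |t|^p, and even there only locally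
  in \<mu>. Compactness of [-R, R] joins the local descriptions, and outside this region F is
  definite. So the counts hold on a full neighbourhood of the origin, and the statement is strong
  enough to serve as its own induction hypothesis. For t < 0 and odd p, division by t^p exchanges
  the two counts, a further reason to carry both.

  The analytic labelling of the eigenvalues of F(0,t) in (b) comes from the same existence theorem,
  applied to \<lambda> - F(0,t).\<close>

unbundle no vec_syntax
no_notation fps_nth (infixl "$" 75)
hide_const (open) Determinants.det

section \<open>Adjoints, Hermitian matrices and unitary diagonalisation\<close>

lemma mat_adjoint_dim [simp]:
  "dim_row (mat_adjoint A) = dim_col A" "dim_col (mat_adjoint A) = dim_row A"
  by (simp_all add: mat_adjoint_def)

lemma mat_adjoint_carrier [simp, intro]:
  "A \<in> carrier_mat n m \<Longrightarrow> mat_adjoint A \<in> carrier_mat m n"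
  by (intro carrier_matI) auto

lemma mat_adjoint_index [simp]:
  "i < dim_col A \<Longrightarrow> j < dim_row A \<Longrightarrow> mat_adjoint (A :: complex mat) $$ (i, j) = cnj (A $$ (j, i))"
  by (simp add: mat_adjoint_def mat_of_rows_index)

lemma mat_adjoint_mult:
  assumes "(A :: complex mat) \<in> carrier_mat n m" "B \<in> carrier_mat m k"
  shows "mat_adjoint (A * B) = mat_adjoint B * mat_adjoint A"
  using assms by (intro eq_matI) (auto simp: scalar_prod_def mult.commute intro!: sum.cong)

lemma mat_adjoint_adjoint [simp]: "mat_adjoint (mat_adjoint (A :: complex mat)) = A"
  by (intro eq_matI) auto

lemma mat_adjoint_one [simp]: "mat_adjoint (1\<^sub>m n :: complex mat) = 1\<^sub>m n"
  by (intro eq_matI) auto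

lemma mat_adjoint_four_block:
  assumes "(A :: complex mat) \<in> carrier_mat n n" "B \<in> carrier_mat n m"
    "C \<in> carrier_mat m n" "D \<in> carrier_mat m m"
  shows "mat_adjoint (four_block_mat A B C D) =
    four_block_mat (mat_adjoint A) (mat_adjoint C) (mat_adjoint B) (mat_adjoint D)"
  using assms by (intro eq_matI) auto

lemma cscalar_adjoint:
  assumes A: "(A :: complex mat) \<in> carrier_mat n m" and u: "u \<in> carrier_vec m" and v: "v \<in> carrier_vec n"
  shows "(A *\<^sub>v u) \<bullet>c v = u \<bullet>c (mat_adjoint A *\<^sub>v v)"
proof -
  have "(A *\<^sub>v u) \<bullet>c v = (\<Sum>i<n. \<Sum>j<m. A $$ (i,j) * u $ j * cnj (v $ i))"
    using assms by (auto simp: scalar_prod_def sum_distrib_right atLeast0LessThan intro!: sum.cong)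
  also have "\<dots> = (\<Sum>j<m. \<Sum>i<n. A $$ (i,j) * u $ j * cnj (v $ i))"
    by (rule sum.swap)
  also have "\<dots> = u \<bullet>c (mat_adjoint A *\<^sub>v v)"
    using assms by (auto simp: scalar_prod_def sum_distrib_left atLeast0LessThan mult_ac intro!: sum.cong)
  finally show ?thesis .
qed

lemma cscalar_self: "(v :: complex vec) \<bullet>c v = of_real (\<Sum>i<dim_vec v. (cmod (v $ i))\<^sup>2)"
  by (auto simp: scalar_prod_def atLeast0LessThan complex_norm_square[symmetric] simp del: of_real_power
      intro!: sum.cong)

lemma hermitian_matI:
  assumes "A \<in> carrier_mat n n" "\<And>i j. i < n \<Longrightarrow> j < n \<Longrightarrow> A $$ (i, j) = cnj (A $$ (j, i))"
  shows "hermitian_mat A"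
proof -
  have "mat_adjoint A = A"
  proof (rule eq_matI)
    fix i j assume "i < dim_row A" "j < dim_col A"
    then show "mat_adjoint A $$ (i, j) = A $$ (i, j)"
      using assms(2)[of i j] assms(1) by (metis carrier_matD mat_adjoint_index)
  qed (use assms(1) in auto)
  with assms(1) show ?thesis by (auto simp: hermitian_mat_def square_mat.simps)
qed

lemma hermitian_mat_index:
  assumes "hermitian_mat A" "A \<in> carrier_mat n n" "i < n" "j < n"
  shows "cnj (A $$ (j, i)) = A $$ (i, j)"
  using assms by (metis carrier_matD(1,2) hermitian_mat_def mat_adjoint_index)

lemma hermitian_mat_congruence:
  assumes A: "hermitian_mat A" "A \<in> carrier_mat n n" and S: "S \<in> carrier_mat n m"
  shows "hermitian_mat (mat_adjoint S * A * S)"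
proof -
  have SA: "mat_adjoint S * A \<in> carrier_mat m n" and S': "mat_adjoint S \<in> carrier_mat m n"
    using A S by auto
  have "mat_adjoint (mat_adjoint S * A * S) = mat_adjoint S * (mat_adjoint A * S)"
    unfolding mat_adjoint_mult[OF SA S] mat_adjoint_mult[OF S' A(2)] by simp
  also have "mat_adjoint A = A" using A by (simp add: hermitian_mat_def)
  also have "mat_adjoint S * (A * S) = mat_adjoint S * A * S"
    using A S assoc_mult_mat[of "mat_adjoint S" m n A n S m] by simp
  finally show ?thesis using A S by (auto simp: hermitian_mat_def square_mat.simps)
qed

text \<open>With a single dimension, fixed by \<open>[where n = ...]\<close>, this rule and the next
  let the simplifier reassociate long products without guessing intermediate dimensions.\<close>

lemma square_mult_closed:
  "(A :: complex mat) \<in> carrier_mat n n \<Longrightarrow> B \<in> carrier_mat n n \<Longrightarrow> A * B \<in> carrier_mat n n"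
  by simp

lemma square_mult_assoc:
  "(A :: complex mat) \<in> carrier_mat n n \<Longrightarrow> B \<in> carrier_mat n n \<Longrightarrow> C \<in> carrier_mat n n \<Longrightarrow>
    A * B * C = A * (B * C)"
  by (rule assoc_mult_mat)

lemma mult_block_diag:
  assumes "(A :: complex mat) \<in> carrier_mat n n" "A' \<in> carrier_mat n n"
    "B \<in> carrier_mat m m" "B' \<in> carrier_mat m m"
  shows "four_block_mat A (0\<^sub>m n m) (0\<^sub>m m n) B * four_block_mat A' (0\<^sub>m n m) (0\<^sub>m m n) B' =
    four_block_mat (A * A') (0\<^sub>m n m) (0\<^sub>m m n) (B * B')"
proof -
  have "A * A' \<in> carrier_mat n n" "B * B' \<in> carrier_mat m m" using assms by auto
  then show ?thesis
    using assms by (subst mult_four_block_mat[of _ n n _ m _ m _ _ n _ m]) simp_all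
qed

text \<open>Gram-Schmidt applied to a basis that starts with \<open>v\<close> keeps \<open>v\<close>
  in front; dividing each vector by its norm makes the columns orthonormal. The matrix serves to
  split off an eigenvector in the spectral theorem.\<close>

lemma orthonormal_extension:
  assumes v: "v \<in> carrier_vec n" and v0: "v \<noteq> 0\<^sub>v n"
  shows "\<exists>W \<in> carrier_mat n n. mat_adjoint W * W = 1\<^sub>m n \<and> (\<exists>c::complex. col W 0 = c \<cdot>\<^sub>v v)"
proof -
  interpret cof_vec_space n "TYPE(complex)" .
  define b where "b = basis_completion v"
  define ws where "ws = gram_schmidt n b"
  from basis_completion[OF v v0, folded b_def]
  have span_b: "span (set b) = carrier_vec n" and dist_b: "distinct b"
    and indep: "\<not> lin_dep (set b)" and b: "set b \<subseteq> carrier_vec n" and hdb: "hd b = v"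
    and len_b: "length b = n" by auto
  have n: "n \<noteq> 0" using v v0 by auto
  from hdb len_b n obtain vs where bv: "b = v # vs" by (cases b, auto)
  from gram_schmidt_result[OF b dist_b indep refl, folded ws_def]
  have ws: "set ws \<subseteq> carrier_vec n" "corthogonal ws" "length ws = n"
    by (auto simp: len_b)
  from gram_schmidt_hd[OF v, of vs, folded bv] have hdws: "hd ws = v" unfolding ws_def .
  define nm where "nm w = complex_of_real (sqrt (\<Sum>i<n. (cmod (w $ i))\<^sup>2))" for w
  define W where "W = mat_of_cols n (map (\<lambda>w. (1 / nm w) \<cdot>\<^sub>v w) ws)"
  have W: "W \<in> carrier_mat n n" using ws by (auto simp: W_def)
  have wsi: "ws ! i \<in> carrier_vec n" if "i < n" for i using ws that by auto
  have Wi: "W $$ (i, j) = (ws ! j) $ i / nm (ws ! j)" if "i < n" "j < n" for i j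
    using that ws wsi[of j] by (auto simp: W_def mat_of_cols_index)
  have nm: "nm w * nm w = w \<bullet>c w" if "w \<in> carrier_vec n" for w
    using that unfolding cscalar_self nm_def of_real_mult[symmetric]
    by (auto simp: sum_nonneg)
  have cnjnm: "cnj (nm w) = nm w" for w by (simp add: nm_def)
  have "mat_adjoint W * W = 1\<^sub>m n"
  proof (rule eq_matI)
    fix i j assume "i < dim_row (1\<^sub>m n)" "j < dim_col (1\<^sub>m n)"
    then have ij: "i < n" "j < n" by auto
    have "(mat_adjoint W * W) $$ (i, j) = (\<Sum>k<n. cnj ((ws ! i) $ k / nm (ws ! i)) * ((ws ! j) $ k / nm (ws ! j)))"
      using ij W by (auto simp: scalar_prod_def Wi atLeast0LessThan intro!: sum.cong)
    also have "\<dots> = (\<Sum>k<n. (ws ! j) $ k * cnj ((ws ! i) $ k)) / (nm (ws ! i) * nm (ws ! j))"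
      by (simp add: sum_divide_distrib cnjnm mult_ac)
    also have "(\<Sum>k<n. (ws ! j) $ k * cnj ((ws ! i) $ k)) = ws ! j \<bullet>c ws ! i"
      using ij by (simp add: scalar_prod_def atLeast0LessThan carrier_vecD[OF wsi])
    also have "ws ! j \<bullet>c ws ! i / (nm (ws ! i) * nm (ws ! j)) = 1\<^sub>m n $$ (i, j)"
    proof (cases "i = j")
      case True
      have "ws ! i \<bullet>c ws ! i \<noteq> 0"
        using corthogonalD[OF ws(2), of i i] ij ws by auto
      then show ?thesis using True ij nm[OF wsi, of i] by simp
    next
      case False
      then have "ws ! j \<bullet>c ws ! i = 0" using corthogonalD[OF ws(2), of j i] ij ws by auto
      then show ?thesis using False ij by simp
    qed
    finally show "(mat_adjoint W * W) $$ (i, j) = 1\<^sub>m n $$ (i, j)" .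
  qed (use W in auto)
  moreover have "col W 0 = (1 / nm v) \<cdot>\<^sub>v v"
  proof (rule eq_vecI)
    have "ws ! 0 = v" using hdws ws n by (cases ws) auto
    then show "col W 0 $ i = ((1 / nm v) \<cdot>\<^sub>v v) $ i" if "i < dim_vec ((1 / nm v) \<cdot>\<^sub>v v)" for i
      using that v W n by (simp add: Wi)
  qed (use W v in auto)
  ultimately show ?thesis using W by blast
qed

lemma unitary_right_inverse:
  "W \<in> carrier_mat n n \<Longrightarrow> mat_adjoint W * W = 1\<^sub>m n \<Longrightarrow> W * mat_adjoint W = (1\<^sub>m n :: complex mat)"
  by (rule mat_mult_left_right_inverse[of _ n]) auto

text \<open>The eigenvalues may be listed in any order.\<close>

lemma hermitian_diagonalization:
  assumes "hermitian_mat A" "A \<in> carrier_mat n n" "char_poly A = (\<Prod>e\<leftarrow>es. [:- e, 1:])"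
  shows "length es = n \<and> (\<exists>U \<in> carrier_mat n n. mat_adjoint U * U = 1\<^sub>m n \<and>
    mat_adjoint U * A * U = mat_diag n (\<lambda>i. es ! i))"
  using assms
proof (induction es arbitrary: A n)
  case Nil
  then have "n = 0" using degree_monic_char_poly[of A n] by auto
  then show ?case using Nil by (auto intro!: bexI[of _ "1\<^sub>m 0"] eq_matI simp: mat_diag_def)
next
  case (Cons e es A n)
  have A: "A \<in> carrier_mat n n" and hA: "hermitian_mat A" by fact+
  have "length (e # es) = n"
    using degree_monic_char_poly[OF A] degree_linear_factors[of uminus "e # es"] Cons.prems(3) by simp
  then have n: "n \<noteq> 0" by auto
  then obtain m where nm: "n = 1 + m" by (metis Suc_pred' neq0_conv plus_1_eq_Suc)
  have "poly (char_poly A) e = 0" using Cons by simp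
  then have "eigenvalue A e" using eigenvalue_root_char_poly[OF A] by simp
  then obtain v where v: "v \<in> carrier_vec n" "v \<noteq> 0\<^sub>v n" "A *\<^sub>v v = e \<cdot>\<^sub>v v"
    using A by (auto simp: eigenvalue_def eigenvector_def)
  from orthonormal_extension[OF v(1,2)] obtain W c where
    W: "W \<in> carrier_mat n n" "mat_adjoint W * W = 1\<^sub>m n" "col W 0 = c \<cdot>\<^sub>v v" by blast
  have W': "W * mat_adjoint W = 1\<^sub>m n" using unitary_right_inverse W by blast
  define A' where "A' = mat_adjoint W * A * W"
  have A': "A' \<in> carrier_mat n n" using W A by (auto simp: A'_def)
  have hA': "hermitian_mat A'" unfolding A'_def by (rule hermitian_mat_congruence[OF hA A W(1)])
  have "col A' 0 = mat_adjoint W *\<^sub>v (A *\<^sub>v col W 0)"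
    using A W(1) n col_mult2[of A n n W n 0] col_mult2[of "mat_adjoint W" n n "A * W" n 0]
      assoc_mult_mat[of "mat_adjoint W" n n A n W n] by (simp add: A'_def)
  also have "A *\<^sub>v col W 0 = e \<cdot>\<^sub>v col W 0"
    using W(3) v A by (simp add: mult_mat_vec[of _ n n] smult_smult_assoc mult.commute)
  also have "mat_adjoint W *\<^sub>v (e \<cdot>\<^sub>v col W 0) = e \<cdot>\<^sub>v (col (mat_adjoint W * W) 0)"
    using W(1) n col_mult2[of "mat_adjoint W" n n W n 0]
      mult_mat_vec[of "mat_adjoint W" n n "col W 0" e] by auto
  also have "\<dots> = e \<cdot>\<^sub>v unit_vec n 0" using W n by simp
  finally have col0: "col A' 0 = e \<cdot>\<^sub>v unit_vec n 0" .
  have c0: "A' $$ (i, 0) = (if i = 0 then e else 0)" if "i < n" for i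
    using arg_cong[OF col0, of "\<lambda>v. v $ i"] A' that n by (auto simp: unit_vec_def)
  \<comment> \<open>Hermitian symmetry turns the vanishing of the first column below its top entry
    into the same for the first row. So the matrix splits into blocks, and the remaining block is
    again Hermitian.\<close>
  have r0: "A' $$ (0, i) = (if i = 0 then e else 0)" if "i < n" for i
    using hermitian_mat_index[OF hA' A', of 0 i] c0 that n
    by (cases "i = 0") auto
  define A3 where "A3 = mat m m (\<lambda>(i, j). A' $$ (Suc i, Suc j))"
  define A1 where "A1 = mat 1 1 (\<lambda>_. e)"
  have A3: "A3 \<in> carrier_mat m m" and A1: "A1 \<in> carrier_mat 1 1" by (auto simp: A3_def A1_def)
  have A'b: "A' = four_block_mat A1 (0\<^sub>m 1 m) (0\<^sub>m m 1) A3"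
    using A' nm by (intro eq_matI) (auto simp: A1_def A3_def c0 r0)
  have hA3: "hermitian_mat A3"
    using hermitian_mat_index[OF hA' A'] nm by (intro hermitian_matI[OF A3]) (auto simp: A3_def)
  have "similar_mat_wit A' A (mat_adjoint W) W"
    by (rule similar_mat_witI[of _ _ n]) (use W W' A A' in \<open>auto simp: A'_def\<close>)
  then have "similar_mat A' A" by (auto simp: similar_mat_def)
  from char_poly_similar[OF this] have "char_poly A' = [:- e, 1:] * (\<Prod>e\<leftarrow>es. [:- e, 1:])"
    using Cons by simp
  moreover have "char_poly A' = char_poly A1 * char_poly A3"
    unfolding A'b by (rule char_poly_four_block_zeros_col[OF A1 _ A3]) auto
  moreover have "char_poly A1 = [:- e, 1:]"
    by (simp add: A1_def char_poly_defs Determinant.det_def sign_def)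
  ultimately have "char_poly A3 = (\<Prod>e\<leftarrow>es. [:- e, 1:])"
    by (metis mult_cancel_left pCons_eq_0_iff zero_neq_one)
  from Cons.IH[OF hA3 A3 this] obtain U where len: "length es = m" and U: "U \<in> carrier_mat m m"
    "mat_adjoint U * U = 1\<^sub>m m" "mat_adjoint U * A3 * U = mat_diag m (\<lambda>i. es ! i)" by blast
  define V where "V = four_block_mat (1\<^sub>m 1) (0\<^sub>m 1 m) (0\<^sub>m m 1) U"
  have V: "V \<in> carrier_mat n n" using U nm by (auto simp: V_def)
  have z: "mat_adjoint (0\<^sub>m k l) = (0\<^sub>m l k :: complex mat)" for k l by (intro eq_matI) auto
  have aV: "mat_adjoint V = four_block_mat (1\<^sub>m 1) (0\<^sub>m 1 m) (0\<^sub>m m 1) (mat_adjoint U)"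
    unfolding V_def using U by (subst mat_adjoint_four_block) (auto simp: z)
  have aVc: "mat_adjoint V \<in> carrier_mat n n" using V by simp
  have VV: "mat_adjoint V * V = 1\<^sub>m n"
    unfolding aV unfolding V_def using U(1) nm
    by (subst mult_block_diag) (auto simp: U(2) intro!: eq_matI)
  have UA: "mat_adjoint U * A3 \<in> carrier_mat m m" "mat_adjoint U * A3 * U \<in> carrier_mat m m"
    using U A3 by auto
  have "mat_adjoint V * A' * V = four_block_mat A1 (0\<^sub>m 1 m) (0\<^sub>m m 1) (mat_adjoint U * A3 * U)"
    unfolding aV unfolding A'b V_def using U(1) A1 A3 UA
    by (subst mult_block_diag; (subst mult_block_diag)?; simp)
  also have "\<dots> = mat_diag n (\<lambda>i. (e # es) ! i)"
    unfolding U by (rule eq_matI) (auto simp: nm A1_def mat_diag_def nth_Cons')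
  finally have D: "mat_adjoint V * A' * V = mat_diag n (\<lambda>i. (e # es) ! i)" .
  have aW: "mat_adjoint W \<in> carrier_mat n n" using W by simp
  have adj: "mat_adjoint (W * V) = mat_adjoint V * mat_adjoint W"
    using W V by (simp add: mat_adjoint_mult)
  have "mat_adjoint (W * V) * (W * V) = mat_adjoint V * (mat_adjoint W * W) * V"
    unfolding adj using W(1) V aW aVc
    by (simp add: square_mult_assoc[where n = n] square_mult_closed)
  then have "mat_adjoint (W * V) * (W * V) = 1\<^sub>m n"
    using W(2) right_mult_one_mat[OF aVc] VV by simp
  moreover have "mat_adjoint (W * V) * A * (W * V) = mat_adjoint V * A' * V"
    unfolding adj A'_def using W(1) V aW aVc A
    by (simp add: square_mult_assoc[where n = n] square_mult_closed)
  moreover have "W * V \<in> carrier_mat n n" using W(1) V by simp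
  moreover have "length (e # es) = n" using len nm by simp
  ultimately show ?case using D by metis
qed

section \<open>Real eigenvalues and inertia\<close>

text \<open>For Hermitian matrices the real parts lose nothing
  (\<open>eigenvalue_mset_real_eigs\<close>), and a real multiset can be filtered by order
  relations.\<close>

definition real_eigs :: "complex mat \<Rightarrow> real multiset" where
  "real_eigs A = image_mset Re (eigenvalue_mset A)"

lemma eigenvalue_mset_linear_factors:
  "char_poly A = (\<Prod>e\<leftarrow>es. [:- e, 1:]) \<Longrightarrow> eigenvalue_mset A = mset es"
proof -
  assume *: "char_poly A = (\<Prod>e\<leftarrow>es. [:- e, 1:])"
  have "proots (\<Prod>e\<leftarrow>es. [:- e, 1:]) = mset es"
  proof (induction es)
    case (Cons e es)
    have "proots ([:- e, 1:] * (\<Prod>e\<leftarrow>es. [:- e, 1:])) = add_mset e (mset es)"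
      by (subst proots_mult) (auto simp: Cons prod_list_zero_iff simp del: mult_pCons_left)
    then show ?case by simp
  qed simp
  with * show ?thesis by (simp add: eigenvalue_mset_def)
qed

text \<open>Some factorisation into linear factors exists over the complex numbers; its roots form
  the same multiset as \<open>es\<close>, and the product does not depend on their order. This makes
  every ordering of the eigenvalues available to \<open>hermitian_diagonalization\<close>.\<close>

lemma char_poly_eigenvalue_mset:
  assumes "A \<in> carrier_mat n n" "mset es = eigenvalue_mset A"
  shows "char_poly A = (\<Prod>e\<leftarrow>es. [:- e, 1:])"
proof -
  from char_poly_factorized[OF assms(1)] obtain as where as: "char_poly A = (\<Prod>e\<leftarrow>as. [:- e, 1:])" by blast
  from eigenvalue_mset_linear_factors[OF this] assms(2) have "mset es = mset as" by simp
  then have "mset (map (\<lambda>e. [:- e, 1:]) es) = mset (map (\<lambda>e. [:- e, 1:]) as)" by simp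
  then show ?thesis using as by (metis prod_mset_prod_list)
qed

lemma diag_mat_mat_diag: "diag_mat (mat_diag n f) = map f [0..<n]"
  by (auto simp: diag_mat_def mat_diag_def intro!: nth_equalityI)

lemma char_poly_unitary_diag:
  assumes "(A :: complex mat) \<in> carrier_mat n n" "U \<in> carrier_mat n n" "mat_adjoint U * U = 1\<^sub>m n"
    "mat_adjoint U * A * U = mat_diag n f"
  shows "char_poly A = (\<Prod>e\<leftarrow>map f [0..<n]. [:- e, 1:])"
proof -
  have "similar_mat_wit (mat_diag n f) A (mat_adjoint U) U"
    using assms unitary_right_inverse[OF assms(2,3)]
    by (intro similar_mat_witI[of _ _ n]) auto
  then have "similar_mat (mat_diag n f) A" by (auto simp: similar_mat_def)
  from char_poly_similar[OF this] have "char_poly A = char_poly (mat_diag n f)" by simp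
  also have "\<dots> = (\<Prod>e\<leftarrow>diag_mat (mat_diag n f). [:- e, 1:])"
    by (rule char_poly_upper_triangular[of _ n]) (auto simp: mat_diag_def)
  finally show ?thesis by (simp add: diag_mat_mat_diag)
qed

lemma real_eigs_unitary_diag:
  assumes "(A :: complex mat) \<in> carrier_mat n n" "U \<in> carrier_mat n n" "mat_adjoint U * U = 1\<^sub>m n"
    "mat_adjoint U * A * U = mat_diag n (\<lambda>i. complex_of_real (f i))"
  shows "real_eigs A = mset (map f [0..<n])" "eigenvalue_mset A = image_mset complex_of_real (real_eigs A)"
proof -
  have *: "eigenvalue_mset A = mset (map (\<lambda>i. complex_of_real (f i)) [0..<n])"
    by (rule eigenvalue_mset_linear_factors[OF char_poly_unitary_diag[OF assms]])
  then show "real_eigs A = mset (map f [0..<n])"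
    by (simp add: real_eigs_def image_mset.compositionality comp_def)
  then show "eigenvalue_mset A = image_mset complex_of_real (real_eigs A)"
    using * by (simp add: image_mset.compositionality comp_def)
qed

text \<open>The order of \<open>rs\<close> is left to the caller: later the negative eigenvalues are
  put first, or all copies of one chosen eigenvalue.\<close>

lemma real_diagonalization:
  assumes A: "hermitian_mat A" "A \<in> carrier_mat n n" and rs: "mset rs = real_eigs A"
  obtains U where "length rs = n" "U \<in> carrier_mat n n" "mat_adjoint U * U = 1\<^sub>m n"
    "mat_adjoint U * A * U = mat_diag n (\<lambda>i. complex_of_real (rs ! i))"
proof -
  \<comment> \<open>A diagonal matrix congruent to a Hermitian one is Hermitian, so its entries
    equal their conjugates.\<close>
  have real: "e \<in> \<real>" if "e \<in># eigenvalue_mset A" for e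
  proof -
    obtain es where es: "mset es = eigenvalue_mset A" by (metis ex_mset)
    from hermitian_diagonalization[OF A char_poly_eigenvalue_mset[OF A(2) es]]
    obtain U where len: "length es = n" and U: "U \<in> carrier_mat n n"
      "mat_adjoint U * A * U = mat_diag n (\<lambda>i. es ! i)" by blast
    have "hermitian_mat (mat_diag n (\<lambda>i. es ! i))"
      using hermitian_mat_congruence[OF A U(1)] U(2) by simp
    from hermitian_mat_index[OF this] have "cnj (es ! i) = es ! i" if "i < n" for i
      using that by (force simp: mat_diag_def)
    then have "es ! i \<in> \<real>" if "i < n" for i using that by (simp add: Reals_cnj_iff)
    moreover from that es have "e \<in> set es" by (metis set_mset_mset)
    ultimately show ?thesis using len by (auto simp: in_set_conv_nth)
  qed
  have "mset (map complex_of_real rs) = image_mset complex_of_real (image_mset Re (eigenvalue_mset A))"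
    using rs by (simp add: real_eigs_def)
  also have "\<dots> = image_mset (\<lambda>e. e) (eigenvalue_mset A)"
    unfolding image_mset.compositionality by (rule image_mset_cong) (use real in auto)
  finally have "mset (map complex_of_real rs) = eigenvalue_mset A" by simp
  from hermitian_diagonalization[OF A char_poly_eigenvalue_mset[OF A(2) this]]
  obtain U where len: "length rs = n" and U: "U \<in> carrier_mat n n" "mat_adjoint U * U = 1\<^sub>m n"
    "mat_adjoint U * A * U = mat_diag n (\<lambda>i. map complex_of_real rs ! i)" by auto
  have "mat_diag n (\<lambda>i. map complex_of_real rs ! i) = mat_diag n (\<lambda>i. complex_of_real (rs ! i))"
    by (rule eq_matI) (auto simp: mat_diag_def len)
  with that[OF len U(1,2)] U(3) show ?thesis by simp
qed

lemma real_diagonalization_ex: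
  assumes A: "hermitian_mat A" "A \<in> carrier_mat n n"
  obtains f U where "U \<in> carrier_mat n n" "mat_adjoint U * U = 1\<^sub>m n"
    "mat_adjoint U * A * U = mat_diag n (\<lambda>i. complex_of_real (f i))"
    "real_eigs A = mset (map f [0..<n])"
proof -
  obtain rs where rs: "mset rs = real_eigs A" by (metis ex_mset)
  from real_diagonalization[OF A rs] obtain U where U: "length rs = n" "U \<in> carrier_mat n n"
    "mat_adjoint U * U = 1\<^sub>m n" "mat_adjoint U * A * U = mat_diag n (\<lambda>i. complex_of_real (rs ! i))" .
  show ?thesis by (rule that[OF U(2-4) real_eigs_unitary_diag(1)[OF A(2) U(2-4)]])
qed

lemma eigenvalue_mset_real_eigs:
  assumes "hermitian_mat A" "A \<in> carrier_mat n n"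
  shows "eigenvalue_mset A = image_mset complex_of_real (real_eigs A)"
  using real_diagonalization_ex[OF assms] real_eigs_unitary_diag(2)[OF assms(2)] by metis

lemma size_real_eigs: "A \<in> carrier_mat n n \<Longrightarrow> size (real_eigs A) = n"
  using char_poly_factorized[of A n] eigenvalue_mset_linear_factors[of A] by (auto simp: real_eigs_def)

lemma neg_inertia_real_eigs:
  assumes "hermitian_mat A" "A \<in> carrier_mat n n"
  shows "neg_inertia A = size {#r \<in># real_eigs A. r < 0#}"
  unfolding neg_inertia_def eigenvalue_mset_real_eigs[OF assms]
  by (simp add: filter_mset_image_mset comp_def)

lemma square_adjoint_sandwich:
  assumes "(A :: complex mat) \<in> carrier_mat n n" "B \<in> carrier_mat n n" "U \<in> carrier_mat n n"
  shows "mat_adjoint U * (A + B) * U = mat_adjoint U * A * U + mat_adjoint U * B * U"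
proof -
  have U': "mat_adjoint U \<in> carrier_mat n n" using assms by simp
  have "mat_adjoint U * (A + B) = mat_adjoint U * A + mat_adjoint U * B"
    by (rule mult_add_distrib_mat[OF U' assms(1,2)])
  then show ?thesis
    using add_mult_distrib_mat[OF mult_carrier_mat[OF U' assms(1)] mult_carrier_mat[OF U' assms(2)] assms(3)] by simp
qed

text \<open>A unitary matrix that diagonalises \<open>A\<close> also diagonalises every affine
  combination of \<open>A\<close> and the identity.\<close>

lemma real_eigs_affine:
  assumes A: "hermitian_mat A" "A \<in> carrier_mat n n"
  shows "real_eigs (complex_of_real c \<cdot>\<^sub>m 1\<^sub>m n + complex_of_real s \<cdot>\<^sub>m A) = image_mset (\<lambda>r. c + s * r) (real_eigs A)"
proof -
  from real_diagonalization_ex[OF A] obtain f U where U: "U \<in> carrier_mat n n"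
    "mat_adjoint U * U = 1\<^sub>m n" "mat_adjoint U * A * U = mat_diag n (\<lambda>i. complex_of_real (f i))"
    "real_eigs A = mset (map f [0..<n])" .
  have U': "mat_adjoint U \<in> carrier_mat n n" using U by simp
  have "mat_adjoint U * (complex_of_real c \<cdot>\<^sub>m 1\<^sub>m n + complex_of_real s \<cdot>\<^sub>m A) * U =
    mat_adjoint U * (complex_of_real c \<cdot>\<^sub>m 1\<^sub>m n) * U + mat_adjoint U * (complex_of_real s \<cdot>\<^sub>m A) * U"
    using A U(1) by (intro square_adjoint_sandwich) auto
  also have "mat_adjoint U * (complex_of_real c \<cdot>\<^sub>m 1\<^sub>m n) * U = complex_of_real c \<cdot>\<^sub>m 1\<^sub>m n"
    using U(1,2) U' mult_smult_distrib[OF U' one_carrier_mat, of "complex_of_real c"]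
      mult_smult_assoc_mat[OF U' U(1), of "complex_of_real c"] by simp
  also have "mat_adjoint U * (complex_of_real s \<cdot>\<^sub>m A) * U = complex_of_real s \<cdot>\<^sub>m (mat_adjoint U * A * U)"
    using U(1) U' A mult_smult_distrib[OF U' A(2), of "complex_of_real s"]
      mult_smult_assoc_mat[OF mult_carrier_mat[OF U' A(2)] U(1), of "complex_of_real s"] by simp
  also have "complex_of_real c \<cdot>\<^sub>m 1\<^sub>m n + complex_of_real s \<cdot>\<^sub>m (mat_adjoint U * A * U) =
      mat_diag n (\<lambda>i. complex_of_real (c + s * f i))"
    unfolding U(3) by (rule eq_matI) (auto simp: mat_diag_def)
  finally have "mat_adjoint U * (complex_of_real c \<cdot>\<^sub>m 1\<^sub>m n + complex_of_real s \<cdot>\<^sub>m A) * U =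
      mat_diag n (\<lambda>i. complex_of_real (c + s * f i))" .
  from real_eigs_unitary_diag(1)[OF _ U(1,2) this] A U(4) show ?thesis
    by (simp add: image_mset.compositionality comp_def)
qed

lemma real_eigs_uminus:
  assumes A: "hermitian_mat A" "A \<in> carrier_mat n n"
  shows "real_eigs (- A) = image_mset uminus (real_eigs A)"
proof -
  have "- A = complex_of_real 0 \<cdot>\<^sub>m 1\<^sub>m n + complex_of_real (-1) \<cdot>\<^sub>m A"
    using A by (intro eq_matI) auto
  with real_eigs_affine[OF A, of 0 "-1"] show ?thesis by simp
qed

lemma hermitian_mat_affine:
  assumes A: "hermitian_mat A" "A \<in> carrier_mat n n"
  shows "hermitian_mat (complex_of_real c \<cdot>\<^sub>m 1\<^sub>m n + complex_of_real s \<cdot>\<^sub>m A)"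
  using assms by (intro hermitian_matI[of _ n]) (auto simp: hermitian_mat_index[OF A])

lemma hermitian_mat_uminus: "hermitian_mat A \<Longrightarrow> A \<in> carrier_mat n n \<Longrightarrow> hermitian_mat (- A)"
  by (intro hermitian_matI[of _ n]) (auto simp: hermitian_mat_index)

lemma hermitian_mat_add:
  "hermitian_mat A \<Longrightarrow> A \<in> carrier_mat n n \<Longrightarrow> hermitian_mat B \<Longrightarrow> B \<in> carrier_mat n n \<Longrightarrow> hermitian_mat (A + B)"
  by (intro hermitian_matI[of _ n]) (auto simp: hermitian_mat_index)

text \<open>\<open>neg_inertia (- A)\<close> serves as the positive index throughout, so that each
  fact about the negative index has its mirror image for free.\<close>

lemma neg_inertia_uminus:
  assumes A: "hermitian_mat A" "A \<in> carrier_mat n n"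
  shows "neg_inertia (- A) = size {#r \<in># real_eigs A. r > 0#}"
  using neg_inertia_real_eigs[OF hermitian_mat_uminus[OF A], of n] A
  by (simp add: real_eigs_uminus[OF A] filter_mset_image_mset comp_def)

lemma inertia_sum:
  assumes A: "hermitian_mat A" "A \<in> carrier_mat n n"
  shows "neg_inertia A + neg_inertia (- A) + count (real_eigs A) 0 = n"
proof -
  have "size M = size {#r \<in># M. r < 0#} + size {#r \<in># M. r > 0#} + count M 0" for M :: "real multiset"
    by (induction M) auto
  from this[of "real_eigs A"] show ?thesis
    using size_real_eigs[OF A(2)] by (simp add: neg_inertia_uminus[OF A] neg_inertia_real_eigs[OF A])
qed

lemma det_zero_real_eigs:
  assumes A: "hermitian_mat A" "A \<in> carrier_mat n n"
  shows "det A = 0 \<longleftrightarrow> count (real_eigs A) 0 \<noteq> 0"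
proof -
  from real_diagonalization_ex[OF A] obtain f U where U: "U \<in> carrier_mat n n"
    "mat_adjoint U * U = 1\<^sub>m n" "mat_adjoint U * A * U = mat_diag n (\<lambda>i. complex_of_real (f i))"
    "real_eigs A = mset (map f [0..<n])" .
  have U': "mat_adjoint U \<in> carrier_mat n n" using U by simp
  have "det (mat_adjoint U) * det U = 1"
    using det_mult[OF U' U(1)] U(2) by simp
  moreover have "det (mat_adjoint U) * det A * det U = det (mat_diag n (\<lambda>i. complex_of_real (f i)))"
    using det_mult[of "mat_adjoint U * A" n U] det_mult[OF U' A(2)] U A U' by simp
  moreover have "det (mat_diag n (\<lambda>i. complex_of_real (f i))) = prod_list (map (\<lambda>i. complex_of_real (f i)) [0..<n])"
    by (subst det_upper_triangular[of _ n]) (auto simp: mat_diag_def diag_mat_def intro!: arg_cong[of _ _ prod_list])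
  ultimately have "det A = 0 \<longleftrightarrow> prod_list (map (\<lambda>i. complex_of_real (f i)) [0..<n]) = 0"
    by (metis mult_eq_0_iff mult_zero_left zero_neq_one)
  also have "\<dots> \<longleftrightarrow> (\<exists>i<n. f i = 0)" by (auto simp: prod_list_zero_iff)
  also have "\<dots> \<longleftrightarrow> 0 \<in># real_eigs A" by (auto simp: U(4))
  finally show ?thesis by (simp add: count_eq_zero_iff)
qed

section \<open>Quadratic forms, Sylvester's law and stability of inertia\<close>

text \<open>The squared Euclidean norm as a real number; \<open>v \<bullet>c v\<close> is the same
  number in the complex type.\<close>

definition nsq :: "complex vec \<Rightarrow> real" where
  "nsq v = (\<Sum>i<dim_vec v. (cmod (v $ i))\<^sup>2)"

lemma nsq_nonneg [simp]: "nsq v \<ge> 0" by (simp add: nsq_def sum_nonneg)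

lemma nsq_pos: "v \<in> carrier_vec n \<Longrightarrow> v \<noteq> 0\<^sub>v n \<Longrightarrow> nsq v > 0"
proof -
  assume v: "v \<in> carrier_vec n" "v \<noteq> 0\<^sub>v n"
  then obtain i where "i < n" "v $ i \<noteq> 0" by (metis carrier_vecD eq_vecI index_zero_vec)
  then show ?thesis unfolding nsq_def using v
    by (intro sum_pos2[of _ i]) auto
qed

lemma cscalar_nsq: "v \<bullet>c v = of_real (nsq v)"
  by (simp add: nsq_def cscalar_self)

lemma qform_congruence:
  assumes A: "(A :: complex mat) \<in> carrier_mat n n" and S: "S \<in> carrier_mat n m" and a: "a \<in> carrier_vec m"
  shows "(A *\<^sub>v (S *\<^sub>v a)) \<bullet>c (S *\<^sub>v a) = ((mat_adjoint S * A * S) *\<^sub>v a) \<bullet>c a"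
proof -
  have S': "mat_adjoint S \<in> carrier_mat m n" using S by simp
  have Sa: "S *\<^sub>v a \<in> carrier_vec n" using S a by auto
  have ASa: "A *\<^sub>v (S *\<^sub>v a) \<in> carrier_vec n" using A Sa by auto
  have "((mat_adjoint S * A * S) *\<^sub>v a) \<bullet>c a = (mat_adjoint S *\<^sub>v (A *\<^sub>v (S *\<^sub>v a))) \<bullet>c a"
    using assoc_mult_mat_vec[OF mult_carrier_mat[OF S' A] S a] assoc_mult_mat_vec[OF S' A Sa] by simp
  also have "\<dots> = (A *\<^sub>v (S *\<^sub>v a)) \<bullet>c (S *\<^sub>v a)"
    using cscalar_adjoint[OF S' ASa a] by simp
  finally show ?thesis by simp
qed

lemma qform_diag:
  assumes "a \<in> carrier_vec n"
  shows "Re ((mat_diag n (\<lambda>i. complex_of_real (f i)) *\<^sub>v a) \<bullet>c a) = (\<Sum>i<n. f i * (cmod (a $ i))\<^sup>2)"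
proof -
  have *: "mat_diag n (\<lambda>i. complex_of_real (f i)) *\<^sub>v a = vec n (\<lambda>i. complex_of_real (f i) * a $ i)"
    using assms
    by (intro eq_vecI) (auto simp: mat_diag_def scalar_prod_def if_distrib[of "\<lambda>x. x * _"] sum.delta cong: if_cong)
  show ?thesis unfolding * using assms
    by (auto simp: scalar_prod_def atLeast0LessThan mult.assoc complex_norm_square[symmetric]
        simp del: of_real_power of_real_mult simp flip: of_real_mult of_real_power intro!: sum.cong)
qed

lemma nsq_isometry:
  assumes "(V :: complex mat) \<in> carrier_mat n m" "mat_adjoint V * V = 1\<^sub>m m" "a \<in> carrier_vec m"
  shows "nsq (V *\<^sub>v a) = nsq a"
proof -
  have "complex_of_real (nsq (V *\<^sub>v a)) = ((mat_adjoint V * 1\<^sub>m n * V) *\<^sub>v a) \<bullet>c a"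
    using qform_congruence[OF one_carrier_mat assms(1,3)] assms by (simp add: cscalar_nsq)
  also have "mat_adjoint V * 1\<^sub>m n * V = 1\<^sub>m m"
    using right_mult_one_mat[of "mat_adjoint V" m n] assms by simp
  finally show ?thesis using assms(3) by (simp add: cscalar_nsq)
qed

text \<open>The columns of \<open>V\<close> are orthonormal eigenvectors for the negative
  eigenvalues, and \<open>\<delta>\<close> bounds these eigenvalues away from 0. The uniform margin
  is what survives a perturbation of \<open>A\<close>.\<close>

lemma neg_inertia_subspace:
  assumes A: "hermitian_mat A" "A \<in> carrier_mat n n" and k: "k = neg_inertia A"
  obtains V \<delta> where "V \<in> carrier_mat n k" "mat_adjoint V * V = 1\<^sub>m k" "\<delta> > 0"
    "\<forall>a\<in>carrier_vec k. Re ((A *\<^sub>v (V *\<^sub>v a)) \<bullet>c (V *\<^sub>v a)) \<le> - \<delta> * nsq a"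
proof -
  define M where "M = real_eigs A"
  obtain ns where ns: "mset ns = {#r \<in># M. r < 0#}" by (metis ex_mset)
  obtain ps where ps: "mset ps = {#r \<in># M. \<not> r < 0#}" by (metis ex_mset)
  define rs where "rs = ns @ ps"
  have rs: "mset rs = real_eigs A" using ns ps by (simp add: rs_def M_def flip: multiset_partition)
  have lenk: "length ns = k" using ns by (metis k M_def neg_inertia_real_eigs[OF A] size_mset)
  from real_diagonalization[OF A rs] obtain U where U: "length rs = n" "U \<in> carrier_mat n n"
    "mat_adjoint U * U = 1\<^sub>m n" "mat_adjoint U * A * U = mat_diag n (\<lambda>i. complex_of_real (rs ! i))" .
  have kn: "k \<le> n" using U(1) lenk by (simp add: rs_def)
  have rneg: "rs ! i < 0" if "i < k" for i
  proof -
    have "rs ! i \<in> set ns" using that lenk by (simp add: rs_def nth_append)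
    then have "rs ! i \<in># mset ns" by simp
    then show ?thesis unfolding ns by simp
  qed
  \<comment> \<open>\<open>E\<close> embeds the first \<open>k\<close> coordinates. As
    \<open>rs\<close> lists the negative eigenvalues first, \<open>U * E\<close> keeps exactly their
    eigenvectors.\<close>
  define E where "E = mat n k (\<lambda>(i, j). if i = j then 1 else 0 :: complex)"
  have E: "E \<in> carrier_mat n k" by (simp add: E_def)
  have EE: "mat_adjoint E * E = 1\<^sub>m k"
    using kn by (intro eq_matI) (auto simp: E_def scalar_prod_def if_distrib[of "\<lambda>x. x * _"] if_distrib[of cnj] sum.delta cong: if_cong)
  have E': "mat_adjoint E \<in> carrier_mat k n" and U': "mat_adjoint U \<in> carrier_mat n n"
    using E U by auto
  define V where "V = U * E"
  have V: "V \<in> carrier_mat n k" using U E by (simp add: V_def)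
  have Va: "V *\<^sub>v a = U *\<^sub>v (E *\<^sub>v a)" if "a \<in> carrier_vec k" for a
    unfolding V_def by (rule assoc_mult_mat_vec[OF U(2) E that])
  have "mat_adjoint V * V = mat_adjoint E * (mat_adjoint U * U) * E"
    unfolding V_def mat_adjoint_mult[OF U(2) E]
    using assoc_mult_mat[OF E' U' mult_carrier_mat[OF U(2) E]] assoc_mult_mat[OF U' U(2) E]
      assoc_mult_mat[OF E' mult_carrier_mat[OF U' U(2)] E] by simp
  also have "\<dots> = 1\<^sub>m k" unfolding U(3) using right_mult_one_mat[of "mat_adjoint E" k n] E EE by simp
  finally have VV: "mat_adjoint V * V = 1\<^sub>m k" .
  \<comment> \<open>The inserted 1 keeps the minimum defined when there is no negative
    eigenvalue.\<close>
  define \<delta> where "\<delta> = Min (insert 1 ((\<lambda>i. - rs ! i) ` {..<k}))"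
  have d: "\<delta> > 0" unfolding \<delta>_def by (subst Min_gr_iff) (auto simp: rneg)
  have dle: "\<delta> \<le> - rs ! i" if "i < k" for i unfolding \<delta>_def using that by (intro Min_le) auto
  show ?thesis
  proof (rule that[OF V VV d], rule ballI)
    fix a :: "complex vec" assume a: "a \<in> carrier_vec k"
    have Ea: "E *\<^sub>v a \<in> carrier_vec n" using E a by simp
    have Eai: "(E *\<^sub>v a) $ i = (if i < k then a $ i else 0)" if "i < n" for i
      using that a by (auto simp: E_def scalar_prod_def if_distrib[of "\<lambda>x. x * _"] sum.delta cong: if_cong)
    have "Re ((A *\<^sub>v (V *\<^sub>v a)) \<bullet>c (V *\<^sub>v a)) = (\<Sum>i<n. rs ! i * (cmod ((E *\<^sub>v a) $ i))\<^sup>2)"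
      unfolding Va[OF a] qform_congruence[OF A(2) U(2) Ea] U(4) by (rule qform_diag[OF Ea])
    also have "\<dots> = (\<Sum>i<k. rs ! i * (cmod (a $ i))\<^sup>2)"
      using kn by (intro sum.mono_neutral_cong_right) (auto simp: Eai)
    also have "\<dots> \<le> (\<Sum>i<k. - \<delta> * (cmod (a $ i))\<^sup>2)"
    proof (rule sum_mono)
      fix i assume "i \<in> {..<k}"
      then have "rs ! i \<le> - \<delta>" using dle[of i] by simp
      then show "rs ! i * (cmod (a $ i))\<^sup>2 \<le> - \<delta> * (cmod (a $ i))\<^sup>2" by (rule mult_right_mono) simp
    qed
    also have "\<dots> = - \<delta> * nsq a" using a by (simp add: nsq_def sum_distrib_left)
    finally show "Re ((A *\<^sub>v (V *\<^sub>v a)) \<bullet>c (V *\<^sub>v a)) \<le> - \<delta> * nsq a" .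
  qed
qed

text \<open>If \<open>k\<close> exceeded the number \<open>q\<close> of negative eigenvalues, a
  dimension count would give a nonzero combination of the columns of \<open>V\<close> orthogonal to
  all eigenvectors with negative eigenvalue. The form is nonnegative there, a contradiction.\<close>

lemma neg_inertia_ge:
  assumes A: "hermitian_mat A" "A \<in> carrier_mat n n" and V: "V \<in> carrier_mat n k"
    and neg: "\<And>a. a \<in> carrier_vec k \<Longrightarrow> a \<noteq> 0\<^sub>v k \<Longrightarrow> Re ((A *\<^sub>v (V *\<^sub>v a)) \<bullet>c (V *\<^sub>v a)) < 0"
  shows "k \<le> neg_inertia A"
proof (rule ccontr)
  assume "\<not> k \<le> neg_inertia A"
  define q where "q = neg_inertia A"
  have qk: "q < k" using \<open>\<not> k \<le> neg_inertia A\<close> by (simp add: q_def)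
  define M where "M = real_eigs A"
  obtain ns where ns: "mset ns = {#r \<in># M. r < 0#}" by (metis ex_mset)
  obtain ps where ps: "mset ps = {#r \<in># M. \<not> r < 0#}" by (metis ex_mset)
  define rs where "rs = ns @ ps"
  have rs: "mset rs = real_eigs A" using ns ps by (simp add: rs_def M_def flip: multiset_partition)
  have lenq: "length ns = q" using ns by (metis q_def M_def neg_inertia_real_eigs[OF A] size_mset)
  from real_diagonalization[OF A rs] obtain U where U: "length rs = n" "U \<in> carrier_mat n n"
    "mat_adjoint U * U = 1\<^sub>m n" "mat_adjoint U * A * U = mat_diag n (\<lambda>i. complex_of_real (rs ! i))" .
  have U': "mat_adjoint U \<in> carrier_mat n n" using U by simp
  have qn: "q \<le> n" using U(1) lenq by (simp add: rs_def)
  have rpos: "rs ! i \<ge> 0" if "q \<le> i" "i < n" for i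
  proof -
    have "rs ! i \<in> set ps" using that lenq U(1) by (auto simp: rs_def nth_append)
    then have "rs ! i \<in># mset ps" by simp
    then show ?thesis unfolding ps by simp
  qed
  define W where "W = mat_adjoint U * V"
  have W: "W \<in> carrier_mat n k" using U' V by (simp add: W_def)
  \<comment> \<open>The first \<open>q\<close> rows of \<open>W\<close>, padded with zero rows to a
    square matrix. Row \<open>q\<close> vanishes since \<open>q < k\<close>, so \<open>N\<close> is
    singular, and a kernel vector \<open>a\<close> makes the first \<open>q\<close> coordinates of
    \<open>W *\<^sub>v a\<close> vanish.\<close>
  define N where "N = mat k k (\<lambda>(i, j). if i < q then W $$ (i, j) else 0)"
  have N: "N \<in> carrier_mat k k" by (simp add: N_def)
  have "transpose_mat N *\<^sub>v unit_vec k q = 0\<^sub>v k"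
    using qk by (intro eq_vecI) (auto simp: N_def scalar_prod_def)
  then have "det (transpose_mat N) = 0"
    using det_0_iff_vec_prod_zero[of "transpose_mat N" k] N qk by (metis transpose_carrier_mat unit_vec_carrier unit_vec_nonzero)
  then have "det N = 0" using Determinant.det_transpose[OF N] by simp
  then obtain a where a: "a \<in> carrier_vec k" "a \<noteq> 0\<^sub>v k" "N *\<^sub>v a = 0\<^sub>v k"
    using det_0_iff_vec_prod_zero[OF N] by blast
  define w where "w = W *\<^sub>v a"
  have w: "w \<in> carrier_vec n" using W a by (simp add: w_def)
  have w0: "w $ i = 0" if "i < q" for i
  proof -
    have "w $ i = (N *\<^sub>v a) $ i"
      using that qk qn W a(1) by (auto simp: w_def N_def scalar_prod_def intro!: sum.cong)
    then show ?thesis using a that qk by simp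
  qed
  have "U *\<^sub>v w = (U * mat_adjoint U) *\<^sub>v (V *\<^sub>v a)"
    using U(2) U' V W a by (simp add: w_def W_def assoc_mult_mat_vec[of _ n n _ k] assoc_mult_mat_vec[of _ n n _ n])
  then have Va: "V *\<^sub>v a = U *\<^sub>v w" using unitary_right_inverse[OF U(2,3)] V a by simp
  have "Re ((A *\<^sub>v (V *\<^sub>v a)) \<bullet>c (V *\<^sub>v a)) = (\<Sum>i<n. rs ! i * (cmod (w $ i))\<^sup>2)"
    unfolding Va qform_congruence[OF A(2) U(2) w] U(4) by (rule qform_diag[OF w])
  also have "\<dots> \<ge> 0"
  proof (rule sum_nonneg)
    fix i assume "i \<in> {..<n}"
    then show "0 \<le> rs ! i * (cmod (w $ i))\<^sup>2" using w0[of i] rpos[of i] by (cases "i < q") auto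
  qed
  finally show False using neg[OF a(1,2)] by simp
qed

lemma hermitian_mat_smult:
  assumes "hermitian_mat A" "A \<in> carrier_mat n n"
  shows "hermitian_mat (complex_of_real c \<cdot>\<^sub>m A)"
proof (rule hermitian_matI[of _ n])
  fix i j assume "i < n" "j < n"
  then show "(complex_of_real c \<cdot>\<^sub>m A) $$ (i, j) = cnj ((complex_of_real c \<cdot>\<^sub>m A) $$ (j, i))"
    using assms(2) hermitian_mat_index[OF assms, of i j] by simp
qed (use assms in simp)

text \<open>\<open>T\<close> carries a subspace on which the congruent form is negative to one on
  which \<open>A\<close> is negative; strict negativity prevents a loss of dimension.\<close>

lemma neg_inertia_congruence_le:
  assumes A: "hermitian_mat A" "A \<in> carrier_mat n n" and T: "T \<in> carrier_mat n m"
  shows "neg_inertia (mat_adjoint T * A * T) \<le> neg_inertia A"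
proof -
  have B: "hermitian_mat (mat_adjoint T * A * T)" "mat_adjoint T * A * T \<in> carrier_mat m m"
    using hermitian_mat_congruence[OF A T] A T by auto
  define k where "k = neg_inertia (mat_adjoint T * A * T)"
  from neg_inertia_subspace[OF B k_def] obtain V \<delta> where V: "V \<in> carrier_mat m k"
    and VV: "mat_adjoint V * V = 1\<^sub>m k" and d: "\<delta> > 0"
    and neg: "\<forall>a\<in>carrier_vec k.
      Re (((mat_adjoint T * A * T) *\<^sub>v (V *\<^sub>v a)) \<bullet>c (V *\<^sub>v a)) \<le> - \<delta> * nsq a" .
  have "k \<le> neg_inertia A"
  proof (rule neg_inertia_ge[OF A mult_carrier_mat[OF T V]])
    fix a :: "complex vec" assume a: "a \<in> carrier_vec k" "a \<noteq> 0\<^sub>v k"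
    have Va: "V *\<^sub>v a \<in> carrier_vec m" using V a by simp
    have "- \<delta> * nsq a < 0" using d nsq_pos[OF a] by simp
    then show "Re ((A *\<^sub>v (T * V *\<^sub>v a)) \<bullet>c (T * V *\<^sub>v a)) < 0"
      using bspec[OF neg a(1)] unfolding assoc_mult_mat_vec[OF T V a(1)] qform_congruence[OF A(2) T Va] by simp
  qed
  then show ?thesis by (simp add: k_def)
qed

text \<open>Sylvester's law of inertia: the inequality for \<open>T\<close> and the one for its
  inverse \<open>S\<close>.\<close>

lemma neg_inertia_congruence:
  assumes A: "hermitian_mat A" "A \<in> carrier_mat n n" and T: "T \<in> carrier_mat n n"
    and S: "S \<in> carrier_mat n n" "T * S = 1\<^sub>m n"
  shows "neg_inertia (mat_adjoint T * A * T) = neg_inertia A"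
proof (rule antisym)
  show "neg_inertia (mat_adjoint T * A * T) \<le> neg_inertia A" by (rule neg_inertia_congruence_le[OF A T])
  have T': "mat_adjoint T \<in> carrier_mat n n" and S': "mat_adjoint S \<in> carrier_mat n n" using T S by auto
  have ST: "mat_adjoint S * mat_adjoint T = 1\<^sub>m n"
    using mat_adjoint_mult[OF T S(1)] S(2) by simp
  have "mat_adjoint S * (mat_adjoint T * A * T) * S = (mat_adjoint S * mat_adjoint T) * A * (T * S)"
    using A(2) T S(1) T' S' by (simp add: square_mult_assoc[where n = n] square_mult_closed)
  also have "\<dots> = A" using A(2) by (simp add: ST S(2))
  finally have "A = mat_adjoint S * (mat_adjoint T * A * T) * S" by simp
  then show "neg_inertia A \<le> neg_inertia (mat_adjoint T * A * T)"
    using neg_inertia_congruence_le[OF hermitian_mat_congruence[OF A T] _ S(1)] mult_carrier_mat[OF mult_carrier_mat[OF T' A(2)] T] by simp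
qed

lemma uminus_sandwich:
  assumes "(A :: complex mat) \<in> carrier_mat n n" "T \<in> carrier_mat n m"
  shows "mat_adjoint T * (- A) * T = - (mat_adjoint T * A * T)"
proof -
  have T': "mat_adjoint T \<in> carrier_mat m n" using assms by simp
  show ?thesis
    using uminus_mult_right_mat[of A "mat_adjoint T"] uminus_mult_left_mat[of "mat_adjoint T * A" T] assms T' by simp
qed

lemma neg_inertia_congruence_uminus:
  assumes A: "hermitian_mat A" "A \<in> carrier_mat n n" and T: "T \<in> carrier_mat n n"
    and S: "S \<in> carrier_mat n n" "T * S = 1\<^sub>m n"
  shows "neg_inertia (- (mat_adjoint T * A * T)) = neg_inertia (- A)"
  using neg_inertia_congruence[OF hermitian_mat_uminus[OF A] _ T S] uminus_sandwich[OF A(2) T] A by simp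

text \<open>Where the larger form is negative, so is the smaller one.\<close>

lemma neg_inertia_mono:
  assumes A: "hermitian_mat A" "A \<in> carrier_mat n n" and B: "hermitian_mat B" "B \<in> carrier_mat n n"
    and le: "\<And>v. v \<in> carrier_vec n \<Longrightarrow> Re ((A *\<^sub>v v) \<bullet>c v) \<le> Re ((B *\<^sub>v v) \<bullet>c v)"
  shows "neg_inertia B \<le> neg_inertia A"
proof -
  from neg_inertia_subspace[OF B refl] obtain V \<delta> where V: "V \<in> carrier_mat n (neg_inertia B)"
    and VV: "mat_adjoint V * V = 1\<^sub>m (neg_inertia B)" and d: "\<delta> > 0"
    and neg: "\<forall>a\<in>carrier_vec (neg_inertia B).
      Re ((B *\<^sub>v (V *\<^sub>v a)) \<bullet>c (V *\<^sub>v a)) \<le> - \<delta> * nsq a" .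
  show ?thesis
  proof (rule neg_inertia_ge[OF A V])
    fix a :: "complex vec" assume a: "a \<in> carrier_vec (neg_inertia B)" "a \<noteq> 0\<^sub>v (neg_inertia B)"
    have "- \<delta> * nsq a < 0" using d nsq_pos[OF a] by simp
    then show "Re ((A *\<^sub>v (V *\<^sub>v a)) \<bullet>c (V *\<^sub>v a)) < 0"
      using bspec[OF neg a(1)] le[of "V *\<^sub>v a"] V a by simp
  qed
qed

text \<open>From 2ab \<le> a^2 + b^2 applied to each pair of coordinates. The factor
  \<open>n\<close> is the price of an entrywise bound and reappears in the choice of every later
  \<epsilon>.\<close>

lemma qform_bound:
  assumes M: "(M :: complex mat) \<in> carrier_mat n n" and v: "v \<in> carrier_vec n"
    and b: "\<And>i j. i < n \<Longrightarrow> j < n \<Longrightarrow> cmod (M $$ (i, j)) \<le> e"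
  shows "\<bar>Re ((M *\<^sub>v v) \<bullet>c v)\<bar> \<le> e * n * nsq v"
proof -
  have "(M *\<^sub>v v) \<bullet>c v = (\<Sum>i<n. \<Sum>j<n. M $$ (i, j) * v $ j * cnj (v $ i))"
    using M v by (auto simp: scalar_prod_def sum_distrib_right atLeast0LessThan intro!: sum.cong)
  then have "\<bar>Re ((M *\<^sub>v v) \<bullet>c v)\<bar> \<le> cmod (\<Sum>i<n. \<Sum>j<n. M $$ (i, j) * v $ j * cnj (v $ i))"
    using abs_Re_le_cmod by metis
  also have "\<dots> \<le> (\<Sum>i<n. \<Sum>j<n. cmod (M $$ (i, j) * v $ j * cnj (v $ i)))"
    by (intro sum_norm_le order_trans[OF norm_sum] order_refl)
  also have "\<dots> \<le> (\<Sum>i<n. \<Sum>j<n. e * (((cmod (v $ i))\<^sup>2 + (cmod (v $ j))\<^sup>2) / 2))"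
  proof (intro sum_mono)
    fix i j assume ij: "i \<in> {..<n}" "j \<in> {..<n}"
    have "cmod (v $ j) * cmod (v $ i) \<le> ((cmod (v $ i))\<^sup>2 + (cmod (v $ j))\<^sup>2) / 2"
      using sum_squares_bound[of "cmod (v $ j)" "cmod (v $ i)"] by (simp add: field_simps)
    then show "cmod (M $$ (i, j) * v $ j * cnj (v $ i)) \<le> e * (((cmod (v $ i))\<^sup>2 + (cmod (v $ j))\<^sup>2) / 2)"
      using b[of i j] ij order_trans[OF norm_ge_zero b[of i j]]
      unfolding norm_mult complex_mod_cnj mult.assoc by (intro mult_mono) auto
  qed
  also have "\<dots> = e * ((\<Sum>i<n. \<Sum>j<n. (cmod (v $ i))\<^sup>2) + (\<Sum>i<n. \<Sum>j<n. (cmod (v $ j))\<^sup>2)) / 2"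
    by (simp only: sum_distrib_left[symmetric] sum_divide_distrib[symmetric] sum.distrib times_divide_eq_right)
  also have "\<dots> = e * n * nsq v"
    using v by (simp add: nsq_def sum_distrib_left[symmetric])
  finally show ?thesis .
qed

lemma qform_diff:
  assumes "(A :: complex mat) \<in> carrier_mat n n" "B \<in> carrier_mat n n" "v \<in> carrier_vec n"
  shows "Re ((A *\<^sub>v v) \<bullet>c v) = Re ((B *\<^sub>v v) \<bullet>c v) + Re (((A - B) *\<^sub>v v) \<bullet>c v)"
proof -
  have v': "conjugate v \<in> carrier_vec n" using assms by simp
  have "(A - B) *\<^sub>v v = A *\<^sub>v v - B *\<^sub>v v"
    using minus_mult_distrib_mat_vec assms by blast
  then have "((A - B) *\<^sub>v v) \<bullet>c v = (A *\<^sub>v v) \<bullet>c v - (B *\<^sub>v v) \<bullet>c v"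
    using minus_scalar_prod_distrib[of "A *\<^sub>v v" n "B *\<^sub>v v" "conjugate v"] assms v' by simp
  then show ?thesis by simp
qed

text \<open>An entrywise perturbation by \<open>\<epsilon>\<close> moves the form by at most
  \<open>\<epsilon> * n\<close> times the squared norm, which is less than the margin
  \<open>\<delta>\<close> on the negative subspace of \<open>A\<close>.\<close>

lemma neg_inertia_lsc:
  assumes A: "hermitian_mat A" "A \<in> carrier_mat n n"
  shows "\<exists>\<epsilon>>0. \<forall>H \<in> carrier_mat n n. hermitian_mat H \<longrightarrow>
    (\<forall>i<n. \<forall>j<n. cmod (H $$ (i, j) - A $$ (i, j)) \<le> \<epsilon>) \<longrightarrow> neg_inertia A \<le> neg_inertia H"
proof -
  define k where "k = neg_inertia A"
  from neg_inertia_subspace[OF A k_def] obtain V \<delta> where V: "V \<in> carrier_mat n k"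
    and VV: "mat_adjoint V * V = 1\<^sub>m k" and d: "\<delta> > 0"
    and neg: "\<forall>a\<in>carrier_vec k. Re ((A *\<^sub>v (V *\<^sub>v a)) \<bullet>c (V *\<^sub>v a)) \<le> - \<delta> * nsq a" .
  define \<epsilon> where "\<epsilon> = \<delta> / (n + 1)"
  have e: "\<epsilon> > 0" using d by (simp add: \<epsilon>_def add_pos_nonneg)
  have en: "\<epsilon> * n < \<delta>" using d by (simp add: \<epsilon>_def field_simps)
  show ?thesis
  proof (intro exI[of _ \<epsilon>] conjI e ballI impI)
    fix H assume H: "H \<in> carrier_mat n n" "hermitian_mat H"
      and close: "\<forall>i<n. \<forall>j<n. cmod (H $$ (i, j) - A $$ (i, j)) \<le> \<epsilon>"
    have "k \<le> neg_inertia H"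
    proof (rule neg_inertia_ge[OF H(2,1) V])
      fix a :: "complex vec" assume a: "a \<in> carrier_vec k" "a \<noteq> 0\<^sub>v k"
      have Va: "V *\<^sub>v a \<in> carrier_vec n" using V a by simp
      have pos: "nsq a > 0" by (rule nsq_pos[OF a])
      have "\<bar>Re (((H - A) *\<^sub>v (V *\<^sub>v a)) \<bullet>c (V *\<^sub>v a))\<bar> \<le> \<epsilon> * n * nsq (V *\<^sub>v a)"
        by (rule qform_bound) (use A H close Va in auto)
      also have "nsq (V *\<^sub>v a) = nsq a" by (rule nsq_isometry[OF V VV a(1)])
      also have "\<epsilon> * n * nsq a < \<delta> * nsq a" using en pos by simp
      finally show "Re ((H *\<^sub>v (V *\<^sub>v a)) \<bullet>c (V *\<^sub>v a)) < 0"
        using qform_diff[OF H(1) A(2) Va] bspec[OF neg a(1)] by linarith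
    qed
    then show "neg_inertia A \<le> neg_inertia H" by (simp add: k_def)
  qed
qed

text \<open>Near \<open>A\<close> neither index can drop. At a nonsingular \<open>A\<close> the two
  already add up to \<open>n\<close>, so neither can rise.\<close>

lemma inertia_locally_constant:
  assumes A: "hermitian_mat A" "A \<in> carrier_mat n n" and det: "det A \<noteq> 0"
  shows "\<exists>\<epsilon>>0. \<forall>H \<in> carrier_mat n n. hermitian_mat H \<longrightarrow>
    (\<forall>i<n. \<forall>j<n. cmod (H $$ (i, j) - A $$ (i, j)) \<le> \<epsilon>) \<longrightarrow>
      neg_inertia H = neg_inertia A \<and> neg_inertia (- H) = neg_inertia (- A)"
proof -
  have A': "hermitian_mat (- A)" "- A \<in> carrier_mat n n" using hermitian_mat_uminus[OF A] A by auto
  from neg_inertia_lsc[OF A] obtain e1 where e1: "e1 > 0" and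
    l1: "\<And>H. H \<in> carrier_mat n n \<Longrightarrow> hermitian_mat H \<Longrightarrow>
      (\<forall>i<n. \<forall>j<n. cmod (H $$ (i, j) - A $$ (i, j)) \<le> e1) \<Longrightarrow> neg_inertia A \<le> neg_inertia H" by blast
  from neg_inertia_lsc[OF A'] obtain e2 where e2: "e2 > 0" and
    l2: "\<And>H. H \<in> carrier_mat n n \<Longrightarrow> hermitian_mat H \<Longrightarrow>
      (\<forall>i<n. \<forall>j<n. cmod (H $$ (i, j) - (- A) $$ (i, j)) \<le> e2) \<Longrightarrow> neg_inertia (- A) \<le> neg_inertia H" by blast
  show ?thesis
  proof (intro exI[of _ "min e1 e2"] conjI ballI impI)
    fix H assume H: "H \<in> carrier_mat n n" "hermitian_mat H"
      and close: "\<forall>i<n. \<forall>j<n. cmod (H $$ (i, j) - A $$ (i, j)) \<le> min e1 e2"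
    have 1: "neg_inertia A \<le> neg_inertia H" using close by (intro l1 H) auto
    have 2: "neg_inertia (- A) \<le> neg_inertia (- H)"
    proof (rule l2)
      show "\<forall>i<n. \<forall>j<n. cmod ((- H) $$ (i, j) - (- A) $$ (i, j)) \<le> e2"
        using close H A by (auto simp: norm_minus_commute)
    qed (use H hermitian_mat_uminus in auto)
    have "neg_inertia A + neg_inertia (- A) = n" using inertia_sum[OF A] det det_zero_real_eigs[OF A]
      by (metis add_cancel_left_right)
    moreover have "neg_inertia H + neg_inertia (- H) \<le> n" using inertia_sum[OF H(2,1)] by simp
    ultimately show "neg_inertia H = neg_inertia A" "neg_inertia (- H) = neg_inertia (- A)" using 1 2 by linarith+
  qed (use e1 e2 in auto)
qed

lemma inertia_positive_definite:
  assumes A: "hermitian_mat A" "A \<in> carrier_mat n n"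
    and pos: "\<And>v. v \<in> carrier_vec n \<Longrightarrow> v \<noteq> 0\<^sub>v n \<Longrightarrow> Re ((A *\<^sub>v v) \<bullet>c v) > 0"
  shows "neg_inertia A = 0" "neg_inertia (- A) = n"
proof -
  have A': "hermitian_mat (- A)" "- A \<in> carrier_mat n n" using hermitian_mat_uminus[OF A] A by auto
  have "n \<le> neg_inertia (- A)"
  proof (rule neg_inertia_ge[OF A' one_carrier_mat])
    fix a :: "complex vec" assume a: "a \<in> carrier_vec n" "a \<noteq> 0\<^sub>v n"
    then show "Re ((- A *\<^sub>v (1\<^sub>m n *\<^sub>v a)) \<bullet>c (1\<^sub>m n *\<^sub>v a)) < 0"
      using pos[OF a] A by (simp add: uminus_scalar_prod[symmetric] uminus_mult_mat_vec)
  qed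
  with inertia_sum[OF A] show "neg_inertia A = 0" "neg_inertia (- A) = n" by auto
qed

lemma real_eigs_block_diag:
  assumes "A \<in> carrier_mat n n" "D \<in> carrier_mat m m"
  shows "real_eigs (four_block_mat A (0\<^sub>m n m) (0\<^sub>m m n) D) = real_eigs A + real_eigs D"
proof -
  have "char_poly (four_block_mat A (0\<^sub>m n m) (0\<^sub>m m n) D) = char_poly A * char_poly D"
    using char_poly_factorized[OF assms(1)] char_poly_factorized[OF assms(2)] assms
    by (intro char_poly_0_block[OF refl]) auto
  moreover have "char_poly A \<noteq> 0" "char_poly D \<noteq> 0"
    using degree_monic_char_poly[OF assms(1)] degree_monic_char_poly[OF assms(2)] by auto
  ultimately show ?thesis by (simp add: real_eigs_def eigenvalue_mset_def proots_mult)
qed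

lemma hermitian_block_diag:
  assumes "hermitian_mat A" "A \<in> carrier_mat n n" "hermitian_mat D" "D \<in> carrier_mat m m"
  shows "hermitian_mat (four_block_mat A (0\<^sub>m n m) (0\<^sub>m m n) D)"
  using assms by (intro hermitian_matI[of _ "n + m"]) (auto simp: hermitian_mat_index)

lemma neg_inertia_block_diag:
  assumes "hermitian_mat A" "A \<in> carrier_mat n n" "hermitian_mat D" "D \<in> carrier_mat m m"
  shows "neg_inertia (four_block_mat A (0\<^sub>m n m) (0\<^sub>m m n) D) = neg_inertia A + neg_inertia D"
    "neg_inertia (- four_block_mat A (0\<^sub>m n m) (0\<^sub>m m n) D) = neg_inertia (- A) + neg_inertia (- D)"
proof -
  have c: "four_block_mat A (0\<^sub>m n m) (0\<^sub>m m n) D \<in> carrier_mat (n + m) (n + m)" using assms by simp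
  show "neg_inertia (four_block_mat A (0\<^sub>m n m) (0\<^sub>m m n) D) = neg_inertia A + neg_inertia D"
    using assms by (simp add: neg_inertia_real_eigs[OF hermitian_block_diag[OF assms] c]
        neg_inertia_real_eigs real_eigs_block_diag)
  show "neg_inertia (- four_block_mat A (0\<^sub>m n m) (0\<^sub>m m n) D) = neg_inertia (- A) + neg_inertia (- D)"
    using assms by (simp add: neg_inertia_uminus[OF hermitian_block_diag[OF assms] c]
        neg_inertia_uminus real_eigs_block_diag)
qed

lemma neg_inertia_affine:
  assumes A: "hermitian_mat A" "A \<in> carrier_mat n n"
  shows "neg_inertia (complex_of_real c \<cdot>\<^sub>m 1\<^sub>m n + complex_of_real s \<cdot>\<^sub>m A) = size {#r \<in># real_eigs A. c + s * r < 0#}"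
    "neg_inertia (- (complex_of_real c \<cdot>\<^sub>m 1\<^sub>m n + complex_of_real s \<cdot>\<^sub>m A)) = size {#r \<in># real_eigs A. c + s * r > 0#}"
proof -
  have c: "complex_of_real c \<cdot>\<^sub>m 1\<^sub>m n + complex_of_real s \<cdot>\<^sub>m A \<in> carrier_mat n n" using A by simp
  show "neg_inertia (complex_of_real c \<cdot>\<^sub>m 1\<^sub>m n + complex_of_real s \<cdot>\<^sub>m A) = size {#r \<in># real_eigs A. c + s * r < 0#}"
    using neg_inertia_real_eigs[OF hermitian_mat_affine[OF A] c]
    by (simp add: real_eigs_affine[OF A] filter_mset_image_mset comp_def)
  show "neg_inertia (- (complex_of_real c \<cdot>\<^sub>m 1\<^sub>m n + complex_of_real s \<cdot>\<^sub>m A)) = size {#r \<in># real_eigs A. c + s * r > 0#}"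
    using neg_inertia_uminus[OF hermitian_mat_affine[OF A] c]
    by (simp add: real_eigs_affine[OF A] filter_mset_image_mset comp_def)
qed

lemma neg_inertia_smult:
  assumes A: "hermitian_mat A" "A \<in> carrier_mat n n" and s: "s > 0"
  shows "neg_inertia (complex_of_real s \<cdot>\<^sub>m A) = neg_inertia A"
    "neg_inertia (- (complex_of_real s \<cdot>\<^sub>m A)) = neg_inertia (- A)"
proof -
  have "complex_of_real s \<cdot>\<^sub>m A = complex_of_real 0 \<cdot>\<^sub>m 1\<^sub>m n + complex_of_real s \<cdot>\<^sub>m A"
    using A by (intro eq_matI) auto
  with neg_inertia_affine[OF A, of 0 s] s
  show "neg_inertia (complex_of_real s \<cdot>\<^sub>m A) = neg_inertia A"
    "neg_inertia (- (complex_of_real s \<cdot>\<^sub>m A)) = neg_inertia (- A)"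
    by (simp_all add: neg_inertia_real_eigs[OF A] neg_inertia_uminus[OF A] zero_less_mult_iff mult_less_0_iff)
qed

section \<open>Holomorphic functions of two variables\<close>

text \<open>Holomorphy on a bidisc, as joint continuity together with holomorphy in each variable.
  In this form it is checked directly for uniform limits and for the blow-up; differentiability in
  both variables at once is then Osgood's lemma.\<close>

definition hol2_on :: "real \<Rightarrow> (complex \<Rightarrow> complex \<Rightarrow> complex) \<Rightarrow> bool" where
  "hol2_on r f \<longleftrightarrow> continuous_on (ball 0 r \<times> ball 0 r) (\<lambda>(z, w). f z w) \<and>
     (\<forall>w\<in>ball 0 r. (\<lambda>z. f z w) holomorphic_on ball 0 r) \<and>
     (\<forall>z\<in>ball 0 r. (\<lambda>w. f z w) holomorphic_on ball 0 r)"

definition hol2 :: "(complex \<Rightarrow> complex \<Rightarrow> complex) \<Rightarrow> bool" where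
  "hol2 f \<longleftrightarrow> (\<exists>r>0. hol2_on r f)"

lemma hol2_on_subset: "hol2_on r f \<Longrightarrow> s \<le> r \<Longrightarrow> hol2_on s f"
  unfolding hol2_on_def
  by (safe; (elim continuous_on_subset)?) (force intro: holomorphic_on_subset)+

lemma hol2_common_radius:
  assumes "hol2 f" "hol2 g"
  obtains r where "r > 0" "hol2_on r f" "hol2_on r g"
proof -
  from assms obtain r s where "r > 0" "hol2_on r f" "s > 0" "hol2_on s g" by (auto simp: hol2_def)
  then show ?thesis by (intro that[of "min r s"]) (auto elim: hol2_on_subset)
qed

lemma hol2_on_swap: "hol2_on r f \<Longrightarrow> hol2_on r (\<lambda>z w. f w z)"
proof -
  assume f: "hol2_on r f"
  have "continuous_on (ball 0 r \<times> ball 0 r) ((\<lambda>(z, w). f z w) \<circ> prod.swap)"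
    using f unfolding hol2_on_def
    by (intro continuous_on_compose continuous_on_swap) (auto simp: product_swap)
  then show ?thesis using f by (auto simp: hol2_on_def o_def split_beta')
qed

text \<open>By uniform continuity on a compact bidisc, \<open>f z w\<close> and
  \<open>f z w0\<close> differ little for all \<open>z\<close> at once, and Cauchy's inequality
  passes this on to the derivatives. The variation in \<open>z\<close> is the continuity of the
  derivative of the single function with \<open>w = w0\<close>.\<close>

lemma continuous_on_deriv_fst:
  assumes f: "hol2_on r f"
  shows "continuous_on (ball 0 r \<times> ball 0 r) (\<lambda>(z, w). deriv (\<lambda>z. f z w) z)"
proof -
  have cont: "continuous_on (ball 0 r \<times> ball 0 r) (\<lambda>(z, w). f z w)"
    and hol: "\<And>w. w \<in> ball 0 r \<Longrightarrow> (\<lambda>z. f z w) holomorphic_on ball 0 r"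
    using f by (auto simp: hol2_on_def)
  have "isCont (\<lambda>(z, w). deriv (\<lambda>z. f z w) z) (z0, w0)" if p: "z0 \<in> ball 0 r" "w0 \<in> ball 0 r" for z0 w0
  proof -
    obtain \<rho> where \<rho>: "\<rho> > 0" "cball z0 \<rho> \<subseteq> ball 0 r" using p(1) open_contains_cball by blast
    obtain \<sigma> where \<sigma>: "\<sigma> > 0" "cball w0 \<sigma> \<subseteq> ball 0 r" using p(2) open_contains_cball by blast
    have uc: "uniformly_continuous_on (cball z0 \<rho> \<times> cball w0 \<sigma>) (\<lambda>(z, w). f z w)"
      by (intro compact_uniformly_continuous continuous_on_subset[OF cont] compact_Times) (use \<rho> \<sigma> in auto)
    have c1: "isCont (deriv (\<lambda>z. f z w0)) z0"
      using holomorphic_on_imp_continuous_on[OF holomorphic_deriv[OF hol[OF p(2)]]] p(1)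
      by (simp add: continuous_on_eq_continuous_at)
    have "((\<lambda>(z, w). deriv (\<lambda>z. f z w) z) \<longlongrightarrow> deriv (\<lambda>z. f z w0) z0) (at (z0, w0))"
    proof (rule tendstoI)
      fix \<epsilon> :: real assume e: "\<epsilon> > 0"
      \<comment> \<open>Cauchy's inequality on a disc of radius \<open>\<rho>/2\<close> turns the
        bound \<open>e'\<close> into \<open>\<epsilon>/4\<close>; the variation in \<open>z\<close>
        takes another \<open>\<epsilon>/2\<close>.\<close>
      define e' where "e' = \<epsilon> * \<rho> / 8"
      have e': "e' > 0" using e \<rho> by (simp add: e'_def)
      from uc e' obtain d where d: "d > 0" "\<And>a b. a \<in> cball z0 \<rho> \<times> cball w0 \<sigma> \<Longrightarrow> b \<in> cball z0 \<rho> \<times> cball w0 \<sigma> \<Longrightarrow>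
        dist b a < d \<Longrightarrow> dist ((\<lambda>(z, w). f z w) b) ((\<lambda>(z, w). f z w) a) < e'"
        unfolding uniformly_continuous_on_def by metis
      from c1 e obtain d2 where d2: "d2 > 0" "\<And>z. dist z z0 < d2 \<Longrightarrow> dist (deriv (\<lambda>z. f z w0) z) (deriv (\<lambda>z. f z w0) z0) < \<epsilon> / 2"
        unfolding continuous_at_eps_delta by (metis half_gt_zero)
      define m where "m = min (min d d2) (min (\<rho>/2) \<sigma>)"
      have m: "m > 0" using d d2 \<rho> \<sigma> by (simp add: m_def)
      show "\<forall>\<^sub>F p in at (z0, w0). dist (case p of (z, w) \<Rightarrow> deriv (\<lambda>z. f z w) z) (deriv (\<lambda>z. f z w0) z0) < \<epsilon>"
        unfolding eventually_at
      proof (intro exI[of _ m] conjI m ballI impI)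
        fix p assume "p \<noteq> (z0, w0) \<and> dist p (z0, w0) < m"
        then obtain z w where pz: "p = (z, w)" and dm: "dist (z, w) (z0, w0) < m" by (cases p) auto
        have dz: "dist z z0 < m" and dw: "dist w w0 < m"
          using dm dist_fst_le[of "(z, w)" "(z0, w0)"] dist_snd_le[of "(z, w)" "(z0, w0)"] by auto
        have "w \<in> cball w0 \<sigma>" using dw by (auto simp: m_def dist_commute)
        then have wr: "w \<in> ball 0 r" using \<sigma> by blast
        have sub: "cball z (\<rho>/2) \<subseteq> cball z0 \<rho>"
        proof
          fix x assume "x \<in> cball z (\<rho>/2)"
          then show "x \<in> cball z0 \<rho>"
            using dz dist_triangle[of z0 x z] by (simp add: m_def dist_commute)
        qed
        then have subr: "cball z (\<rho>/2) \<subseteq> ball 0 r" using \<rho> by blast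
        have "z \<in> cball z (\<rho>/2)" using \<rho> by simp
        then have zr: "z \<in> ball 0 r" using subr by blast
        have h: "(\<lambda>z. f z w - f z w0) holomorphic_on ball 0 r"
          using hol[OF wr] hol[OF p(2)] by (intro holomorphic_intros)
        have "norm ((deriv ^^ 1) (\<lambda>z. f z w - f z w0) z) \<le> fact 1 * e' / (\<rho>/2) ^ 1"
        proof (rule Cauchy_inequality)
          show "(\<lambda>z. f z w - f z w0) holomorphic_on ball z (\<rho>/2)"
            using h subr by (meson ball_subset_cball holomorphic_on_subset order_trans)
          show "continuous_on (cball z (\<rho>/2)) (\<lambda>z. f z w - f z w0)"
            using h subr holomorphic_on_imp_continuous_on continuous_on_subset by blast
          fix x assume "norm (z - x) = \<rho>/2"
          then have x: "x \<in> cball z0 \<rho>" using sub by (auto simp: dist_norm)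
          have "dist (x, w) (x, w0) < d" using dw by (simp add: dist_Pair_Pair m_def)
          with d(2)[of "(x, w0)" "(x, w)"] x dw \<sigma> show "norm (f x w - f x w0) \<le> e'"
            by (auto simp: m_def dist_norm norm_minus_commute)
        qed (use \<rho> in auto)
        moreover have "deriv (\<lambda>z. f z w - f z w0) z = deriv (\<lambda>z. f z w) z - deriv (\<lambda>z. f z w0) z"
          using hol[OF wr] hol[OF p(2)] zr
          by (intro deriv_diff) (auto simp: holomorphic_on_imp_differentiable_at)
        ultimately have "dist (deriv (\<lambda>z. f z w) z) (deriv (\<lambda>z. f z w0) z) \<le> \<epsilon> / 4"
          using \<rho> by (simp add: dist_norm e'_def field_simps)
        moreover have "dist (deriv (\<lambda>z. f z w0) z) (deriv (\<lambda>z. f z w0) z0) < \<epsilon> / 2"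
          using d2(2)[of z] dz by (simp add: m_def)
        ultimately show "dist (case p of (z, w) \<Rightarrow> deriv (\<lambda>z. f z w) z) (deriv (\<lambda>z. f z w0) z0) < \<epsilon>"
          using dist_triangle[of "deriv (\<lambda>z. f z w) z" "deriv (\<lambda>z. f z w0) z0" "deriv (\<lambda>z. f z w0) z"] e
          by (simp add: pz)
      qed
    qed
    then show ?thesis by (simp add: isCont_def)
  qed
  then show ?thesis by (auto simp: continuous_on_eq_continuous_at open_Times)
qed

text \<open>Osgood's lemma.\<close>

lemma hol2_on_has_derivative:
  assumes f: "hol2_on r f" and p: "z \<in> ball 0 r" "w \<in> ball 0 r"
  shows "((\<lambda>(z, w). f z w) has_derivative
    (\<lambda>(u, v). deriv (\<lambda>z. f z w) z * u + deriv (\<lambda>w. f z w) w * v)) (at (z, w))"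
proof -
  define fy where "fy z w = blinfun_mult_right (deriv (\<lambda>w. f z w) w)" for z w
  have fy: "blinfun_apply (fy z w) = (*) (deriv (\<lambda>w. f z w) w)" for z w
    by (simp add: fy_def fun_eq_iff blinfun_mult_right.rep_eq)
  \<comment> \<open>\<open>has_derivative_partialsI\<close> asks for the first partial derivative at
    the point and for continuity of the second one, which is the previous lemma with the variables
    swapped.\<close>
  have d: "continuous_on (ball 0 r \<times> ball 0 r) ((\<lambda>(w, z). deriv (\<lambda>w. f z w) w) \<circ> prod.swap)"
    using continuous_on_deriv_fst[OF hol2_on_swap[OF f]]
    by (intro continuous_on_compose continuous_on_swap) (auto simp: product_swap)
  have "continuous_on (ball 0 r \<times> ball 0 r) (\<lambda>p. blinfun_mult_right (((\<lambda>(w, z). deriv (\<lambda>w. f z w) w) \<circ> prod.swap) p))"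
    by (rule bounded_linear.continuous_on[OF bounded_linear_blinfun_mult_right d])
  then have c: "continuous_on (ball 0 r \<times> ball 0 r) (\<lambda>(z, w). fy z w)"
    by (simp add: fy_def o_def split_beta')
  have "((\<lambda>(z, w). f z w) has_derivative (\<lambda>(u, v). deriv (\<lambda>z. f z w) z * u + blinfun_apply (fy z w) v))
    (at (z, w) within ball 0 r \<times> ball 0 r)"
  proof (rule has_derivative_partialsI)
    show "((\<lambda>z. f z w) has_derivative (*) (deriv (\<lambda>z. f z w) z)) (at z within ball 0 r)"
      using f p holomorphic_derivI[of "\<lambda>z. f z w" "ball 0 r" z "ball 0 r"]
      by (auto simp: hol2_on_def has_field_derivative_def)
    show "((\<lambda>w. f z w) has_derivative blinfun_apply (fy z w)) (at w within ball 0 r)"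
      if "z \<in> ball 0 r" "w \<in> ball 0 r" for z w
      using f that holomorphic_derivI[of "\<lambda>w. f z w" "ball 0 r" w "ball 0 r"]
      by (auto simp: hol2_on_def has_field_derivative_def fy)
    show "continuous (at (z, w) within ball 0 r \<times> ball 0 r) (\<lambda>(z, w). fy z w)"
      using c p by (auto simp: continuous_on_eq_continuous_within)
  qed (use p in auto)
  moreover have "at (z, w) within ball 0 r \<times> ball 0 r = at (z, w)"
    using p by (intro at_within_open open_Times) auto
  ultimately show ?thesis by (simp add: fy)
qed

lemma hol2_on_compose_holomorphic:
  assumes f: "hol2_on r f" and g: "g holomorphic_on S" and h: "h holomorphic_on S" and S: "open S"
    and im: "g ` S \<subseteq> ball 0 r" "h ` S \<subseteq> ball 0 r"
  shows "(\<lambda>x. f (g x) (h x)) holomorphic_on S"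
proof (rule holomorphic_onI)
  fix x assume x: "x \<in> S"
  define a where "a = deriv (\<lambda>z. f z (h x)) (g x)"
  define b where "b = deriv (\<lambda>w. f (g x) w) (h x)"
  have g': "(g has_derivative (*) (deriv g x)) (at x)" and h': "(h has_derivative (*) (deriv h x)) (at x)"
    using holomorphic_derivI[OF g S x] holomorphic_derivI[OF h S x] by (auto simp: has_field_derivative_def)
  have "((\<lambda>(z, w). f z w) has_derivative (\<lambda>(u, v). a * u + b * v)) (at (g x, h x))"
    unfolding a_def b_def using im x by (intro hol2_on_has_derivative[OF f]) auto
  from has_derivative_compose[OF has_derivative_Pair[OF g' h'] this]
  have "((\<lambda>x. f (g x) (h x)) has_derivative (\<lambda>u. a * (deriv g x * u) + b * (deriv h x * u))) (at x)" by simp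
  moreover have "(\<lambda>u. a * (deriv g x * u) + b * (deriv h x * u)) = (*) (a * deriv g x + b * deriv h x)"
    by (auto simp: algebra_simps)
  ultimately show "(\<lambda>x. f (g x) (h x)) field_differentiable at x within S"
    by (auto simp: field_differentiable_def has_field_derivative_def intro: has_derivative_at_withinI)
qed

lemma hol2_compose:
  assumes f: "hol2 f" and g: "hol2 g" and h: "hol2 h" and z: "g 0 0 = 0" "h 0 0 = 0"
  shows "hol2 (\<lambda>z w. f (g z w) (h z w))"
proof -
  from f obtain r where r: "r > 0" "hol2_on r f" by (auto simp: hol2_def)
  from hol2_common_radius[OF g h] obtain s where s: "s > 0" "hol2_on s g" "hol2_on s h" .
  have gh: "continuous_on (ball 0 s \<times> ball 0 s) (\<lambda>(z, w). (g z w, h z w))"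
    using s unfolding hol2_on_def split_beta' by (intro continuous_on_Pair) auto
  have op: "open ((\<lambda>(z, w). (g z w, h z w)) -` (ball 0 r \<times> ball 0 r) \<inter> (ball 0 s \<times> ball 0 s))"
    using gh by (subst (asm) continuous_on_open_vimage) (auto simp: open_Times)
  have "(0, 0) \<in> (\<lambda>(z, w). (g z w, h z w)) -` (ball 0 r \<times> ball 0 r) \<inter> (ball 0 s \<times> ball 0 s)"
    using z r s by simp
  with op obtain A B where AB: "open A" "open B" "(0, 0) \<in> A \<times> B"
    "A \<times> B \<subseteq> (\<lambda>(z, w). (g z w, h z w)) -` (ball 0 r \<times> ball 0 r) \<inter> (ball 0 s \<times> ball 0 s)"
    by (rule open_prod_elim)
  obtain a b where ab: "a > 0" "ball 0 a \<subseteq> A" "b > 0" "ball 0 b \<subseteq> B"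
    using AB(1-3) by (meson SigmaE2 mem_Sigma_iff open_contains_ball)
  define q where "q = min (min a b) s"
  have q: "q > 0" "q \<le> s" using ab s by (auto simp: q_def)
  have im: "g z w \<in> ball 0 r" "h z w \<in> ball 0 r" if "z \<in> ball 0 q" "w \<in> ball 0 q" for z w
  proof -
    have "(z, w) \<in> A \<times> B" using that ab by (auto simp: q_def)
    with AB(4) show "g z w \<in> ball 0 r" "h z w \<in> ball 0 r" by auto
  qed
  have sg: "hol2_on q g" and sh: "hol2_on q h" using s q by (auto intro: hol2_on_subset)
  have "continuous_on (ball 0 q \<times> ball 0 q) (\<lambda>p. (\<lambda>(z, w). f z w) ((\<lambda>(z, w). (g z w, h z w)) p))"
  proof (rule continuous_on_compose2[of "ball 0 r \<times> ball 0 r" "\<lambda>(z, w). f z w"])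
    show "continuous_on (ball 0 r \<times> ball 0 r) (\<lambda>(z, w). f z w)" using r by (auto simp: hol2_on_def)
    show "continuous_on (ball 0 q \<times> ball 0 q) (\<lambda>(z, w). (g z w, h z w))"
      by (rule continuous_on_subset[OF gh]) (use q in auto)
  qed (use im in auto)
  then have "continuous_on (ball 0 q \<times> ball 0 q) (\<lambda>(z, w). f (g z w) (h z w))" by (simp add: split_beta')
  moreover have "(\<lambda>z. f (g z w) (h z w)) holomorphic_on ball 0 q" if "w \<in> ball 0 q" for w
    using sg sh im that by (intro hol2_on_compose_holomorphic[OF r(2)]) (auto simp: hol2_on_def)
  moreover have "(\<lambda>w. f (g z w) (h z w)) holomorphic_on ball 0 q" if "z \<in> ball 0 q" for z
    using sg sh im that by (intro hol2_on_compose_holomorphic[OF r(2)]) (auto simp: hol2_on_def)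
  ultimately show ?thesis unfolding hol2_def using q by (auto simp: hol2_on_def)
qed

lemma hol2_const [simp, intro]: "hol2 (\<lambda>z w. c)"
  by (auto simp: hol2_def hol2_on_def split_beta' intro!: exI[of _ 1] continuous_intros holomorphic_intros)

lemma hol2_fst [simp, intro]: "hol2 (\<lambda>z w. z)"
  by (auto simp: hol2_def hol2_on_def split_beta' intro!: exI[of _ 1] continuous_intros holomorphic_intros)

lemma hol2_add [intro]:
  assumes "hol2 f" "hol2 g" shows "hol2 (\<lambda>z w. f z w + g z w)"
proof -
  from hol2_common_radius[OF assms] obtain r where "r > 0" "hol2_on r f" "hol2_on r g" .
  then show ?thesis
    by (auto simp: hol2_def hol2_on_def split_beta' intro!: exI[of _ r] continuous_intros holomorphic_intros)
qed

lemma hol2_mult [intro]: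
  assumes "hol2 f" "hol2 g" shows "hol2 (\<lambda>z w. f z w * g z w)"
proof -
  from hol2_common_radius[OF assms] obtain r where "r > 0" "hol2_on r f" "hol2_on r g" .
  then show ?thesis
    by (auto simp: hol2_def hol2_on_def split_beta' intro!: exI[of _ r] continuous_intros holomorphic_intros)
qed

lemma hol2_uminus [intro]: "hol2 f \<Longrightarrow> hol2 (\<lambda>z w. - f z w)"
  using hol2_mult[OF hol2_const[of "-1"], of f] by simp

lemma hol2_diff [intro]: "hol2 f \<Longrightarrow> hol2 g \<Longrightarrow> hol2 (\<lambda>z w. f z w - g z w)"
  using hol2_add[of f "\<lambda>z w. - g z w"] hol2_uminus[of g] by simp

lemma hol2_sum [intro]: "(\<And>i. i \<in> I \<Longrightarrow> hol2 (f i)) \<Longrightarrow> hol2 (\<lambda>z w. \<Sum>i\<in>I. f i z w)"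
  by (induction I rule: infinite_finite_induct) auto

lemma hol2_prod [intro]: "(\<And>i. i \<in> I \<Longrightarrow> hol2 (f i)) \<Longrightarrow> hol2 (\<lambda>z w. \<Prod>i\<in>I. f i z w)"
  by (induction I rule: infinite_finite_induct) auto

lemma hol2_of_fst: "g analytic_on {0} \<Longrightarrow> hol2 (\<lambda>z w. g z)"
proof -
  assume "g analytic_on {0}"
  then obtain e where e: "e > 0" "g holomorphic_on ball 0 e" by (auto simp: analytic_at_ball)
  then have "continuous_on (ball 0 e \<times> ball 0 e) (\<lambda>p. g (fst p))"
    by (intro continuous_on_compose2[OF holomorphic_on_imp_continuous_on[OF e(2)]] continuous_intros) auto
  with e show ?thesis by (auto simp: hol2_def hol2_on_def split_beta' intro!: exI[of _ e] holomorphic_intros)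
qed

lemma hol2_of_snd: "g analytic_on {0} \<Longrightarrow> hol2 (\<lambda>z w. g w)"
  using hol2_of_fst[of g] hol2_on_swap by (auto simp: hol2_def)

lemma hol2_inverse:
  assumes "hol2 f" "f 0 0 \<noteq> 0" shows "hol2 (\<lambda>z w. inverse (f z w))"
proof -
  \<comment> \<open>\<open>hol2_compose\<close> wants inner functions that vanish at the origin, so
    the constant \<open>f 0 0\<close> is moved into the outer function.\<close>
  have "(\<lambda>z. inverse (f 0 0 + z)) analytic_on {0}"
    using assms by (intro analytic_intros) auto
  from hol2_compose[OF hol2_of_fst[OF this] hol2_diff[OF assms(1) hol2_const[of "f 0 0"]] hol2_const[of 0]]
  show ?thesis by simp
qed

lemma hol2_restrict_fst: "hol2 f \<Longrightarrow> (\<lambda>z. f z 0) analytic_on {0}"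
  by (auto simp: hol2_def hol2_on_def analytic_at_ball)

lemma hol2_restrict_snd: "hol2 f \<Longrightarrow> (\<lambda>w. f 0 w) analytic_on {0}"
  by (auto simp: hol2_def hol2_on_def analytic_at_ball)

lemma hol2_isCont: "hol2 f \<Longrightarrow> isCont (\<lambda>(z, w). f z w) (0, 0)"
  by (auto simp: hol2_def hol2_on_def continuous_on_eq_continuous_at open_Times)

text \<open>The mean value inequality for \<open>f z w\<close> minus its linear part in
  \<open>z\<close>; joint continuity of the derivative makes it uniform in \<open>w\<close>. It
  yields the contraction below, the limit of the blow-up, and the comparison of a family with its
  values at \<lambda> = 0.\<close>

lemma hol2_increment_estimate:
  assumes f: "hol2 f" and e: "\<epsilon> > 0"
  obtains s where "s > 0" "\<And>z z' w. z \<in> ball 0 s \<Longrightarrow> z' \<in> ball 0 s \<Longrightarrow> w \<in> ball 0 s \<Longrightarrow>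
    cmod (f z w - f z' w - deriv (\<lambda>z. f z 0) 0 * (z - z')) \<le> \<epsilon> * cmod (z - z')"
proof -
  from f obtain r where r: "r > 0" "hol2_on r f" by (auto simp: hol2_def)
  define D where "D = deriv (\<lambda>z. f z 0) 0"
  have "isCont (\<lambda>(z, w). deriv (\<lambda>z. f z w) z) (0, 0)"
    using continuous_on_deriv_fst[OF r(2)] r(1) by (auto simp: continuous_on_eq_continuous_at open_Times)
  with e obtain d where d: "d > 0" "\<And>p. dist p (0, 0) < d \<Longrightarrow>
      dist ((\<lambda>(z, w). deriv (\<lambda>z. f z w) z) p) ((\<lambda>(z, w). deriv (\<lambda>z. f z w) z) (0, 0)) < \<epsilon>"
    unfolding continuous_at_eps_delta by metis
  define s where "s = min r (d / 2)"
  show ?thesis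
  proof (rule that[of s])
    show "s > 0" using r d by (simp add: s_def)
    fix z z' w :: complex assume *: "z \<in> ball 0 s" "z' \<in> ball 0 s" "w \<in> ball 0 s"
    have "norm ((f z w - D * z) - (f z' w - D * z')) \<le> \<epsilon> * norm (z - z')"
    proof (rule field_differentiable_bound[of "ball 0 s"])
      fix x :: complex assume x: "x \<in> ball 0 s"
      have "((\<lambda>z. f z w) has_field_derivative deriv (\<lambda>z. f z w) x) (at x)"
        using r x * by (intro holomorphic_derivI[of _ "ball 0 r"]) (auto simp: hol2_on_def s_def)
      then show "((\<lambda>z. f z w - D * z) has_field_derivative (deriv (\<lambda>z. f z w) x - D)) (at x within ball 0 s)"
        by (auto intro!: derivative_eq_intros simp: has_field_derivative_at_within)
      have "dist (x, w) (0, 0) \<le> norm x + norm w"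
        by (simp add: dist_Pair_Pair sqrt_sum_squares_le_sum)
      also have "\<dots> < d" using x * by (auto simp: s_def)
      finally show "norm (deriv (\<lambda>z. f z w) x - D) \<le> \<epsilon>"
        using d(2)[of "(x, w)"] by (simp add: D_def dist_norm)
    qed (use * in auto)
    then show "cmod (f z w - f z' w - deriv (\<lambda>z. f z 0) 0 * (z - z')) \<le> \<epsilon> * cmod (z - z')"
      by (simp add: D_def algebra_simps)
  qed
qed

text \<open>The solution is built by iteration from 0 in order to keep it real: at a real parameter
  every iterate is real, hence so is the limit. Holomorphy passes to the limit because the
  convergence is uniform.\<close>

lemma hol2_implicit_function:
  assumes f: "hol2 f" and f0: "f 0 0 = 0" and D: "deriv (\<lambda>z. f z 0) 0 = 1"
    and real: "q > 0" "\<And>x t. \<bar>x\<bar> < q \<Longrightarrow> \<bar>t\<bar> < q \<Longrightarrow> f (complex_of_real x) (complex_of_real t) \<in> \<real>"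
  obtains g where "g analytic_on {0}" "g 0 = 0" "\<forall>\<^sub>F w in nhds 0. f (g w) w = 0"
    "\<forall>\<^sub>F t in nhds (0::real). g (complex_of_real t) \<in> \<real>"
proof -
  from f obtain r where r: "r > 0" "hol2_on r f" by (auto simp: hol2_def)
  from hol2_increment_estimate[OF f, of "1/2"] obtain s1 where s1: "s1 > 0"
    "\<And>z z' w. z \<in> ball 0 s1 \<Longrightarrow> z' \<in> ball 0 s1 \<Longrightarrow> w \<in> ball 0 s1 \<Longrightarrow>
      cmod (f z w - f z' w - (z - z')) \<le> 1/2 * cmod (z - z')" by (auto simp: D)
  \<comment> \<open>The bound by \<open>q\<close> keeps real iterates where \<open>f\<close> is
    known to take real values.\<close>
  define \<rho> where "\<rho> = min (min s1 r) q / 2"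
  have \<rho>: "\<rho> > 0" "\<rho> < s1" "\<rho> < r" "\<rho> < q" using s1 r real by (auto simp: \<rho>_def)
  have "isCont (\<lambda>w. f 0 w) 0"
    using hol2_restrict_snd[OF f] by (rule analytic_at_imp_isCont)
  then have "\<exists>d>0. \<forall>w. cmod w < d \<longrightarrow> cmod (f 0 w) < \<rho> / 4"
    using \<rho>(1) f0 unfolding continuous_at_eps_delta by (auto simp: dist_norm dest!: spec[of _ "\<rho> / 4"])
  then obtain \<eta>0 where \<eta>0: "\<eta>0 > 0" "\<And>w. cmod w < \<eta>0 \<Longrightarrow> cmod (f 0 w) < \<rho> / 4"
    by blast
  define \<eta> where "\<eta> = min \<eta>0 \<rho>"
  have \<eta>: "\<eta> > 0" "\<eta> \<le> \<rho>" using \<eta>0 \<rho> by (auto simp: \<eta>_def)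
  \<comment> \<open>Its derivative in \<open>z\<close> vanishes at the origin, hence the contraction
    factor 1/2. The disc of radius \<open>\<rho>\<close> is mapped into itself because \<rho>/2 +
    \<rho>/4 \<le> \<rho>.\<close>
  define \<phi> where "\<phi> w z = z - f z w" for w z
  have contr: "cmod (\<phi> w z - \<phi> w z') \<le> 1/2 * cmod (z - z')"
    if "z \<in> cball 0 \<rho>" "z' \<in> cball 0 \<rho>" "w \<in> ball 0 \<eta>" for z z' w
  proof -
    have "cmod (\<phi> w z - \<phi> w z') = cmod (f z w - f z' w - (z - z'))"
      by (simp add: \<phi>_def norm_minus_commute algebra_simps)
    then show ?thesis using s1(2)[of z z' w] that \<rho> \<eta> by auto
  qed
  have self: "\<phi> w z \<in> cball 0 \<rho>" if "z \<in> cball 0 \<rho>" "w \<in> ball 0 \<eta>" for z w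
  proof -
    have "cmod (\<phi> w z) \<le> cmod (\<phi> w z - \<phi> w 0) + cmod (\<phi> w 0)"
      by (metis diff_add_cancel norm_triangle_ineq)
    also have "\<dots> \<le> 1/2 * cmod z + \<rho> / 4"
      using contr[of z 0 w] \<eta>0(2)[of w] that \<rho> by (intro add_mono) (auto simp: \<phi>_def \<eta>_def)
    also have "\<dots> \<le> \<rho>" using that \<rho>(1) by simp
    finally show ?thesis by simp
  qed
  have "\<exists>z \<in> cball 0 \<rho>. \<phi> w z = z" if "w \<in> ball 0 \<eta>" for w
  proof -
    have "\<exists>!z\<in>cball 0 \<rho>. \<phi> w z = z"
    proof (rule Banach_fix)
      show "complete (cball 0 \<rho> :: complex set)" by (simp add: complete_eq_closed)
      show "dist (\<phi> w x) (\<phi> w y) \<le> 1/2 * dist x y" if "x \<in> cball 0 \<rho>" "y \<in> cball 0 \<rho>" for x y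
        using contr[OF that \<open>w \<in> ball 0 \<eta>\<close>] by (simp add: dist_norm)
    qed (use \<rho> self that in auto)
    then show ?thesis by blast
  qed
  then obtain g where g: "\<And>w. w \<in> ball 0 \<eta> \<Longrightarrow> g w \<in> cball 0 \<rho>" "\<And>w. w \<in> ball 0 \<eta> \<Longrightarrow> \<phi> w (g w) = g w"
    by metis
  define it where "it n w = ((\<phi> w) ^^ n) 0" for n w
  have it_in: "it n w \<in> cball 0 \<rho>" if "w \<in> ball 0 \<eta>" for n w
    by (induction n) (use that \<rho> self in \<open>auto simp: it_def simp del: mem_cball\<close>)
  have it_g: "cmod (it n w - g w) \<le> (1/2) ^ n * \<rho>" if "w \<in> ball 0 \<eta>" for n w
  proof (induction n)
    case 0 then show ?case using g(1)[OF that] by (simp add: it_def)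
  next
    case (Suc n)
    have "cmod (it (Suc n) w - g w) = cmod (\<phi> w (it n w) - \<phi> w (g w))"
      using g(2)[OF that] by (simp add: it_def)
    also have "\<dots> \<le> 1/2 * cmod (it n w - g w)" by (rule contr[OF it_in[OF that] g(1)[OF that] that])
    finally show ?case using Suc by simp
  qed
  have it_hol: "it n holomorphic_on ball 0 \<eta>" for n
  proof (induction n)
    case 0 then show ?case by (simp add: it_def)
  next
    case (Suc n)
    have "(\<lambda>w. f (it n w) w) holomorphic_on ball 0 \<eta>"
    proof (rule hol2_on_compose_holomorphic[OF r(2) Suc])
      show "it n ` ball 0 \<eta> \<subseteq> ball 0 r"
      proof safe
        fix w :: complex assume "w \<in> ball 0 \<eta>"
        from it_in[OF this, of n] show "it n w \<in> ball 0 r" using \<rho> by auto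
      qed
    qed (use \<rho> \<eta> in auto)
    then have "(\<lambda>w. it n w - f (it n w) w) holomorphic_on ball 0 \<eta>" using Suc by (intro holomorphic_intros)
    then show ?case by (simp add: it_def \<phi>_def)
  qed
  have ul: "uniform_limit (ball 0 \<eta>) it g sequentially"
  proof (rule uniform_limitI)
    fix e :: real assume e: "e > 0"
    have "(\<lambda>n. (1/2) ^ n * \<rho>) \<longlonglongrightarrow> 0 * \<rho>" by (intro tendsto_mult LIMSEQ_realpow_zero tendsto_const) auto
    then have "\<forall>\<^sub>F n in sequentially. (1/2) ^ n * \<rho> < e" using e by (intro order_tendstoD) auto
    then show "\<forall>\<^sub>F n in sequentially. \<forall>w\<in>ball 0 \<eta>. dist (it n w) (g w) < e"
      by eventually_elim (auto simp: dist_norm intro!: le_less_trans[OF it_g])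
  qed
  have hol: "g holomorphic_on ball 0 \<eta>"
  proof (rule holomorphic_uniform_sequence[OF open_ball it_hol])
    fix x :: complex assume "x \<in> ball 0 \<eta>"
    then obtain d where "d > 0" "cball x d \<subseteq> ball 0 \<eta>" using open_contains_cball by blast
    then show "\<exists>d>0. cball x d \<subseteq> ball 0 \<eta> \<and> uniform_limit (cball x d) it g sequentially"
      using uniform_limit_on_subset[OF ul] by blast
  qed
  show ?thesis
  proof (rule that)
    show "g analytic_on {0}" using hol \<eta> by (auto simp: analytic_at_ball)
    have "it n 0 = 0" for n by (induction n) (auto simp: it_def \<phi>_def f0)
    then have "cmod (g 0) \<le> (1/2) ^ n * \<rho>" for n using it_g[of 0 n] \<eta> by simp
    moreover have "(\<lambda>n. (1/2) ^ n * \<rho>) \<longlonglongrightarrow> 0 * \<rho>" by (intro tendsto_mult LIMSEQ_realpow_zero tendsto_const) auto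
    ultimately have "cmod (g 0) \<le> 0 * \<rho>" by (intro LIMSEQ_le_const) auto
    then show "g 0 = 0" by simp
    have "\<forall>\<^sub>F w in nhds 0. w \<in> ball 0 \<eta>" using \<eta> by (intro eventually_nhds_in_open) auto
    then show "\<forall>\<^sub>F w in nhds 0. f (g w) w = 0"
      by eventually_elim (use g(2) in \<open>auto simp: \<phi>_def\<close>)
    have "\<forall>\<^sub>F t in nhds (0::real). t \<in> ball 0 \<eta>" using \<eta> by (intro eventually_nhds_in_open) auto
    then show "\<forall>\<^sub>F t in nhds (0::real). g (complex_of_real t) \<in> \<real>"
    proof eventually_elim
      case (elim t)
      then have t: "complex_of_real t \<in> ball 0 \<eta>" by simp
      have itr: "it n (complex_of_real t) \<in> \<real>" for n
      proof (induction n)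
        case 0 then show ?case by (simp add: it_def)
      next
        case (Suc n)
        then obtain x where x: "it n (complex_of_real t) = complex_of_real x" by (auto elim: Reals_cases)
        have "\<bar>x\<bar> < q" "\<bar>t\<bar> < q" using it_in[OF t, of n] x \<rho> \<eta> t by auto
        from real(2)[OF this] have "f (complex_of_real x) (complex_of_real t) \<in> \<real>" .
        moreover have "it (Suc n) (complex_of_real t) = complex_of_real x - f (complex_of_real x) (complex_of_real t)"
          using x by (simp add: it_def \<phi>_def)
        ultimately show ?case by simp
      qed
      have "(\<lambda>n. it n (complex_of_real t)) \<longlonglongrightarrow> g (complex_of_real t)"
        using tendsto_uniform_limitI[OF ul t] .
      then show ?case
        by (rule Lim_in_closed_set[OF closed_complex_Reals, rotated 2]) (auto simp: itr)
    qed
  qed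
qed

section \<open>Blow-up and orders of vanishing\<close>

text \<open>Up to an error controlled by the increment estimate, the quotient is
  \<open>D * (c + z) + b w\<close> with \<open>D\<close> the derivative of \<open>G\<close> in its
  first argument at the origin. This comparison function is continuous and agrees with the
  prescribed value at \<open>w = 0\<close>, so the quotient is jointly continuous there. Holomorphy
  in \<open>w\<close> across 0 is then a removable singularity.\<close>

lemma hol2_blowup:
  assumes G: "hol2 G" and b: "b analytic_on {0}" and p: "p \<ge> 1"
    and Gb: "\<forall>\<^sub>F w in nhds 0. G 0 w = w ^ p * b w"
  shows "hol2 (\<lambda>z w. if w = 0 then deriv (\<lambda>z. G z 0) 0 * (c + z) + b 0 else G (w ^ p * (c + z)) w / w ^ p)"
    (is "hol2 ?K")
proof -
  define D where "D = deriv (\<lambda>z. G z 0) 0"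
  define M where "M = cmod c + 1"
  have M: "M > 0" by (simp add: M_def add_nonneg_pos)
  from G obtain r where r: "r > 0" "hol2_on r G" by (auto simp: hol2_def)
  from b obtain e1 where e1: "e1 > 0" "b holomorphic_on ball 0 e1" by (auto simp: analytic_at_ball)
  from Gb obtain e2 where e2: "e2 > 0" "\<And>w. w \<in> ball 0 e2 \<Longrightarrow> G 0 w = w ^ p * b w"
    by (auto simp: eventually_nhds_metric dist_commute)
  \<comment> \<open>For |z| < 1 the factor \<open>c + z\<close> stays below \<open>M\<close>, and
    for |w| < 1 the power \<open>w ^ p\<close> is at most |w| in modulus. The bound
    \<open>r / M\<close> then keeps the argument \<open>w ^ p * (c + z)\<close> in the domain of
    \<open>G\<close>.\<close>
  define q where "q = min (min (min e1 e2) (min r 1)) (r / M)"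
  have q: "q > 0" "q \<le> e1" "q \<le> e2" "q \<le> r" "q \<le> 1" "q \<le> r / M" using e1 e2 r M by (auto simp: q_def)
  have cz: "cmod (c + z) < M" if "z \<in> ball 0 q" for z
    using norm_triangle_ineq[of c z] that q by (auto simp: M_def)
  have wp: "cmod (w ^ p) \<le> cmod w" if "w \<in> ball 0 q" for w
    using that q p power_decreasing[of 1 p "cmod w"] by (auto simp: norm_power)
  have arg: "cmod (w ^ p * (c + z)) \<le> cmod w * M" if "z \<in> ball 0 q" "w \<in> ball 0 q" for z w
    unfolding norm_mult using cz[OF that(1)] wp[OF that(2)] by (intro mult_mono) auto
  have arg_r: "w ^ p * (c + z) \<in> ball 0 r" if "z \<in> ball 0 q" "w \<in> ball 0 q" for z w
  proof -
    have "cmod w * M < r / M * M" using that q M by (intro mult_strict_right_mono) auto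
    then show ?thesis using arg[OF that] M by simp
  qed
  have hz: "(\<lambda>z. ?K z w) holomorphic_on ball 0 q" if w: "w \<in> ball 0 q" for w
  proof (cases "w = 0")
    case True
    then show ?thesis by (simp, intro holomorphic_intros)
  next
    case False
    have "(\<lambda>z. G (w ^ p * (c + z)) w) holomorphic_on ball 0 q"
      by (rule hol2_on_compose_holomorphic[OF r(2)])
         (use arg_r w q in \<open>auto intro!: holomorphic_intros simp del: mem_ball simp: image_subset_iff\<close>)
    then show ?thesis using False by (auto intro!: holomorphic_intros)
  qed
  have hw: "(\<lambda>w. ?K z w) holomorphic_on ball 0 q - {0}" if z: "z \<in> ball 0 q" for z
  proof -
    have "(\<lambda>w. G (w ^ p * (c + z)) w) holomorphic_on ball 0 q - {0}"
      by (rule hol2_on_compose_holomorphic[OF r(2)])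
         (use arg_r z q in \<open>auto intro!: holomorphic_intros simp del: mem_ball simp: image_subset_iff\<close>)
    then have "(\<lambda>w. G (w ^ p * (c + z)) w / w ^ p) holomorphic_on ball 0 q - {0}"
      by (auto intro!: holomorphic_intros)
    then show ?thesis by (rule holomorphic_transform) auto
  qed
  have contK: "isCont (\<lambda>(z, w). ?K z w) (z, w)" if zw: "z \<in> ball 0 q" "w \<in> ball 0 q" for z w
  proof (cases "w = 0")
    case False
    have "continuous_on (ball 0 q \<times> (ball 0 q - {0}))
      (\<lambda>x. (\<lambda>(z, w). G z w) ((\<lambda>(z, w). (w ^ p * (c + z), w)) x))"
    proof (rule continuous_on_compose2[of "ball 0 r \<times> ball 0 r" "\<lambda>(z, w). G z w"])
      show "continuous_on (ball 0 r \<times> ball 0 r) (\<lambda>(z, w). G z w)" using r by (auto simp: hol2_on_def)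
      show "continuous_on (ball 0 q \<times> (ball 0 q - {0})) (\<lambda>(z, w). (w ^ p * (c + z), w))"
        unfolding split_beta' by (intro continuous_intros)
    qed (use arg_r q in \<open>auto simp: image_subset_iff subset_iff\<close>)
    then have "continuous_on (ball 0 q \<times> (ball 0 q - {0})) (\<lambda>x. G (snd x ^ p * (c + fst x)) (snd x))"
      by (simp add: split_beta')
    then have "continuous_on (ball 0 q \<times> (ball 0 q - {0})) (\<lambda>x. G (snd x ^ p * (c + fst x)) (snd x) / snd x ^ p)"
      by (intro continuous_intros) auto
    then have "continuous_on (ball 0 q \<times> (ball 0 q - {0})) (\<lambda>(z, w). ?K z w)"
      by (rule continuous_on_eq) (auto split: if_splits)
    then show ?thesis using zw False
      by (subst (asm) continuous_on_eq_continuous_at) (auto intro!: open_Times)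
  next
    case True
    have "((\<lambda>x. (case x of (z, w) \<Rightarrow> ?K z w) - (D * (c + fst x) + b (snd x))) \<longlongrightarrow> 0) (at (z, 0))"
    proof (rule tendstoI)
      fix \<epsilon> :: real assume e: "\<epsilon> > 0"
      define \<epsilon>' where "\<epsilon>' = \<epsilon> / (2 * M)"
      have e': "\<epsilon>' > 0" using e M by (simp add: \<epsilon>'_def)
      from hol2_increment_estimate[OF G e'] obtain s where s: "s > 0"
        "\<And>z z' w. z \<in> ball 0 s \<Longrightarrow> z' \<in> ball 0 s \<Longrightarrow> w \<in> ball 0 s \<Longrightarrow>
          cmod (G z w - G z' w - D * (z - z')) \<le> \<epsilon>' * cmod (z - z')" by (auto simp: D_def)
      define \<delta> where "\<delta> = min (min q s) (s / M)"
      have \<delta>: "\<delta> > 0" "\<delta> \<le> q" "\<delta> \<le> s" "\<delta> \<le> s / M" using q s M by (auto simp: \<delta>_def)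
      have est: "cmod (?K z w - (D * (c + z) + b w)) < \<epsilon>" if z: "z \<in> ball 0 q" and w: "w \<in> ball 0 \<delta>" for z w
      proof (cases "w = 0")
        case True then show ?thesis using e by (simp add: D_def)
      next
        case False
        have wq: "w \<in> ball 0 q" using w \<delta> by auto
        have "cmod w * M < s / M * M" using w \<delta> M by (intro mult_strict_right_mono) auto
        then have "w ^ p * (c + z) \<in> ball 0 s" using arg[OF z wq] M by simp
        then have 1: "cmod (G (w ^ p * (c + z)) w - G 0 w - D * (w ^ p * (c + z) - 0)) \<le> \<epsilon>' * cmod (w ^ p * (c + z) - 0)"
          using w \<delta> s(1) by (intro s(2)) auto
        have "G 0 w = w ^ p * b w" using wq q by (intro e2) auto
        then have "?K z w - (D * (c + z) + b w) = (G (w ^ p * (c + z)) w - G 0 w - D * (w ^ p * (c + z) - 0)) / w ^ p"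
          using False by (simp add: field_simps)
        then have "cmod (?K z w - (D * (c + z) + b w)) \<le> \<epsilon>' * cmod (w ^ p * (c + z)) / cmod (w ^ p)"
          using 1 by (simp add: norm_divide divide_right_mono)
        also have "\<dots> = \<epsilon>' * cmod (c + z)" using False by (simp add: norm_mult)
        also have "\<dots> < \<epsilon>' * (2 * M)" using cz[OF z] M e' by (intro mult_strict_left_mono) auto
        also have "\<dots> = \<epsilon>" using M by (simp add: \<epsilon>'_def)
        finally show ?thesis .
      qed
      have "\<forall>\<^sub>F x in nhds (z, 0). x \<in> ball 0 q \<times> ball 0 \<delta>"
        using zw \<delta> by (intro eventually_nhds_in_open open_Times) auto
      then have "\<forall>\<^sub>F x in at (z, 0). x \<in> ball 0 q \<times> ball 0 \<delta>" by (auto simp: eventually_at_filter elim: eventually_mono)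
      then show "\<forall>\<^sub>F x in at (z, 0). dist ((case x of (z, w) \<Rightarrow> ?K z w) - (D * (c + fst x) + b (snd x))) 0 < \<epsilon>"
      proof eventually_elim
        case (elim x)
        then obtain a a' where x: "x = (a, a')" "a \<in> ball 0 q" "a' \<in> ball 0 \<delta>" by (cases x) auto
        have "(case x of (z, w) \<Rightarrow> ?K z w) - (D * (c + fst x) + b (snd x)) = ?K a a' - (D * (c + a) + b a')"
          unfolding x(1) by (simp only: prod.case fst_conv snd_conv)
        then show ?case using est[OF x(2,3)] by (simp only: dist_norm diff_0_right)
      qed
    qed
    moreover have "isCont b 0" using b by (rule analytic_at_imp_isCont)
    then have "((\<lambda>x. D * (c + fst x) + b (snd x)) \<longlongrightarrow> D * (c + z) + b 0) (at (z, 0))"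
      by (intro tendsto_intros isCont_tendsto_compose[of 0 b] tendsto_eq_intros) auto
    ultimately have "((\<lambda>x. case x of (z, w) \<Rightarrow> ?K z w) \<longlongrightarrow> 0 + (D * (c + z) + b 0)) (at (z, 0))"
      by (rule tendsto_add[THEN tendsto_cong[THEN iffD1, rotated]]) (auto simp: eventually_at_filter)
    then show ?thesis using True by (simp add: isCont_def D_def)
  qed
  have "hol2_on q ?K"
    unfolding hol2_on_def
  proof (intro conjI ballI hz)
    show c: "continuous_on (ball 0 q \<times> ball 0 q) (\<lambda>(z, w). ?K z w)"
      by (rule continuous_at_imp_continuous_on) (use contK in auto)
    fix z :: complex assume z: "z \<in> ball 0 q"
    show "(\<lambda>w. ?K z w) holomorphic_on ball 0 q"
    proof (rule no_isolated_singularity[OF _ hw[OF z]])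
      have "continuous_on (ball 0 q) (\<lambda>w. (\<lambda>(z, w). ?K z w) (z, w))"
        by (rule continuous_on_compose2[OF c]) (use z in \<open>auto intro!: continuous_intros\<close>)
      then show "continuous_on (ball 0 q) (\<lambda>w. ?K z w)" by simp
    qed auto
  qed
  with q show ?thesis by (auto simp: hol2_def)
qed

lemma analytic_zero_order:
  assumes g: "g analytic_on {0}" "g 0 = 0" and nz: "\<not> (\<forall>\<^sub>F w in nhds 0. g w = (0::complex))"
  obtains n h where "n \<ge> 1" "h analytic_on {0}" "h 0 \<noteq> 0" "\<forall>\<^sub>F w in nhds 0. g w = w ^ n * h w"
proof -
  from g obtain e where e: "e > 0" "g holomorphic_on ball 0 e" by (auto simp: analytic_at_ball)
  have nc: "\<not> g constant_on ball 0 e"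
  proof
    assume "g constant_on ball 0 e"
    then obtain c where c: "\<And>w. w \<in> ball 0 e \<Longrightarrow> g w = c" by (auto simp: constant_on_def)
    then have "c = 0" using g(2) e(1) by force
    have "\<forall>\<^sub>F w in nhds 0. w \<in> ball (0::complex) e" using e by (intro eventually_nhds_in_open) auto
    then have "\<forall>\<^sub>F w in nhds 0. g w = 0" by eventually_elim (use c \<open>c = 0\<close> in auto)
    with nz show False by simp
  qed
  have z: "0 \<in> ball 0 e" using e(1) by simp
  have "\<exists>n>0. \<exists>r>0. \<exists>h. h holomorphic_on ball 0 r \<and> (\<forall>w\<in>ball 0 r. g w = (w - 0) ^ n * h w \<and> h w \<noteq> 0)"
    by (rule holomorphic_factor_zero_nonconstant[OF e(2) open_ball connected_ball z g(2) nc]) blast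
  then obtain h r n where h: "0 < n" "0 < r" "h holomorphic_on ball 0 r"
    "\<And>w. w \<in> ball 0 r \<Longrightarrow> g w = (w - 0) ^ n * h w" "\<And>w. w \<in> ball 0 r \<Longrightarrow> h w \<noteq> 0" by blast
  have "\<forall>\<^sub>F w in nhds 0. w \<in> ball (0::complex) r" using h by (intro eventually_nhds_in_open) auto
  then have "\<forall>\<^sub>F w in nhds 0. g w = w ^ n * h w" by eventually_elim (use h in auto)
  then show ?thesis using h by (intro that[of n h]) (auto simp: analytic_at_ball)
qed

text \<open>\<open>p\<close> is the least order of vanishing among the functions that are not
  identically zero, and it is attained. Identically vanishing functions get the cofactor 0.\<close>

lemma analytic_common_zero_order:
  fixes g :: "'i \<Rightarrow> complex \<Rightarrow> complex"
  assumes fin: "finite I" and g: "\<And>i. i \<in> I \<Longrightarrow> g i analytic_on {0}" "\<And>i. i \<in> I \<Longrightarrow> g i 0 = 0"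
    and nz: "\<exists>i\<in>I. \<not> (\<forall>\<^sub>F w in nhds 0. g i w = 0)"
  obtains p b where "p \<ge> 1" "\<And>i. i \<in> I \<Longrightarrow> b i analytic_on {0}"
    "\<And>i. i \<in> I \<Longrightarrow> \<forall>\<^sub>F w in nhds 0. g i w = w ^ p * b i w" "\<exists>i\<in>I. b i 0 \<noteq> 0"
proof -
  define J where "J = {i \<in> I. \<not> (\<forall>\<^sub>F w in nhds 0. g i w = 0)}"
  have J: "finite J" "J \<noteq> {}" using fin nz by (auto simp: J_def)
  have "\<exists>n h. n \<ge> 1 \<and> h analytic_on {0} \<and> h 0 \<noteq> 0 \<and> (\<forall>\<^sub>F w in nhds 0. g i w = w ^ n * h w)" if "i \<in> J" for i
  proof -
    from that have i: "i \<in> I" "\<not> (\<forall>\<^sub>F w in nhds 0. g i w = 0)" by (auto simp: J_def)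
    obtain n h where "n \<ge> 1" "h analytic_on {0}" "h 0 \<noteq> 0" "\<forall>\<^sub>F w in nhds 0. g i w = w ^ n * h w"
      by (rule analytic_zero_order[OF g(1)[OF i(1)] g(2)[OF i(1)] i(2)])
    then show ?thesis by blast
  qed
  then obtain n h where nh: "\<And>i. i \<in> J \<Longrightarrow> n i \<ge> 1 \<and> h i analytic_on {0} \<and> h i 0 \<noteq> (0::complex) \<and> (\<forall>\<^sub>F w in nhds 0. g i w = w ^ n i * h i w)"
    by metis
  define p where "p = Min (n ` J)"
  have pn: "p \<le> n i" if "i \<in> J" for i using J that by (simp add: p_def)
  have "p \<in> n ` J" unfolding p_def using J by (intro Min_in) auto
  then obtain i0 where i0: "i0 \<in> J" "p = n i0" by auto
  define b where "b i = (if i \<in> J then \<lambda>w. w ^ (n i - p) * h i w else (\<lambda>w. 0))" for i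
  show ?thesis
  proof (rule that[of p b])
    show "p \<ge> 1" using nh[OF i0(1)] i0 by simp
    show "b i analytic_on {0}" if "i \<in> I" for i using nh[of i] by (auto simp: b_def intro!: analytic_intros)
    show "\<forall>\<^sub>F w in nhds 0. g i w = w ^ p * b i w" if "i \<in> I" for i
    proof (cases "i \<in> J")
      case True
      then have "\<forall>\<^sub>F w in nhds 0. g i w = w ^ n i * h i w" using nh by blast
      then show ?thesis
        by eventually_elim (use True pn[OF True] in \<open>auto simp: b_def mult.assoc[symmetric] power_add[symmetric]\<close>)
    next
      case False
      then show ?thesis using that by (auto simp: J_def b_def)
    qed
    show "\<exists>i\<in>I. b i 0 \<noteq> 0" using i0 nh[OF i0(1)] by (intro bexI[of _ i0]) (auto simp: b_def J_def)
  qed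
qed

section \<open>Passage between real-analytic and holomorphic functions\<close>

text \<open>Unconditional summability at the corner \<open>(r, r)\<close> is absolute summability
  there. It dominates the series on the closed bidisc, so by the M-test the sum is a uniform limit
  of polynomials.\<close>

lemma hol2_of_double_series:
  fixes a :: "nat \<Rightarrow> nat \<Rightarrow> complex"
  assumes r: "r > 0" and sm: "(\<lambda>(m, n). (r ^ m * r ^ n) *\<^sub>R a m n) summable_on UNIV"
  shows "hol2 (\<lambda>z w. \<Sum>\<^sub>\<infinity>(m, n). a m n * z ^ m * w ^ n)"
proof -
  define T where "T = (\<lambda>(m, n) (z, w). a m n * z ^ m * w ^ n)"
  define M where "M = (\<lambda>(m, n). norm ((r ^ m * r ^ n) *\<^sub>R a m n))"
  have M: "M summable_on UNIV"
    using sm summable_on_iff_abs_summable_on_complex unfolding M_def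
    by (metis (mono_tags, lifting) case_prod_beta' summable_on_cong)
  have ul: "uniform_limit (cball 0 r \<times> cball 0 r) (\<lambda>X p. \<Sum>x\<in>X. T x p) (\<lambda>p. \<Sum>\<^sub>\<infinity>x. T x p) (finite_subsets_at_top UNIV)"
  proof (rule Weierstrass_m_test_general[OF _ M])
    fix x :: "nat \<times> nat" and p assume "p \<in> cball (0::complex) r \<times> cball (0::complex) r"
    then obtain m n z w where x: "x = (m, n)" and p: "p = (z, w)" and zw: "cmod z \<le> r" "cmod w \<le> r"
      by (cases x, cases p) auto
    have "cmod z ^ m * cmod w ^ n \<le> r ^ m * r ^ n" using zw r by (intro mult_mono power_mono) auto
    then have "cmod (a m n) * (cmod z ^ m * cmod w ^ n) \<le> cmod (a m n) * (r ^ m * r ^ n)" by (intro mult_left_mono) auto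
    then show "norm (T x p) \<le> M x" using r by (simp add: T_def M_def x p norm_mult norm_power mult_ac)
  qed
  have "continuous_on (cball 0 r \<times> cball 0 r) (\<lambda>p. \<Sum>\<^sub>\<infinity>x. T x p)"
  proof (rule uniform_limit_theorem[OF _ ul])
    show "\<forall>\<^sub>F X in finite_subsets_at_top UNIV. continuous_on (cball 0 r \<times> cball 0 r) (\<lambda>p. \<Sum>x\<in>X. T x p)"
      by (intro always_eventually allI) (auto simp: T_def split_beta' intro!: continuous_intros)
  qed simp
  then have 1: "continuous_on (ball 0 r \<times> ball 0 r) (\<lambda>p. \<Sum>\<^sub>\<infinity>x. T x p)"
    by (rule continuous_on_subset) (auto simp: less_imp_le)
  have 2: "(\<lambda>z. \<Sum>\<^sub>\<infinity>x. T x (z, w)) holomorphic_on ball 0 r" if w: "w \<in> ball 0 r" for w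
  proof (rule holomorphic_uniform_limit)
    show "\<forall>\<^sub>F X in finite_subsets_at_top UNIV. continuous_on (cball 0 r) (\<lambda>z. \<Sum>x\<in>X. T x (z, w)) \<and>
      (\<lambda>z. \<Sum>x\<in>X. T x (z, w)) holomorphic_on ball 0 r"
      by (intro always_eventually allI) (auto simp: T_def split_beta' intro!: continuous_intros holomorphic_intros)
    show "uniform_limit (cball 0 r) (\<lambda>X z. \<Sum>x\<in>X. T x (z, w)) (\<lambda>z. \<Sum>\<^sub>\<infinity>x. T x (z, w)) (finite_subsets_at_top UNIV)"
      by (rule uniform_limit_compose'[OF ul, of "\<lambda>z. (z, w)"]) (use w in auto)
  qed auto
  have 3: "(\<lambda>w. \<Sum>\<^sub>\<infinity>x. T x (z, w)) holomorphic_on ball 0 r" if z: "z \<in> ball 0 r" for z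
  proof (rule holomorphic_uniform_limit)
    show "\<forall>\<^sub>F X in finite_subsets_at_top UNIV. continuous_on (cball 0 r) (\<lambda>w. \<Sum>x\<in>X. T x (z, w)) \<and>
      (\<lambda>w. \<Sum>x\<in>X. T x (z, w)) holomorphic_on ball 0 r"
      by (intro always_eventually allI) (auto simp: T_def split_beta' intro!: continuous_intros holomorphic_intros)
    show "uniform_limit (cball 0 r) (\<lambda>X w. \<Sum>x\<in>X. T x (z, w)) (\<lambda>w. \<Sum>\<^sub>\<infinity>x. T x (z, w)) (finite_subsets_at_top UNIV)"
      by (rule uniform_limit_compose'[OF ul, of "\<lambda>w. (z, w)"]) (use z in auto)
  qed auto
  have eq: "(\<Sum>\<^sub>\<infinity>(m, n). a m n * z ^ m * w ^ n) = (\<Sum>\<^sub>\<infinity>x. T x (z, w))" for z w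
    by (simp add: T_def split_beta')
  have "hol2_on r (\<lambda>z w. \<Sum>\<^sub>\<infinity>(m, n). a m n * z ^ m * w ^ n)"
    unfolding hol2_on_def eq using 1 2 3 by (simp add: split_beta')
  with r show ?thesis by (auto simp: hol2_def)
qed

lemma real_analytic2_complexification:
  fixes f :: "real \<Rightarrow> real \<Rightarrow> complex"
  assumes "real_analytic2_at f 0 0"
  obtains g where "hol2 g"
    "\<forall>\<^sub>F (x, t) in nhds (0, 0). g (complex_of_real x) (complex_of_real t) = f x t"
proof -
  from assms obtain r a where r: "r > 0" and hs: "\<And>x y. \<bar>x\<bar> < r \<Longrightarrow> \<bar>y\<bar> < r \<Longrightarrow>
      ((\<lambda>(m, n). (x ^ m * y ^ n) *\<^sub>R a m n) has_sum f x y) UNIV"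
    by (auto simp: real_analytic2_at_def)
  define g where "g = (\<lambda>z w. \<Sum>\<^sub>\<infinity>(m, n). a m n * z ^ m * w ^ n)"
  \<comment> \<open>Summability is given only strictly inside the square of half-side
    \<open>r\<close>; hence the corner at \<open>r/2\<close>.\<close>
  have "(\<lambda>(m, n). ((r/2) ^ m * (r/2) ^ n) *\<^sub>R a m n) summable_on UNIV"
    using hs[of "r/2" "r/2"] r by (auto intro: has_sum_imp_summable)
  then have "hol2 g" unfolding g_def using r by (intro hol2_of_double_series[of "r/2"]) auto
  moreover have "g (complex_of_real x) (complex_of_real t) = f x t" if "\<bar>x\<bar> < r" "\<bar>t\<bar> < r" for x t
  proof -
    have "(\<lambda>(m, n). a m n * complex_of_real x ^ m * complex_of_real t ^ n) = (\<lambda>(m, n). (x ^ m * t ^ n) *\<^sub>R a m n)"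
      by (auto simp: scaleR_conv_of_real fun_eq_iff)
    then show ?thesis using infsumI[OF hs[OF that]] by (simp add: g_def)
  qed
  then have "\<forall>\<^sub>F (x, t) in nhds (0, 0). g (complex_of_real x) (complex_of_real t) = f x t"
    using eventually_nhds_in_open[of "ball 0 r \<times> ball 0 r" "(0, 0)"] r
    by (auto simp: open_Times elim!: eventually_mono)
  ultimately show ?thesis by (rule that)
qed

text \<open>The Taylor series is recentred at each real \<open>t\<close>, because analyticity is
  asked at all points near 0. Powers of \<open>x - t\<close> are real, so taking real parts acts on
  the coefficients alone.\<close>

lemma real_analytic_at_Re:
  assumes l: "l holomorphic_on ball 0 r" and t: "\<bar>t\<bar> < r"
  shows "real_analytic_at (\<lambda>t. Re (l (complex_of_real t))) t"
  unfolding real_analytic_at_def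
proof (intro exI[of _ "r - \<bar>t\<bar>"] conjI exI[of _ "\<lambda>n. Re ((deriv ^^ n) l (complex_of_real t) / fact n)"] allI impI)
  fix x assume x: "\<bar>x - t\<bar> < r - \<bar>t\<bar>"
  have "ball (complex_of_real t) (r - \<bar>t\<bar>) \<subseteq> ball 0 r"
    by (simp add: ball_subset_ball_iff)
  then have "l holomorphic_on ball (complex_of_real t) (r - \<bar>t\<bar>)" using l holomorphic_on_subset by blast
  moreover have "complex_of_real x \<in> ball (complex_of_real t) (r - \<bar>t\<bar>)"
    using x by (simp add: dist_norm norm_minus_commute del: of_real_diff flip: of_real_diff)
  ultimately have "(\<lambda>n. (deriv ^^ n) l (complex_of_real t) / fact n * (complex_of_real x - complex_of_real t) ^ n) sums l (complex_of_real x)"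
    by (rule holomorphic_power_series)
  then have "(\<lambda>n. Re ((deriv ^^ n) l (complex_of_real t) / fact n * (complex_of_real x - complex_of_real t) ^ n)) sums Re (l (complex_of_real x))"
    by (rule sums_Re)
  moreover have "Re (u * (complex_of_real x - complex_of_real t) ^ n) = (x - t) ^ n *\<^sub>R Re u" for u n
    by (simp flip: of_real_diff of_real_power)
  ultimately show "(\<lambda>n. (x - t) ^ n *\<^sub>R Re ((deriv ^^ n) l (complex_of_real t) / fact n)) sums Re (l (complex_of_real x))"
    by (simp only:)
qed (use t in auto)

lemma real_analytic_complexification:
  fixes g :: "real \<Rightarrow> real"
  assumes "real_analytic_at g 0"
  obtains l where "l analytic_on {0}" "\<forall>\<^sub>F t in nhds 0. l (complex_of_real t) = complex_of_real (g t)"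
proof -
  from assms obtain r a where r: "r > 0" and s: "\<And>x. \<bar>x\<bar> < r \<Longrightarrow> (\<lambda>n. x ^ n * a n) sums g x"
    by (auto simp: real_analytic_at_def)
  define l where "l z = (\<Sum>n. complex_of_real (a n) * (z - 0) ^ n)" for z :: complex
  have sm: "(\<lambda>n. complex_of_real (a n) * (z - 0) ^ n) sums l z" if "z \<in> ball 0 (r/2)" for z
  proof -
    have "(\<lambda>n. complex_of_real ((r/2) ^ n * a n)) sums complex_of_real (g (r/2))"
      using s[of "r/2"] r by (intro sums_of_real) auto
    then have "summable (\<lambda>n. complex_of_real (a n) * complex_of_real (r/2) ^ n)"
      by (simp add: sums_iff mult.commute)
    then have "summable (\<lambda>n. complex_of_real (a n) * z ^ n)"
      by (rule powser_inside) (use that r in auto)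
    then show ?thesis unfolding l_def by (simp add: summable_sums)
  qed
  have "l holomorphic_on ball 0 (r/2)" by (rule power_series_holomorphic[OF sm])
  then have "l analytic_on {0}" using r by (auto simp: analytic_at_ball intro!: exI[of _ "r/2"])
  moreover have "l (complex_of_real t) = complex_of_real (g t)" if "\<bar>t\<bar> < r/2" for t
  proof -
    have "(\<lambda>n. complex_of_real (t ^ n * a n)) sums complex_of_real (g t)"
      using s[of t] that by (intro sums_of_real) auto
    then have "(\<lambda>n. complex_of_real (a n) * (complex_of_real t - 0) ^ n) sums complex_of_real (g t)"
      by (simp add: mult.commute)
    from sums_unique2[OF sm this] show ?thesis using that by simp
  qed
  then have "\<forall>\<^sub>F t in nhds 0. l (complex_of_real t) = complex_of_real (g t)"
    using eventually_nhds_in_open[of "ball 0 (r/2)" "0::real"] r by (auto elim!: eventually_mono)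
  ultimately show ?thesis by (rule that)
qed

lemma filterlim_of_real_nhds_0: "filterlim complex_of_real (nhds 0) (nhds 0)"
  using tendsto_of_real[OF filterlim_ident[of "nhds (0::real)"], where 'a = complex] by simp

lemma eventually_nhds_0_of_real:
  "\<forall>\<^sub>F w in nhds 0. P w \<Longrightarrow> \<forall>\<^sub>F t in nhds 0. P (complex_of_real t)"
  by (rule eventually_compose_filterlim[OF _ filterlim_of_real_nhds_0])

text \<open>An extension that is not identically zero is \<open>w ^ n\<close> times a nonvanishing
  factor, whose value at 0 is the leading coefficient. That value is real as a limit of real
  quotients.\<close>

lemma analytic_rate_dichotomy:
  assumes l: "l analytic_on {0}" and lg: "\<forall>\<^sub>F t in nhds 0. l (complex_of_real t) = complex_of_real (g t)"
  shows "(\<forall>\<^sub>F t in nhds 0. g t = 0) \<or>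
    (\<exists>p c. c \<noteq> 0 \<and> ((\<lambda>t. g t / t ^ p) \<longlongrightarrow> c) (at 0) \<and> (g 0 = 0 \<longrightarrow> p \<ge> 1))"
proof (cases "\<forall>\<^sub>F w in nhds 0. l w = 0")
  case True
  from eventually_nhds_0_of_real[OF True] have "\<forall>\<^sub>F t in nhds 0. l (complex_of_real t) = 0" .
  with lg have "\<forall>\<^sub>F t in nhds 0. g t = 0" by eventually_elim auto
  then show ?thesis by blast
next
  case False
  have l0: "l 0 = complex_of_real (g 0)" using eventually_nhds_x_imp_x[OF lg] by simp
  have lim: "(l \<longlongrightarrow> l 0) (nhds 0)" if "l analytic_on {0}" for l :: "complex \<Rightarrow> complex"
    using analytic_at_imp_isCont[OF that] by (simp add: isCont_def tendsto_at_iff_tendsto_nhds)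
  obtain n h where h: "h analytic_on {0}" "h 0 \<noteq> 0" "\<forall>\<^sub>F w in nhds 0. l w = w ^ n * h w" "l 0 = 0 \<Longrightarrow> n \<ge> 1"
  proof (cases "l 0 = 0")
    case True
    with analytic_zero_order[OF l True False] that show ?thesis by metis
  next
    case False
    show ?thesis by (rule that[of l 0]) (use l False in auto)
  qed
  have hlim: "((\<lambda>t. h (complex_of_real t)) \<longlongrightarrow> h 0) (at (0::real))"
    using filterlim_compose[OF lim[OF h(1)] filterlim_of_real_nhds_0] by (rule tendsto_mono[rotated]) (simp add: at_within_def)
  have "\<forall>\<^sub>F t in nhds 0. l (complex_of_real t) = complex_of_real t ^ n * h (complex_of_real t)"
    by (rule eventually_nhds_0_of_real[OF h(3)])
  with lg have "\<forall>\<^sub>F t in nhds 0. t \<noteq> 0 \<longrightarrow> h (complex_of_real t) = complex_of_real (g t / t ^ n)"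
    by eventually_elim (auto simp: field_simps)
  then have eq: "\<forall>\<^sub>F t in at 0. h (complex_of_real t) = complex_of_real (g t / t ^ n)"
    by (simp add: eventually_at_filter)
  have lim2: "((\<lambda>t. complex_of_real (g t / t ^ n)) \<longlongrightarrow> h 0) (at 0)"
    using hlim tendsto_cong[OF eq] by simp
  then have "((\<lambda>t. g t / t ^ n) \<longlongrightarrow> Re (h 0)) (at 0)" using tendsto_Re by fastforce
  moreover have "h 0 \<in> \<real>"
    by (rule Lim_in_closed_set[OF closed_complex_Reals _ _ lim2]) auto
  with h(2) have "Re (h 0) \<noteq> 0" by (auto elim: Reals_cases)
  ultimately show ?thesis using h(4) l0 by auto
qed

section \<open>Hermitian families\<close>

text \<open>Complex arguments give access to removable singularities and to fixed-point iteration
  with holomorphic limits; the symmetry itself can be asked only at real arguments.\<close>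

definition herm_family :: "nat \<Rightarrow> (complex \<Rightarrow> complex \<Rightarrow> complex mat) \<Rightarrow> bool" where
  "herm_family d F \<longleftrightarrow> (\<forall>z w. F z w \<in> carrier_mat d d) \<and>
     (\<forall>i<d. \<forall>j<d. hol2 (\<lambda>z w. F z w $$ (i, j))) \<and>
     (\<forall>\<^sub>F (x, t) in nhds (0, 0). hermitian_mat (F (complex_of_real x) (complex_of_real t)))"

definition unit_deriv :: "nat \<Rightarrow> (complex \<Rightarrow> complex \<Rightarrow> complex mat) \<Rightarrow> bool" where
  "unit_deriv d F \<longleftrightarrow> (\<forall>i<d. \<forall>j<d. deriv (\<lambda>z. F z 0 $$ (i, j)) 0 = (if i = j then 1 else 0))"

text \<open>The two counts characterise the branches by inertia. Subtracted from \<open>d\<close>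
  they show that the nullity of F at \<open>(x, t)\<close> is the number of branches through that
  point, so multiplicities are built in. A multiset allows coinciding branches and fixes no order,
  which would change where branches cross.\<close>

definition branches :: "nat \<Rightarrow> (complex \<Rightarrow> complex \<Rightarrow> complex mat) \<Rightarrow> (complex \<Rightarrow> complex) multiset \<Rightarrow> bool" where
  "branches d F L \<longleftrightarrow> size L = d \<and>
     (\<forall>l\<in>#L. l analytic_on {0} \<and> l 0 = 0 \<and> (\<forall>\<^sub>F t in nhds 0. l (complex_of_real t) \<in> \<real>)) \<and>
     (\<forall>\<^sub>F (x, t) in nhds (0, 0).
        neg_inertia (F (complex_of_real x) (complex_of_real t)) = size {#l \<in># L. Re (l (complex_of_real t)) > x#} \<and>
        neg_inertia (- F (complex_of_real x) (complex_of_real t)) = size {#l \<in># L. Re (l (complex_of_real t)) < x#})"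

lemma filterlim_of_real_nhds_00:
  "filterlim (\<lambda>(x, t). (complex_of_real x, complex_of_real t)) (nhds (0, 0)) (nhds (0, 0))"
  unfolding nhds_prod split_beta'
  by (intro filterlim_Pair filterlim_compose[OF filterlim_of_real_nhds_0] filterlim_fst filterlim_snd)

lemma herm_family_near:
  assumes F: "herm_family d F" and e: "\<epsilon> > 0"
  shows "\<forall>\<^sub>F (x, t) in nhds (0, 0). \<forall>i<d. \<forall>j<d.
    cmod (F (complex_of_real x) (complex_of_real t) $$ (i, j) - F 0 0 $$ (i, j)) \<le> \<epsilon>"
proof -
  have "\<forall>\<^sub>F p in nhds (0, 0). cmod (F (complex_of_real (fst p)) (complex_of_real (snd p)) $$ (i, j) - F 0 0 $$ (i, j)) \<le> \<epsilon>"
    if "i < d" "j < d" for i j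
  proof -
    have "isCont (\<lambda>(z, w). F z w $$ (i, j)) (0, 0)" using F that by (intro hol2_isCont) (auto simp: herm_family_def)
    then have "((\<lambda>(z, w). F z w $$ (i, j)) \<longlongrightarrow> F 0 0 $$ (i, j)) (nhds (0, 0))"
      by (simp add: isCont_def tendsto_nhds_iff)
    from filterlim_compose[OF this filterlim_of_real_nhds_00]
    have "((\<lambda>p. F (complex_of_real (fst p)) (complex_of_real (snd p)) $$ (i, j)) \<longlongrightarrow> F 0 0 $$ (i, j)) (nhds (0, 0))"
      by (simp add: split_beta')
    from tendstoD[OF this e] show ?thesis by eventually_elim (simp add: dist_norm)
  qed
  then have "\<forall>\<^sub>F p in nhds (0, 0). \<forall>i\<in>{..<d}. \<forall>j\<in>{..<d}.
      cmod (F (complex_of_real (fst p)) (complex_of_real (snd p)) $$ (i, j) - F 0 0 $$ (i, j)) \<le> \<epsilon>"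
    by (intro eventually_ball_finite ballI) auto
  then show ?thesis by eventually_elim (auto simp: split_beta')
qed

lemma herm_family_carrier: "herm_family d F \<Longrightarrow> F z w \<in> carrier_mat d d"
  by (simp add: herm_family_def)

lemma herm_family_hol2: "herm_family d F \<Longrightarrow> i < d \<Longrightarrow> j < d \<Longrightarrow> hol2 (\<lambda>z w. F z w $$ (i, j))"
  by (simp add: herm_family_def)

lemma herm_family_hermitian_0: "herm_family d F \<Longrightarrow> hermitian_mat (F 0 0)"
  unfolding herm_family_def using eventually_nhds_x_imp_x by fastforce

lemma herm_family_inertia_const:
  assumes F: "herm_family d F" and det: "det (F 0 0) \<noteq> 0"
  shows "\<forall>\<^sub>F (x, t) in nhds (0, 0).
    neg_inertia (F (complex_of_real x) (complex_of_real t)) = neg_inertia (F 0 0) \<and>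
    neg_inertia (- F (complex_of_real x) (complex_of_real t)) = neg_inertia (- F 0 0)"
proof -
  from inertia_locally_constant[OF herm_family_hermitian_0[OF F] herm_family_carrier[OF F] det]
  obtain \<epsilon> where e: "\<epsilon> > 0" "\<And>H. H \<in> carrier_mat d d \<Longrightarrow> hermitian_mat H \<Longrightarrow>
    (\<forall>i<d. \<forall>j<d. cmod (H $$ (i, j) - F 0 0 $$ (i, j)) \<le> \<epsilon>) \<Longrightarrow>
      neg_inertia H = neg_inertia (F 0 0) \<and> neg_inertia (- H) = neg_inertia (- F 0 0)" by metis
  have "\<forall>\<^sub>F (x, t) in nhds (0, 0). hermitian_mat (F (complex_of_real x) (complex_of_real t))"
    using F by (simp add: herm_family_def)
  with herm_family_near[OF F e(1)] show ?thesis
  proof eventually_elim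
    case (elim p)
    then show ?case using e(2)[OF herm_family_carrier[OF F]] by (simp add: split_beta')
  qed
qed

lemma hol2_det:
  assumes "\<And>z w. M z w \<in> carrier_mat n n" "\<And>i j. i < n \<Longrightarrow> j < n \<Longrightarrow> hol2 (\<lambda>z w. M z w $$ (i, j))"
  shows "hol2 (\<lambda>z w. det (M z w))"
proof -
  have "hol2 (\<lambda>z w. \<Sum>p\<in>{p. p permutes {0..<n}}. signof p * (\<Prod>i = 0..<n. M z w $$ (i, p i)))"
    using assms(2) by (intro hol2_sum hol2_mult hol2_const hol2_prod) (auto dest: permutes_in_image)
  then show ?thesis using det_def'[OF assms(1)] by simp
qed

lemma hol2_mat_mult:
  assumes "\<And>z w. M z w \<in> carrier_mat n m" "\<And>z w. N z w \<in> carrier_mat m k"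
    and "\<And>i j. i < n \<Longrightarrow> j < m \<Longrightarrow> hol2 (\<lambda>z w. M z w $$ (i, j))"
    and "\<And>i j. i < m \<Longrightarrow> j < k \<Longrightarrow> hol2 (\<lambda>z w. N z w $$ (i, j))"
    and ij: "i < n" "j < k"
  shows "hol2 (\<lambda>z w. (M z w * N z w) $$ (i, j))"
proof -
  have eq: "(M z w * N z w) $$ (i, j) = (\<Sum>l = 0..<m. M z w $$ (i, l) * N z w $$ (l, j))" for z w
    using assms(1,2)[of z w] ij by (auto simp: scalar_prod_def intro!: sum.cong)
  show ?thesis unfolding eq using assms by (intro hol2_sum hol2_mult) auto
qed

lemma herm_family_congruence:
  assumes F: "herm_family d F" and U: "U \<in> carrier_mat d d"
  shows "herm_family d (\<lambda>z w. mat_adjoint U * F z w * U)"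
  unfolding herm_family_def
proof (intro conjI allI impI)
  show "mat_adjoint U * F z w * U \<in> carrier_mat d d" for z w
    using U herm_family_carrier[OF F, of z w] by auto
  have 1: "hol2 (\<lambda>z w. (mat_adjoint U * F z w) $$ (i, j))" if "i < d" "j < d" for i j
    by (rule hol2_mat_mult[of _ d d _ d]) (use U F that in \<open>auto simp: herm_family_def\<close>)
  have 2: "mat_adjoint U * F z w \<in> carrier_mat d d" for z w
    by (rule mult_carrier_mat[OF mat_adjoint_carrier[OF U] herm_family_carrier[OF F]])
  show "hol2 (\<lambda>z w. (mat_adjoint U * F z w * U) $$ (i, j))" if "i < d" "j < d" for i j
    by (rule hol2_mat_mult[OF 2, of "\<lambda>z w. U" d]) (use U 1 that in auto)
  have "\<forall>\<^sub>F (x, t) in nhds (0, 0). hermitian_mat (F (complex_of_real x) (complex_of_real t))"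
    using F by (simp add: herm_family_def)
  then show "\<forall>\<^sub>F (x, t) in nhds (0, 0). hermitian_mat (mat_adjoint U * F (complex_of_real x) (complex_of_real t) * U)"
  proof eventually_elim
    case (elim p)
    then show ?case using hermitian_mat_congruence[OF _ herm_family_carrier[OF F] U] by (auto simp: split_beta')
  qed
qed

text \<open>When F(0,t) is small compared with \<open>x\<close>, the form of F(x,t) is dominated by
  \<open>x\<close> times the squared norm. This supplies the counts outside the region reached by a
  blow-up, where all branches lie on one side of \<open>x\<close>.\<close>

lemma definite_region:
  assumes F: "herm_family d F" and D: "unit_deriv d F"
  obtains \<epsilon> where "\<epsilon> > 0" "\<forall>\<^sub>F (x, t) in nhds (0, 0).
    (\<forall>i<d. \<forall>j<d. cmod (F 0 (complex_of_real t) $$ (i, j)) \<le> \<epsilon> * \<bar>x\<bar>) \<longrightarrow>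
    (x > 0 \<longrightarrow> neg_inertia (F (complex_of_real x) (complex_of_real t)) = 0 \<and>
       neg_inertia (- F (complex_of_real x) (complex_of_real t)) = d) \<and>
    (x < 0 \<longrightarrow> neg_inertia (F (complex_of_real x) (complex_of_real t)) = d \<and>
       neg_inertia (- F (complex_of_real x) (complex_of_real t)) = 0)"
proof -
  \<comment> \<open>Each entry deviates from that of \<open>x\<close> times the identity by at most
    2\<epsilon>|x|: one \<epsilon> from the increment estimate, one from the smallness of F(0,t).
    With the factor \<open>d\<close> of \<open>qform_bound\<close> this needs 2\<epsilon>d < 1;
    \<open>d + 1\<close> covers \<open>d = 0\<close>.\<close>
  define \<epsilon> :: real where "\<epsilon> = 1 / (4 * (d + 1))"
  have e: "\<epsilon> > 0" by (simp add: \<epsilon>_def)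
  have ed: "2 * \<epsilon> * d < 1" by (simp add: \<epsilon>_def field_simps)
  have "\<exists>s>0. \<forall>z z' w. z \<in> ball 0 s \<longrightarrow> z' \<in> ball 0 s \<longrightarrow> w \<in> ball 0 s \<longrightarrow>
    cmod (F z w $$ (i, j) - F z' w $$ (i, j) - (if i = j then 1 else 0) * (z - z')) \<le> \<epsilon> * cmod (z - z')"
    if "i < d" "j < d" for i j
  proof -
    have D': "deriv (\<lambda>z. F z 0 $$ (i, j)) 0 = (if i = j then 1 else 0)" using D that by (simp add: unit_deriv_def)
    show ?thesis by (rule hol2_increment_estimate[OF herm_family_hol2[OF F that] e], unfold D') blast
  qed
  then obtain s where s: "\<And>i j. i < d \<Longrightarrow> j < d \<Longrightarrow> s i j > 0"
    "\<And>i j z z' w. i < d \<Longrightarrow> j < d \<Longrightarrow> z \<in> ball 0 (s i j) \<Longrightarrow> z' \<in> ball 0 (s i j) \<Longrightarrow> w \<in> ball 0 (s i j) \<Longrightarrow>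
    cmod (F z w $$ (i, j) - F z' w $$ (i, j) - (if i = j then 1 else 0) * (z - z')) \<le> \<epsilon> * cmod (z - z')" by metis
  define q where "q = Min (insert 1 ((\<lambda>(i, j). s i j) ` ({..<d} \<times> {..<d})))"
  have q: "q > 0" unfolding q_def by (subst Min_gr_iff) (auto simp: s)
  have qs: "q \<le> s i j" if "i < d" "j < d" for i j unfolding q_def using that by (intro Min_le) auto
  have "\<forall>\<^sub>F p in nhds (0, 0). p \<in> ball (0::real) q \<times> ball (0::real) q"
    using q by (intro eventually_nhds_in_open open_Times) auto
  moreover have "\<forall>\<^sub>F (x, t) in nhds (0, 0). hermitian_mat (F (complex_of_real x) (complex_of_real t))"
    using F by (simp add: herm_family_def)
  ultimately have "\<forall>\<^sub>F (x, t) in nhds (0, 0).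
    (\<forall>i<d. \<forall>j<d. cmod (F 0 (complex_of_real t) $$ (i, j)) \<le> \<epsilon> * \<bar>x\<bar>) \<longrightarrow>
    (x > 0 \<longrightarrow> neg_inertia (F (complex_of_real x) (complex_of_real t)) = 0 \<and>
       neg_inertia (- F (complex_of_real x) (complex_of_real t)) = d) \<and>
    (x < 0 \<longrightarrow> neg_inertia (F (complex_of_real x) (complex_of_real t)) = d \<and>
       neg_inertia (- F (complex_of_real x) (complex_of_real t)) = 0)"
  proof eventually_elim
    case (elim p)
    obtain x t where p: "p = (x, t)" by (cases p)
    define A where "A = F (complex_of_real x) (complex_of_real t)"
    have A: "hermitian_mat A" "A \<in> carrier_mat d d" using elim p herm_family_carrier[OF F] by (auto simp: A_def)
    have A': "hermitian_mat (- A)" "- A \<in> carrier_mat d d" using hermitian_mat_uminus[OF A] A by auto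
    have xt: "\<bar>x\<bar> < q" "\<bar>t\<bar> < q" using elim p by auto
    {
      assume small: "\<forall>i<d. \<forall>j<d. cmod (F 0 (complex_of_real t) $$ (i, j)) \<le> \<epsilon> * \<bar>x\<bar>"
      have est: "\<bar>Re ((A *\<^sub>v v) \<bullet>c v) - x * nsq v\<bar> \<le> 2 * \<epsilon> * \<bar>x\<bar> * d * nsq v" if v: "v \<in> carrier_vec d" for v
      proof -
        define X where "X = complex_of_real x \<cdot>\<^sub>m (1\<^sub>m d :: complex mat)"
        have X: "X \<in> carrier_mat d d" by (simp add: X_def)
        have Xv: "Re ((X *\<^sub>v v) \<bullet>c v) = x * nsq v"
        proof -
          have "X *\<^sub>v v = complex_of_real x \<cdot>\<^sub>v v"
            using v by (intro eq_vecI) (auto simp: X_def)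
          then show ?thesis using v by (simp add: cscalar_nsq)
        qed
        have "\<bar>Re (((A - X) *\<^sub>v v) \<bullet>c v)\<bar> \<le> (2 * \<epsilon> * \<bar>x\<bar>) * d * nsq v"
        proof (rule qform_bound[OF _ v])
          show "A - X \<in> carrier_mat d d" by (rule minus_carrier_mat[OF X])
          fix i j assume ij: "i < d" "j < d"
          have "(A - X) $$ (i, j) = (F (complex_of_real x) (complex_of_real t) $$ (i, j) - F 0 (complex_of_real t) $$ (i, j)
             - (if i = j then 1 else 0) * (complex_of_real x - 0)) + F 0 (complex_of_real t) $$ (i, j)"
            using A(2) ij by (simp add: X_def A_def)
          also have "cmod \<dots> \<le> \<epsilon> * cmod (complex_of_real x - 0) + \<epsilon> * \<bar>x\<bar>"
          proof (rule norm_triangle_le, rule add_mono)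
            show "cmod (F (complex_of_real x) (complex_of_real t) $$ (i, j) - F 0 (complex_of_real t) $$ (i, j)
               - (if i = j then 1 else 0) * (complex_of_real x - 0)) \<le> \<epsilon> * cmod (complex_of_real x - 0)"
              using xt qs[OF ij] q by (intro s(2)[OF ij]) auto
            show "cmod (F 0 (complex_of_real t) $$ (i, j)) \<le> \<epsilon> * \<bar>x\<bar>" using small ij by blast
          qed
          finally show "cmod ((A - X) $$ (i, j)) \<le> 2 * \<epsilon> * \<bar>x\<bar>" by simp
        qed
        then show ?thesis using qform_diff[OF A(2) X v] Xv by simp
      qed
      have key: "2 * \<epsilon> * \<bar>x\<bar> * d * nsq v < \<bar>x\<bar> * nsq v" if "v \<in> carrier_vec d" "v \<noteq> 0\<^sub>v d" "x \<noteq> 0" for v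
      proof -
        have "2 * \<epsilon> * d * (\<bar>x\<bar> * nsq v) < 1 * (\<bar>x\<bar> * nsq v)"
          using nsq_pos[OF that(1,2)] that(3) by (intro mult_strict_right_mono[OF ed]) auto
        then show ?thesis by (simp add: mult_ac)
      qed
      have "neg_inertia A = 0 \<and> neg_inertia (- A) = d" if "x > 0"
      proof -
        have "Re ((A *\<^sub>v v) \<bullet>c v) > 0" if "v \<in> carrier_vec d" "v \<noteq> 0\<^sub>v d" for v
          using est[OF that(1)] key[OF that] \<open>x > 0\<close> unfolding abs_le_iff abs_of_pos[OF \<open>x > 0\<close>] by linarith
        with inertia_positive_definite[OF A] show ?thesis by blast
      qed
      moreover have "neg_inertia A = d \<and> neg_inertia (- A) = 0" if "x < 0"
      proof -
        have "Re ((- A *\<^sub>v v) \<bullet>c v) > 0" if v: "v \<in> carrier_vec d" "v \<noteq> 0\<^sub>v d" for v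
        proof -
          have "Re ((A *\<^sub>v v) \<bullet>c v) < 0" 
            using est[OF v(1)] key[OF v] \<open>x < 0\<close> unfolding abs_le_iff abs_of_neg[OF \<open>x < 0\<close>] by linarith
          moreover have "(- A *\<^sub>v v) \<bullet>c v = - ((A *\<^sub>v v) \<bullet>c v)"
            using A(2) v by (simp add: uminus_mult_mat_vec uminus_scalar_prod[symmetric, of _ d])
          ultimately show ?thesis by simp
        qed
        with inertia_positive_definite[OF A'] show ?thesis by simp
      qed
      ultimately have "(x > 0 \<longrightarrow> neg_inertia A = 0 \<and> neg_inertia (- A) = d) \<and>
        (x < 0 \<longrightarrow> neg_inertia A = d \<and> neg_inertia (- A) = 0)" by blast
    }
    then show ?case unfolding p A_def prod.case by blast
  qed
  then show ?thesis by (rule that[OF e])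
qed

section \<open>Reduction of the size by a Schur complement\<close>

lemma mat_adjoint_add:
  "(A :: complex mat) \<in> carrier_mat n m \<Longrightarrow> B \<in> carrier_mat n m \<Longrightarrow>
    mat_adjoint (A + B) = mat_adjoint A + mat_adjoint B"
  by (intro eq_matI) auto

text \<open>Block elimination. \<open>P\<close> is minus the inverse of \<open>c\<close> times the
  adjoint of \<open>b\<close>, given by its defining equation, and \<open>a + b * P\<close> is the
  Schur complement. Changing the sign of \<open>P\<close> inverts the unipotent matrix
  \<open>T\<close>, as Sylvester's law requires.\<close>

lemma schur_complement_congruence:
  fixes a b c P :: "complex mat"
  assumes a: "a \<in> carrier_mat e e" and b: "b \<in> carrier_mat e n" and c: "c \<in> carrier_mat n n"
    and P: "P \<in> carrier_mat n e" and ca: "mat_adjoint c = c" and cP: "mat_adjoint b + c * P = 0\<^sub>m n e"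
  defines "T \<equiv> four_block_mat (1\<^sub>m e) (0\<^sub>m e n) P (1\<^sub>m n)"
  shows "mat_adjoint T * four_block_mat a b (mat_adjoint b) c * T = four_block_mat (a + b * P) (0\<^sub>m e n) (0\<^sub>m n e) c"
    "T * four_block_mat (1\<^sub>m e) (0\<^sub>m e n) (- P) (1\<^sub>m n) = 1\<^sub>m (e + n)"
proof -
  have P': "mat_adjoint P \<in> carrier_mat e n" and b': "mat_adjoint b \<in> carrier_mat n e" using P b by auto
  have z: "mat_adjoint (0\<^sub>m k l) = (0\<^sub>m l k :: complex mat)" for k l by (intro eq_matI) auto
  have T': "mat_adjoint T = four_block_mat (1\<^sub>m e) (mat_adjoint P) (0\<^sub>m n e) (1\<^sub>m n)"
    unfolding T_def using P by (subst mat_adjoint_four_block[of _ e _ n]) (auto simp: z)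
  have Tc: "T \<in> carrier_mat (e + n) (e + n)" using P by (simp add: T_def)
  have Kc: "four_block_mat a b (mat_adjoint b) c \<in> carrier_mat (e + n) (e + n)" using a c by simp
  have S: "a + b * P \<in> carrier_mat e e" using a b P by simp
  have "mat_adjoint (mat_adjoint b + c * P) = mat_adjoint (mat_adjoint b) + mat_adjoint P * mat_adjoint c"
    using mat_adjoint_add[OF b' mult_carrier_mat[OF c P]] mat_adjoint_mult[OF c P] by simp
  then have bP: "b + mat_adjoint P * c = 0\<^sub>m e n" unfolding cP ca z by simp
  have "four_block_mat a b (mat_adjoint b) c * T =
    four_block_mat (a * 1\<^sub>m e + b * P) (a * 0\<^sub>m e n + b * 1\<^sub>m n) (mat_adjoint b * 1\<^sub>m e + c * P) (mat_adjoint b * 0\<^sub>m e n + c * 1\<^sub>m n)"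
    unfolding T_def using a b c P b' by (subst mult_four_block_mat[of _ e e _ n _ n _ _ e _ n]) auto
  also have "\<dots> = four_block_mat (a + b * P) b (0\<^sub>m n e) c"
    using right_mult_one_mat[OF a] right_mult_one_mat[OF b] right_mult_one_mat[OF b'] right_mult_one_mat[OF c]
      right_mult_zero_mat[OF a, of n] right_mult_zero_mat[OF b', of n] left_add_zero_mat[OF b] left_add_zero_mat[OF c] cP by simp
  finally have KT: "four_block_mat a b (mat_adjoint b) c * T = four_block_mat (a + b * P) b (0\<^sub>m n e) c" .
  have "mat_adjoint T * four_block_mat a b (mat_adjoint b) c * T = mat_adjoint T * (four_block_mat a b (mat_adjoint b) c * T)"
    by (rule square_mult_assoc[OF mat_adjoint_carrier[OF Tc] Kc Tc])
  also have "\<dots> = four_block_mat (1\<^sub>m e * (a + b * P) + mat_adjoint P * 0\<^sub>m n e) (1\<^sub>m e * b + mat_adjoint P * c)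
    (0\<^sub>m n e * (a + b * P) + 1\<^sub>m n * 0\<^sub>m n e) (0\<^sub>m n e * b + 1\<^sub>m n * c)"
    unfolding KT T' using S b c P' by (subst mult_four_block_mat[of _ e e _ n _ n _ _ e _ n]) auto
  also have "\<dots> = four_block_mat (a + b * P) (0\<^sub>m e n) (0\<^sub>m n e) c"
    using left_mult_one_mat[OF S] left_mult_one_mat[OF b] left_mult_one_mat[OF c] right_mult_zero_mat[OF P', of e]
      left_mult_zero_mat[OF S, of n] left_mult_zero_mat[OF b, of n] right_add_zero_mat[OF S] left_add_zero_mat[OF c] bP by simp
  finally show "mat_adjoint T * four_block_mat a b (mat_adjoint b) c * T = four_block_mat (a + b * P) (0\<^sub>m e n) (0\<^sub>m n e) c" .
  have P0: "P + - P = 0\<^sub>m n e" using P by (intro eq_matI) auto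
  have mP: "- P \<in> carrier_mat n e" using P by simp
  have "T * four_block_mat (1\<^sub>m e) (0\<^sub>m e n) (- P) (1\<^sub>m n) =
    four_block_mat (1\<^sub>m e * 1\<^sub>m e + 0\<^sub>m e n * (- P)) (1\<^sub>m e * 0\<^sub>m e n + 0\<^sub>m e n * 1\<^sub>m n)
      (P * 1\<^sub>m e + 1\<^sub>m n * (- P)) (P * 0\<^sub>m e n + 1\<^sub>m n * 1\<^sub>m n)"
    unfolding T_def using P mP by (subst mult_four_block_mat[of _ e e _ n _ n _ _ e _ n]) auto
  also have "\<dots> = four_block_mat (1\<^sub>m e) (0\<^sub>m e n) (0\<^sub>m n e) (1\<^sub>m n)"
    using left_mult_zero_mat[OF mP, of e] right_mult_one_mat[OF P] left_mult_one_mat[OF mP] right_mult_zero_mat[OF P, of n] P0 by simp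
  also have "\<dots> = 1\<^sub>m (e + n)" by (intro eq_matI) auto
  finally show "T * four_block_mat (1\<^sub>m e) (0\<^sub>m e n) (- P) (1\<^sub>m n) = 1\<^sub>m (e + n)" .
qed

text \<open>The lower block stays nonsingular near the origin and contributes constant indices, so
  only the family \<open>S\<close> of size \<open>e\<close> varies. Both \<open>b\<close> and
  \<open>P\<close> vanish at the origin, so \<open>b * P\<close> is of second order there and
  \<open>S\<close> inherits the first-order data of \<open>K\<close>.\<close>

lemma schur_reduction:
  assumes K: "herm_family (e + n) K"
    and K0: "K 0 0 = four_block_mat (0\<^sub>m e e) (0\<^sub>m e n) (0\<^sub>m n e) C0"
    and C0: "C0 \<in> carrier_mat n n" "det C0 \<noteq> 0"
  obtains S where "herm_family e S" "S 0 0 = 0\<^sub>m e e"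
    "\<forall>i<e. \<forall>j<e. deriv (\<lambda>z. S z 0 $$ (i, j)) 0 = deriv (\<lambda>z. K z 0 $$ (i, j)) 0"
    "\<forall>\<^sub>F (x, t) in nhds (0, 0).
      neg_inertia (K (complex_of_real x) (complex_of_real t)) =
        neg_inertia (S (complex_of_real x) (complex_of_real t)) + neg_inertia C0 \<and>
      neg_inertia (- K (complex_of_real x) (complex_of_real t)) =
        neg_inertia (- S (complex_of_real x) (complex_of_real t)) + neg_inertia (- C0)"
proof -
  define a where "a z w = mat e e (\<lambda>(i, j). K z w $$ (i, j))" for z w
  define b where "b z w = mat e n (\<lambda>(i, j). K z w $$ (i, e + j))" for z w
  define b' where "b' z w = mat n e (\<lambda>(i, j). K z w $$ (e + i, j))" for z w
  define c where "c z w = mat n n (\<lambda>(i, j). K z w $$ (e + i, e + j))" for z w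
  have carr: "a z w \<in> carrier_mat e e" "b z w \<in> carrier_mat e n" "b' z w \<in> carrier_mat n e" "c z w \<in> carrier_mat n n" for z w
    by (auto simp: a_def b_def b'_def c_def)
  have Kc: "K z w \<in> carrier_mat (e + n) (e + n)" for z w by (rule herm_family_carrier[OF K])
  have Kb: "K z w = four_block_mat (a z w) (b z w) (b' z w) (c z w)" for z w
    using Kc[of z w] by (intro eq_matI) (auto simp: a_def b_def b'_def c_def)
  have holK: "hol2 (\<lambda>z w. K z w $$ (i, j))" if "i < e + n" "j < e + n" for i j
    using herm_family_hol2[OF K that] .
  have hola: "hol2 (\<lambda>z w. a z w $$ (i, j))" if "i < e" "j < e" for i j using that holK by (simp add: a_def)
  have holb: "hol2 (\<lambda>z w. b z w $$ (i, j))" if "i < e" "j < n" for i j using that holK by (simp add: b_def)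
  have holb': "hol2 (\<lambda>z w. b' z w $$ (i, j))" if "i < n" "j < e" for i j using that holK by (simp add: b'_def)
  have holc: "hol2 (\<lambda>z w. c z w $$ (i, j))" if "i < n" "j < n" for i j using that holK by (simp add: c_def)
  have K00: "K 0 0 $$ (i, j) = (if i < e \<or> j < e then 0 else C0 $$ (i - e, j - e))" if "i < e + n" "j < e + n" for i j
    using that C0 by (auto simp: K0)
  have c0: "c 0 0 = C0" using C0 by (intro eq_matI) (auto simp: c_def K00)
  have hdet: "hol2 (\<lambda>z w. det (c z w))" by (rule hol2_det[OF carr(4) holc])
  \<comment> \<open>The inverse as adjugate over determinant: its entries are visibly holomorphic,
    and \<open>ci\<close> is total, also where \<open>c\<close> is singular.\<close>
  define ci where "ci z w = inverse (det (c z w)) \<cdot>\<^sub>m adj_mat (c z w)" for z w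
  have cic: "ci z w \<in> carrier_mat n n" for z w using adj_mat(1)[OF carr(4)] by (simp add: ci_def)
  have holci: "hol2 (\<lambda>z w. ci z w $$ (i, j))" if ij: "i < n" "j < n" for i j
  proof -
    have "hol2 (\<lambda>z w. det (mat_delete (c z w) j i))"
    proof (rule hol2_det)
      show "mat_delete (c z w) j i \<in> carrier_mat (n - 1) (n - 1)" for z w
        using carr(4)[of z w] by (simp add: mat_delete_def)
      fix k l assume kl: "k < n - 1" "l < n - 1"
      have "mat_delete (c z w) j i $$ (k, l) = c z w $$ (if k < j then k else Suc k, if l < i then l else Suc l)" for z w
        using kl carr(4)[of z w] by (simp add: mat_delete_def)
      then show "hol2 (\<lambda>z w. mat_delete (c z w) j i $$ (k, l))" using kl by (simp add: holc)
    qed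
    then have "hol2 (\<lambda>z w. inverse (det (c z w)) * ((-1) ^ (j + i) * det (mat_delete (c z w) j i)))"
      using C0 c0 by (intro hol2_mult hol2_inverse hdet hol2_const) auto
    moreover have "ci z w $$ (i, j) = inverse (det (c z w)) * ((-1) ^ (j + i) * det (mat_delete (c z w) j i))" for z w
      using ij carr(4)[of z w] adj_mat(1)[OF carr(4), of z w] by (simp add: ci_def adj_mat_def cofactor_def)
    ultimately show ?thesis by simp
  qed
  have cci: "c z w * ci z w = 1\<^sub>m n" if "det (c z w) \<noteq> 0" for z w
  proof -
    have "c z w * ci z w = inverse (det (c z w)) \<cdot>\<^sub>m (det (c z w) \<cdot>\<^sub>m 1\<^sub>m n)"
      unfolding ci_def using mult_smult_distrib[OF carr(4) adj_mat(1)[OF carr(4)]] adj_mat(2)[OF carr(4)] by metis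
    also have "\<dots> = 1\<^sub>m n" using that by (intro eq_matI) auto
    finally show ?thesis .
  qed
  define P where "P z w = - (ci z w * b' z w)" for z w
  have Pc: "P z w \<in> carrier_mat n e" for z w
    using mult_carrier_mat[OF cic carr(3), of z w z w] by (simp add: P_def)
  have holP: "hol2 (\<lambda>z w. P z w $$ (i, j))" if ij: "i < n" "j < e" for i j
  proof -
    have "hol2 (\<lambda>z w. - ((ci z w * b' z w) $$ (i, j)))"
      by (intro hol2_uminus hol2_mat_mult[OF cic carr(3) holci holb' ij])
    moreover have "P z w $$ (i, j) = - ((ci z w * b' z w) $$ (i, j))" for z w
      using ij cic[of z w] carr(3)[of z w] by (auto simp: P_def)
    ultimately show ?thesis by simp
  qed
  define S where "S z w = a z w + b z w * P z w" for z w
  have Sc: "S z w \<in> carrier_mat e e" for z w using carr[of z w] Pc[of z w] by (simp add: S_def)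
  have Sij: "S z w $$ (i, j) = a z w $$ (i, j) + (\<Sum>k = 0..<n. b z w $$ (i, k) * P z w $$ (k, j))" if "i < e" "j < e" for z w i j
    using that carr[of z w] Pc[of z w] by (auto simp: S_def scalar_prod_def intro!: sum.cong)
  have b00: "b 0 0 $$ (i, k) = 0" if "i < e" "k < n" for i k using that by (simp add: b_def K00)
  have b'0: "b' 0 0 = 0\<^sub>m n e" by (intro eq_matI) (auto simp: b'_def K00)
  have P00: "P 0 0 $$ (k, j) = 0" if "k < n" "j < e" for k j
    using that right_mult_zero_mat[OF cic[of 0 0], of e] unfolding P_def b'0 by simp
  have ev: "\<forall>\<^sub>F (x, t) in nhds (0, 0). hermitian_mat (K (complex_of_real x) (complex_of_real t))"
    using K by (simp add: herm_family_def)
  have "isCont (\<lambda>(z, w). det (c z w)) (0, 0)" by (rule hol2_isCont[OF hdet])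
  then have "((\<lambda>(z, w). det (c z w)) \<longlongrightarrow> det C0) (nhds (0, 0))"
    by (simp add: isCont_def tendsto_nhds_iff c0)
  from filterlim_compose[OF this filterlim_of_real_nhds_00]
  have "\<forall>\<^sub>F p in nhds (0, 0). det (c (complex_of_real (fst p)) (complex_of_real (snd p))) \<noteq> 0"
    using tendsto_imp_eventually_ne[OF _ C0(2)] by (fastforce simp: split_beta')
  with ev have main: "\<forall>\<^sub>F (x, t) in nhds (0, 0).
     hermitian_mat (S (complex_of_real x) (complex_of_real t)) \<and>
     hermitian_mat (c (complex_of_real x) (complex_of_real t)) \<and>
      neg_inertia (K (complex_of_real x) (complex_of_real t)) =
        neg_inertia (S (complex_of_real x) (complex_of_real t)) + neg_inertia (c (complex_of_real x) (complex_of_real t)) \<and>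
      neg_inertia (- K (complex_of_real x) (complex_of_real t)) =
        neg_inertia (- S (complex_of_real x) (complex_of_real t)) + neg_inertia (- c (complex_of_real x) (complex_of_real t))"
  proof eventually_elim
    case (elim p)
    define z w where "z = complex_of_real (fst p)" and "w = complex_of_real (snd p)"
    have hK: "hermitian_mat (K z w)" and dc: "det (c z w) \<noteq> 0" using elim by (auto simp: split_beta' z_def w_def)
    note hi = hermitian_mat_index[OF hK Kc]
    have hc: "hermitian_mat (c z w)" by (rule hermitian_matI[OF carr(4)]) (simp add: c_def hi)
    then have ca: "mat_adjoint (c z w) = c z w" by (simp add: hermitian_mat_def)
    have ba: "mat_adjoint (b z w) = b' z w" by (intro eq_matI) (auto simp: b_def b'_def hi)
    have "c z w * (ci z w * b' z w) = b' z w"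
      using assoc_mult_mat[OF carr(4) cic carr(3), of z w z w z w] cci[OF dc] carr(3)[of z w] by simp
    then have cP: "mat_adjoint (b z w) + c z w * P z w = 0\<^sub>m n e"
      unfolding ba P_def using uminus_mult_right_mat[of "c z w" "ci z w * b' z w"] carr[of z w] cic[of z w]
      by (intro eq_matI) auto
    define T where "T = four_block_mat (1\<^sub>m e) (0\<^sub>m e n) (P z w) (1\<^sub>m n)"
    define T' where "T' = four_block_mat (1\<^sub>m e) (0\<^sub>m e n) (- P z w) (1\<^sub>m n)"
    have T: "T \<in> carrier_mat (e + n) (e + n)" "T' \<in> carrier_mat (e + n) (e + n)" by (simp_all add: T_def T'_def)
    have TKT: "mat_adjoint T * K z w * T = four_block_mat (S z w) (0\<^sub>m e n) (0\<^sub>m n e) (c z w)"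
      using schur_complement_congruence(1)[OF carr(1,2,4) Pc ca cP] unfolding Kb ba T_def S_def .
    have TT: "T * T' = 1\<^sub>m (e + n)"
      using schur_complement_congruence(2)[OF carr(1,2,4) Pc ca cP] unfolding T_def T'_def .
    have hB: "hermitian_mat (four_block_mat (S z w) (0\<^sub>m e n) (0\<^sub>m n e) (c z w))"
      using hermitian_mat_congruence[OF hK Kc T(1)] unfolding TKT .
    have Bc: "four_block_mat (S z w) (0\<^sub>m e n) (0\<^sub>m n e) (c z w) \<in> carrier_mat (e + n) (e + n)"
      using Sc carr(4) by simp
    have hS: "hermitian_mat (S z w)"
    proof (rule hermitian_matI[OF Sc])
      fix i j assume "i < e" "j < e"
      then show "S z w $$ (i, j) = cnj (S z w $$ (j, i))"
        using hermitian_mat_index[OF hB Bc, of i j] Sc[of z w] carr(4)[of z w] by simp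
    qed
    show ?case
      using neg_inertia_congruence[OF hK Kc T TT] neg_inertia_congruence_uminus[OF hK Kc T TT]
        neg_inertia_block_diag[OF hS Sc hc carr(4)] hS hc unfolding TKT by (simp add: split_beta' z_def w_def)
  qed
  have famS: "herm_family e S"
    unfolding herm_family_def
  proof (intro conjI allI impI Sc)
    show "hol2 (\<lambda>z w. S z w $$ (i, j))" if "i < e" "j < e" for i j
      unfolding Sij[OF that] using that by (intro hol2_add hola hol2_sum hol2_mult holb holP) auto
    show "\<forall>\<^sub>F (x, t) in nhds (0, 0). hermitian_mat (S (complex_of_real x) (complex_of_real t))"
      using main by eventually_elim auto
  qed
  have famc: "herm_family n c"
    unfolding herm_family_def
  proof (intro conjI allI impI carr(4) holc)
    show "\<forall>\<^sub>F (x, t) in nhds (0, 0). hermitian_mat (c (complex_of_real x) (complex_of_real t))"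
      using main by eventually_elim auto
  qed
  have cc: "\<forall>\<^sub>F (x, t) in nhds (0, 0).
    neg_inertia (c (complex_of_real x) (complex_of_real t)) = neg_inertia C0 \<and>
    neg_inertia (- c (complex_of_real x) (complex_of_real t)) = neg_inertia (- C0)"
    using herm_family_inertia_const[OF famc] C0 unfolding c0 by simp
  show ?thesis
  proof (rule that[OF famS])
    show "S 0 0 = 0\<^sub>m e e"
    proof (rule eq_matI)
      fix i j assume "i < dim_row (0\<^sub>m e e)" "j < dim_col (0\<^sub>m e e)"
      then have ij: "i < e" "j < e" by auto
      then show "S 0 0 $$ (i, j) = 0\<^sub>m e e $$ (i, j)" by (simp add: Sij b00 a_def K00)
    qed (use Sc[of 0 0] in auto)
    show "\<forall>i<e. \<forall>j<e. deriv (\<lambda>z. S z 0 $$ (i, j)) 0 = deriv (\<lambda>z. K z 0 $$ (i, j)) 0"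
    proof (intro allI impI)
      fix i j assume ij: "i < e" "j < e"
      have da: "((\<lambda>z. a z 0 $$ (i, j)) has_field_derivative deriv (\<lambda>z. a z 0 $$ (i, j)) 0) (at 0)"
        using analytic_on_imp_differentiable_at[OF hol2_restrict_fst[OF hola[OF ij]]]
        by (simp add: DERIV_deriv_iff_field_differentiable)
      have "((\<lambda>z. b z 0 $$ (i, k) * P z 0 $$ (k, j)) has_field_derivative 0) (at 0)" if k: "k < n" for k
      proof -
        have "((\<lambda>z. b z 0 $$ (i, k)) has_field_derivative deriv (\<lambda>z. b z 0 $$ (i, k)) 0) (at 0)"
          using analytic_on_imp_differentiable_at[OF hol2_restrict_fst[OF holb[OF ij(1) k]]]
          by (simp add: DERIV_deriv_iff_field_differentiable)
        moreover have "((\<lambda>z. P z 0 $$ (k, j)) has_field_derivative deriv (\<lambda>z. P z 0 $$ (k, j)) 0) (at 0)"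
          using analytic_on_imp_differentiable_at[OF hol2_restrict_fst[OF holP[OF k ij(2)]]]
          by (simp add: DERIV_deriv_iff_field_differentiable)
        ultimately show ?thesis using b00[OF ij(1) k] P00[OF k ij(2)] by (auto intro!: derivative_eq_intros)
      qed
      then have "((\<lambda>z. \<Sum>k = 0..<n. b z 0 $$ (i, k) * P z 0 $$ (k, j)) has_field_derivative (\<Sum>k = 0..<n. 0)) (at 0)"
        by (intro DERIV_sum) auto
      from DERIV_add[OF da this] have "deriv (\<lambda>z. S z 0 $$ (i, j)) 0 = deriv (\<lambda>z. a z 0 $$ (i, j)) 0"
        unfolding Sij[OF ij] by (simp add: DERIV_imp_deriv)
      then show "deriv (\<lambda>z. S z 0 $$ (i, j)) 0 = deriv (\<lambda>z. K z 0 $$ (i, j)) 0" using ij by (simp add: a_def)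
    qed
    show "\<forall>\<^sub>F (x, t) in nhds (0, 0).
      neg_inertia (K (complex_of_real x) (complex_of_real t)) =
        neg_inertia (S (complex_of_real x) (complex_of_real t)) + neg_inertia C0 \<and>
      neg_inertia (- K (complex_of_real x) (complex_of_real t)) =
        neg_inertia (- S (complex_of_real x) (complex_of_real t)) + neg_inertia (- C0)"
      using main cc by eventually_elim auto
  qed
qed

lemma eventually_nhds_00_snd: "\<forall>\<^sub>F t in nhds (0::real). P t \<Longrightarrow> \<forall>\<^sub>F (x, t) in nhds (c::real, 0). P t"
  using eventually_compose_filterlim[of P "nhds (0::real)" snd "nhds (c, 0)"]
  by (simp add: split_beta' nhds_prod filterlim_snd)

lemma eventually_nhds_00_slice: "\<forall>\<^sub>F p in nhds (0::real, 0::real). P p \<Longrightarrow> \<forall>\<^sub>F t in nhds 0. P (0, t)"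
  by (rule eventually_compose_filterlim) (auto simp: nhds_prod intro!: filterlim_Pair tendsto_const filterlim_ident)

lemma real_eigs_mat_diag:
  "real_eigs (mat_diag n (\<lambda>i. complex_of_real (f i))) = mset (map f [0..<n])"
  by (rule real_eigs_unitary_diag(1)[of _ _ "1\<^sub>m n"])
    (simp_all add: left_mult_one_mat[OF mat_diag_dim] right_mult_one_mat[OF mat_diag_dim])

lemma hermitian_mat_diag: "hermitian_mat (mat_diag n (\<lambda>i. complex_of_real (f i)))"
  by (rule hermitian_matI[of _ n]) (auto simp: mat_diag_def)

section \<open>Branches of the blown-up family\<close>

text \<open>With the \<open>e\<close> copies of \<open>m\<close> listed first, conjugation makes the
  value at the origin block diagonal: a zero block of size \<open>e\<close> and the nonzero numbers
  \<open>m - r\<close> for the other eigenvalues \<open>r\<close> of \<open>D\<close>. The Schur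
  complement is a family of size \<open>e\<close> with unit derivative, to which \<open>IH\<close>
  applies. An eigenvalue \<open>r > m\<close> gives a negative entry and thus adds 1 to the negative
  index, one with \<open>r < m\<close> to the positive index.\<close>

lemma cluster_branches:
  assumes K: "herm_family d K" and D: "hermitian_mat D" "D \<in> carrier_mat d d"
    and K0: "\<And>z. K z 0 = (z + complex_of_real m) \<cdot>\<^sub>m 1\<^sub>m d - D"
    and e: "e = count (real_eigs D) m"
    and IH: "\<And>F. herm_family e F \<Longrightarrow> F 0 0 = 0\<^sub>m e e \<Longrightarrow> unit_deriv e F \<Longrightarrow> \<exists>L. branches e F L"
  obtains L where "size L = e"
    "\<forall>l\<in>#L. l analytic_on {0} \<and> l 0 = 0 \<and> (\<forall>\<^sub>F t in nhds 0. l (complex_of_real t) \<in> \<real>)"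
    "\<forall>\<^sub>F (x, t) in nhds (0, 0).
      neg_inertia (K (complex_of_real x) (complex_of_real t)) =
        size {#l \<in># L. Re (l (complex_of_real t)) > x#} + size {#r \<in># real_eigs D. r > m#} \<and>
      neg_inertia (- K (complex_of_real x) (complex_of_real t)) =
        size {#l \<in># L. Re (l (complex_of_real t)) < x#} + size {#r \<in># real_eigs D. r < m#}"
proof -
  define M where "M = real_eigs D"
  obtain os where os: "mset os = {#r \<in># M. r \<noteq> m#}" by (metis ex_mset)
  define n where "n = length os"
  define rs where "rs = replicate e m @ os"
  have rs: "mset rs = real_eigs D"
    using multiset_partition[of M "\<lambda>r. r = m"] os
    by (simp add: rs_def e M_def filter_eq_replicate_mset)
  from real_diagonalization[OF D rs] obtain U where U: "length rs = d" "U \<in> carrier_mat d d"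
    "mat_adjoint U * U = 1\<^sub>m d" "mat_adjoint U * D * U = mat_diag d (\<lambda>i. complex_of_real (rs ! i))" .
  have d: "d = e + n" using U(1) by (simp add: rs_def n_def)
  have U': "mat_adjoint U \<in> carrier_mat d d" using U by simp
  have UU: "U * mat_adjoint U = 1\<^sub>m d" by (rule unitary_right_inverse[OF U(2,3)])
  have osm: "os ! i \<noteq> m" if "i < n" for i
  proof -
    have "os ! i \<in># mset os" using that by (simp add: n_def)
    then show ?thesis unfolding os by simp
  qed
  define J where "J z w = mat_adjoint U * K z w * U" for z w
  have J: "herm_family d J" unfolding J_def by (rule herm_family_congruence[OF K U(2)])
  have J0: "J z 0 $$ (i, j) = (if i = j then z + complex_of_real m - complex_of_real (rs ! i) else 0)"
    if "i < d" "j < d" for z i j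
  proof -
    have X: "(z + complex_of_real m) \<cdot>\<^sub>m 1\<^sub>m d \<in> carrier_mat d d" by simp
    have mD: "- D \<in> carrier_mat d d" using D by simp
    have eq: "(z + complex_of_real m) \<cdot>\<^sub>m 1\<^sub>m d - D = (z + complex_of_real m) \<cdot>\<^sub>m 1\<^sub>m d + - D"
      using D by (intro eq_matI) auto
    have "J z 0 = mat_adjoint U * ((z + complex_of_real m) \<cdot>\<^sub>m 1\<^sub>m d) * U + - mat_diag d (\<lambda>i. complex_of_real (rs ! i))"
      unfolding J_def K0 eq square_adjoint_sandwich[OF X mD U(2)] uminus_sandwich[OF D(2) U(2)] U(4) ..
    also have "mat_adjoint U * ((z + complex_of_real m) \<cdot>\<^sub>m 1\<^sub>m d) * U = (z + complex_of_real m) \<cdot>\<^sub>m 1\<^sub>m d"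
      using mult_smult_distrib[OF U' one_carrier_mat, of "z + complex_of_real m"]
        mult_smult_assoc_mat[OF U' U(2), of "z + complex_of_real m"] U(3) right_mult_one_mat[OF U'] by simp
    finally show ?thesis using that by (simp add: mat_diag_def)
  qed
  define C0 where "C0 = mat_diag n (\<lambda>i. complex_of_real (m - os ! i))"
  have C0: "C0 \<in> carrier_mat n n" "hermitian_mat C0" unfolding C0_def by (simp, rule hermitian_mat_diag)
  have eC0: "real_eigs C0 = image_mset (\<lambda>r. m - r) (mset os)"
  proof -
    have "map (\<lambda>i. m - os ! i) [0..<n] = map (\<lambda>r. m - r) os" by (auto simp: n_def intro!: nth_equalityI)
    then show ?thesis unfolding C0_def real_eigs_mat_diag by simp
  qed
  have dC0: "det C0 \<noteq> 0"
    using det_zero_real_eigs[OF C0(2,1)] by (auto simp: eC0 os count_eq_zero_iff)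
  have nC0: "neg_inertia C0 = size {#r \<in># real_eigs D. r > m#}"
  proof -
    have "neg_inertia C0 = size {#r \<in># M. r \<noteq> m \<and> m - r < 0#}"
      by (simp add: neg_inertia_real_eigs[OF C0(2,1)] eC0 os filter_mset_image_mset comp_def filter_filter_mset conj_commute)
    also have "{#r \<in># M. r \<noteq> m \<and> m - r < 0#} = {#r \<in># M. r > m#}" by (rule filter_mset_cong) auto
    finally show ?thesis by (simp add: M_def)
  qed
  have nC0': "neg_inertia (- C0) = size {#r \<in># real_eigs D. r < m#}"
  proof -
    have "neg_inertia (- C0) = size {#r \<in># M. r \<noteq> m \<and> m - r > 0#}"
      by (simp add: neg_inertia_uminus[OF C0(2,1)] eC0 os filter_mset_image_mset comp_def filter_filter_mset conj_commute)
    also have "{#r \<in># M. r \<noteq> m \<and> m - r > 0#} = {#r \<in># M. r < m#}" by (rule filter_mset_cong) auto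
    finally show ?thesis by (simp add: M_def)
  qed
  have J00: "J 0 0 = four_block_mat (0\<^sub>m e e) (0\<^sub>m e n) (0\<^sub>m n e) C0"
  proof (rule eq_matI)
    fix i j assume "i < dim_row (four_block_mat (0\<^sub>m e e) (0\<^sub>m e n) (0\<^sub>m n e) C0)"
      "j < dim_col (four_block_mat (0\<^sub>m e e) (0\<^sub>m e n) (0\<^sub>m n e) C0)"
    then have ij: "i < d" "j < d" using C0 d by auto
    then show "J 0 0 $$ (i, j) = four_block_mat (0\<^sub>m e e) (0\<^sub>m e n) (0\<^sub>m n e) C0 $$ (i, j)"
      using C0(1) d by (auto simp: J0 rs_def nth_append C0_def mat_diag_def)
  qed (use herm_family_carrier[OF J, of 0 0] C0 d in auto)
  obtain S where S: "herm_family e S" "S 0 0 = 0\<^sub>m e e"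
    "\<forall>i<e. \<forall>j<e. deriv (\<lambda>z. S z 0 $$ (i, j)) 0 = deriv (\<lambda>z. J z 0 $$ (i, j)) 0"
    "\<forall>\<^sub>F (x, t) in nhds (0, 0).
      neg_inertia (J (complex_of_real x) (complex_of_real t)) =
        neg_inertia (S (complex_of_real x) (complex_of_real t)) + neg_inertia C0 \<and>
      neg_inertia (- J (complex_of_real x) (complex_of_real t)) =
        neg_inertia (- S (complex_of_real x) (complex_of_real t)) + neg_inertia (- C0)"
    by (rule schur_reduction[OF J[unfolded d] J00 C0(1) dC0])
  have "unit_deriv e S"
    unfolding unit_deriv_def
  proof (intro allI impI)
    fix i j assume ij: "i < e" "j < e"
    have "rs ! i = m" using ij by (simp add: rs_def nth_append)
    then have J': "J z 0 $$ (i, j) = (if i = j then z else 0)" for z using J0[of i j z] ij d by (cases "i = j") auto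
    have "deriv (\<lambda>z. S z 0 $$ (i, j)) 0 = deriv (\<lambda>z. J z 0 $$ (i, j)) 0" using S(3) ij by blast
    also have "\<dots> = deriv (\<lambda>z. if i = j then z else 0) 0" unfolding J' ..
    also have "\<dots> = (if i = j then 1 else 0)" by simp
    finally show "deriv (\<lambda>z. S z 0 $$ (i, j)) 0 = (if i = j then 1 else 0)" .
  qed
  from IH[OF S(1,2) this] obtain L where L: "branches e S L" ..
  have hK: "\<forall>\<^sub>F (x, t) in nhds (0, 0). hermitian_mat (K (complex_of_real x) (complex_of_real t))"
    using K by (simp add: herm_family_def)
  have bL: "\<forall>\<^sub>F (x, t) in nhds (0, 0).
        neg_inertia (S (complex_of_real x) (complex_of_real t)) = size {#l \<in># L. Re (l (complex_of_real t)) > x#} \<and>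
        neg_inertia (- S (complex_of_real x) (complex_of_real t)) = size {#l \<in># L. Re (l (complex_of_real t)) < x#}"
    using L by (simp add: branches_def)
  show ?thesis
  proof (rule that)
    show "size L = e" "\<forall>l\<in>#L. l analytic_on {0} \<and> l 0 = 0 \<and> (\<forall>\<^sub>F t in nhds 0. l (complex_of_real t) \<in> \<real>)"
      using L by (auto simp: branches_def)
    show "\<forall>\<^sub>F (x, t) in nhds (0, 0).
      neg_inertia (K (complex_of_real x) (complex_of_real t)) =
        size {#l \<in># L. Re (l (complex_of_real t)) > x#} + size {#r \<in># real_eigs D. r > m#} \<and>
      neg_inertia (- K (complex_of_real x) (complex_of_real t)) =
        size {#l \<in># L. Re (l (complex_of_real t)) < x#} + size {#r \<in># real_eigs D. r < m#}"
      using S(4) hK bL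
    proof eventually_elim
      case (elim p)
      then have h: "hermitian_mat (K (complex_of_real (fst p)) (complex_of_real (snd p)))" by (simp add: split_beta')
      show ?case
        using elim neg_inertia_congruence[OF h herm_family_carrier[OF K] U(2) U' UU]
          neg_inertia_congruence_uminus[OF h herm_family_carrier[OF K] U(2) U' UU]
        by (simp add: split_beta' J_def nC0 nC0')
    qed
  qed
qed

text \<open>The value at \<open>w = 0\<close> is the limit.\<close>

definition blowup :: "nat \<Rightarrow> nat \<Rightarrow> (complex \<Rightarrow> complex \<Rightarrow> complex mat) \<Rightarrow> (nat \<Rightarrow> nat \<Rightarrow> complex \<Rightarrow> complex) \<Rightarrow> complex \<Rightarrow> complex \<Rightarrow> complex mat" where
  "blowup d p G b z w = mat d d (\<lambda>(i, j).
     if w = 0 then (if i = j then 1 else 0) * z + b i j 0 else G (w ^ p * z) w $$ (i, j) / w ^ p)"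

text \<open>The leading coefficients are limits, along real \<open>t\<close>, of the Hermitian
  matrices G(0,t) divided by t^p.\<close>

lemma blowup_limit_hermitian:
  assumes G: "herm_family d G" and b: "\<And>i j. i < d \<Longrightarrow> j < d \<Longrightarrow> b i j analytic_on {0}"
    and Gb: "\<And>i j. i < d \<Longrightarrow> j < d \<Longrightarrow> \<forall>\<^sub>F w in nhds 0. G 0 w $$ (i, j) = w ^ p * b i j w"
    and ij: "i < d" "j < d"
  shows "cnj (b j i 0) = b i j 0"
proof -
  have "\<forall>\<^sub>F (x, t) in nhds (0, 0). hermitian_mat (G (complex_of_real x) (complex_of_real t))"
    using G by (simp add: herm_family_def)
  from eventually_nhds_00_slice[OF this] have h: "\<forall>\<^sub>F t in nhds 0. hermitian_mat (G 0 (complex_of_real t))" by simp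
  have lim: "((\<lambda>t. b k l (complex_of_real t)) \<longlongrightarrow> b k l 0) (at (0::real))" if "k < d" "l < d" for k l
  proof -
    have "(b k l \<longlongrightarrow> b k l 0) (nhds 0)"
      using analytic_at_imp_isCont[OF b[OF that]] by (simp add: isCont_def tendsto_nhds_iff)
    from filterlim_compose[OF this filterlim_of_real_nhds_0] show ?thesis
      by (rule tendsto_mono[rotated]) (simp add: at_within_def)
  qed
  have "\<forall>\<^sub>F t in nhds (0::real). t \<noteq> 0 \<longrightarrow> cnj (b j i (complex_of_real t)) = b i j (complex_of_real t)"
    using h eventually_nhds_0_of_real[OF Gb[OF ij]] eventually_nhds_0_of_real[OF Gb[OF ij(2,1)]]
  proof eventually_elim
    case (elim t)
    show ?case
    proof
      assume t: "t \<noteq> 0"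
      have "complex_of_real t ^ p * cnj (b j i (complex_of_real t)) = cnj (G 0 (complex_of_real t) $$ (j, i))"
        using elim by simp
      also have "\<dots> = G 0 (complex_of_real t) $$ (i, j)"
        using elim by (intro hermitian_mat_index[OF _ herm_family_carrier[OF G]]) (use ij in auto)
      also have "\<dots> = complex_of_real t ^ p * b i j (complex_of_real t)" using elim by simp
      finally show "cnj (b j i (complex_of_real t)) = b i j (complex_of_real t)" using t by simp
    qed
  qed
  then have "\<forall>\<^sub>F t in at (0::real). cnj (b j i (complex_of_real t)) = b i j (complex_of_real t)"
    by (simp add: eventually_at_filter)
  from tendsto_cong[OF this] have "((\<lambda>t. b i j (complex_of_real t)) \<longlongrightarrow> cnj (b j i 0)) (at (0::real))"
    using tendsto_cnj[OF lim[OF ij(2,1)]] by simp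
  from tendsto_unique[OF _ this lim[OF ij]] show ?thesis by simp
qed

text \<open>Families are germs at the origin, whereas the blow-up is needed near every eigenvalue of
  its limit; hence the shift by \<open>m\<close>. Since \<open>p \<ge> 1\<close>, the real points
  (t^p (x + m), t) tend to the origin, where \<open>G\<close> is Hermitian.\<close>

lemma blowup_family:
  assumes G: "herm_family d G" "unit_deriv d G" and p: "p \<ge> 1"
    and b: "\<And>i j. i < d \<Longrightarrow> j < d \<Longrightarrow> b i j analytic_on {0}"
    and Gb: "\<And>i j. i < d \<Longrightarrow> j < d \<Longrightarrow> \<forall>\<^sub>F w in nhds 0. G 0 w $$ (i, j) = w ^ p * b i j w"
  shows "herm_family d (\<lambda>z w. blowup d p G b (z + complex_of_real m) w)"
  unfolding herm_family_def
proof (intro conjI allI impI)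
  show "blowup d p G b (z + complex_of_real m) w \<in> carrier_mat d d" for z w by (simp add: blowup_def)
  show "hol2 (\<lambda>z w. blowup d p G b (z + complex_of_real m) w $$ (i, j))" if ij: "i < d" "j < d" for i j
  proof -
    have "deriv (\<lambda>z. G z 0 $$ (i, j)) 0 = (if i = j then 1 else 0)" using G(2) ij by (simp add: unit_deriv_def)
    note K = hol2_blowup[OF herm_family_hol2[OF G(1) ij] b[OF ij] p Gb[OF ij], of "complex_of_real m", unfolded this]
    have eq: "blowup d p G b (z + complex_of_real m) w $$ (i, j) =
      (if w = 0 then (if i = j then 1 else 0) * (complex_of_real m + z) + b i j 0
       else G (w ^ p * (complex_of_real m + z)) w $$ (i, j) / w ^ p)" for z w
      using ij by (simp add: blowup_def add.commute)
    show ?thesis unfolding eq by (rule K)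
  qed
  have hG: "\<forall>\<^sub>F (x, t) in nhds (0, 0). hermitian_mat (G (complex_of_real x) (complex_of_real t))"
    using G by (simp add: herm_family_def)
  have "((\<lambda>q :: real \<times> real. (snd q ^ p * (fst q + m), snd q)) \<longlongrightarrow> (0 ^ p * (0 + m), 0)) (nhds (0, 0))"
  proof -
    have "(fst \<longlongrightarrow> (0::real)) (nhds (0::real, 0::real))" "(snd \<longlongrightarrow> (0::real)) (nhds (0::real, 0::real))"
      unfolding nhds_prod by (rule filterlim_fst filterlim_snd)+
    then show ?thesis by (intro tendsto_intros)
  qed
  moreover have "(0::real) ^ p = 0" using p by simp
  ultimately have "filterlim (\<lambda>q :: real \<times> real. (snd q ^ p * (fst q + m), snd q)) (nhds (0, 0)) (nhds (0, 0))"
    by simp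
  from eventually_compose_filterlim[OF hG this]
  show "\<forall>\<^sub>F (x, t) in nhds (0, 0). hermitian_mat (blowup d p G b (complex_of_real x + complex_of_real m) (complex_of_real t))"
  proof eventually_elim
    case (elim q)
    obtain x t where q: "q = (x, t)" by (cases q)
    show ?case unfolding q prod.case
    proof (rule hermitian_matI[of _ d])
      fix i j assume ij: "i < d" "j < d"
      show "blowup d p G b (complex_of_real x + complex_of_real m) (complex_of_real t) $$ (i, j) =
        cnj (blowup d p G b (complex_of_real x + complex_of_real m) (complex_of_real t) $$ (j, i))"
      proof (cases "t = 0")
        case True
        then show ?thesis using ij blowup_limit_hermitian[OF G(1) b Gb ij] by (simp add: blowup_def)
      next
        case False
        have "hermitian_mat (G (complex_of_real t ^ p * (complex_of_real x + complex_of_real m)) (complex_of_real t))"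
          using elim by (simp add: q)
        from hermitian_mat_index[OF this herm_family_carrier[OF G(1)] ij] show ?thesis
          using False ij by (simp add: blowup_def)
      qed
    qed (simp add: blowup_def)
  qed
qed

lemma size_filter_mset_sum:
  assumes "finite E"
  shows "size {#x \<in># (\<Sum>m\<in>E. A m). P x#} = (\<Sum>m\<in>E. size {#x \<in># A m. P x#})"
  using assms by (induction E) auto

lemma size_filter_mset_count:
  fixes M :: "'a multiset"
  shows "size {#r \<in># M. P r#} = (\<Sum>m\<in>set_mset M. if P m then count M m else 0)"
  unfolding size_multiset_overloaded_eq by (intro sum.mono_neutral_cong_left) auto

text \<open>The branches are \<open>m + l\<close> with \<open>l\<close> in the cluster of the
  eigenvalue \<open>m\<close> of \<open>D\<close>. The counts are claimed near every real
  \<open>\<mu>0\<close>, also where \<open>\<mu>0\<close> is not an eigenvalue and its cluster is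
  empty, so that a compactness argument in \<open>\<mu>0\<close> can follow. \<open>drop\<close>
  makes each cluster smaller than \<open>d\<close>.\<close>

lemma blowup_branches:
  assumes G: "herm_family d G" "unit_deriv d G" and p: "p \<ge> 1"
    and b: "\<And>i j. i < d \<Longrightarrow> j < d \<Longrightarrow> b i j analytic_on {0}"
    and Gb: "\<And>i j. i < d \<Longrightarrow> j < d \<Longrightarrow> \<forall>\<^sub>F w in nhds 0. G 0 w $$ (i, j) = w ^ p * b i j w"
    and D: "D = - mat d d (\<lambda>(i, j). b i j 0)"
    and IH: "\<And>e F. e < d \<Longrightarrow> herm_family e F \<Longrightarrow> F 0 0 = 0\<^sub>m e e \<Longrightarrow> unit_deriv e F \<Longrightarrow> \<exists>L. branches e F L"
    and drop: "\<And>m. count (real_eigs D) m < d"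
  obtains N where "size N = d"
    "\<forall>\<nu>\<in>#N. \<nu> analytic_on {0} \<and> (\<forall>\<^sub>F t in nhds 0. \<nu> (complex_of_real t) \<in> \<real>)"
    "\<forall>\<mu>0::real. \<forall>\<^sub>F (x, t) in nhds (\<mu>0, 0).
      neg_inertia (blowup d p G b (complex_of_real x) (complex_of_real t)) = size {#\<nu> \<in># N. Re (\<nu> (complex_of_real t)) > x#} \<and>
      neg_inertia (- blowup d p G b (complex_of_real x) (complex_of_real t)) = size {#\<nu> \<in># N. Re (\<nu> (complex_of_real t)) < x#}"
proof -
  define M where "M = real_eigs D"
  have Dc: "D \<in> carrier_mat d d" by (simp add: D)
  have hD: "hermitian_mat D"
    by (rule hermitian_matI[OF Dc]) (simp add: D blowup_limit_hermitian[OF G(1) b Gb])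
  have "\<forall>m. \<exists>L. size L = count M m \<and>
    (\<forall>l\<in>#L. l analytic_on {0} \<and> l 0 = 0 \<and> (\<forall>\<^sub>F t in nhds 0. l (complex_of_real t) \<in> \<real>)) \<and>
    (\<forall>\<^sub>F (x, t) in nhds (0, 0).
      neg_inertia (blowup d p G b (complex_of_real x + complex_of_real m) (complex_of_real t)) =
        size {#l \<in># L. Re (l (complex_of_real t)) > x#} + size {#r \<in># M. r > m#} \<and>
      neg_inertia (- blowup d p G b (complex_of_real x + complex_of_real m) (complex_of_real t)) =
        size {#l \<in># L. Re (l (complex_of_real t)) < x#} + size {#r \<in># M. r < m#})"
  proof
    fix m
    have K0: "blowup d p G b (z + complex_of_real m) 0 = (z + complex_of_real m) \<cdot>\<^sub>m 1\<^sub>m d - D" for z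
      by (rule eq_matI) (auto simp: blowup_def D)
    obtain L where "size L = count M m"
      "\<forall>l\<in>#L. l analytic_on {0} \<and> l 0 = 0 \<and> (\<forall>\<^sub>F t in nhds 0. l (complex_of_real t) \<in> \<real>)"
      "\<forall>\<^sub>F (x, t) in nhds (0, 0).
        neg_inertia (blowup d p G b (complex_of_real x + complex_of_real m) (complex_of_real t)) =
          size {#l \<in># L. Re (l (complex_of_real t)) > x#} + size {#r \<in># M. r > m#} \<and>
        neg_inertia (- blowup d p G b (complex_of_real x + complex_of_real m) (complex_of_real t)) =
          size {#l \<in># L. Re (l (complex_of_real t)) < x#} + size {#r \<in># M. r < m#}"
      by (rule cluster_branches[OF blowup_family[OF G p b Gb, of m] hD Dc K0 refl IH[OF drop], folded M_def])
    then show "\<exists>L. size L = count M m \<and>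
    (\<forall>l\<in>#L. l analytic_on {0} \<and> l 0 = 0 \<and> (\<forall>\<^sub>F t in nhds 0. l (complex_of_real t) \<in> \<real>)) \<and>
    (\<forall>\<^sub>F (x, t) in nhds (0, 0).
      neg_inertia (blowup d p G b (complex_of_real x + complex_of_real m) (complex_of_real t)) =
        size {#l \<in># L. Re (l (complex_of_real t)) > x#} + size {#r \<in># M. r > m#} \<and>
      neg_inertia (- blowup d p G b (complex_of_real x + complex_of_real m) (complex_of_real t)) =
        size {#l \<in># L. Re (l (complex_of_real t)) < x#} + size {#r \<in># M. r < m#})" by blast
  qed
  from choice[OF this] obtain L where L: "\<forall>m. size (L m) = count M m \<and>
    (\<forall>l\<in>#L m. l analytic_on {0} \<and> l 0 = 0 \<and> (\<forall>\<^sub>F t in nhds 0. l (complex_of_real t) \<in> \<real>)) \<and>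
    (\<forall>\<^sub>F (x, t) in nhds (0, 0).
      neg_inertia (blowup d p G b (complex_of_real x + complex_of_real m) (complex_of_real t)) =
        size {#l \<in># L m. Re (l (complex_of_real t)) > x#} + size {#r \<in># M. r > m#} \<and>
      neg_inertia (- blowup d p G b (complex_of_real x + complex_of_real m) (complex_of_real t)) =
        size {#l \<in># L m. Re (l (complex_of_real t)) < x#} + size {#r \<in># M. r < m#})" ..
  have Ls: "size (L m) = count M m" for m using L by blast
  have La: "l analytic_on {0} \<and> l 0 = 0 \<and> (\<forall>\<^sub>F t in nhds 0. l (complex_of_real t) \<in> \<real>)" if "l \<in># L m" for m l
    using L that by blast
  have Li: "\<forall>\<^sub>F (x, t) in nhds (0, 0).
      neg_inertia (blowup d p G b (complex_of_real x + complex_of_real m) (complex_of_real t)) =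
        size {#l \<in># L m. Re (l (complex_of_real t)) > x#} + size {#r \<in># M. r > m#} \<and>
      neg_inertia (- blowup d p G b (complex_of_real x + complex_of_real m) (complex_of_real t)) =
        size {#l \<in># L m. Re (l (complex_of_real t)) < x#} + size {#r \<in># M. r < m#}" for m
    using L by blast
  define N where "N = (\<Sum>m\<in>set_mset M. image_mset (\<lambda>l w. complex_of_real m + l w) (L m))"
  have cnt: "size {#\<nu> \<in># N. P \<nu>#} = (\<Sum>m\<in>set_mset M. size {#l \<in># L m. P (\<lambda>w. complex_of_real m + l w)#})" for P
    unfolding N_def by (simp add: size_filter_mset_sum filter_mset_image_mset comp_def)
  show ?thesis
  proof (rule that[of N])
    have "size N = (\<Sum>m\<in>set_mset M. count M m)" using cnt[of "\<lambda>_. True"] Ls by simp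
    also have "\<dots> = size M" by (simp add: size_multiset_overloaded_eq)
    finally show "size N = d" using size_real_eigs[OF Dc] by (simp add: M_def)
    show "\<forall>\<nu>\<in>#N. \<nu> analytic_on {0} \<and> (\<forall>\<^sub>F t in nhds 0. \<nu> (complex_of_real t) \<in> \<real>)"
    proof
      fix \<nu> assume "\<nu> \<in># N"
      then obtain m l where l: "l \<in># L m" "\<nu> = (\<lambda>w. complex_of_real m + l w)"
        unfolding N_def by (auto simp: set_mset_sum)
      have "\<forall>\<^sub>F t in nhds 0. l (complex_of_real t) \<in> \<real>" using La[OF l(1)] by blast
      then have "\<forall>\<^sub>F t in nhds 0. \<nu> (complex_of_real t) \<in> \<real>" by eventually_elim (simp add: l(2))
      then show "\<nu> analytic_on {0} \<and> (\<forall>\<^sub>F t in nhds 0. \<nu> (complex_of_real t) \<in> \<real>)"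
        using La[OF l(1)] by (auto simp: l(2) intro!: analytic_intros)
    qed
    show "\<forall>\<mu>0::real. \<forall>\<^sub>F (x, t) in nhds (\<mu>0, 0).
      neg_inertia (blowup d p G b (complex_of_real x) (complex_of_real t)) = size {#\<nu> \<in># N. Re (\<nu> (complex_of_real t)) > x#} \<and>
      neg_inertia (- blowup d p G b (complex_of_real x) (complex_of_real t)) = size {#\<nu> \<in># N. Re (\<nu> (complex_of_real t)) < x#}"
    proof
      fix \<mu>0 :: real
      \<comment> \<open>At most half the distance from \<open>\<mu>0\<close> to any other
        eigenvalue. When \<open>x\<close> and all \<open>l\<close> are below \<open>\<delta>\<close>
        in modulus, no branch of another cluster can cross the level
        \<open>x + \<mu>0\<close>.\<close>
      define \<delta> where "\<delta> = Min (insert 1 ((\<lambda>m. \<bar>m - \<mu>0\<bar> / 2) ` (set_mset M - {\<mu>0})))"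
      have d0: "\<delta> > 0" unfolding \<delta>_def by (subst Min_gr_iff) auto
      have dm: "2 * \<delta> \<le> \<bar>m - \<mu>0\<bar>" if "m \<in># M" "m \<noteq> \<mu>0" for m
      proof -
        have "\<delta> \<le> \<bar>m - \<mu>0\<bar> / 2" unfolding \<delta>_def using that by (intro Min_le) auto
        then show ?thesis by simp
      qed
      have "\<forall>\<^sub>F t in nhds 0. \<forall>m\<in>set_mset M. \<forall>l\<in>set_mset (L m). \<bar>Re (l (complex_of_real t))\<bar> < \<delta>"
      proof (intro eventually_ball_finite ballI finite_set_mset)
        fix m l assume "l \<in># L m"
        then have "l analytic_on {0}" "l 0 = 0" using La by auto
        then have "(l \<longlongrightarrow> 0) (nhds 0)"
          using analytic_at_imp_isCont[of l 0] by (simp add: isCont_def tendsto_nhds_iff)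
        from tendstoD[OF filterlim_compose[OF this filterlim_of_real_nhds_0] d0]
        show "\<forall>\<^sub>F t in nhds 0. \<bar>Re (l (complex_of_real t))\<bar> < \<delta>"
          by eventually_elim (auto intro: le_less_trans[OF abs_Re_le_cmod])
      qed
      from eventually_nhds_00_snd[OF this, of 0]
      have e1: "\<forall>\<^sub>F q in nhds (0::real, 0). \<forall>m\<in>set_mset M. \<forall>l\<in>set_mset (L m). \<bar>Re (l (complex_of_real (snd q)))\<bar> < \<delta>"
        by (simp add: split_beta')
      have "\<forall>\<^sub>F q in nhds (0::real, 0::real). q \<in> ball 0 \<delta> \<times> UNIV"
        using d0 by (intro eventually_nhds_in_open open_Times) auto
      with Li[of \<mu>0] e1 have "\<forall>\<^sub>F q in nhds (0::real, 0::real).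
        neg_inertia (blowup d p G b (complex_of_real (fst q + \<mu>0)) (complex_of_real (snd q))) =
          size {#\<nu> \<in># N. Re (\<nu> (complex_of_real (snd q))) > fst q + \<mu>0#} \<and>
        neg_inertia (- blowup d p G b (complex_of_real (fst q + \<mu>0)) (complex_of_real (snd q))) =
          size {#\<nu> \<in># N. Re (\<nu> (complex_of_real (snd q))) < fst q + \<mu>0#}"
      proof eventually_elim
        case (elim q)
        obtain x t where q: "q = (x, t)" by (cases q)
        have x: "\<bar>x\<bar> < \<delta>" using elim q by auto
        have L0: "L \<mu>0 = {#}" if "\<mu>0 \<notin># M" using Ls[of \<mu>0] that by (simp add: not_in_iff)
        \<comment> \<open>\<open>P m\<close> says that the whole cluster of \<open>m\<close> lies on
          the counted side. Only the cluster of \<open>\<mu>0\<close> itself has to be counted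
          branch by branch.\<close>
        have part: "size {#l \<in># L m. Q m l#} = (if m = \<mu>0 then size {#l \<in># L \<mu>0. Q \<mu>0 l#} else 0) + (if P m then count M m else 0)"
          if "m \<in># M" "\<not> P \<mu>0" "\<And>l. m \<noteq> \<mu>0 \<Longrightarrow> l \<in># L m \<Longrightarrow> Q m l \<longleftrightarrow> P m" for m P and Q :: "real \<Rightarrow> _ \<Rightarrow> bool"
        proof (cases "m = \<mu>0")
          case False
          have "{#l \<in># L m. Q m l#} = {#l \<in># L m. P m#}" by (rule filter_mset_cong) (use that(3) False in auto)
          then show ?thesis using False Ls[of m] by simp
        qed (use that in simp)
        have tot: "(\<Sum>m\<in>set_mset M. size {#l \<in># L m. Q m l#}) = size {#l \<in># L \<mu>0. Q \<mu>0 l#} + size {#r \<in># M. P r#}"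
          if "\<not> P \<mu>0" "\<And>m l. m \<in># M \<Longrightarrow> m \<noteq> \<mu>0 \<Longrightarrow> l \<in># L m \<Longrightarrow> Q m l \<longleftrightarrow> P m" for P and Q :: "real \<Rightarrow> _ \<Rightarrow> bool"
        proof -
          have "(\<Sum>m\<in>set_mset M. size {#l \<in># L m. Q m l#}) =
            (\<Sum>m\<in>set_mset M. (if m = \<mu>0 then size {#l \<in># L \<mu>0. Q \<mu>0 l#} else 0) + (if P m then count M m else 0))"
            by (intro sum.cong refl part that)
          also have "\<dots> = size {#l \<in># L \<mu>0. Q \<mu>0 l#} + size {#r \<in># M. P r#}"
            unfolding sum.distrib size_filter_mset_count[of P M] using L0 by (simp add: sum.delta)
          finally show ?thesis .
        qed
        have sm: "\<bar>Re (l (complex_of_real t))\<bar> < \<delta>" if "m \<in># M" "l \<in># L m" for m l using elim that q by auto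
        have "(\<Sum>m\<in>set_mset M. size {#l \<in># L m. Re (complex_of_real m + l (complex_of_real t)) > x + \<mu>0#}) =
          size {#l \<in># L \<mu>0. Re (complex_of_real \<mu>0 + l (complex_of_real t)) > x + \<mu>0#} + size {#r \<in># M. r > \<mu>0#}"
        proof (rule tot)
          fix m l assume ml: "m \<in># M" "m \<noteq> \<mu>0" "l \<in># L m"
          show "(Re (complex_of_real m + l (complex_of_real t)) > x + \<mu>0) = (m > \<mu>0)"
            using dm[OF ml(1,2)] sm[OF ml(1,3)] x by auto
        qed simp
        moreover have "(\<Sum>m\<in>set_mset M. size {#l \<in># L m. Re (complex_of_real m + l (complex_of_real t)) < x + \<mu>0#}) =
          size {#l \<in># L \<mu>0. Re (complex_of_real \<mu>0 + l (complex_of_real t)) < x + \<mu>0#} + size {#r \<in># M. r < \<mu>0#}"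
        proof (rule tot)
          fix m l assume ml: "m \<in># M" "m \<noteq> \<mu>0" "l \<in># L m"
          show "(Re (complex_of_real m + l (complex_of_real t)) < x + \<mu>0) = (m < \<mu>0)"
            using dm[OF ml(1,2)] sm[OF ml(1,3)] x by auto
        qed simp
        ultimately show ?case using elim unfolding cnt q by simp
      qed
      then have ev: "\<forall>\<^sub>F q in nhds (0::real, 0::real). (case (fst q + \<mu>0, snd q) of (x, t) \<Rightarrow>
        neg_inertia (blowup d p G b (complex_of_real x) (complex_of_real t)) = size {#\<nu> \<in># N. Re (\<nu> (complex_of_real t)) > x#} \<and>
        neg_inertia (- blowup d p G b (complex_of_real x) (complex_of_real t)) = size {#\<nu> \<in># N. Re (\<nu> (complex_of_real t)) < x#})"
        by simp
      have "((\<lambda>q::real \<times> real. (fst q - \<mu>0, snd q)) \<longlongrightarrow> (\<mu>0 - \<mu>0, 0)) (nhds (\<mu>0, 0))"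
      proof -
        have "(fst \<longlongrightarrow> \<mu>0) (nhds (\<mu>0, 0::real))" "(snd \<longlongrightarrow> (0::real)) (nhds (\<mu>0, 0::real))"
          unfolding nhds_prod by (rule filterlim_fst filterlim_snd)+
        then show ?thesis by (intro tendsto_intros)
      qed
      then have "filterlim (\<lambda>q::real \<times> real. (fst q - \<mu>0, snd q)) (nhds (0, 0)) (nhds (\<mu>0, 0))" by simp
      from eventually_compose_filterlim[OF ev this]
      show "\<forall>\<^sub>F (x, t) in nhds (\<mu>0, 0).
        neg_inertia (blowup d p G b (complex_of_real x) (complex_of_real t)) = size {#\<nu> \<in># N. Re (\<nu> (complex_of_real t)) > x#} \<and>
        neg_inertia (- blowup d p G b (complex_of_real x) (complex_of_real t)) = size {#\<nu> \<in># N. Re (\<nu> (complex_of_real t)) < x#}"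
        by simp
    qed
  qed
qed

text \<open>The tube lemma: finitely many boxes cover the interval, and their sides in the
  \<open>t\<close> direction have a common neighbourhood of 0.\<close>

lemma eventually_nhds_compact_slice:
  fixes P :: "real \<Rightarrow> real \<Rightarrow> bool"
  assumes "\<And>x. x \<in> {a..b} \<Longrightarrow> \<forall>\<^sub>F (y, t) in nhds (x, 0). P y t"
  shows "\<forall>\<^sub>F t in nhds 0. \<forall>x\<in>{a..b}. P x t"
proof -
  have "\<exists>A B. open A \<and> x \<in> A \<and> open B \<and> 0 \<in> B \<and> (\<forall>y\<in>A. \<forall>t\<in>B. P y t)" if x: "x \<in> {a..b}" for x
  proof -
    from assms[OF x] obtain S where S: "open S" "(x, 0) \<in> S" "\<And>y t. (y, t) \<in> S \<Longrightarrow> P y t"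
      unfolding eventually_nhds by auto
    from S(1,2) obtain A B where "open A" "open B" "(x, 0) \<in> A \<times> B" "A \<times> B \<subseteq> S" by (rule open_prod_elim)
    then show ?thesis using S(3) by blast
  qed
  then obtain A B where AB: "\<And>x. x \<in> {a..b} \<Longrightarrow> open (A x) \<and> x \<in> A x \<and> open (B x) \<and> 0 \<in> B x \<and> (\<forall>y\<in>A x. \<forall>t\<in>B x. P y t)"
    by metis
  obtain C where C: "C \<subseteq> {a..b}" "finite C" "{a..b} \<subseteq> (\<Union>c\<in>C. A c)"
    by (rule compactE_image[of "{a..b}" "{a..b}" A]) (use AB in auto)
  have "\<forall>\<^sub>F t in nhds 0. \<forall>c\<in>C. t \<in> B c"
    using AB C by (intro eventually_ball_finite ballI eventually_nhds_in_open) auto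
  then show ?thesis
  proof eventually_elim
    case (elim t)
    show ?case
    proof
      fix x assume "x \<in> {a..b}"
      then obtain c where "c \<in> C" "x \<in> A c" using C by blast
      then show "P x t" using AB[of c] C elim by blast
    qed
  qed
qed

lemma neg_inertia_zero: "neg_inertia (0\<^sub>m d d) = 0" "neg_inertia (- 0\<^sub>m d d) = 0"
proof -
  have h: "hermitian_mat (1\<^sub>m d)" by (simp add: hermitian_mat_def square_mat.simps)
  have "complex_of_real 0 \<cdot>\<^sub>m 1\<^sub>m d + complex_of_real 0 \<cdot>\<^sub>m 1\<^sub>m d = (0\<^sub>m d d :: complex mat)"
    by (intro eq_matI) auto
  with neg_inertia_affine[OF h one_carrier_mat, of 0 0]
  show "neg_inertia (0\<^sub>m d d) = 0" "neg_inertia (- 0\<^sub>m d d) = 0" by simp_all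
qed

lemma analytic_eventually_bounded:
  assumes "finite I" "\<And>i. i \<in> I \<Longrightarrow> f i analytic_on {0}"
  obtains C :: real where "C > 0" "\<forall>\<^sub>F t in nhds (0::real). \<forall>i\<in>I. cmod (f i (complex_of_real t)) \<le> C"
proof -
  define C where "C = (\<Sum>i\<in>I. cmod (f i 0)) + 1"
  have "C > 0" by (simp add: C_def add_nonneg_pos sum_nonneg)
  moreover have "\<forall>\<^sub>F t in nhds (0::real). \<forall>i\<in>I. cmod (f i (complex_of_real t)) \<le> C"
  proof (intro eventually_ball_finite assms(1) ballI)
    fix i assume i: "i \<in> I"
    have "(f i \<longlongrightarrow> f i 0) (nhds 0)"
      using analytic_at_imp_isCont[OF assms(2)[OF i]] by (simp add: isCont_def tendsto_nhds_iff)
    from tendsto_norm[OF filterlim_compose[OF this filterlim_of_real_nhds_0]]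
    have "\<forall>\<^sub>F t in nhds (0::real). cmod (f i (complex_of_real t)) < cmod (f i 0) + 1"
      by (rule order_tendstoD) simp
    moreover have "cmod (f i 0) \<le> (\<Sum>i\<in>I. cmod (f i 0))" by (rule member_le_sum) (use i assms(1) in auto)
    ultimately show "\<forall>\<^sub>F t in nhds (0::real). cmod (f i (complex_of_real t)) \<le> C"
      by (auto simp: C_def elim!: eventually_mono)
  qed
  ultimately show ?thesis by (rule that)
qed

text \<open>Where |x| > R |t|^p, the family is definite and every branch is smaller than |x|.
  Elsewhere, for t nonzero, x = t^p \<mu> with \<mu> in the compact interval [-R, R], and the counts
  are those of the blow-up, uniformly in \<mu> by the tube lemma.\<close>

lemma branches_of_blowup:
  assumes G: "herm_family d G" "unit_deriv d G" and p: "p \<ge> 1"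
    and b: "\<And>i j. i < d \<Longrightarrow> j < d \<Longrightarrow> b i j analytic_on {0}"
    and Gb: "\<And>i j. i < d \<Longrightarrow> j < d \<Longrightarrow> \<forall>\<^sub>F w in nhds 0. G 0 w $$ (i, j) = w ^ p * b i j w"
    and N: "size N = d"
    "\<forall>\<nu>\<in>#N. \<nu> analytic_on {0} \<and> (\<forall>\<^sub>F t in nhds 0. \<nu> (complex_of_real t) \<in> \<real>)"
    "\<forall>\<mu>0::real. \<forall>\<^sub>F (x, t) in nhds (\<mu>0, 0).
      neg_inertia (blowup d p G b (complex_of_real x) (complex_of_real t)) = size {#\<nu> \<in># N. Re (\<nu> (complex_of_real t)) > x#} \<and>
      neg_inertia (- blowup d p G b (complex_of_real x) (complex_of_real t)) = size {#\<nu> \<in># N. Re (\<nu> (complex_of_real t)) < x#}"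
  shows "branches d G (image_mset (\<lambda>\<nu> w. w ^ p * \<nu> w) N)"
proof -
  obtain \<epsilon> where \<epsilon>: "\<epsilon> > 0" and def: "\<forall>\<^sub>F (x, t) in nhds (0, 0).
    (\<forall>i<d. \<forall>j<d. cmod (G 0 (complex_of_real t) $$ (i, j)) \<le> \<epsilon> * \<bar>x\<bar>) \<longrightarrow>
    (x > 0 \<longrightarrow> neg_inertia (G (complex_of_real x) (complex_of_real t)) = 0 \<and>
       neg_inertia (- G (complex_of_real x) (complex_of_real t)) = d) \<and>
    (x < 0 \<longrightarrow> neg_inertia (G (complex_of_real x) (complex_of_real t)) = d \<and>
       neg_inertia (- G (complex_of_real x) (complex_of_real t)) = 0)"
    by (rule definite_region[OF G])
  obtain \<beta> where \<beta>: "\<beta> > 0" "\<forall>\<^sub>F t in nhds (0::real). \<forall>q\<in>{..<d} \<times> {..<d}. cmod ((\<lambda>(i, j). b i j) q (complex_of_real t)) \<le> \<beta>"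
    by (rule analytic_eventually_bounded[of "{..<d} \<times> {..<d}" "\<lambda>(i, j). b i j"]) (use b in auto)
  obtain C where C: "C > 0" "\<forall>\<^sub>F t in nhds (0::real). \<forall>\<nu>\<in>set_mset N. cmod (\<nu> (complex_of_real t)) \<le> C"
    by (rule analytic_eventually_bounded[of "set_mset N" "\<lambda>\<nu>. \<nu>"]) (use N(2) in auto)
  \<comment> \<open>The bound \<open>\<beta> / \<epsilon>\<close> makes G(0,t) small enough for
    \<open>definite_region\<close> once |x| > R |t|^p; the bound \<open>C\<close> keeps every branch
    within R |t|^p.\<close>
  define R where "R = max (\<beta> / \<epsilon>) C"
  have R: "R > 0" "\<beta> \<le> \<epsilon> * R" "C \<le> R"
    using \<beta>(1) C(1) \<epsilon> by (auto simp: R_def max_def field_simps)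
  have sl: "\<forall>\<^sub>F t in nhds 0. \<forall>x\<in>{-R..R}.
      neg_inertia (blowup d p G b (complex_of_real x) (complex_of_real t)) = size {#\<nu> \<in># N. Re (\<nu> (complex_of_real t)) > x#} \<and>
      neg_inertia (- blowup d p G b (complex_of_real x) (complex_of_real t)) = size {#\<nu> \<in># N. Re (\<nu> (complex_of_real t)) < x#}"
    by (rule eventually_nhds_compact_slice) (use N(3) in blast)
  have gb: "\<forall>\<^sub>F t in nhds (0::real). \<forall>i\<in>{..<d}. \<forall>j\<in>{..<d}. G 0 (complex_of_real t) $$ (i, j) = complex_of_real t ^ p * b i j (complex_of_real t)"
    by (intro eventually_ball_finite ballI eventually_nhds_0_of_real Gb) auto
  have G00: "G 0 0 = 0\<^sub>m d d"
  proof (rule eq_matI)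
    fix i j assume "i < dim_row (0\<^sub>m d d)" "j < dim_col (0\<^sub>m d d)"
    then have ij: "i < d" "j < d" by auto
    from eventually_nhds_x_imp_x[OF Gb[OF ij]] p ij show "G 0 0 $$ (i, j) = 0\<^sub>m d d $$ (i, j)" by simp
  qed (use herm_family_carrier[OF G(1), of 0 0] in auto)
  have hG: "\<forall>\<^sub>F (x, t) in nhds (0, 0). hermitian_mat (G (complex_of_real x) (complex_of_real t))"
    using G by (simp add: herm_family_def)
  have cnt: "size {#l \<in># image_mset (\<lambda>\<nu> w. w ^ p * \<nu> w) N. P l#} = size {#\<nu> \<in># N. P (\<lambda>w. w ^ p * \<nu> w)#}" for P
    by (simp add: filter_mset_image_mset comp_def)
  have Re_eq: "Re (complex_of_real t ^ p * u) = t ^ p * Re u" for t u by (simp flip: of_real_power)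
  have "\<forall>\<^sub>F (x, t) in nhds (0, 0).
     neg_inertia (G (complex_of_real x) (complex_of_real t)) = size {#\<nu> \<in># N. t ^ p * Re (\<nu> (complex_of_real t)) > x#} \<and>
     neg_inertia (- G (complex_of_real x) (complex_of_real t)) = size {#\<nu> \<in># N. t ^ p * Re (\<nu> (complex_of_real t)) < x#}"
    using def hG eventually_nhds_00_snd[OF \<beta>(2)] eventually_nhds_00_snd[OF C(2)]
      eventually_nhds_00_snd[OF sl] eventually_nhds_00_snd[OF gb]
  proof eventually_elim
    case (elim q)
    obtain x t where q: "q = (x, t)" by (cases q)
    define A where "A = G (complex_of_real x) (complex_of_real t)"
    have A: "hermitian_mat A" "A \<in> carrier_mat d d" using elim(2) herm_family_carrier[OF G(1)] by (auto simp: A_def q)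
    have bb: "cmod (b i j (complex_of_real t)) \<le> \<beta>" if "i < d" "j < d" for i j using elim(3) that by (auto simp: q)
    have nb: "cmod (\<nu> (complex_of_real t)) \<le> C" if "\<nu> \<in># N" for \<nu> using elim(4) that by (auto simp: q)
    have G0: "G 0 (complex_of_real t) $$ (i, j) = complex_of_real t ^ p * b i j (complex_of_real t)" if "i < d" "j < d" for i j
      using elim(6) that by (auto simp: q)
    have "neg_inertia A = size {#\<nu> \<in># N. t ^ p * Re (\<nu> (complex_of_real t)) > x#} \<and>
      neg_inertia (- A) = size {#\<nu> \<in># N. t ^ p * Re (\<nu> (complex_of_real t)) < x#}"
    proof (cases "\<bar>x\<bar> > R * \<bar>t\<bar> ^ p")
      case True
      have "0 \<le> R * \<bar>t\<bar> ^ p" using R(1) by simp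
      then have x0: "x \<noteq> 0" using True by auto
      have "cmod (G 0 (complex_of_real t) $$ (i, j)) \<le> \<epsilon> * \<bar>x\<bar>" if ij: "i < d" "j < d" for i j
      proof -
        have "cmod (G 0 (complex_of_real t) $$ (i, j)) \<le> \<bar>t\<bar> ^ p * \<beta>"
          unfolding G0[OF ij] norm_mult norm_power using bb[OF ij] by (simp add: mult_left_mono)
        also have "\<dots> \<le> \<bar>t\<bar> ^ p * (\<epsilon> * R)" using R by (intro mult_left_mono) auto
        also have "\<dots> = \<epsilon> * (R * \<bar>t\<bar> ^ p)" by simp
        also have "\<dots> \<le> \<epsilon> * \<bar>x\<bar>" using True \<epsilon> by (intro mult_left_mono) auto
        finally show ?thesis .
      qed
      then have dA: "(x > 0 \<longrightarrow> neg_inertia A = 0 \<and> neg_inertia (- A) = d) \<and> (x < 0 \<longrightarrow> neg_inertia A = d \<and> neg_inertia (- A) = 0)"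
        using elim(1) unfolding q A_def by simp
      have small: "\<bar>t ^ p * Re (\<nu> (complex_of_real t))\<bar> < \<bar>x\<bar>" if "\<nu> \<in># N" for \<nu>
      proof -
        have "\<bar>Re (\<nu> (complex_of_real t))\<bar> \<le> R" using nb[OF that] abs_Re_le_cmod[of "\<nu> (complex_of_real t)"] R by linarith
        then have "\<bar>t\<bar> ^ p * \<bar>Re (\<nu> (complex_of_real t))\<bar> \<le> \<bar>t\<bar> ^ p * R" by (intro mult_left_mono) auto
        then show ?thesis using True by (simp add: abs_mult power_abs mult.commute)
      qed
      show ?thesis
      proof (cases "x > 0")
        case True
        have "{#\<nu> \<in># N. t ^ p * Re (\<nu> (complex_of_real t)) > x#} = {#\<nu> \<in># N. False#}"
          "{#\<nu> \<in># N. t ^ p * Re (\<nu> (complex_of_real t)) < x#} = {#\<nu> \<in># N. True#}"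
          by (rule filter_mset_cong[OF refl], use small True in force)+
        then show ?thesis using dA True N(1) by simp
      next
        case False
        then have x: "x < 0" using x0 by simp
        have "{#\<nu> \<in># N. t ^ p * Re (\<nu> (complex_of_real t)) > x#} = {#\<nu> \<in># N. True#}"
          "{#\<nu> \<in># N. t ^ p * Re (\<nu> (complex_of_real t)) < x#} = {#\<nu> \<in># N. False#}"
          by (rule filter_mset_cong[OF refl], use small x in force)+
        then show ?thesis using dA x N(1) by simp
      qed
    next
      case False
      show ?thesis
      \<comment> \<open>At \<open>t = 0\<close> the inner region is the origin alone, since
        \<open>p \<ge> 1\<close>; there \<open>G\<close> vanishes and all counts are 0.\<close>
      proof (cases "t = 0")
        case True
        have zp: "(0::real) ^ p = 0" using p by simp
        have "x = 0" using False by (simp add: True zp)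
        then show ?thesis using True p by (simp add: A_def G00 neg_inertia_zero zero_power)
      next
        case t: False
        define s where "s = t ^ p"
        have s: "s \<noteq> 0" using t by (simp add: s_def)
        define \<mu> where "\<mu> = x / s"
        have "\<bar>\<mu>\<bar> \<le> R" using False s by (simp add: \<mu>_def s_def abs_divide power_abs field_simps)
        then have "\<mu> \<in> {-R..R}" by auto
        define K where "K = blowup d p G b (complex_of_real \<mu>) (complex_of_real t)"
        have K: "neg_inertia K = size {#\<nu> \<in># N. Re (\<nu> (complex_of_real t)) > \<mu>#}"
          "neg_inertia (- K) = size {#\<nu> \<in># N. Re (\<nu> (complex_of_real t)) < \<mu>#}"
          using elim(5) \<open>\<mu> \<in> {-R..R}\<close> by (auto simp: q K_def)
        have sx: "complex_of_real t ^ p * complex_of_real \<mu> = complex_of_real x"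
        proof -
          have "complex_of_real t ^ p = complex_of_real s" by (simp add: s_def)
          then show ?thesis using s by (simp add: \<mu>_def)
        qed
        have Kij: "K $$ (i, j) = A $$ (i, j) / complex_of_real s" if "i < d" "j < d" for i j
          using that t by (simp add: K_def blowup_def sx A_def s_def)
        have Kc: "K \<in> carrier_mat d d" by (simp add: K_def blowup_def)
        show ?thesis
        proof (cases "s > 0")
          case True
          have "K = complex_of_real (1 / s) \<cdot>\<^sub>m A" by (rule eq_matI) (use A Kc Kij in auto)
          then have "neg_inertia K = neg_inertia A" "neg_inertia (- K) = neg_inertia (- A)"
            using neg_inertia_smult[OF A, of "1 / s"] True by simp_all
          then show ?thesis using K True unfolding s_def[symmetric] \<mu>_def by (simp add: divide_less_eq less_divide_eq mult.commute)
        next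
          case neg: False
          then have sn: "s < 0" using s by simp
          \<comment> \<open>This is the case \<open>t < 0\<close> with \<open>p\<close> odd. Scaling
            by a negative number exchanges the two indices, and dividing \<open>x\<close> by
            \<open>s\<close> reverses the inequalities, so the counts agree again.\<close>
          have "- K = complex_of_real (1 / (- s)) \<cdot>\<^sub>m A" by (rule eq_matI) (use A Kc Kij s in \<open>auto simp: field_simps\<close>)
          moreover have "1 / (- s) > 0" using sn by simp
          ultimately have "neg_inertia (- K) = neg_inertia A" "neg_inertia (- (- K)) = neg_inertia (- A)"
            using neg_inertia_smult[OF A, of "1 / (- s)"] by metis+
          then show ?thesis using K sn Kc unfolding s_def[symmetric] \<mu>_def by (simp add: neg_divide_less_eq neg_less_divide_eq mult.commute)
        qed
      qed
    qed
    then show ?case by (simp add: q A_def)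
  qed
  then have "\<forall>\<^sub>F (x, t) in nhds (0, 0).
     neg_inertia (G (complex_of_real x) (complex_of_real t)) = size {#l \<in># image_mset (\<lambda>\<nu> w. w ^ p * \<nu> w) N. Re (l (complex_of_real t)) > x#} \<and>
     neg_inertia (- G (complex_of_real x) (complex_of_real t)) = size {#l \<in># image_mset (\<lambda>\<nu> w. w ^ p * \<nu> w) N. Re (l (complex_of_real t)) < x#}"
    unfolding cnt Re_eq .
  moreover have "l analytic_on {0} \<and> l 0 = 0 \<and> (\<forall>\<^sub>F t in nhds 0. l (complex_of_real t) \<in> \<real>)"
    if l: "l \<in># image_mset (\<lambda>\<nu> w. w ^ p * \<nu> w) N" for l
  proof -
    from l obtain \<nu> where \<nu>: "\<nu> \<in># N" "l = (\<lambda>w. w ^ p * \<nu> w)" by auto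
    have "\<forall>\<^sub>F t in nhds 0. \<nu> (complex_of_real t) \<in> \<real>" using N(2) \<nu>(1) by blast
    then have "\<forall>\<^sub>F t in nhds 0. l (complex_of_real t) \<in> \<real>" by eventually_elim (simp add: \<nu>(2))
    then show ?thesis using N(2) \<nu> p by (auto intro!: analytic_intros)
  qed
  ultimately show ?thesis using N(1) by (auto simp: branches_def)
qed

section \<open>Existence of analytic branches\<close>

lemma real_eigs_scalar:
  assumes D: "hermitian_mat D" "D \<in> carrier_mat d d" and c: "count (real_eigs D) m = d"
  shows "D = complex_of_real m \<cdot>\<^sub>m 1\<^sub>m d"
proof -
  from real_diagonalization_ex[OF D] obtain f U where U: "U \<in> carrier_mat d d"
    "mat_adjoint U * U = 1\<^sub>m d" "mat_adjoint U * D * U = mat_diag d (\<lambda>i. complex_of_real (f i))"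
    "real_eigs D = mset (map f [0..<d])" .
  have U': "mat_adjoint U \<in> carrier_mat d d" using U by simp
  have UU: "U * mat_adjoint U = 1\<^sub>m d" by (rule unitary_right_inverse[OF U(1,2)])
  have "size (real_eigs D) = size {#r \<in># real_eigs D. r = m#} + size {#r \<in># real_eigs D. r \<noteq> m#}"
    by (metis multiset_partition size_union)
  then have "size {#r \<in># real_eigs D. r \<noteq> m#} = 0"
    using size_real_eigs[OF D(2)] c by (simp add: filter_eq_replicate_mset)
  then have em: "{#r \<in># real_eigs D. r \<noteq> m#} = {#}" by simp
  have "r = m" if "r \<in># real_eigs D" for r
  proof (rule ccontr)
    assume "r \<noteq> m"
    then have "r \<in># {#r \<in># real_eigs D. r \<noteq> m#}" using that by simp
    then show False unfolding em by simp
  qed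
  then have "f i = m" if "i < d" for i using that U(4) by simp
  then have dg: "mat_diag d (\<lambda>i. complex_of_real (f i)) = complex_of_real m \<cdot>\<^sub>m 1\<^sub>m d"
    by (intro eq_matI) (auto simp: mat_diag_def)
  have "D = (U * mat_adjoint U) * D * (U * mat_adjoint U)" using D UU by simp
  also have "\<dots> = U * (mat_adjoint U * D * U) * mat_adjoint U"
    using D(2) U(1) U' by (simp add: square_mult_assoc[where n = d] square_mult_closed)
  also have "\<dots> = complex_of_real m \<cdot>\<^sub>m (U * mat_adjoint U)"
    unfolding U(3) dg using mult_smult_distrib[OF U(1) one_carrier_mat, of "complex_of_real m"]
      mult_smult_assoc_mat[OF U(1) U', of "complex_of_real m"] right_mult_one_mat[OF U(1)] by simp
  finally show ?thesis by (simp add: UU)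
qed

lemma eventually_nhds_00_box:
  assumes "\<forall>\<^sub>F (x, t) in nhds (0::real, 0::real). P x t"
  obtains q where "q > 0" "\<And>x t. \<bar>x\<bar> < q \<Longrightarrow> \<bar>t\<bar> < q \<Longrightarrow> P x t"
proof -
  from assms obtain S where S: "open S" "(0, 0) \<in> S" "\<And>x t. (x, t) \<in> S \<Longrightarrow> P x t"
    unfolding eventually_nhds by auto
  from S(1,2) obtain A B where AB: "open A" "open B" "(0, 0) \<in> A \<times> B" "A \<times> B \<subseteq> S" by (rule open_prod_elim)
  obtain a where a: "a > 0" "ball 0 a \<subseteq> A" using AB by (meson SigmaE2 open_contains_ball)
  obtain b where b: "b > 0" "ball 0 b \<subseteq> B" using AB by (meson SigmaE2 open_contains_ball)
  show ?thesis
  proof (rule that[of "min a b"])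
    fix x t :: real assume "\<bar>x\<bar> < min a b" "\<bar>t\<bar> < min a b"
    then have "x \<in> A" "t \<in> B" using a b by auto
    then show "P x t" using AB S by blast
  qed (use a b in auto)
qed

text \<open>Since \<open>l\<close> is real at real parameters, the shift sends real points to real
  points, and the symmetry survives.\<close>

lemma herm_family_shift:
  assumes F: "herm_family d F" and l: "l analytic_on {0}" "l 0 = 0" "\<forall>\<^sub>F t in nhds 0. l (complex_of_real t) \<in> \<real>"
  shows "herm_family d (\<lambda>z w. F (l w + z) w)"
  unfolding herm_family_def
proof (intro conjI allI impI herm_family_carrier[OF F])
  show "hol2 (\<lambda>z w. F (l w + z) w $$ (i, j))" if "i < d" "j < d" for i j
    by (rule hol2_compose[OF herm_family_hol2[OF F that], of "\<lambda>z w. l w + z" "\<lambda>z w. w"])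
       (use l in \<open>auto intro!: hol2_of_snd hol2_add\<close>)
  have hF: "\<forall>\<^sub>F (x, t) in nhds (0, 0). hermitian_mat (F (complex_of_real x) (complex_of_real t))"
    using F by (simp add: herm_family_def)
  have "(l \<longlongrightarrow> l 0) (nhds 0)"
    using analytic_at_imp_isCont[OF l(1)] by (simp add: isCont_def tendsto_nhds_iff)
  from tendsto_Re[OF filterlim_compose[OF this filterlim_of_real_nhds_0]] l(2)
  have lim: "((\<lambda>t. Re (l (complex_of_real t))) \<longlongrightarrow> 0) (nhds 0)" by simp
  have f: "(fst \<longlongrightarrow> (0::real)) (nhds (0::real, 0::real))" "(snd \<longlongrightarrow> (0::real)) (nhds (0::real, 0::real))"
    unfolding nhds_prod by (rule filterlim_fst filterlim_snd)+
  have "((\<lambda>q :: real \<times> real. (Re (l (complex_of_real (snd q))) + fst q, snd q)) \<longlongrightarrow> (0 + 0, 0)) (nhds (0, 0))"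
    by (intro tendsto_intros f filterlim_compose[OF lim])
  then have "filterlim (\<lambda>q :: real \<times> real. (Re (l (complex_of_real (snd q))) + fst q, snd q)) (nhds (0, 0)) (nhds (0, 0))" by simp
  from eventually_compose_filterlim[OF hF this] eventually_nhds_00_snd[OF l(3)]
  show "\<forall>\<^sub>F (x, t) in nhds (0, 0). hermitian_mat (F (l (complex_of_real t) + complex_of_real x) (complex_of_real t))"
  proof eventually_elim
    case (elim q)
    then show ?case by (auto simp: split_beta' elim!: Reals_cases)
  qed
qed

text \<open>A level \<open>x\<close> for \<open>F\<close> is the level x - l(t) for the shifted
  family, and real points near the origin go to real points near the origin.\<close>

lemma branches_shift:
  assumes l: "l analytic_on {0}" "l 0 = 0" "\<forall>\<^sub>F t in nhds 0. l (complex_of_real t) \<in> \<real>"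
    and L: "branches d (\<lambda>z w. F (l w + z) w) L"
  shows "branches d F (image_mset (\<lambda>\<nu> w. l w + \<nu> w) L)"
proof -
  have "(l \<longlongrightarrow> l 0) (nhds 0)"
    using analytic_at_imp_isCont[OF l(1)] by (simp add: isCont_def tendsto_nhds_iff)
  from tendsto_Re[OF filterlim_compose[OF this filterlim_of_real_nhds_0]] l(2)
  have lim: "((\<lambda>t. Re (l (complex_of_real t))) \<longlongrightarrow> 0) (nhds 0)" by simp
  have f: "(fst \<longlongrightarrow> (0::real)) (nhds (0::real, 0::real))" "(snd \<longlongrightarrow> (0::real)) (nhds (0::real, 0::real))"
    unfolding nhds_prod by (rule filterlim_fst filterlim_snd)+
  have "((\<lambda>q :: real \<times> real. (fst q - Re (l (complex_of_real (snd q))), snd q)) \<longlongrightarrow> (0 - 0, 0)) (nhds (0, 0))"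
    by (intro tendsto_intros f filterlim_compose[OF lim])
  then have flt: "filterlim (\<lambda>q :: real \<times> real. (fst q - Re (l (complex_of_real (snd q))), snd q)) (nhds (0, 0)) (nhds (0, 0))" by simp
  have bL: "\<forall>\<^sub>F (x, t) in nhds (0, 0).
    neg_inertia (F (l (complex_of_real t) + complex_of_real x) (complex_of_real t)) = size {#\<nu> \<in># L. Re (\<nu> (complex_of_real t)) > x#} \<and>
    neg_inertia (- F (l (complex_of_real t) + complex_of_real x) (complex_of_real t)) = size {#\<nu> \<in># L. Re (\<nu> (complex_of_real t)) < x#}"
    using L by (simp add: branches_def)
  have "\<forall>\<^sub>F (x, t) in nhds (0, 0).
    neg_inertia (F (complex_of_real x) (complex_of_real t)) = size {#\<nu> \<in># L. Re (l (complex_of_real t) + \<nu> (complex_of_real t)) > x#} \<and>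
    neg_inertia (- F (complex_of_real x) (complex_of_real t)) = size {#\<nu> \<in># L. Re (l (complex_of_real t) + \<nu> (complex_of_real t)) < x#}"
    using eventually_compose_filterlim[OF bL flt] eventually_nhds_00_snd[OF l(3)]
  proof eventually_elim
    case (elim q)
    obtain x t where q: "q = (x, t)" by (cases q)
    from elim q obtain r where r: "l (complex_of_real t) = complex_of_real r" by (auto elim: Reals_cases)
    have c: "complex_of_real r + complex_of_real (x - r) = complex_of_real x" by simp
    show ?case using elim(1) unfolding q prod.case fst_conv snd_conv r Re_complex_of_real c
      by (simp add: less_diff_eq diff_less_eq add.commute)
  qed
  moreover have "k analytic_on {0} \<and> k 0 = 0 \<and> (\<forall>\<^sub>F t in nhds 0. k (complex_of_real t) \<in> \<real>)"
    if k: "k \<in># image_mset (\<lambda>\<nu> w. l w + \<nu> w) L" for k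
  proof -
    from k obtain \<nu> where \<nu>: "\<nu> \<in># L" "k = (\<lambda>w. l w + \<nu> w)" by auto
    have nu: "\<nu> analytic_on {0}" "\<nu> 0 = 0" "\<forall>\<^sub>F t in nhds 0. \<nu> (complex_of_real t) \<in> \<real>" using L \<nu>(1) by (auto simp: branches_def)
    from nu(3) l(3) have "\<forall>\<^sub>F t in nhds 0. k (complex_of_real t) \<in> \<real>" by eventually_elim (simp add: \<nu>(2))
    then show ?thesis using nu l \<nu>(2) by (auto intro!: analytic_intros)
  qed
  ultimately show ?thesis using L by (auto simp: branches_def filter_mset_image_mset comp_def)
qed

lemma size_filter_replicate_mset: "size {#l \<in># replicate_mset n a. P l#} = (if P a then n else 0)"
  by (induction n) auto

theorem analytic_branches:
  assumes "herm_family d F" "F 0 0 = 0\<^sub>m d d" "unit_deriv d F"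
  shows "\<exists>L. branches d F L"
  using assms
proof (induction d arbitrary: F rule: less_induct)
  case (less d F)
  note F = less.prems
  show ?case
  proof (cases "d = 0")
    case True
    have "neg_inertia A = 0" if "A \<in> carrier_mat 0 0" for A
      using inertia_sum[OF hermitian_matI[OF that] that] by simp
    then have "branches d F {#}"
      using herm_family_carrier[OF F(1)] True by (auto simp: branches_def split_beta')
    then show ?thesis ..
  next
    case False
    \<comment> \<open>The trace divided by \<open>d\<close> has derivative 1 at the origin and is
      real at real points, which is what \<open>hol2_implicit_function\<close> asks for.\<close>
    define h where "h z w = (\<Sum>i<d. F z w $$ (i, i)) / of_nat d" for z w
    have holh: "hol2 h"
    proof -
      have "hol2 (\<lambda>z w. (1 / of_nat d) * (\<Sum>i<d. F z w $$ (i, i)))"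
        by (intro hol2_mult hol2_const hol2_sum herm_family_hol2[OF F(1)]) auto
      then show ?thesis by (simp add: h_def[abs_def])
    qed
    have h0: "h 0 0 = 0" by (simp add: h_def F(2))
    have "((\<lambda>z. F z 0 $$ (i, i)) has_field_derivative 1) (at 0)" if "i < d" for i
    proof -
      have "(\<lambda>z. F z 0 $$ (i, i)) field_differentiable at 0"
        using analytic_on_imp_differentiable_at[OF hol2_restrict_fst[OF herm_family_hol2[OF F(1) that that]]] by simp
      then show ?thesis using F(3) that by (auto simp: unit_deriv_def DERIV_deriv_iff_field_differentiable[symmetric])
    qed
    then have "((\<lambda>z. \<Sum>i<d. F z 0 $$ (i, i)) has_field_derivative (\<Sum>i<d. 1)) (at 0)"
      by (intro DERIV_sum) auto
    then have "((\<lambda>z. h z 0) has_field_derivative (\<Sum>i<d. 1) / of_nat d) (at 0)"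
      unfolding h_def by (rule DERIV_cdivide)
    then have dh: "deriv (\<lambda>z. h z 0) 0 = 1" using False by (simp add: DERIV_imp_deriv)
    have hF: "\<forall>\<^sub>F (x, t) in nhds (0, 0). hermitian_mat (F (complex_of_real x) (complex_of_real t))"
      using F by (simp add: herm_family_def)
    have "\<forall>\<^sub>F (x, t) in nhds (0, 0). h (complex_of_real x) (complex_of_real t) \<in> \<real>"
      using hF
    proof eventually_elim
      case (elim q)
      obtain x t where q: "q = (x, t)" by (cases q)
      have "F (complex_of_real x) (complex_of_real t) $$ (i, i) \<in> \<real>" if "i < d" for i
        using hermitian_mat_index[OF _ herm_family_carrier[OF F(1)] that that] elim q by (simp add: Reals_cnj_iff)
      then show ?case by (auto simp: q h_def intro!: Reals_divide sum_in_Reals)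
    qed
    then obtain r where r: "r > 0" "\<And>x t. \<bar>x\<bar> < r \<Longrightarrow> \<bar>t\<bar> < r \<Longrightarrow> h (complex_of_real x) (complex_of_real t) \<in> \<real>"
      by (rule eventually_nhds_00_box) blast
    obtain l where l: "l analytic_on {0}" "l 0 = 0" "\<forall>\<^sub>F w in nhds 0. h (l w) w = 0"
      "\<forall>\<^sub>F t in nhds 0. l (complex_of_real t) \<in> \<real>"
      by (rule hol2_implicit_function[OF holh h0 dh r])
    define G where "G z w = F (l w + z) w" for z w
    have G: "herm_family d G" unfolding G_def[abs_def] by (rule herm_family_shift[OF F(1) l(1,2,4)])
    have uG: "unit_deriv d G" using F(3) by (simp add: unit_deriv_def G_def l(2))
    have G00: "G 0 0 = 0\<^sub>m d d" by (simp add: G_def l(2) F(2))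
    have trG: "\<forall>\<^sub>F w in nhds 0. (\<Sum>i<d. G 0 w $$ (i, i)) = 0"
      using l(3) by eventually_elim (use False in \<open>simp add: h_def G_def\<close>)
    have anG: "(\<lambda>w. G 0 w $$ (i, j)) analytic_on {0}" if "i < d" "j < d" for i j
      by (rule hol2_restrict_snd[OF herm_family_hol2[OF G that]])
    have "\<exists>L. branches d G L"
    proof (cases "\<exists>q\<in>{..<d} \<times> {..<d}. \<not> (\<forall>\<^sub>F w in nhds 0. G 0 w $$ q = 0)")
      \<comment> \<open>As G(0,t) vanishes identically, the smallness condition of
        \<open>definite_region\<close> holds for every \<open>x\<close>. So \<open>G\<close> is
        definite off \<open>x = 0\<close>, and all \<open>d\<close> branches of \<open>G\<close> are
        zero.\<close>
      case zero: False
      obtain \<epsilon> where \<epsilon>: "\<epsilon> > 0" and def: "\<forall>\<^sub>F (x, t) in nhds (0, 0).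
        (\<forall>i<d. \<forall>j<d. cmod (G 0 (complex_of_real t) $$ (i, j)) \<le> \<epsilon> * \<bar>x\<bar>) \<longrightarrow>
        (x > 0 \<longrightarrow> neg_inertia (G (complex_of_real x) (complex_of_real t)) = 0 \<and>
           neg_inertia (- G (complex_of_real x) (complex_of_real t)) = d) \<and>
        (x < 0 \<longrightarrow> neg_inertia (G (complex_of_real x) (complex_of_real t)) = d \<and>
           neg_inertia (- G (complex_of_real x) (complex_of_real t)) = 0)"
        by (rule definite_region[OF G uG])
      have "\<forall>\<^sub>F w in nhds 0. \<forall>q\<in>{..<d} \<times> {..<d}. G 0 w $$ q = 0"
        using zero by (intro eventually_ball_finite) auto
      from eventually_nhds_00_snd[OF eventually_nhds_0_of_real[OF this], of 0] def
      have "\<forall>\<^sub>F (x, t) in nhds (0, 0).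
        neg_inertia (G (complex_of_real x) (complex_of_real t)) = (if 0 > x then d else 0) \<and>
        neg_inertia (- G (complex_of_real x) (complex_of_real t)) = (if 0 < x then d else 0)"
      proof eventually_elim
        case (elim q)
        obtain x t where q: "q = (x, t)" by (cases q)
        have z: "G 0 (complex_of_real t) $$ (i, j) = 0" if "i < d" "j < d" for i j using elim(1) that by (auto simp: q)
        then have "G 0 (complex_of_real t) = 0\<^sub>m d d"
          using herm_family_carrier[OF G, of 0 "complex_of_real t"] by (intro eq_matI) auto
        moreover have "\<forall>i<d. \<forall>j<d. cmod (G 0 (complex_of_real t) $$ (i, j)) \<le> \<epsilon> * \<bar>x\<bar>"
          using z \<epsilon> by simp
        with elim(2) have "(x > 0 \<longrightarrow> neg_inertia (G (complex_of_real x) (complex_of_real t)) = 0 \<and>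
           neg_inertia (- G (complex_of_real x) (complex_of_real t)) = d) \<and>
        (x < 0 \<longrightarrow> neg_inertia (G (complex_of_real x) (complex_of_real t)) = d \<and>
           neg_inertia (- G (complex_of_real x) (complex_of_real t)) = 0)" unfolding q prod.case by blast
        ultimately show ?case using neg_inertia_zero[of d]
          by (cases x "0::real" rule: linorder_cases) (auto simp: q)
      qed
      then have "branches d G (replicate_mset d (\<lambda>w. 0))"
        by (auto simp: branches_def split_beta' in_replicate_mset size_filter_replicate_mset elim!: eventually_mono)
      then show ?thesis ..
    next
      case True
      have ann: "(\<lambda>w. G 0 w $$ q) analytic_on {0}" "G 0 0 $$ q = 0" if "q \<in> {..<d} \<times> {..<d}" for q
        using that anG G00 by auto
      obtain p B where p: "p \<ge> 1" and B: "\<And>q. q \<in> {..<d} \<times> {..<d} \<Longrightarrow> B q analytic_on {0}"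
        "\<And>q. q \<in> {..<d} \<times> {..<d} \<Longrightarrow> \<forall>\<^sub>F w in nhds 0. G 0 w $$ q = w ^ p * B q w"
        "\<exists>q\<in>{..<d} \<times> {..<d}. B q 0 \<noteq> 0"
        by (rule analytic_common_zero_order[of "{..<d} \<times> {..<d}" "\<lambda>q w. G 0 w $$ q", OF _ ann True]) auto
      define b where "b i j = B (i, j)" for i j
      have b: "b i j analytic_on {0}" "\<forall>\<^sub>F w in nhds 0. G 0 w $$ (i, j) = w ^ p * b i j w" if "i < d" "j < d" for i j
        using B(1,2)[of "(i, j)"] that by (auto simp: b_def)
      define D where "D = - mat d d (\<lambda>(i, j). b i j 0)"
      have Dc: "D \<in> carrier_mat d d" by (simp add: D_def)
      have hD: "hermitian_mat D"
        by (rule hermitian_matI[OF Dc]) (simp add: D_def blowup_limit_hermitian[OF G b])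
      \<comment> \<open>The trace of \<open>G 0 w\<close> is zero by the choice of \<open>l\<close>;
        divide by \<open>w ^ p\<close> for nonzero \<open>w\<close> and pass to the limit.\<close>
      have trb: "(\<Sum>i<d. b i i 0) = 0"
      proof -
        have "(\<lambda>w. \<Sum>i<d. b i i w) analytic_on {0}" using b(1) by (intro analytic_intros) auto
        then have lim: "((\<lambda>w. \<Sum>i<d. b i i w) \<longlongrightarrow> (\<Sum>i<d. b i i 0)) (at 0)"
          using analytic_at_imp_isCont by (force simp: isCont_def)
        have "\<forall>\<^sub>F w in nhds 0. \<forall>i\<in>{..<d}. G 0 w $$ (i, i) = w ^ p * b i i w"
          using b(2) by (intro eventually_ball_finite) auto
        with trG have "\<forall>\<^sub>F w in nhds 0. w \<noteq> 0 \<longrightarrow> (\<Sum>i<d. b i i w) = 0"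
        proof eventually_elim
          case (elim w)
          then have "w ^ p * (\<Sum>i<d. b i i w) = 0" by (simp add: sum_distrib_left)
          then show ?case by (metis mult_eq_0_iff power_not_zero)
        qed
        then have "\<forall>\<^sub>F w in at 0. (\<Sum>i<d. b i i w) = 0" by (simp add: eventually_at_filter)
        from tendsto_cong[OF this] lim have "((\<lambda>w. 0) \<longlongrightarrow> (\<Sum>i<d. b i i 0)) (at (0::complex))" by simp
        from tendsto_unique[OF _ this tendsto_const] show ?thesis by simp
      qed
      \<comment> \<open>An eigenvalue of multiplicity \<open>d\<close> would make \<open>D\<close>
        scalar; being trace-free, \<open>D\<close> would be zero, contrary to the choice of
        \<open>p\<close> as the exact common order.\<close>
      have drop: "count (real_eigs D) m < d" for m
      proof (rule ccontr)
        assume "\<not> count (real_eigs D) m < d"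
        moreover have "count (real_eigs D) m \<le> d" using size_real_eigs[OF Dc] count_le_size by metis
        ultimately have Dm: "D = complex_of_real m \<cdot>\<^sub>m 1\<^sub>m d" using real_eigs_scalar[OF hD Dc] by simp
        have bij: "b i j 0 = - (complex_of_real m * (if i = j then 1 else 0))" if "i < d" "j < d" for i j
        proof -
          have "b i j 0 = - ((complex_of_real m \<cdot>\<^sub>m 1\<^sub>m d) $$ (i, j))" unfolding Dm[symmetric] D_def using that by simp
          then show ?thesis using that by simp
        qed
        have "(\<Sum>i<d. - complex_of_real m) = 0" using trb bij by simp
        then have "m = 0" using False by simp
        then show False using B(3) bij by (auto simp: b_def)
      qed
      obtain N where N: "size N = d"
        "\<forall>\<nu>\<in>#N. \<nu> analytic_on {0} \<and> (\<forall>\<^sub>F t in nhds 0. \<nu> (complex_of_real t) \<in> \<real>)"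
        "\<forall>\<mu>0::real. \<forall>\<^sub>F (x, t) in nhds (\<mu>0, 0).
          neg_inertia (blowup d p G b (complex_of_real x) (complex_of_real t)) = size {#\<nu> \<in># N. Re (\<nu> (complex_of_real t)) > x#} \<and>
          neg_inertia (- blowup d p G b (complex_of_real x) (complex_of_real t)) = size {#\<nu> \<in># N. Re (\<nu> (complex_of_real t)) < x#}"
        by (rule blowup_branches[OF G uG p b D_def less.IH drop])
      from branches_of_blowup[OF G uG p b N] show ?thesis ..
    qed
    then obtain L where "branches d (\<lambda>z w. F (l w + z) w) L" unfolding G_def[abs_def] ..
    from branches_shift[OF l(1,2,4) this] show ?thesis ..
  qed
qed

section \<open>The inverse square root and the linear pencil\<close>

lemma qform_unit_vec:
  assumes "(A :: complex mat) \<in> carrier_mat n n" "i < n"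
  shows "(A *\<^sub>v unit_vec n i) \<bullet>c unit_vec n i = A $$ (i, i)"
proof -
  have "conjugate (unit_vec n i :: complex vec) = unit_vec n i"
    by (intro eq_vecI) (auto simp: unit_vec_def)
  then show ?thesis using assms by simp
qed

text \<open>All eigenvalues of \<open>- P\<close> are negative, so its negative subspace with margin
  \<open>\<delta>\<close> is the whole space.\<close>

lemma pos_def_lower_bound:
  assumes P: "pos_def_mat P" "P \<in> carrier_mat n n"
  obtains \<delta> where "\<delta> > 0" "\<forall>v\<in>carrier_vec n. \<delta> * nsq v \<le> Re ((P *\<^sub>v v) \<bullet>c v)"
proof -
  have h: "hermitian_mat P" using P by (simp add: pos_def_mat_def)
  have "neg_inertia (- P) = n"
    by (rule inertia_positive_definite(2)[OF h P(2)]) (use P in \<open>auto simp: pos_def_mat_def\<close>)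
  then have n: "n = neg_inertia (- P)" by simp
  obtain V \<delta> where V: "V \<in> carrier_mat n n" and VV: "mat_adjoint V * V = 1\<^sub>m n" and d: "\<delta> > 0"
    and neg: "\<forall>a\<in>carrier_vec n. Re ((- P *\<^sub>v (V *\<^sub>v a)) \<bullet>c (V *\<^sub>v a)) \<le> - \<delta> * nsq a"
    by (rule neg_inertia_subspace[OF hermitian_mat_uminus[OF h P(2)] _ n]) (use P in auto)
  have V': "mat_adjoint V \<in> carrier_mat n n" using V by simp
  show ?thesis
  proof (rule that[OF d], rule ballI)
    fix v :: "complex vec" assume v: "v \<in> carrier_vec n"
    define a where "a = mat_adjoint V *\<^sub>v v"
    have a: "a \<in> carrier_vec n" using V' v by (simp add: a_def)
    have Va: "V *\<^sub>v a = v"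
      using assoc_mult_mat_vec[OF V V' v] unitary_right_inverse[OF V VV] v by (simp add: a_def)
    have "nsq v = nsq a" using nsq_isometry[OF V VV a] Va by simp
    moreover have "(- P *\<^sub>v v) \<bullet>c v = - ((P *\<^sub>v v) \<bullet>c v)"
      using P(2) v by (simp add: uminus_mult_mat_vec uminus_scalar_prod[symmetric, of _ n])
    ultimately show "\<delta> * nsq v \<le> Re ((P *\<^sub>v v) \<bullet>c v)" using bspec[OF neg a] by (simp add: Va)
  qed
qed

text \<open>The diagonal entry is the value of the form of \<open>P\<close> at column
  \<open>i\<close> of \<open>U\<close>, a unit vector.\<close>

lemma pos_def_congruence_diag:
  assumes P: "pos_def_mat P" "P \<in> carrier_mat n n" and U: "U \<in> carrier_mat n n" "mat_adjoint U * U = 1\<^sub>m n"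
    and i: "i < n"
  shows "Re ((mat_adjoint U * P * U) $$ (i, i)) > 0"
proof -
  have u: "unit_vec n i \<in> carrier_vec n" by simp
  have "nsq (U *\<^sub>v unit_vec n i) = nsq (unit_vec n i)" by (rule nsq_isometry[OF U u])
  moreover have "nsq (unit_vec n i) > 0" using i by (intro nsq_pos[of _ n]) auto
  moreover have "nsq (0\<^sub>v n) = 0" by (simp add: nsq_def)
  ultimately have "U *\<^sub>v unit_vec n i \<noteq> 0\<^sub>v n" by auto
  then have "Re ((P *\<^sub>v (U *\<^sub>v unit_vec n i)) \<bullet>c (U *\<^sub>v unit_vec n i)) > 0"
    using P U u by (auto simp: pos_def_mat_def)
  moreover have "mat_adjoint U * P * U \<in> carrier_mat n n" using U P by auto
  ultimately show ?thesis
    using qform_congruence[OF P(2) U(1) u] qform_unit_vec[of "mat_adjoint U * P * U" n i] i by simp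
qed

text \<open>In an eigenbasis of \<open>P\<close>, take the reciprocal square roots of the
  eigenvalues.\<close>

lemma inv_sqrt_exists:
  assumes P: "pos_def_mat P" "P \<in> carrier_mat n n"
  shows "\<exists>R\<in>carrier_mat n n. pos_def_mat R \<and> P * (R * R) = 1\<^sub>m n"
proof -
  have h: "hermitian_mat P" using P by (simp add: pos_def_mat_def)
  from real_diagonalization_ex[OF h P(2)] obtain f U where U: "U \<in> carrier_mat n n"
    "mat_adjoint U * U = 1\<^sub>m n" "mat_adjoint U * P * U = mat_diag n (\<lambda>i. complex_of_real (f i))"
    "real_eigs P = mset (map f [0..<n])" .
  have U': "mat_adjoint U \<in> carrier_mat n n" using U by simp
  have UU: "U * mat_adjoint U = 1\<^sub>m n" by (rule unitary_right_inverse[OF U(1,2)])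
  have f: "f i > 0" if "i < n" for i
    using pos_def_congruence_diag[OF P U(1,2) that] that by (simp add: U(3) mat_diag_def)
  define S where "S = mat_diag n (\<lambda>i. complex_of_real (1 / sqrt (f i)))"
  define E where "E = mat_diag n (\<lambda>i. complex_of_real (f i))"
  have S: "S \<in> carrier_mat n n" "hermitian_mat S" unfolding S_def by (simp, rule hermitian_mat_diag)
  have E: "E \<in> carrier_mat n n" by (simp add: E_def)
  define R where "R = U * S * mat_adjoint U"
  have R: "R \<in> carrier_mat n n" unfolding R_def by (rule mult_carrier_mat[OF mult_carrier_mat[OF U(1) S(1)] U'])
  have hR: "hermitian_mat R"
    using hermitian_mat_congruence[OF S(2,1) U'] by (simp add: R_def)
  have pR: "pos_def_mat R"
    unfolding pos_def_mat_def
  proof (intro conjI hR ballI impI)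
    fix v :: "complex vec" assume "v \<in> carrier_vec (dim_row R)" "v \<noteq> 0\<^sub>v (dim_row R)"
    then have v: "v \<in> carrier_vec n" "v \<noteq> 0\<^sub>v n" using R by auto
    define w where "w = mat_adjoint U *\<^sub>v v"
    have w: "w \<in> carrier_vec n" using U' v by (simp add: w_def)
    have "nsq w = nsq v" unfolding w_def by (rule nsq_isometry[OF U' _ v(1)]) (simp add: UU)
    with nsq_pos[OF v] have "w \<noteq> 0\<^sub>v n" by (auto simp: nsq_def)
    then obtain k where k: "k < n" "w $ k \<noteq> 0" using w by (metis carrier_vecD eq_vecI index_zero_vec)
    have "Re ((R *\<^sub>v v) \<bullet>c v) = Re ((S *\<^sub>v w) \<bullet>c w)"
      using qform_congruence[OF S(1) U' v(1)] by (simp add: w_def R_def)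
    also have "\<dots> = (\<Sum>i<n. 1 / sqrt (f i) * (cmod (w $ i))\<^sup>2)" unfolding S_def by (rule qform_diag[OF w])
    also have "\<dots> > 0" using k f by (intro sum_pos2[of _ k]) (auto simp: less_imp_le)
    finally show "0 < Re ((R *\<^sub>v v) \<bullet>c v)" .
  qed
  have ESS: "E * (S * S) = 1\<^sub>m n"
  proof -
    have "E * (S * S) = mat_diag n (\<lambda>i. complex_of_real (f i) * (complex_of_real (1 / sqrt (f i)) * complex_of_real (1 / sqrt (f i))))"
      by (simp add: E_def S_def)
    also have "\<dots> = 1\<^sub>m n"
    proof (rule eq_matI)
      fix i j assume "i < dim_row (1\<^sub>m n)" "j < dim_col (1\<^sub>m n)"
      then have ij: "i < n" "j < n" by auto
      have "f j * (1 / sqrt (f j) * (1 / sqrt (f j))) = 1"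
        using f[OF ij(2)] by (simp add: real_sqrt_mult_self)
      then have "complex_of_real (f j) * (complex_of_real (1 / sqrt (f j)) * complex_of_real (1 / sqrt (f j))) = 1"
        by (metis of_real_1 of_real_mult)
      then show "mat_diag n (\<lambda>i. complex_of_real (f i) * (complex_of_real (1 / sqrt (f i)) * complex_of_real (1 / sqrt (f i)))) $$ (i, j) = 1\<^sub>m n $$ (i, j)"
        using ij by (simp add: mat_diag_def)
    qed (auto simp: mat_diag_def)
    finally show ?thesis .
  qed
  have "P = (U * mat_adjoint U) * P * (U * mat_adjoint U)" using P UU by simp
  also have "\<dots> = U * (mat_adjoint U * P * U) * mat_adjoint U"
    using P(2) U(1) U' by (simp add: square_mult_assoc[where n = n] square_mult_closed)
  finally have PE: "P = U * E * mat_adjoint U" unfolding U(3) E_def .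
  have "P * (R * R) = U * E * (mat_adjoint U * U) * S * (mat_adjoint U * U) * S * mat_adjoint U"
    unfolding PE R_def using S(1) E U(1) U' by (simp add: square_mult_assoc[where n = n] square_mult_closed)
  also have "\<dots> = U * (E * (S * S)) * mat_adjoint U"
    unfolding U(2) using S(1) E U(1) U' by (simp add: square_mult_assoc[where n = n] square_mult_closed)
  also have "\<dots> = 1\<^sub>m n" unfolding ESS using U(1) UU by simp
  finally show ?thesis using R pR by blast
qed

text \<open>The difference X = R - S satisfies RX + XS = RR - SS = 0. In an eigenbasis of X, the
  diagonal entries of this identity are an eigenvalue of X times the sum of the corresponding
  diagonal entries of R and S. That sum is positive, so every eigenvalue of X is 0.\<close>

lemma pos_def_sqrt_unique:
  assumes R: "pos_def_mat R" "R \<in> carrier_mat n n" and S: "pos_def_mat S" "S \<in> carrier_mat n n"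
    and eq: "R * R = S * S"
  shows "R = S"
proof -
  have hR: "hermitian_mat R" and hS: "hermitian_mat S" using R S by (auto simp: pos_def_mat_def)
  define X where "X = R + - S"
  have mS: "- S \<in> carrier_mat n n" using S by simp
  have X: "X \<in> carrier_mat n n" "hermitian_mat X"
    using R S hermitian_mat_add[OF hR R(2) hermitian_mat_uminus[OF hS S(2)] mS] by (auto simp: X_def)
  have RX: "R * X + X * S = 0\<^sub>m n n"
  proof -
    have 1: "R * X = R * R + - (R * S)"
      using mult_add_distrib_mat[OF R(2) R(2) mS] uminus_mult_right_mat[of R S] R S by (simp add: X_def)
    have 2: "X * S = R * S + - (S * S)"
      using add_mult_distrib_mat[OF R(2) mS S(2)] uminus_mult_left_mat[of S S] S by (simp add: X_def)
    have c: "R * S \<in> carrier_mat n n" "S * S \<in> carrier_mat n n" using R S by auto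
    show ?thesis unfolding 1 2 eq using c by (intro eq_matI) (auto simp del: index_mult_mat)
  qed
  from real_diagonalization_ex[OF X(2,1)] obtain g U where U: "U \<in> carrier_mat n n"
    "mat_adjoint U * U = 1\<^sub>m n" "mat_adjoint U * X * U = mat_diag n (\<lambda>i. complex_of_real (g i))"
    "real_eigs X = mset (map g [0..<n])" .
  have U': "mat_adjoint U \<in> carrier_mat n n" using U by simp
  have UU: "U * mat_adjoint U = 1\<^sub>m n" by (rule unitary_right_inverse[OF U(1,2)])
  define R' where "R' = mat_adjoint U * R * U"
  define S' where "S' = mat_adjoint U * S * U"
  have R': "R' \<in> carrier_mat n n" and S': "S' \<in> carrier_mat n n" using R S U by (auto simp: R'_def S'_def)
  have RXc: "R * X \<in> carrier_mat n n" "X * S \<in> carrier_mat n n" using R X S by auto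
  have e1: "R' * mat_diag n (\<lambda>i. complex_of_real (g i)) = mat_adjoint U * (R * X) * U"
  proof -
    have "R' * mat_diag n (\<lambda>i. complex_of_real (g i)) = mat_adjoint U * R * (U * mat_adjoint U) * X * U"
      unfolding U(3)[symmetric] R'_def using U(1) U' R(2) X(1) by (simp add: square_mult_assoc[where n = n] square_mult_closed)
    also have "\<dots> = mat_adjoint U * (R * X) * U"
      unfolding UU using U(1) U' R(2) X(1) by (simp add: square_mult_assoc[where n = n] square_mult_closed)
    finally show ?thesis .
  qed
  have e2: "mat_diag n (\<lambda>i. complex_of_real (g i)) * S' = mat_adjoint U * (X * S) * U"
  proof -
    have "mat_diag n (\<lambda>i. complex_of_real (g i)) * S' = mat_adjoint U * X * (U * mat_adjoint U) * S * U"
      unfolding U(3)[symmetric] S'_def using U(1) U' S(2) X(1) by (simp add: square_mult_assoc[where n = n] square_mult_closed)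
    also have "\<dots> = mat_adjoint U * (X * S) * U"
      unfolding UU using U(1) U' S(2) X(1) by (simp add: square_mult_assoc[where n = n] square_mult_closed)
    finally show ?thesis .
  qed
  have g0: "g i = 0" if i: "i < n" for i
  proof -
    have "R' * mat_diag n (\<lambda>i. complex_of_real (g i)) + mat_diag n (\<lambda>i. complex_of_real (g i)) * S' = 0\<^sub>m n n"
      unfolding e1 e2 square_adjoint_sandwich[OF RXc U(1), symmetric] RX
      using right_mult_zero_mat[OF U', of n] left_mult_zero_mat[OF U(1), of n] by simp
    from arg_cong[OF this, of "\<lambda>A. A $$ (i, i)"]
    have "R' $$ (i, i) * complex_of_real (g i) + complex_of_real (g i) * S' $$ (i, i) = 0"
      unfolding mat_diag_mult_left[OF S'] mat_diag_mult_right[OF R'] using i by simp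
    then have "complex_of_real (g i) * (R' $$ (i, i) + S' $$ (i, i)) = 0" by (simp add: algebra_simps)
    moreover have "Re (R' $$ (i, i) + S' $$ (i, i)) > 0"
      using pos_def_congruence_diag[OF R U(1,2) i] pos_def_congruence_diag[OF S U(1,2) i] by (simp add: R'_def S'_def)
    then have "R' $$ (i, i) + S' $$ (i, i) \<noteq> 0" by (metis less_irrefl zero_complex.sel(1))
    ultimately show ?thesis by simp
  qed
  have "mat_diag n (\<lambda>i. complex_of_real (g i)) = 0\<^sub>m n n" by (rule eq_matI) (auto simp: mat_diag_def g0)
  then have z: "mat_adjoint U * X * U = 0\<^sub>m n n" using U(3) by simp
  have "X = (U * mat_adjoint U) * X * (U * mat_adjoint U)" using X UU by simp
  also have "\<dots> = U * (mat_adjoint U * X * U) * mat_adjoint U"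
    using X(1) U(1) U' by (simp add: square_mult_assoc[where n = n] square_mult_closed)
  also have "\<dots> = 0\<^sub>m n n" unfolding z using right_mult_zero_mat[OF U(1), of n] left_mult_zero_mat[OF U', of n] by simp
  finally have X0: "X = 0\<^sub>m n n" .
  show ?thesis
  proof (rule eq_matI)
    fix i j assume "i < dim_row S" "j < dim_col S"
    then have ij: "i < n" "j < n" using S by auto
    from arg_cong[OF X0, of "\<lambda>A. A $$ (i, j)"] show "R $$ (i, j) = S $$ (i, j)" using ij R S by (simp add: X_def)
  qed (use R S in auto)
qed

text \<open>Justifies the description operator in \<open>inv_sqrt_mat\<close>: the squares of two
  candidates are both the inverse of \<open>P\<close>, so the candidates agree by uniqueness of the
  square root. The symmetric form of the identity arises because a right inverse of a square matrix
  is also a left inverse.\<close>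

lemma inv_sqrt_mat_props:
  assumes P: "pos_def_mat P" "P \<in> carrier_mat n n"
  shows "inv_sqrt_mat P \<in> carrier_mat n n" "pos_def_mat (inv_sqrt_mat P)"
    "inv_sqrt_mat P * P * inv_sqrt_mat P = 1\<^sub>m n"
proof -
  have dr: "dim_row P = n" using P by simp
  have inv: "inverts_mat P A \<longleftrightarrow> P * A = 1\<^sub>m n" for A using P by (simp add: inverts_mat_def)
  obtain R where R: "R \<in> carrier_mat n n" "pos_def_mat R" "P * (R * R) = 1\<^sub>m n"
    using inv_sqrt_exists[OF P] by blast
  have "inv_sqrt_mat P = R"
    unfolding inv_sqrt_mat_def dr inv
  proof (rule the_equality)
    show "R \<in> carrier_mat n n \<and> pos_def_mat R \<and> P * (R * R) = 1\<^sub>m n" using R by blast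
    fix S assume S: "S \<in> carrier_mat n n \<and> pos_def_mat S \<and> P * (S * S) = 1\<^sub>m n"
    have RR: "R * R \<in> carrier_mat n n" and SS: "S * S \<in> carrier_mat n n" using R S by auto
    have "(R * R) * P = 1\<^sub>m n" by (rule mat_mult_left_right_inverse[OF P(2) RR R(3)])
    moreover have "(R * R) * (P * (S * S)) = (R * R) * P * (S * S)"
      using assoc_mult_mat[OF RR P(2) SS] by simp
    ultimately have "R * R = S * S"
      using S left_mult_one_mat[OF SS] right_mult_one_mat[OF RR] by simp
    from pos_def_sqrt_unique[OF R(2,1) _ _ this] S have "R = S" by blast
    then show "S = R" ..
  qed
  moreover have "R * P * R = 1\<^sub>m n"
  proof -
    have "(P * R) * R = 1\<^sub>m n" using assoc_mult_mat[OF P(2) R(1) R(1)] R(3) by simp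
    then have "R * (P * R) = 1\<^sub>m n" by (rule mat_mult_left_right_inverse[OF mult_carrier_mat[OF P(2) R(1)] R(1)])
    then show ?thesis using assoc_mult_mat[OF R(1) P(2) R(1)] by simp
  qed
  ultimately show "inv_sqrt_mat P \<in> carrier_mat n n" "pos_def_mat (inv_sqrt_mat P)"
    "inv_sqrt_mat P * P * inv_sqrt_mat P = 1\<^sub>m n" using R by simp_all
qed

text \<open>Multiplying the pencil by \<open>R\<close> on both sides turns it into the
  characteristic matrix of \<open>- (R * Q * R)\<close>. The two determinants of \<open>R\<close>
  are nonzero constants and add no roots.\<close>

lemma proots_pencil_poly:
  assumes P: "P \<in> carrier_mat n n" and Q: "Q \<in> carrier_mat n n" and R: "R \<in> carrier_mat n n"
    and RPR: "R * P * R = 1\<^sub>m n"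
  shows "proots (pencil_poly P Q) = eigenvalue_mset (- (R * Q * R))"
proof -
  interpret h: comm_ring_hom "\<lambda>a::complex. [:a:]" by unfold_locales (auto simp: one_pCons)
  define c where "c = map_mat (\<lambda>a::complex. [:a:])"
  have cc: "c A \<in> carrier_mat n n" if "A \<in> carrier_mat n n" for A using that by (simp add: c_def)
  have cm: "c (A * B) = c A * c B" if "A \<in> carrier_mat n n" "B \<in> carrier_mat n n" for A B
    unfolding c_def by (rule map_poly_mult(1)[OF that])
  define X where "X = [:0, 1:] \<cdot>\<^sub>m c P"
  have X: "X \<in> carrier_mat n n" using cc[OF P] by (simp add: X_def)
  have RQ: "R * Q \<in> carrier_mat n n" and RP: "R * P \<in> carrier_mat n n" using R Q P by auto
  have "c R * (X + c Q) * c R = c R * X * c R + c R * c Q * c R"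
    using mult_add_distrib_mat[OF cc[OF R] X cc[OF Q]]
      add_mult_distrib_mat[OF mult_carrier_mat[OF cc[OF R] X] mult_carrier_mat[OF cc[OF R] cc[OF Q]] cc[OF R]] by simp
  also have "c R * X * c R = [:0, 1:] \<cdot>\<^sub>m (c R * c P * c R)"
    unfolding X_def using mult_smult_distrib[OF cc[OF R] cc[OF P]]
      mult_smult_assoc_mat[OF mult_carrier_mat[OF cc[OF R] cc[OF P]] cc[OF R]] by metis
  also have "c R * c P * c R = c (R * P * R)" using cm[OF R P] cm[OF RP R] by simp
  also have "c R * c Q * c R = c (R * Q * R)" using cm[OF R Q] cm[OF RQ R] by simp
  also have "[:0, 1:] \<cdot>\<^sub>m c (R * P * R) + c (R * Q * R) = char_poly_matrix (- (R * Q * R))"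
    unfolding RPR char_poly_matrix_def c_def using R Q by (intro eq_matI) auto
  finally have eq: "char_poly (- (R * Q * R)) = det (c R * (X + c Q) * c R)" by (simp add: char_poly_def)
  also have "\<dots> = det (c R) * det (X + c Q) * det (c R)"
    using det_mult[OF cc[OF R], of "X + c Q"] det_mult[OF mult_carrier_mat[OF cc[OF R], of "X + c Q" n] cc[OF R]] cc[OF Q] X by simp
  also have "det (X + c Q) = pencil_poly P Q" by (simp add: pencil_poly_def X_def c_def)
  also have "det (c R) = [:det R:]" unfolding c_def by (rule h.hom_det)
  finally have cp: "char_poly (- (R * Q * R)) = [:det R:] * pencil_poly P Q * [:det R:]" .
  have "- (R * Q * R) \<in> carrier_mat n n" using mult_carrier_mat[OF RQ R] by simp
  \<comment> \<open>Nonvanishing of the product shows that no factor is zero, as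
    \<open>proots_mult\<close> requires.\<close>
  from degree_monic_char_poly[OF this] have "char_poly (- (R * Q * R)) \<noteq> 0" by auto
  then have "proots (char_poly (- (R * Q * R))) = proots (pencil_poly P Q)"
    unfolding cp by (subst proots_mult; (subst proots_mult)?; auto)
  then show ?thesis by (simp add: eigenvalue_mset_def)
qed

section \<open>Counting rates\<close>

text \<open>Asymptotic equivalence reads the quotient as 1 where both functions vanish. For
  \<open>t > 0\<close> and \<open>c \<noteq> 0\<close> the comparison function has no zero, so the
  plain quotient may be used.\<close>

lemma has_rate_iff: "has_rate g p \<longleftrightarrow> (\<exists>c. c \<noteq> 0 \<and> ((\<lambda>t. g t / t ^ p) \<longlongrightarrow> c) (at_right 0))"
proof
  assume "has_rate g p"
  then obtain c where c: "c \<noteq> 0" "g \<sim>[at_right 0] (\<lambda>t. c * t ^ p)" by (auto simp: has_rate_def)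
  have "\<forall>\<^sub>F t in at_right (0::real). c * (if g t = 0 \<and> c * t ^ p = 0 then 1 else g t / (c * t ^ p)) = g t / t ^ p"
    unfolding eventually_at_right_field using c(1) by (intro exI[of _ 1]) auto
  moreover have "((\<lambda>t. c * (if g t = 0 \<and> c * t ^ p = 0 then 1 else g t / (c * t ^ p))) \<longlongrightarrow> c * 1) (at_right 0)"
    by (intro tendsto_intros asymp_equivD[OF c(2)])
  ultimately have "((\<lambda>t. g t / t ^ p) \<longlongrightarrow> c) (at_right 0)" by (simp add: tendsto_cong)
  with c(1) show "\<exists>c. c \<noteq> 0 \<and> ((\<lambda>t. g t / t ^ p) \<longlongrightarrow> c) (at_right 0)" by blast
next
  assume "\<exists>c. c \<noteq> 0 \<and> ((\<lambda>t. g t / t ^ p) \<longlongrightarrow> c) (at_right 0)"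
  then obtain c where c: "c \<noteq> 0" "((\<lambda>t. g t / t ^ p) \<longlongrightarrow> c) (at_right 0)" by blast
  have "((\<lambda>t. g t / t ^ p / c) \<longlongrightarrow> c / c) (at_right 0)" by (intro tendsto_intros c)
  then have "((\<lambda>t. g t / (c * t ^ p)) \<longlongrightarrow> 1) (at_right 0)" using c(1) by (simp add: mult.commute)
  then show "has_rate g p" unfolding has_rate_def by (intro exI[of _ c] conjI c(1) asymp_equivI')
qed

lemma tendsto_power_at_right_0: "k > 0 \<Longrightarrow> ((\<lambda>t::real. t ^ k) \<longlongrightarrow> 0) (at_right 0)"
proof -
  assume "k > 0"
  moreover have "((\<lambda>t::real. t ^ k) \<longlongrightarrow> 0 ^ k) (at_right 0)" by (intro tendsto_power tendsto_ident_at)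
  ultimately show ?thesis by (simp add: zero_power)
qed

lemma rate_limit_strict:
  assumes "((\<lambda>t. g t / t ^ p) \<longlongrightarrow> c) (at_right 0)" "((\<lambda>t. g t / t ^ p') \<longlongrightarrow> c') (at_right 0)" "p < p'"
  shows "c = (0::real)"
proof -
  have "((\<lambda>t. g t / t ^ p' * t ^ (p' - p)) \<longlongrightarrow> c' * 0) (at_right 0)"
    using assms(3) by (intro tendsto_mult assms(2) tendsto_power_at_right_0) simp
  moreover have "\<forall>\<^sub>F t in at_right (0::real). g t / t ^ p' * t ^ (p' - p) = g t / t ^ p"
  proof -
    have "t ^ p' = t ^ p * t ^ (p' - p)" for t :: real using assms(3) by (simp flip: power_add)
    then show ?thesis unfolding eventually_at_right_field by (intro exI[of _ 1]) auto
  qed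
  ultimately have "((\<lambda>t. g t / t ^ p) \<longlongrightarrow> 0) (at_right 0)" by (simp add: tendsto_cong)
  from tendsto_unique[OF _ assms(1) this] show ?thesis by simp
qed

lemma has_rate_unique: "has_rate g p \<Longrightarrow> has_rate g p' \<Longrightarrow> p = p'"
  unfolding has_rate_iff using rate_limit_strict[of g p _ p'] rate_limit_strict[of g p' _ p]
  by (metis linorder_neqE_nat)

text \<open>The dichotomy satisfied by analytic functions; it is the form in which analyticity
  enters the comparison of rates.\<close>

definition tame :: "(real \<Rightarrow> real) \<Rightarrow> bool" where
  "tame g \<longleftrightarrow> (\<forall>\<^sub>F t in at_right 0. g t = 0) \<or> (\<exists>p. has_rate g p)"

text \<open>A rate below \<open>q\<close> eventually exceeds every multiple of \<open>t ^ q\<close>,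
  while a function of rate at least \<open>q\<close> is bounded by a multiple of it. In the
  borderline case of rate exactly \<open>q\<close> that multiple must exceed the modulus of the
  leading coefficient, hence the threshold \<open>C0\<close>.\<close>

lemma tame_threshold:
  assumes "tame g"
  shows "\<exists>C0>0. \<forall>C\<ge>C0. \<forall>\<^sub>F t in at_right 0. (\<bar>g t\<bar> > C * t ^ q) = (\<exists>p<q. has_rate g p)"
proof (cases "\<forall>\<^sub>F t in at_right 0. g t = 0")
  case True
  have no: "\<not> has_rate g p" for p
  proof
    assume "has_rate g p"
    then obtain c where c: "c \<noteq> 0" "((\<lambda>t. g t / t ^ p) \<longlongrightarrow> c) (at_right 0)" by (auto simp: has_rate_iff)
    have "\<forall>\<^sub>F t in at_right 0. g t / t ^ p = 0" using True by eventually_elim simp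
    from tendsto_cong[OF this] c(2) have "((\<lambda>t. 0) \<longlongrightarrow> c) (at_right (0::real))" by simp
    from tendsto_unique[OF _ this tendsto_const] c(1) show False by simp
  qed
  have "\<forall>\<^sub>F t in at_right 0. (\<bar>g t\<bar> > C * t ^ q) = (\<exists>p<q. has_rate g p)" if "C \<ge> 1" for C
  proof -
    have "\<forall>\<^sub>F t in at_right (0::real). t > 0" by (simp add: eventually_at_right_less)
    with True show ?thesis by eventually_elim (use no that in \<open>simp add: not_less\<close>)
  qed
  then show ?thesis by (intro exI[of _ 1]) auto
next
  case False
  with assms obtain p where r: "has_rate g p" by (auto simp: tame_def)
  then obtain c where c: "c \<noteq> 0" "((\<lambda>t. g t / t ^ p) \<longlongrightarrow> c) (at_right 0)" by (auto simp: has_rate_iff)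
  have iff: "(\<exists>p<q. has_rate g p) \<longleftrightarrow> p < q" using r has_rate_unique by blast
  have pos: "\<forall>\<^sub>F t in at_right (0::real). t > 0" by (simp add: eventually_at_right_less)
  have small: "\<forall>\<^sub>F t in at_right (0::real). t < 1" unfolding eventually_at_right_field by (intro exI[of _ 1]) auto
  have lim: "((\<lambda>t. \<bar>g t / t ^ p\<bar>) \<longlongrightarrow> \<bar>c\<bar>) (at_right 0)" by (intro tendsto_intros c)
  show ?thesis
  proof (cases "p < q")
    case True
    have "\<forall>\<^sub>F t in at_right 0. \<bar>g t\<bar> > C * t ^ q" if "C \<ge> 1" for C
    proof -
      have "((\<lambda>t. \<bar>g t / t ^ p\<bar> - C * t ^ (q - p)) \<longlongrightarrow> \<bar>c\<bar> - C * 0) (at_right 0)"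
        using True by (intro tendsto_intros lim tendsto_power_at_right_0) simp
      then have "\<forall>\<^sub>F t in at_right 0. \<bar>g t / t ^ p\<bar> - C * t ^ (q - p) > 0" using c(1) by (intro order_tendstoD) auto
      with pos show ?thesis
      proof eventually_elim
        case (elim t)
        have "C * t ^ (q - p) * t ^ p < \<bar>g t / t ^ p\<bar> * t ^ p" using elim by (intro mult_strict_right_mono) auto
        moreover have "t ^ (q - p) * t ^ p = t ^ q" using True by (simp flip: power_add)
        ultimately show ?case using elim by (simp add: abs_divide mult.assoc)
      qed
    qed
    then show ?thesis using iff True by (intro exI[of _ 1]) auto
  next
    case F: False
    have "\<forall>\<^sub>F t in at_right 0. \<not> \<bar>g t\<bar> > C * t ^ q" if C: "C \<ge> \<bar>c\<bar> + 1" for C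
    proof -
      have "\<forall>\<^sub>F t in at_right 0. \<bar>g t / t ^ p\<bar> < \<bar>c\<bar> + 1" using lim by (rule order_tendstoD) simp
      with pos small show ?thesis
      proof eventually_elim
        case (elim t)
        have "\<bar>g t\<bar> = \<bar>g t / t ^ p\<bar> * t ^ p" using elim by (simp add: abs_divide)
        also have "\<dots> \<le> C * t ^ q"
          using elim F C by (intro mult_mono power_decreasing) auto
        finally show ?case by simp
      qed
    qed
    then show ?thesis unfolding iff using F by (intro exI[of _ "\<bar>c\<bar> + 1"]) (auto simp: add_nonneg_pos)
  qed
qed

text \<open>For large \<open>C\<close> the three thresholds \<open>C\<close>,
  \<open>\<alpha> * C\<close> and \<open>\<beta> * C\<close> all detect exactly the rates below
  \<open>q\<close>, so \<open>ineq\<close> squeezes the two counts together. The count for one rate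
  \<open>p\<close> is the difference between \<open>q = Suc p\<close> and \<open>q = p\<close>; for
  \<open>q = 0\<close> both sides are empty.\<close>

lemma card_rates_eq:
  fixes lam mu :: "'k \<Rightarrow> real \<Rightarrow> real"
  assumes K: "finite K" and tame: "\<And>k. k \<in> K \<Longrightarrow> tame (lam k)" "\<And>k. k \<in> K \<Longrightarrow> tame (mu k)"
    and ab: "\<alpha> > 0" "\<beta> > 0"
    and ineq: "\<And>q C. q \<ge> 1 \<Longrightarrow> C > 0 \<Longrightarrow> \<forall>\<^sub>F t in at_right 0.
      card {k \<in> K. \<bar>mu k t\<bar> > \<beta> * C * t ^ q} \<le> card {k \<in> K. \<bar>lam k t\<bar> > C * t ^ q} \<and>
      card {k \<in> K. \<bar>lam k t\<bar> > C * t ^ q} \<le> card {k \<in> K. \<bar>mu k t\<bar> > \<alpha> * C * t ^ q}"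
  shows "card {k \<in> K. has_rate (lam k) p} = card {k \<in> K. has_rate (mu k) p}"
proof -
  have main: "card {k \<in> K. \<exists>p<q. has_rate (lam k) p} = card {k \<in> K. \<exists>p<q. has_rate (mu k) p}" for q
  proof (cases "q = 0")
    case False
    from tame_threshold[OF tame(1)] have "\<forall>k\<in>K. \<exists>C0>0. \<forall>C\<ge>C0. \<forall>\<^sub>F t in at_right 0. (\<bar>lam k t\<bar> > C * t ^ q) = (\<exists>p<q. has_rate (lam k) p)" by blast
    from bchoice[OF this] obtain L where L: "\<forall>k\<in>K. L k > 0 \<and> (\<forall>C\<ge>L k. \<forall>\<^sub>F t in at_right 0. (\<bar>lam k t\<bar> > C * t ^ q) = (\<exists>p<q. has_rate (lam k) p))" by blast
    from tame_threshold[OF tame(2)] have "\<forall>k\<in>K. \<exists>C0>0. \<forall>C\<ge>C0. \<forall>\<^sub>F t in at_right 0. (\<bar>mu k t\<bar> > C * t ^ q) = (\<exists>p<q. has_rate (mu k) p)" by blast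
    from bchoice[OF this] obtain M where M: "\<forall>k\<in>K. M k > 0 \<and> (\<forall>C\<ge>M k. \<forall>\<^sub>F t in at_right 0. (\<bar>mu k t\<bar> > C * t ^ q) = (\<exists>p<q. has_rate (mu k) p))" by blast
    \<comment> \<open>Chosen so that \<open>C\<close> is above every \<open>L k\<close>, and both
      \<open>\<alpha> * C\<close> and \<open>\<beta> * C\<close> are above every
      \<open>M k\<close>.\<close>
    define C where "C = 1 + (\<Sum>k\<in>K. L k) + (\<Sum>k\<in>K. M k) / \<alpha> + (\<Sum>k\<in>K. M k) / \<beta>"
    have sL: "(\<Sum>k\<in>K. L k) \<ge> 0" using L by (intro sum_nonneg) (auto intro: less_imp_le)
    have sM: "(\<Sum>k\<in>K. M k) \<ge> 0" using M by (intro sum_nonneg) (auto intro: less_imp_le)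
    have C0: "C > 0" using sL sM ab by (simp add: C_def add_pos_nonneg)
    have CL: "L k \<le> C" if "k \<in> K" for k
    proof -
      have "L k \<le> (\<Sum>k\<in>K. L k)" using L by (intro member_le_sum that K) (auto intro: less_imp_le)
      moreover have "0 \<le> (\<Sum>k\<in>K. M k) / \<alpha>" "0 \<le> (\<Sum>k\<in>K. M k) / \<beta>" using sM ab by auto
      ultimately show ?thesis unfolding C_def by linarith
    qed
    have CM: "M k \<le> \<alpha> * C" "M k \<le> \<beta> * C" if "k \<in> K" for k
    proof -
      have m: "M k \<le> (\<Sum>k\<in>K. M k)" using M by (intro member_le_sum that K) (auto intro: less_imp_le)
      have nn: "0 \<le> (\<Sum>k\<in>K. M k) / \<alpha>" "0 \<le> (\<Sum>k\<in>K. M k) / \<beta>" using sM ab by auto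
      have "(\<Sum>k\<in>K. M k) / \<alpha> \<le> C" "(\<Sum>k\<in>K. M k) / \<beta> \<le> C"
        unfolding C_def using nn sL by linarith+
      then have "(\<Sum>k\<in>K. M k) \<le> \<alpha> * C" "(\<Sum>k\<in>K. M k) \<le> \<beta> * C"
        using ab by (simp_all add: pos_divide_le_eq mult.commute)
      then show "M k \<le> \<alpha> * C" "M k \<le> \<beta> * C" using m by auto
    qed
    have e1: "\<forall>\<^sub>F t in at_right 0. \<forall>k\<in>K. (\<bar>lam k t\<bar> > C * t ^ q) = (\<exists>p<q. has_rate (lam k) p)"
      using L CL by (intro eventually_ball_finite K) auto
    have e2: "\<forall>\<^sub>F t in at_right 0. \<forall>k\<in>K. (\<bar>mu k t\<bar> > \<alpha> * C * t ^ q) = (\<exists>p<q. has_rate (mu k) p)"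
      using M CM by (intro eventually_ball_finite K) auto
    have e3: "\<forall>\<^sub>F t in at_right 0. \<forall>k\<in>K. (\<bar>mu k t\<bar> > \<beta> * C * t ^ q) = (\<exists>p<q. has_rate (mu k) p)"
      using M CM by (intro eventually_ball_finite K) auto
    have e4: "\<forall>\<^sub>F t in at_right 0.
      card {k \<in> K. \<bar>mu k t\<bar> > \<beta> * C * t ^ q} \<le> card {k \<in> K. \<bar>lam k t\<bar> > C * t ^ q} \<and>
      card {k \<in> K. \<bar>lam k t\<bar> > C * t ^ q} \<le> card {k \<in> K. \<bar>mu k t\<bar> > \<alpha> * C * t ^ q}"
      by (rule ineq) (use False C0 in auto)
    from e1 e2 e3 e4 have "\<forall>\<^sub>F t in at_right (0::real). card {k \<in> K. \<exists>p<q. has_rate (lam k) p} = card {k \<in> K. \<exists>p<q. has_rate (mu k) p}"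
    proof eventually_elim
      case (elim t)
      have "{k \<in> K. \<bar>lam k t\<bar> > C * t ^ q} = {k \<in> K. \<exists>p<q. has_rate (lam k) p}"
        "{k \<in> K. \<bar>mu k t\<bar> > \<alpha> * C * t ^ q} = {k \<in> K. \<exists>p<q. has_rate (mu k) p}"
        "{k \<in> K. \<bar>mu k t\<bar> > \<beta> * C * t ^ q} = {k \<in> K. \<exists>p<q. has_rate (mu k) p}"
        using elim(1-3) by blast+
      with elim(4) show ?case by simp
    qed
    then show ?thesis by simp
  qed simp
  have split: "card {k \<in> K. \<exists>p'<Suc p. has_rate (f k) p'} = card {k \<in> K. \<exists>p'<p. has_rate (f k) p'} + card {k \<in> K. has_rate (f k) p}"
    for f :: "'k \<Rightarrow> real \<Rightarrow> real"
  proof -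
    have "{k \<in> K. \<exists>p'<Suc p. has_rate (f k) p'} = {k \<in> K. \<exists>p'<p. has_rate (f k) p'} \<union> {k \<in> K. has_rate (f k) p}"
      by (auto simp: less_Suc_eq)
    moreover have "{k \<in> K. \<exists>p'<p. has_rate (f k) p'} \<inter> {k \<in> K. has_rate (f k) p} = {}"
      using has_rate_unique by blast
    ultimately show ?thesis using K by (simp add: card_Un_disjoint)
  qed
  show ?thesis using main[of "Suc p"] main[of p] split[of lam] split[of mu] by simp
qed

text \<open>The multiplicity of \<open>a\<close> is the jump of the upper count at \<open>a\<close>.
  It can be read off at two levels on either side of \<open>a\<close>, chosen off the finite
  exceptional set.\<close>

lemma multiset_eq_by_upper_counts:
  fixes A B :: "real multiset"
  assumes S: "finite S" and eq: "\<And>r. r \<notin> S \<Longrightarrow> size {#a \<in># A. a > r#} = size {#b \<in># B. b > r#}"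
  shows "A = B"
proof (rule multiset_eqI)
  fix a
  define W where "W = set_mset A \<union> set_mset B \<union> S - {a}"
  have W: "finite W" using S by (simp add: W_def)
  \<comment> \<open>No element of either multiset and no exceptional level other than
    \<open>a\<close> lies closer than \<open>e\<close> to \<open>a\<close>, so the levels at
    distance \<open>e/2\<close> are admissible.\<close>
  define e where "e = Min (insert 1 ((\<lambda>w. \<bar>w - a\<bar>) ` W))"
  have e: "e > 0" unfolding e_def using W by (subst Min_gr_iff) (auto simp: W_def)
  have ew: "e \<le> \<bar>w - a\<bar>" if "w \<in> W" for w unfolding e_def using that W by (intro Min_le) auto
  have cnt: "size {#x \<in># M. x > a - e/2#} = size {#x \<in># M. x > a + e/2#} + count M a" if "set_mset M \<subseteq> W \<union> {a}" for M
    using that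
  proof (induction M)
    case (add x M)
    show ?case
    proof (cases "x = a")
      case False
      then have "e \<le> \<bar>x - a\<bar>" using add.prems by (intro ew) auto
      then have "(x > a - e/2) = (x > a + e/2)" using e by (auto simp: abs_if split: if_splits)
      then show ?thesis using add False by simp
    qed (use add e in simp)
  qed simp
  have "a - e/2 \<notin> S" "a + e/2 \<notin> S"
    using ew[of "a - e/2"] ew[of "a + e/2"] e by (auto simp: W_def)
  then have "size {#x \<in># A. x > a - e/2#} = size {#x \<in># B. x > a - e/2#}"
    "size {#x \<in># A. x > a + e/2#} = size {#x \<in># B. x > a + e/2#}" using eq by auto
  moreover have "set_mset A \<subseteq> W \<union> {a}" "set_mset B \<subseteq> W \<union> {a}" by (auto simp: W_def)
  ultimately show "count A a = count B a" using cnt[of A] cnt[of B] by simp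
qed

lemma size_trichotomy:
  fixes M :: "real multiset"
  shows "size M = size {#r \<in># M. r < x#} + size {#r \<in># M. r > x#} + count M x"
  by (induction M) auto

text \<open>Inside (-q, q) the two counts and the size give the multiplicities; this already
  contains \<open>B\<close> in \<open>A\<close>, and equal size forces equality. Thus counts near 0
  also exclude elements of \<open>A\<close> far from 0.\<close>

lemma multiset_eq_by_local_counts:
  fixes A B :: "real multiset"
  assumes sz: "size A = size B" and B: "\<And>b. b \<in># B \<Longrightarrow> \<bar>b\<bar> < q"
    and gt: "\<And>x. \<bar>x\<bar> < q \<Longrightarrow> size {#a \<in># A. a > x#} = size {#b \<in># B. b > x#}"
    and lt: "\<And>x. \<bar>x\<bar> < q \<Longrightarrow> size {#a \<in># A. a < x#} = size {#b \<in># B. b < x#}"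
  shows "A = B"
proof -
  have "count B x \<le> count A x" for x
  proof (cases "\<bar>x\<bar> < q")
    case True
    then show ?thesis using gt[OF True] lt[OF True] size_trichotomy[of A x] size_trichotomy[of B x] sz by simp
  next
    case False
    then have "x \<notin># B" using B by blast
    then show ?thesis by (simp add: not_in_iff)
  qed
  then have "B \<subseteq># A" by (simp add: subseteq_mset_def)
  then show ?thesis using sz by (metis mset_subset_size subset_mset.less_le nat_less_le)
qed

section \<open>Slopes, shifts and labellings\<close>

text \<open>Branches are numbered from 1 but lists from 0, hence \<open>k - 1\<close>.\<close>

lemma image_mset_nth:
  "image_mset (\<lambda>k. f (xs ! (k - 1))) (mset_set {1..length xs}) = image_mset f (mset xs)"
proof -
  have "map (\<lambda>k. xs ! (k - 1)) [1..<Suc (length xs)] = xs" by (rule nth_equalityI) (auto simp del: upt_Suc)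
  moreover have "mset_set {1..length xs} = mset [1..<Suc (length xs)]"
    by (metis atLeastLessThanSuc_atLeastAtMost mset_upt)
  ultimately have "image_mset (\<lambda>k. xs ! (k - 1)) (mset_set {1..length xs}) = mset xs" by (metis mset_map)
  from arg_cong[OF this, of "image_mset f"] show ?thesis by (simp add: image_mset.compositionality comp_def)
qed

lemma card_nth: "card {k \<in> {1..length xs}. P (xs ! (k - 1))} = size {#l \<in># mset xs. P l#}"
proof -
  have "size {#b \<in># image_mset (\<lambda>k. P (xs ! (k - 1))) (mset_set {1..length xs}). b#} = size {#b \<in># image_mset P (mset xs). b#}"
    unfolding image_mset_nth ..
  then show ?thesis by (simp add: filter_mset_image_mset comp_def filter_mset_mset_set)
qed

lemma tendsto_at_imp_at_right: "(f \<longlongrightarrow> c) (at (x::real)) \<Longrightarrow> (f \<longlongrightarrow> c) (at_right x)"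
  by (rule tendsto_mono[OF at_le]) auto

lemma branch_real_part:
  assumes l: "l analytic_on {0}" "l 0 = 0" "\<forall>\<^sub>F t in nhds 0. l (complex_of_real t) \<in> \<real>"
  shows "\<forall>\<^sub>F t in nhds 0. real_analytic_at (\<lambda>t. Re (l (complex_of_real t))) t"
    "(\<forall>\<^sub>F t in nhds 0. Re (l (complex_of_real t)) = 0) \<or> (\<exists>p\<ge>1. has_rate (\<lambda>t. Re (l (complex_of_real t))) p)"
    "((\<lambda>t. Re (l (complex_of_real t))) has_real_derivative Re (deriv l 0)) (at 0)"
proof -
  from l(1) obtain r where r: "r > 0" "l holomorphic_on ball 0 r" by (auto simp: analytic_at_ball)
  have "\<forall>\<^sub>F t in nhds 0. t \<in> ball (0::real) r" using r by (intro eventually_nhds_in_open) auto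
  then show "\<forall>\<^sub>F t in nhds 0. real_analytic_at (\<lambda>t. Re (l (complex_of_real t))) t"
    by eventually_elim (use real_analytic_at_Re[OF r(2)] in auto)
  have "\<forall>\<^sub>F t in nhds 0. l (complex_of_real t) = complex_of_real (Re (l (complex_of_real t)))"
    using l(3) by eventually_elim simp
  from analytic_rate_dichotomy[OF l(1) this] l(2)
  show "(\<forall>\<^sub>F t in nhds 0. Re (l (complex_of_real t)) = 0) \<or> (\<exists>p\<ge>1. has_rate (\<lambda>t. Re (l (complex_of_real t))) p)"
    unfolding has_rate_iff by (auto intro: tendsto_at_imp_at_right)
  have "(l has_field_derivative deriv l 0) (at (complex_of_real 0))"
    using analytic_on_imp_differentiable_at[OF l(1)] by (simp add: DERIV_deriv_iff_field_differentiable)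
  then have "((\<lambda>t. l (complex_of_real t)) has_vector_derivative deriv l 0) (at 0)"
    by (rule has_vector_derivative_real_field)
  from bounded_linear.has_vector_derivative[OF bounded_linear_Re this]
  show "((\<lambda>t. Re (l (complex_of_real t))) has_real_derivative Re (deriv l 0)) (at 0)"
    by (simp add: has_real_derivative_iff_has_vector_derivative)
qed

lemma has_field_derivative_sandwich:
  fixes M :: "complex \<Rightarrow> complex mat"
  assumes A: "A \<in> carrier_mat d d" and B: "B \<in> carrier_mat d d" and M: "\<And>z. M z \<in> carrier_mat d d"
    and M': "M' \<in> carrier_mat d d"
    and der: "\<And>i j. i < d \<Longrightarrow> j < d \<Longrightarrow> ((\<lambda>z. M z $$ (i, j)) has_field_derivative M' $$ (i, j)) (at x)"
    and ij: "i < d" "j < d"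
  shows "((\<lambda>z. (A * M z * B) $$ (i, j)) has_field_derivative (A * M' * B) $$ (i, j)) (at x)"
proof -
  have eq: "(A * N * B) $$ (i, j) = (\<Sum>l<d. (\<Sum>k<d. A $$ (i, k) * N $$ (k, l)) * B $$ (l, j))"
    if N: "N \<in> carrier_mat d d" for N
  proof -
    have "A * N \<in> carrier_mat d d" using A N by simp
    then have "(A * N * B) $$ (i, j) = (\<Sum>l<d. (A * N) $$ (i, l) * B $$ (l, j))"
      using A N B ij by (auto simp: scalar_prod_def atLeast0LessThan simp del: assoc_mult_mat intro!: sum.cong)
    also have "\<dots> = (\<Sum>l<d. (\<Sum>k<d. A $$ (i, k) * N $$ (k, l)) * B $$ (l, j))"
      using A N ij by (auto simp: scalar_prod_def atLeast0LessThan intro!: sum.cong)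
    finally show ?thesis .
  qed
  show ?thesis unfolding eq[OF M] eq[OF M']
    by (intro DERIV_sum DERIV_cmult_right DERIV_cmult der) (use ij in auto)
qed

text \<open>The chain rule along the line in direction (c, 1), from differentiability in both
  variables together.\<close>

lemma hol2_line_limit:
  assumes f: "hol2 f" "f 0 0 = 0"
  shows "((\<lambda>t. f (complex_of_real (c * t)) (complex_of_real t) / complex_of_real t) \<longlongrightarrow>
    complex_of_real c * deriv (\<lambda>z. f z 0) 0 + deriv (\<lambda>w. f 0 w) 0) (at_right 0)"
proof -
  from f obtain r where r: "r > 0" "hol2_on r f" by (auto simp: hol2_def)
  define a where "a = deriv (\<lambda>z. f z 0) 0"
  define b where "b = deriv (\<lambda>w. f 0 w) 0"
  have g: "((\<lambda>w. complex_of_real c * w) has_derivative (\<lambda>u. complex_of_real c * u)) (at 0)"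
    by (auto intro!: derivative_eq_intros)
  have F: "((\<lambda>(z, w). f z w) has_derivative (\<lambda>(u, v). a * u + b * v)) (at (complex_of_real c * 0, 0))"
    using hol2_on_has_derivative[OF r(2), of 0 0] r(1) by (simp add: a_def b_def)
  from has_derivative_compose[OF has_derivative_Pair[OF g has_derivative_ident] F]
  have "((\<lambda>w. f (complex_of_real c * w) w) has_derivative (\<lambda>u. a * (complex_of_real c * u) + b * u)) (at 0)" by simp
  moreover have "(\<lambda>u. a * (complex_of_real c * u) + b * u) = (*) (complex_of_real c * a + b)"
    by (auto simp: algebra_simps)
  ultimately have "((\<lambda>w. f (complex_of_real c * w) w) has_field_derivative (complex_of_real c * a + b)) (at 0)"
    by (simp add: has_field_derivative_def)
  then have lim: "((\<lambda>w. f (complex_of_real c * w) w / w) \<longlongrightarrow> complex_of_real c * a + b) (at 0)"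
    by (simp add: has_field_derivative_iff f(2))
  have "(complex_of_real \<longlongrightarrow> 0) (at_right 0)"
    by (rule tendsto_mono[OF _ filterlim_of_real_nhds_0]) (simp add: at_within_def)
  moreover have "\<forall>\<^sub>F t in at_right (0::real). complex_of_real t \<noteq> 0"
    unfolding eventually_at_right_field by (intro exI[of _ 1]) auto
  ultimately have "filterlim complex_of_real (at 0) (at_right 0)" by (rule filterlim_atI)
  from filterlim_compose[OF lim this] show ?thesis by (simp add: a_def b_def)
qed

text \<open>F(ct,t)/t tends to H = c + W. If \<open>c\<close> is neither a slope nor an eigenvalue
  of \<open>- W\<close>, then H is nonsingular and shares its negative index with F(ct,t) for small
  t > 0. On the side of F this index counts the slopes above \<open>c\<close>, on the side of H the
  eigenvalues of \<open>- W\<close> above \<open>c\<close>.\<close>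

lemma slopes_eq:
  assumes F: "herm_family d F" "F 0 0 = 0\<^sub>m d d" "unit_deriv d F" and L: "branches d F L"
    and W: "W \<in> carrier_mat d d" "\<And>i j. i < d \<Longrightarrow> j < d \<Longrightarrow> W $$ (i, j) = deriv (\<lambda>w. F 0 w $$ (i, j)) 0"
  shows "hermitian_mat W" "image_mset (\<lambda>l. Re (deriv l 0)) L = real_eigs (- W)"
proof -
  have lim: "((\<lambda>t. F (complex_of_real (c * t)) (complex_of_real t) $$ (i, j) / complex_of_real t) \<longlongrightarrow>
    complex_of_real c * (if i = j then 1 else 0) + W $$ (i, j)) (at_right 0)" if ij: "i < d" "j < d" for c i j
    using hol2_line_limit[OF herm_family_hol2[OF F(1) ij], of c] F(2,3) W(2)[OF ij] ij by (simp add: unit_deriv_def)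
  have hF: "\<forall>\<^sub>F (x, t) in nhds (0, 0). hermitian_mat (F (complex_of_real x) (complex_of_real t))"
    using F by (simp add: herm_family_def)
  have ray: "\<forall>\<^sub>F t in at_right 0. P (c * t) t" if "\<forall>\<^sub>F (x, t) in nhds (0::real, 0::real). P x t" for P c
  proof -
    have "((\<lambda>t::real. (c * t, t)) \<longlongrightarrow> (c * 0, 0)) (at_right 0)" by (intro tendsto_intros)
    then have "filterlim (\<lambda>t::real. (c * t, t)) (nhds (0, 0)) (at_right 0)" by simp
    from eventually_compose_filterlim[OF that this] show ?thesis by simp
  qed
  have hF': "\<forall>\<^sub>F t in at_right 0. hermitian_mat (F (complex_of_real (c * t)) (complex_of_real t))" for c
    by (rule ray[OF hF])
  show hW: "hermitian_mat W"
  proof (rule hermitian_matI[OF W(1)])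
    fix i j assume ij: "i < d" "j < d"
    have l1: "((\<lambda>t. F (complex_of_real (0 * t)) (complex_of_real t) $$ (i, j) / complex_of_real t) \<longlongrightarrow> W $$ (i, j)) (at_right 0)"
      using lim[OF ij, of 0] by simp
    have l2: "((\<lambda>t. cnj (F (complex_of_real (0 * t)) (complex_of_real t) $$ (j, i) / complex_of_real t)) \<longlongrightarrow> cnj (W $$ (j, i))) (at_right 0)"
      using tendsto_cnj[OF lim[OF ij(2,1), of 0]] by simp
    have "\<forall>\<^sub>F t in at_right 0. cnj (F (complex_of_real (0 * t)) (complex_of_real t) $$ (j, i) / complex_of_real t) =
      F (complex_of_real (0 * t)) (complex_of_real t) $$ (i, j) / complex_of_real t"
      using hF'[of 0] by eventually_elim (use hermitian_mat_index[OF _ herm_family_carrier[OF F(1)] ij] in simp)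
    from tendsto_cong[OF this] l2
    have "((\<lambda>t. F (complex_of_real (0 * t)) (complex_of_real t) $$ (i, j) / complex_of_real t) \<longlongrightarrow> cnj (W $$ (j, i))) (at_right 0)" by simp
    from tendsto_unique[OF _ l1 this] show "W $$ (i, j) = cnj (W $$ (j, i))" by simp
  qed
  have mW: "hermitian_mat (- W)" "- W \<in> carrier_mat d d" using hermitian_mat_uminus[OF hW W(1)] W(1) by auto
  define S where "S = (\<lambda>l. Re (deriv l 0)) ` set_mset L \<union> set_mset (real_eigs (- W))"
  show "image_mset (\<lambda>l. Re (deriv l 0)) L = real_eigs (- W)"
  proof (rule multiset_eq_by_upper_counts)
    show "finite S" by (simp add: S_def)
    fix c assume c: "c \<notin> S"
    \<comment> \<open>c + W, written through \<open>- W\<close> so that the affine eigenvalue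
      formulas apply.\<close>
    define H where "H = complex_of_real c \<cdot>\<^sub>m 1\<^sub>m d + complex_of_real (-1) \<cdot>\<^sub>m (- W)"
    have H: "hermitian_mat H" "H \<in> carrier_mat d d"
      unfolding H_def by (rule hermitian_mat_affine[OF mW], use mW in simp)
    have Hij: "H $$ (i, j) = complex_of_real c * (if i = j then 1 else 0) + W $$ (i, j)" if "i < d" "j < d" for i j
      using that W(1) by (simp add: H_def)
    have rH: "real_eigs H = image_mset (\<lambda>r. c + (-1) * r) (real_eigs (- W))"
      unfolding H_def by (rule real_eigs_affine[OF mW])
    have dH: "det H \<noteq> 0"
      using det_zero_real_eigs[OF H] c by (auto simp: rH count_eq_zero_iff S_def)
    obtain \<epsilon> where e: "\<epsilon> > 0" "\<And>A. A \<in> carrier_mat d d \<Longrightarrow> hermitian_mat A \<Longrightarrow>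
        (\<forall>i<d. \<forall>j<d. cmod (A $$ (i, j) - H $$ (i, j)) \<le> \<epsilon>) \<Longrightarrow> neg_inertia A = neg_inertia H"
      using inertia_locally_constant[OF H dH] by metis
    have near: "\<forall>\<^sub>F t in at_right 0. \<forall>i\<in>{..<d}. \<forall>j\<in>{..<d}.
      cmod (F (complex_of_real (c * t)) (complex_of_real t) $$ (i, j) / complex_of_real t - H $$ (i, j)) \<le> \<epsilon>"
    proof (intro eventually_ball_finite ballI)
      fix i j assume "i \<in> {..<d}" "j \<in> {..<d}"
      then have ij: "i < d" "j < d" by auto
      from tendstoD[OF lim[OF ij, of c] e(1)]
      show "\<forall>\<^sub>F t in at_right 0. cmod (F (complex_of_real (c * t)) (complex_of_real t) $$ (i, j) / complex_of_real t - H $$ (i, j)) \<le> \<epsilon>"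
        by eventually_elim (simp add: Hij[OF ij] dist_norm)
    qed auto
    have "\<forall>\<^sub>F (x, t) in nhds (0, 0). neg_inertia (F (complex_of_real x) (complex_of_real t)) = size {#l \<in># L. Re (l (complex_of_real t)) > x#}"
      using L by (auto simp: branches_def elim!: eventually_mono)
    from ray[OF this] have inL: "\<forall>\<^sub>F t in at_right 0.
      neg_inertia (F (complex_of_real (c * t)) (complex_of_real t)) = size {#l \<in># L. Re (l (complex_of_real t)) > c * t#}" .
    have pos: "\<forall>\<^sub>F t in at_right (0::real). t > 0" by (simp add: eventually_at_right_less)
    have sl: "\<forall>\<^sub>F t in at_right 0. \<forall>l\<in>set_mset L. (Re (l (complex_of_real t)) > c * t) = (Re (deriv l 0) > c)"
    proof (intro eventually_ball_finite ballI)
      fix l assume l: "l \<in># L"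
      have "((\<lambda>t. Re (l (complex_of_real t))) has_real_derivative Re (deriv l 0)) (at 0)" and l0: "l 0 = 0"
        using L l branch_real_part(3)[of l] by (auto simp: branches_def)
      then have "((\<lambda>t. Re (l (complex_of_real t)) / t) \<longlongrightarrow> Re (deriv l 0)) (at 0)"
        by (simp add: has_field_derivative_iff)
      then have lm: "((\<lambda>t. Re (l (complex_of_real t)) / t) \<longlongrightarrow> Re (deriv l 0)) (at_right 0)"
        by (rule tendsto_at_imp_at_right)
      have "Re (deriv l 0) \<noteq> c" using c l by (auto simp: S_def)
      then consider "Re (deriv l 0) > c" | "Re (deriv l 0) < c" by linarith
      then show "\<forall>\<^sub>F t in at_right 0. (Re (l (complex_of_real t)) > c * t) = (Re (deriv l 0) > c)"
      proof cases
        case 1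
        from order_tendstoD(1)[OF lm 1] pos show ?thesis
          by eventually_elim (use 1 in \<open>simp add: less_divide_eq\<close>)
      next
        case 2
        from order_tendstoD(2)[OF lm 2] pos show ?thesis
          by eventually_elim (use 2 in \<open>simp add: divide_less_eq\<close>)
      qed
    qed auto
    have "\<forall>\<^sub>F t in at_right (0::real). size {#l \<in># L. Re (deriv l 0) > c#} = size {#r \<in># real_eigs (- W). r > c#}"
      using near hF'[of c] inL pos sl
    proof eventually_elim
      case (elim t)
      define A where "A = F (complex_of_real (c * t)) (complex_of_real t)"
      have A: "hermitian_mat A" "A \<in> carrier_mat d d" using elim(2) herm_family_carrier[OF F(1)] by (auto simp: A_def)
      have "neg_inertia (complex_of_real (1 / t) \<cdot>\<^sub>m A) = neg_inertia H"
      proof (rule e(2)[OF _ hermitian_mat_smult[OF A]])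
        show "\<forall>i<d. \<forall>j<d. cmod ((complex_of_real (1 / t) \<cdot>\<^sub>m A) $$ (i, j) - H $$ (i, j)) \<le> \<epsilon>"
          using elim(1) A(2) by (auto simp: A_def)
      qed (use A in simp)
      then have "neg_inertia A = neg_inertia H" using neg_inertia_smult(1)[OF A, of "1 / t"] elim(4) by simp
      also have "\<dots> = size {#r \<in># real_eigs (- W). r > c#}"
        unfolding H_def neg_inertia_affine(1)[OF mW] by simp
      finally have "size {#r \<in># real_eigs (- W). r > c#} = size {#l \<in># L. Re (l (complex_of_real t)) > c * t#}"
        using elim(3) by (simp add: A_def)
      also have "{#l \<in># L. Re (l (complex_of_real t)) > c * t#} = {#l \<in># L. Re (deriv l 0) > c#}"
        by (rule filter_mset_cong) (use elim(5) in auto)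
      finally show ?case by simp
    qed
    then show "size {#a \<in># image_mset (\<lambda>l. Re (deriv l 0)) L. a > c#} = size {#b \<in># real_eigs (- W). b > c#}"
      by (simp add: filter_mset_image_mset comp_def)
  qed
qed

lemma qform_affine:
  assumes H: "H \<in> carrier_mat d d" and v: "v \<in> carrier_vec d"
  shows "Re (((complex_of_real c \<cdot>\<^sub>m 1\<^sub>m d + complex_of_real s \<cdot>\<^sub>m H) *\<^sub>v v) \<bullet>c v) = c * nsq v + s * Re ((H *\<^sub>v v) \<bullet>c v)"
proof -
  have Hv: "H *\<^sub>v v \<in> carrier_vec d" and v': "conjugate v \<in> carrier_vec d" using H v by auto
  have "(complex_of_real c \<cdot>\<^sub>m 1\<^sub>m d + complex_of_real s \<cdot>\<^sub>m H) *\<^sub>v v = complex_of_real c \<cdot>\<^sub>v v + complex_of_real s \<cdot>\<^sub>v (H *\<^sub>v v)"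
  proof -
    have "(complex_of_real c \<cdot>\<^sub>m 1\<^sub>m d + complex_of_real s \<cdot>\<^sub>m H) *\<^sub>v v
      = (complex_of_real c \<cdot>\<^sub>m 1\<^sub>m d) *\<^sub>v v + (complex_of_real s \<cdot>\<^sub>m H) *\<^sub>v v"
      by (rule add_mult_distrib_mat_vec) (use H v in auto)
    moreover have "(complex_of_real c \<cdot>\<^sub>m 1\<^sub>m d) *\<^sub>v v = complex_of_real c \<cdot>\<^sub>v v"
      using v by (intro eq_vecI) auto
    moreover have "(complex_of_real s \<cdot>\<^sub>m H) *\<^sub>v v = complex_of_real s \<cdot>\<^sub>v (H *\<^sub>v v)"
      using v H by (intro eq_vecI) auto
    ultimately show ?thesis by simp
  qed
  then have "((complex_of_real c \<cdot>\<^sub>m 1\<^sub>m d + complex_of_real s \<cdot>\<^sub>m H) *\<^sub>v v) \<bullet>c v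
    = complex_of_real c * (v \<bullet>c v) + complex_of_real s * ((H *\<^sub>v v) \<bullet>c v)"
    using add_scalar_prod_distrib[of "complex_of_real c \<cdot>\<^sub>v v" d "complex_of_real s \<cdot>\<^sub>v (H *\<^sub>v v)" "conjugate v"] v v' Hv
    by simp
  then show ?thesis by (simp add: cscalar_nsq)
qed

text \<open>For x > 0 the difference F(x,t) - F(0,t) lies between \<alpha>x and \<beta>x as a form,
  and for negative arguments the order is reversed. Monotonicity of the index then compares F with
  scalar shifts of F(0,t), whose eigenvalues are explicit.\<close>

lemma inertia_shift_bounds:
  assumes F: "herm_family d F" and P: "pos_def_mat P" "P \<in> carrier_mat d d"
    and PF: "\<And>i j. i < d \<Longrightarrow> j < d \<Longrightarrow> P $$ (i, j) = deriv (\<lambda>z. F z 0 $$ (i, j)) 0"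
  obtains \<alpha> \<beta> where "\<alpha> > 0" "\<beta> > 0" "\<forall>\<^sub>F (x, t) in nhds (0, 0).
    (x > 0 \<longrightarrow> size {#r \<in># real_eigs (F 0 (complex_of_real t)). r < - (\<beta> * x)#} \<le> neg_inertia (F (complex_of_real x) (complex_of_real t)) \<and>
      neg_inertia (F (complex_of_real x) (complex_of_real t)) \<le> size {#r \<in># real_eigs (F 0 (complex_of_real t)). r < - (\<alpha> * x)#} \<and>
      size {#r \<in># real_eigs (F 0 (complex_of_real t)). r > \<beta> * x#} \<le> neg_inertia (- F (complex_of_real (- x)) (complex_of_real t)) \<and>
      neg_inertia (- F (complex_of_real (- x)) (complex_of_real t)) \<le> size {#r \<in># real_eigs (F 0 (complex_of_real t)). r > \<alpha> * x#})"
proof -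
  obtain \<delta> where \<delta>: "\<delta> > 0" "\<forall>v\<in>carrier_vec d. \<delta> * nsq v \<le> Re ((P *\<^sub>v v) \<bullet>c v)"
    by (rule pos_def_lower_bound[OF P])
  \<comment> \<open>The increment estimate then perturbs the form of \<open>P\<close> by at most
    half its lower bound \<open>\<delta>\<close>, which leaves
    \<open>\<alpha> = \<delta> / 2\<close>. From above, the form of \<open>P\<close> is bounded by
    \<open>B * d\<close>, and the remaining \<open>\<delta>\<close> in \<open>\<beta>\<close>
    absorbs the error.\<close>
  define \<epsilon> where "\<epsilon> = \<delta> / (2 * (d + 1))"
  have e: "\<epsilon> > 0" using \<delta> by (simp add: \<epsilon>_def)
  have ed: "\<epsilon> * d \<le> \<delta> / 2" using \<delta> by (simp add: \<epsilon>_def field_simps)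
  define B where "B = (\<Sum>q\<in>{..<d} \<times> {..<d}. cmod (P $$ q))"
  have B: "cmod (P $$ (i, j)) \<le> B" if "i < d" "j < d" for i j
    unfolding B_def by (rule member_le_sum) (use that in auto)
  have B0: "B \<ge> 0" by (simp add: B_def sum_nonneg)
  define \<alpha> where "\<alpha> = \<delta> / 2"
  define \<beta> where "\<beta> = B * d + \<delta>"
  have ab: "\<alpha> > 0" "\<beta> > 0" using \<delta> B0 by (auto simp: \<alpha>_def \<beta>_def add_nonneg_pos)
  have "\<forall>i\<in>{..<d}. \<forall>j\<in>{..<d}. \<exists>s>0. \<forall>z z' w. z \<in> ball 0 s \<longrightarrow> z' \<in> ball 0 s \<longrightarrow> w \<in> ball 0 s \<longrightarrow>
    cmod (F z w $$ (i, j) - F z' w $$ (i, j) - P $$ (i, j) * (z - z')) \<le> \<epsilon> * cmod (z - z')"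
  proof (intro ballI)
    fix i j assume "i \<in> {..<d}" "j \<in> {..<d}"
    then have ij: "i < d" "j < d" by auto
    show "\<exists>s>0. \<forall>z z' w. z \<in> ball 0 s \<longrightarrow> z' \<in> ball 0 s \<longrightarrow> w \<in> ball 0 s \<longrightarrow>
      cmod (F z w $$ (i, j) - F z' w $$ (i, j) - P $$ (i, j) * (z - z')) \<le> \<epsilon> * cmod (z - z')"
      unfolding PF[OF ij] by (rule hol2_increment_estimate[OF herm_family_hol2[OF F ij] e]) blast
  qed
  then obtain s where s: "\<And>i j. i < d \<Longrightarrow> j < d \<Longrightarrow> s i j > 0"
    "\<And>i j z z' w. i < d \<Longrightarrow> j < d \<Longrightarrow> z \<in> ball 0 (s i j) \<Longrightarrow> z' \<in> ball 0 (s i j) \<Longrightarrow> w \<in> ball 0 (s i j) \<Longrightarrow>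
    cmod (F z w $$ (i, j) - F z' w $$ (i, j) - P $$ (i, j) * (z - z')) \<le> \<epsilon> * cmod (z - z')" by (metis lessThan_iff)
  define q where "q = Min (insert 1 ((\<lambda>(i, j). s i j) ` ({..<d} \<times> {..<d})))"
  have q: "q > 0" unfolding q_def by (subst Min_gr_iff) (auto simp: s)
  have qs: "q \<le> s i j" if "i < d" "j < d" for i j unfolding q_def using that by (intro Min_le) auto
  have hF: "\<forall>\<^sub>F (x, t) in nhds (0, 0). hermitian_mat (F (complex_of_real x) (complex_of_real t))"
    using F by (simp add: herm_family_def)
  obtain q2 where q2: "q2 > 0" "\<And>x t. \<bar>x\<bar> < q2 \<Longrightarrow> \<bar>t\<bar> < q2 \<Longrightarrow> hermitian_mat (F (complex_of_real x) (complex_of_real t))"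
    by (rule eventually_nhds_00_box[OF hF]) blast
  \<comment> \<open>The factor \<open>sgn x\<close> treats both signs of \<open>x\<close> at
    once.\<close>
  have key: "\<alpha> * \<bar>x\<bar> * nsq v \<le> sgn x * (Re ((F (complex_of_real x) (complex_of_real t) *\<^sub>v v) \<bullet>c v) - Re ((F 0 (complex_of_real t) *\<^sub>v v) \<bullet>c v)) \<and>
    sgn x * (Re ((F (complex_of_real x) (complex_of_real t) *\<^sub>v v) \<bullet>c v) - Re ((F 0 (complex_of_real t) *\<^sub>v v) \<bullet>c v)) \<le> \<beta> * \<bar>x\<bar> * nsq v"
    if xt: "\<bar>x\<bar> < q" "\<bar>t\<bar> < q" "x \<noteq> 0" and v: "v \<in> carrier_vec d" for x t v
  proof -
    define A H where "A = F (complex_of_real x) (complex_of_real t)" and "H = F 0 (complex_of_real t)"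
    have A: "A \<in> carrier_mat d d" and H: "H \<in> carrier_mat d d" using herm_family_carrier[OF F] by (auto simp: A_def H_def)
    define Y where "Y = complex_of_real 0 \<cdot>\<^sub>m 1\<^sub>m d + complex_of_real x \<cdot>\<^sub>m P"
    have Y: "Y \<in> carrier_mat d d" using P by (simp add: Y_def)
    have AH: "A - H \<in> carrier_mat d d" by (rule minus_carrier_mat[OF H])
    have "\<bar>Re (((A - H - Y) *\<^sub>v v) \<bullet>c v)\<bar> \<le> \<epsilon> * \<bar>x\<bar> * d * nsq v"
    proof (rule qform_bound[OF minus_carrier_mat[OF Y] v])
      fix i j assume ij: "i < d" "j < d"
      have "cmod (F (complex_of_real x) (complex_of_real t) $$ (i, j) - F 0 (complex_of_real t) $$ (i, j) - P $$ (i, j) * (complex_of_real x - 0)) \<le> \<epsilon> * cmod (complex_of_real x - 0)"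
        using xt qs[OF ij] q by (intro s(2)[OF ij]) auto
      then show "cmod ((A - H - Y) $$ (i, j)) \<le> \<epsilon> * \<bar>x\<bar>"
        using A H P(2) ij by (simp add: Y_def A_def H_def mult.commute)
    qed
    moreover have "Re ((Y *\<^sub>v v) \<bullet>c v) = x * Re ((P *\<^sub>v v) \<bullet>c v)"
      unfolding Y_def using qform_affine[OF P(2) v, of 0 x] by simp
    ultimately have est: "\<bar>Re ((A *\<^sub>v v) \<bullet>c v) - Re ((H *\<^sub>v v) \<bullet>c v) - x * Re ((P *\<^sub>v v) \<bullet>c v)\<bar> \<le> \<epsilon> * d * (\<bar>x\<bar> * nsq v)"
      using qform_diff[OF A H v] qform_diff[OF AH Y v] by (simp add: mult_ac)
    have "\<epsilon> * d * (\<bar>x\<bar> * nsq v) \<le> \<delta> / 2 * (\<bar>x\<bar> * nsq v)" using ed by (intro mult_right_mono) auto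
    with est have est2: "\<bar>Re ((A *\<^sub>v v) \<bullet>c v) - Re ((H *\<^sub>v v) \<bullet>c v) - x * Re ((P *\<^sub>v v) \<bullet>c v)\<bar> \<le> \<delta> / 2 * (\<bar>x\<bar> * nsq v)" by linarith
    have "\<bar>Re ((P *\<^sub>v v) \<bullet>c v)\<bar> \<le> B * d * nsq v" by (rule qform_bound[OF P(2) v B])
    then have pu: "\<bar>x\<bar> * Re ((P *\<^sub>v v) \<bullet>c v) \<le> \<bar>x\<bar> * (B * d * nsq v)" by (intro mult_left_mono) auto
    have pl: "\<bar>x\<bar> * (\<delta> * nsq v) \<le> \<bar>x\<bar> * Re ((P *\<^sub>v v) \<bullet>c v)" using \<delta>(2) v by (intro mult_left_mono) auto
    define E where "E = \<delta> / 2 * (\<bar>x\<bar> * nsq v)"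
    define X where "X = sgn x * (Re ((A *\<^sub>v v) \<bullet>c v) - Re ((H *\<^sub>v v) \<bullet>c v))"
    have "\<bar>X - \<bar>x\<bar> * Re ((P *\<^sub>v v) \<bullet>c v)\<bar> \<le> E"
      using est2 xt(3) unfolding E_def X_def by (cases "x > 0") (auto simp: abs_if split: if_splits)
    moreover have "2 * E \<le> \<bar>x\<bar> * Re ((P *\<^sub>v v) \<bullet>c v)" using pl by (simp add: E_def algebra_simps)
    ultimately have "E \<le> X" "X \<le> \<bar>x\<bar> * (B * d * nsq v) + E" using pu by linarith+
    then have "\<delta> / 2 * (\<bar>x\<bar> * nsq v) \<le> sgn x * (Re ((A *\<^sub>v v) \<bullet>c v) - Re ((H *\<^sub>v v) \<bullet>c v))"
      "sgn x * (Re ((A *\<^sub>v v) \<bullet>c v) - Re ((H *\<^sub>v v) \<bullet>c v)) \<le> \<bar>x\<bar> * (B * d * nsq v) + \<delta> / 2 * (\<bar>x\<bar> * nsq v)"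
      unfolding E_def X_def .
    moreover have "\<bar>x\<bar> * (B * d * nsq v) + \<delta> / 2 * (\<bar>x\<bar> * nsq v) \<le> \<beta> * \<bar>x\<bar> * nsq v"
    proof -
      have "\<beta> * \<bar>x\<bar> * nsq v = \<bar>x\<bar> * (B * d * nsq v) + \<delta> * (\<bar>x\<bar> * nsq v)" by (simp add: \<beta>_def algebra_simps)
      moreover have "\<delta> / 2 * (\<bar>x\<bar> * nsq v) \<le> \<delta> * (\<bar>x\<bar> * nsq v)" using \<delta>(1) by (intro mult_right_mono) auto
      ultimately show ?thesis by linarith
    qed
    ultimately show ?thesis by (auto simp: \<alpha>_def A_def H_def mult.assoc)
  qed
  define m where "m = min q q2"
  have m: "m > 0" using q q2 by (simp add: m_def)
  have "\<forall>\<^sub>F p in nhds (0, 0). p \<in> ball (0::real) m \<times> ball (0::real) m"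
    using m by (intro eventually_nhds_in_open open_Times) auto
  then have "\<forall>\<^sub>F (x, t) in nhds (0, 0).
    (x > 0 \<longrightarrow> size {#r \<in># real_eigs (F 0 (complex_of_real t)). r < - (\<beta> * x)#} \<le> neg_inertia (F (complex_of_real x) (complex_of_real t)) \<and>
      neg_inertia (F (complex_of_real x) (complex_of_real t)) \<le> size {#r \<in># real_eigs (F 0 (complex_of_real t)). r < - (\<alpha> * x)#} \<and>
      size {#r \<in># real_eigs (F 0 (complex_of_real t)). r > \<beta> * x#} \<le> neg_inertia (- F (complex_of_real (- x)) (complex_of_real t)) \<and>
      neg_inertia (- F (complex_of_real (- x)) (complex_of_real t)) \<le> size {#r \<in># real_eigs (F 0 (complex_of_real t)). r > \<alpha> * x#})"
  proof eventually_elim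
    case (elim p)
    obtain x t where p: "p = (x, t)" by (cases p)
    have xt: "\<bar>x\<bar> < q" "\<bar>t\<bar> < q" "\<bar>x\<bar> < q2" "\<bar>t\<bar> < q2" using elim by (auto simp: p m_def)
    show ?case unfolding p prod.case
    proof
      assume x: "x > 0"
      define H A A' where "H = F 0 (complex_of_real t)" and "A = F (complex_of_real x) (complex_of_real t)"
        and "A' = - F (complex_of_real (- x)) (complex_of_real t)"
      have H: "hermitian_mat H" "H \<in> carrier_mat d d"
        using q2(2)[of 0 t] q2(1) xt herm_family_carrier[OF F] by (auto simp: H_def)
      have A: "hermitian_mat A" "A \<in> carrier_mat d d"
        using q2(2)[of x t] xt herm_family_carrier[OF F] by (auto simp: A_def)
      have A'0: "hermitian_mat (F (complex_of_real (- x)) (complex_of_real t))"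
        using q2(2)[of "- x" t] xt by simp
      have A': "hermitian_mat A'" "A' \<in> carrier_mat d d"
        using hermitian_mat_uminus[OF A'0 herm_family_carrier[OF F]] herm_family_carrier[OF F, of "complex_of_real (- x)" "complex_of_real t"]
        by (auto simp: A'_def)
      have kA: "\<alpha> * x * nsq v + Re ((H *\<^sub>v v) \<bullet>c v) \<le> Re ((A *\<^sub>v v) \<bullet>c v)" "Re ((A *\<^sub>v v) \<bullet>c v) \<le> \<beta> * x * nsq v + Re ((H *\<^sub>v v) \<bullet>c v)"
        if "v \<in> carrier_vec d" for v
        using key[of x t v] xt x that by (auto simp: A_def H_def)
      have kA': "\<alpha> * x * nsq v - Re ((H *\<^sub>v v) \<bullet>c v) \<le> Re ((A' *\<^sub>v v) \<bullet>c v)" "Re ((A' *\<^sub>v v) \<bullet>c v) \<le> \<beta> * x * nsq v - Re ((H *\<^sub>v v) \<bullet>c v)"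
        if v: "v \<in> carrier_vec d" for v
      proof -
        have "(A' *\<^sub>v v) \<bullet>c v = - ((F (complex_of_real (- x)) (complex_of_real t) *\<^sub>v v) \<bullet>c v)"
          using herm_family_carrier[OF F, of "complex_of_real (- x)" "complex_of_real t"] v
          by (simp add: A'_def uminus_mult_mat_vec uminus_scalar_prod[symmetric, of _ d])
        then show "\<alpha> * x * nsq v - Re ((H *\<^sub>v v) \<bullet>c v) \<le> Re ((A' *\<^sub>v v) \<bullet>c v)" "Re ((A' *\<^sub>v v) \<bullet>c v) \<le> \<beta> * x * nsq v - Re ((H *\<^sub>v v) \<bullet>c v)"
          using key[of "- x" t v] xt x v by (auto simp: H_def)
      qed
      have af: "hermitian_mat (complex_of_real c \<cdot>\<^sub>m 1\<^sub>m d + complex_of_real s \<cdot>\<^sub>m H)"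
        "complex_of_real c \<cdot>\<^sub>m 1\<^sub>m d + complex_of_real s \<cdot>\<^sub>m H \<in> carrier_mat d d" for c s
        using hermitian_mat_affine[OF H] H by auto
      have n1: "neg_inertia (complex_of_real (\<beta> * x) \<cdot>\<^sub>m 1\<^sub>m d + complex_of_real 1 \<cdot>\<^sub>m H) \<le> neg_inertia A"
        by (rule neg_inertia_mono[OF A af]) (use kA in \<open>simp only: qform_affine[OF H(2)]\<close>, simp)
      have n2: "neg_inertia A \<le> neg_inertia (complex_of_real (\<alpha> * x) \<cdot>\<^sub>m 1\<^sub>m d + complex_of_real 1 \<cdot>\<^sub>m H)"
        by (rule neg_inertia_mono[OF af A]) (use kA in \<open>simp only: qform_affine[OF H(2)]\<close>, simp)
      have n3: "neg_inertia (complex_of_real (\<beta> * x) \<cdot>\<^sub>m 1\<^sub>m d + complex_of_real (-1) \<cdot>\<^sub>m H) \<le> neg_inertia A'"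
        by (rule neg_inertia_mono[OF A' af]) (use kA' in \<open>simp only: qform_affine[OF H(2)]\<close>, simp)
      have n4: "neg_inertia A' \<le> neg_inertia (complex_of_real (\<alpha> * x) \<cdot>\<^sub>m 1\<^sub>m d + complex_of_real (-1) \<cdot>\<^sub>m H)"
        by (rule neg_inertia_mono[OF af A']) (use kA' in \<open>simp only: qform_affine[OF H(2)]\<close>, simp)
      have c: "(c + 1 * r < 0) = (r < - c)" "(c + (-1) * r < 0) = (r > c)" for c r :: real by linarith+
      show "size {#r \<in># real_eigs (F 0 (complex_of_real t)). r < - (\<beta> * x)#} \<le> neg_inertia (F (complex_of_real x) (complex_of_real t)) \<and>
      neg_inertia (F (complex_of_real x) (complex_of_real t)) \<le> size {#r \<in># real_eigs (F 0 (complex_of_real t)). r < - (\<alpha> * x)#} \<and>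
      size {#r \<in># real_eigs (F 0 (complex_of_real t)). r > \<beta> * x#} \<le> neg_inertia (- F (complex_of_real (- x)) (complex_of_real t)) \<and>
      neg_inertia (- F (complex_of_real (- x)) (complex_of_real t)) \<le> size {#r \<in># real_eigs (F 0 (complex_of_real t)). r > \<alpha> * x#}"
        using n1 n2 n3 n4 unfolding neg_inertia_affine(1)[OF H] c unfolding A_def A'_def H_def by simp
    qed
  qed
  then show ?thesis by (rule that[OF ab])
qed

text \<open>Rellich's theorem at the origin: the branches of the family \<open>z - F(0,w)\<close>,
  which has unit derivative, are the eigenvalues of F(0,t). The counts are known only for levels
  near 0; equality of the sizes accounts for all eigenvalues.\<close>

lemma eigenvalue_branches:
  assumes F: "herm_family d F" "F 0 0 = 0\<^sub>m d d"
  obtains L where "size L = d"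
    "\<forall>l\<in>#L. l analytic_on {0} \<and> l 0 = 0 \<and> (\<forall>\<^sub>F t in nhds 0. l (complex_of_real t) \<in> \<real>)"
    "\<forall>\<^sub>F t in nhds 0. real_eigs (F 0 (complex_of_real t)) = image_mset (\<lambda>l. Re (l (complex_of_real t))) L"
proof -
  define G where "G z w = z \<cdot>\<^sub>m 1\<^sub>m d - F 0 w" for z w
  have hF: "\<forall>\<^sub>F (x, t) in nhds (0, 0). hermitian_mat (F (complex_of_real x) (complex_of_real t))"
    using F by (simp add: herm_family_def)
  from eventually_nhds_00_slice[OF hF] have hF0: "\<forall>\<^sub>F t in nhds 0. hermitian_mat (F 0 (complex_of_real t))" by simp
  note Fc = herm_family_carrier[OF F(1)]
  have Gaff: "G (complex_of_real x) w = complex_of_real x \<cdot>\<^sub>m 1\<^sub>m d + complex_of_real (-1) \<cdot>\<^sub>m F 0 w" for x w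
    using Fc[of 0 w] by (intro eq_matI) (auto simp: G_def)
  have Gij: "G z w $$ (i, j) = z * (if i = j then 1 else 0) - F 0 w $$ (i, j)" if "i < d" "j < d" for z w i j
    using that Fc[of 0 w] by (simp add: G_def)
  have G: "herm_family d G"
    unfolding herm_family_def
  proof (intro conjI allI impI)
    show "G z w \<in> carrier_mat d d" for z w unfolding G_def by (rule minus_carrier_mat[OF Fc])
    show "hol2 (\<lambda>z w. G z w $$ (i, j))" if ij: "i < d" "j < d" for i j
      unfolding Gij[OF ij]
      by (intro hol2_diff hol2_mult hol2_fst hol2_const hol2_of_snd hol2_restrict_snd herm_family_hol2[OF F(1) ij])
    show "\<forall>\<^sub>F (x, t) in nhds (0, 0). hermitian_mat (G (complex_of_real x) (complex_of_real t))"
      using eventually_nhds_00_snd[OF hF0, of 0]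
    proof eventually_elim
      case (elim q)
      then have "hermitian_mat (F 0 (complex_of_real (snd q)))" by (simp add: split_beta')
      from hermitian_mat_affine[OF this Fc, of "fst q" "-1"] show ?case by (simp add: split_beta' Gaff)
    qed
  qed
  have G0: "G 0 0 = 0\<^sub>m d d" by (rule eq_matI) (auto simp: G_def F(2))
  have uG: "unit_deriv d G"
    unfolding unit_deriv_def
  proof (intro allI impI)
    fix i j assume ij: "i < d" "j < d"
    have "((\<lambda>z. z * (if i = j then 1 else 0) - F 0 0 $$ (i, j)) has_field_derivative (if i = j then 1 else 0)) (at 0)"
      by (auto intro!: derivative_eq_intros)
    then show "deriv (\<lambda>z. G z 0 $$ (i, j)) 0 = (if i = j then 1 else 0)"
      unfolding Gij[OF ij] by (rule DERIV_imp_deriv)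
  qed
  from analytic_branches[OF G G0 uG] obtain L where L: "branches d G L" ..
  then have La: "\<forall>l\<in>#L. l analytic_on {0} \<and> l 0 = 0 \<and> (\<forall>\<^sub>F t in nhds 0. l (complex_of_real t) \<in> \<real>)" and Ls: "size L = d"
    by (auto simp: branches_def)
  have "\<forall>\<^sub>F (x, t) in nhds (0, 0).
        neg_inertia (G (complex_of_real x) (complex_of_real t)) = size {#l \<in># L. Re (l (complex_of_real t)) > x#} \<and>
        neg_inertia (- G (complex_of_real x) (complex_of_real t)) = size {#l \<in># L. Re (l (complex_of_real t)) < x#}"
    using L by (simp add: branches_def)
  then obtain q where q: "q > 0" "\<And>x t. \<bar>x\<bar> < q \<Longrightarrow> \<bar>t\<bar> < q \<Longrightarrow>
        neg_inertia (G (complex_of_real x) (complex_of_real t)) = size {#l \<in># L. Re (l (complex_of_real t)) > x#} \<and>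
        neg_inertia (- G (complex_of_real x) (complex_of_real t)) = size {#l \<in># L. Re (l (complex_of_real t)) < x#}"
    by (rule eventually_nhds_00_box) blast
  have sm: "\<forall>\<^sub>F t in nhds 0. \<forall>l\<in>set_mset L. \<bar>Re (l (complex_of_real t))\<bar> < q"
  proof (intro eventually_ball_finite ballI finite_set_mset)
    fix l assume "l \<in># L"
    then have "l analytic_on {0}" "l 0 = 0" using La by auto
    then have "(l \<longlongrightarrow> 0) (nhds 0)"
      using analytic_at_imp_isCont[of l 0] by (simp add: isCont_def tendsto_nhds_iff)
    from tendstoD[OF filterlim_compose[OF this filterlim_of_real_nhds_0] q(1)]
    show "\<forall>\<^sub>F t in nhds 0. \<bar>Re (l (complex_of_real t))\<bar> < q"
      by eventually_elim (auto intro: le_less_trans[OF abs_Re_le_cmod])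
  qed
  have "\<forall>\<^sub>F t in nhds 0. t \<in> ball (0::real) q" using q by (intro eventually_nhds_in_open) auto
  with sm hF0 have "\<forall>\<^sub>F t in nhds 0. real_eigs (F 0 (complex_of_real t)) = image_mset (\<lambda>l. Re (l (complex_of_real t))) L"
  proof eventually_elim
    case (elim t)
    have H: "hermitian_mat (F 0 (complex_of_real t))" "F 0 (complex_of_real t) \<in> carrier_mat d d" using elim Fc by auto
    show ?case
    proof (rule multiset_eq_by_local_counts)
      show "size (real_eigs (F 0 (complex_of_real t))) = size (image_mset (\<lambda>l. Re (l (complex_of_real t))) L)"
        using size_real_eigs[OF H(2)] Ls by simp
      show "\<bar>b\<bar> < q" if "b \<in># image_mset (\<lambda>l. Re (l (complex_of_real t))) L" for b using that elim by auto
      fix x :: real assume x: "\<bar>x\<bar> < q"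
      have c: "(x + (-1) * r < 0) = (r > x)" "(x + (-1) * r > 0) = (r < x)" for r by linarith+
      show "size {#a \<in># real_eigs (F 0 (complex_of_real t)). a > x#} = size {#b \<in># image_mset (\<lambda>l. Re (l (complex_of_real t))) L. b > x#}"
        using q(2)[OF x, of t] elim neg_inertia_affine(1)[OF H, of x "-1"] unfolding Gaff c
        by (simp add: filter_mset_image_mset comp_def)
      show "size {#a \<in># real_eigs (F 0 (complex_of_real t)). a < x#} = size {#b \<in># image_mset (\<lambda>l. Re (l (complex_of_real t))) L. b < x#}"
        using q(2)[OF x, of t] elim neg_inertia_affine(2)[OF H, of x "-1"] unfolding Gaff c
        by (simp add: filter_mset_image_mset comp_def)
    qed
  qed
  then show ?thesis by (rule that[OF Ls La])
qed

section \<open>Hermitian families with positive definite derivative\<close>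

lemma analytic_has_deriv_at_0: "f analytic_on {0} \<Longrightarrow> (f has_field_derivative deriv f 0) (at 0)"
  by (simp add: DERIV_deriv_iff_field_differentiable analytic_on_imp_differentiable_at)

text \<open>Identifies the vector derivatives behind \<open>mat_partial1\<close> and
  \<open>mat_partial2\<close> with complex derivatives of the holomorphic extension.\<close>

lemma analytic_vector_derivative_at_0:
  assumes g: "g analytic_on {0}" and eq: "\<forall>\<^sub>F t in nhds 0. g (complex_of_real t) = f t"
  shows "vector_derivative f (at 0) = deriv g 0"
proof -
  have "((\<lambda>t. g (complex_of_real t)) has_vector_derivative deriv g 0) (at 0)"
    using analytic_has_deriv_at_0[OF g] by (intro has_vector_derivative_real_field) simp
  moreover have "vector_derivative f (at 0) = vector_derivative (\<lambda>t. g (complex_of_real t)) (at 0)"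
    by (rule vector_derivative_cong_eq) (use eq in \<open>auto elim!: eventually_mono\<close>)
  ultimately show ?thesis by (simp add: vector_derivative_at)
qed

text \<open>The entries are extended one by one. The extension agrees with \<open>F\<close> at real
  points near the origin, and Hermitian symmetry is inherited there.\<close>

lemma mat_complexification:
  fixes F :: "real \<Rightarrow> real \<Rightarrow> complex mat"
  assumes an: "\<And>i j. i < d \<Longrightarrow> j < d \<Longrightarrow> real_analytic2_at (\<lambda>x t. F x t $$ (i, j)) 0 0"
    and dim: "\<forall>\<^sub>F (x, t) in nhds (0, 0). F x t \<in> carrier_mat d d"
    and herm: "\<forall>\<^sub>F (x, t) in nhds (0, 0). hermitian_mat (F x t)"
  obtains G where "herm_family d G"
    "\<forall>\<^sub>F (x, t) in nhds (0, 0). G (complex_of_real x) (complex_of_real t) = F x t"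
    "mat_partial1 F 0 0 = mat d d (\<lambda>(i, j). deriv (\<lambda>z. G z 0 $$ (i, j)) 0)"
    "mat_partial2 F 0 0 = mat d d (\<lambda>(i, j). deriv (\<lambda>w. G 0 w $$ (i, j)) 0)"
proof -
  have "\<forall>q\<in>{..<d} \<times> {..<d}. \<exists>g. hol2 g \<and>
    (\<forall>\<^sub>F (x, t) in nhds (0, 0). g (complex_of_real x) (complex_of_real t) = F x t $$ q)"
  proof
    fix q assume "q \<in> {..<d} \<times> {..<d}"
    then have "real_analytic2_at (\<lambda>x t. F x t $$ q) 0 0" using an by auto
    then show "\<exists>g. hol2 g \<and> (\<forall>\<^sub>F (x, t) in nhds (0, 0). g (complex_of_real x) (complex_of_real t) = F x t $$ q)"
      by (rule real_analytic2_complexification) blast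
  qed
  from bchoice[OF this] obtain g where g: "\<And>q. q \<in> {..<d} \<times> {..<d} \<Longrightarrow> hol2 (g q)"
    "\<And>q. q \<in> {..<d} \<times> {..<d} \<Longrightarrow> \<forall>\<^sub>F (x, t) in nhds (0, 0). g q (complex_of_real x) (complex_of_real t) = F x t $$ q"
    by auto
  define G where "G z w = mat d d (\<lambda>q. g q z w)" for z w
  have Gij: "G z w $$ (i, j) = g (i, j) z w" if "i < d" "j < d" for z w i j using that by (simp add: G_def)
  have "\<forall>\<^sub>F p in nhds (0, 0). \<forall>q\<in>{..<d} \<times> {..<d}.
      g q (complex_of_real (fst p)) (complex_of_real (snd p)) = F (fst p) (snd p) $$ q"
    using g(2) by (intro eventually_ball_finite ballI) (auto simp: split_beta')
  then have GF: "\<forall>\<^sub>F (x, t) in nhds (0, 0). G (complex_of_real x) (complex_of_real t) = F x t"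
    using dim by eventually_elim (auto simp: G_def split_beta')
  have "herm_family d G"
    unfolding herm_family_def
  proof (intro conjI allI impI)
    show "G z w \<in> carrier_mat d d" for z w by (simp add: G_def)
    show "hol2 (\<lambda>z w. G z w $$ (i, j))" if "i < d" "j < d" for i j
      using g(1)[of "(i, j)"] that by (simp add: Gij)
    show "\<forall>\<^sub>F (x, t) in nhds (0, 0). hermitian_mat (G (complex_of_real x) (complex_of_real t))"
      using herm GF by eventually_elim (auto simp: split_beta')
  qed
  moreover have F0: "F 0 0 \<in> carrier_mat d d" using eventually_nhds_x_imp_x[OF dim] by simp
  have s1: "\<forall>\<^sub>F x in nhds 0. G (complex_of_real x) 0 = F x 0"
  proof -
    have "filterlim (\<lambda>x. (x, 0)) (nhds (0, 0)) (nhds (0::real))"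
      unfolding nhds_prod by (intro filterlim_Pair filterlim_ident tendsto_const)
    from eventually_compose_filterlim[OF GF this] show ?thesis by simp
  qed
  have s2: "\<forall>\<^sub>F t in nhds 0. G 0 (complex_of_real t) = F 0 t"
    using eventually_nhds_00_slice[OF GF] by simp
  have "vector_derivative (\<lambda>x. F x 0 $$ (i, j)) (at 0) = deriv (\<lambda>z. G z 0 $$ (i, j)) 0" if "i < d" "j < d" for i j
  proof (rule analytic_vector_derivative_at_0)
    show "(\<lambda>z. G z 0 $$ (i, j)) analytic_on {0}" unfolding Gij[OF that] by (rule hol2_restrict_fst) (use g that in auto)
    show "\<forall>\<^sub>F t in nhds 0. G (complex_of_real t) 0 $$ (i, j) = F t 0 $$ (i, j)" using s1 by eventually_elim simp
  qed
  then have "mat_partial1 F 0 0 = mat d d (\<lambda>(i, j). deriv (\<lambda>z. G z 0 $$ (i, j)) 0)"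
    using F0 by (intro eq_matI) (auto simp: mat_partial1_def mat_deriv_def)
  moreover have "vector_derivative (\<lambda>t. F 0 t $$ (i, j)) (at 0) = deriv (\<lambda>w. G 0 w $$ (i, j)) 0" if "i < d" "j < d" for i j
  proof (rule analytic_vector_derivative_at_0)
    show "(\<lambda>w. G 0 w $$ (i, j)) analytic_on {0}" unfolding Gij[OF that] by (rule hol2_restrict_snd) (use g that in auto)
    show "\<forall>\<^sub>F t in nhds 0. G 0 (complex_of_real t) $$ (i, j) = F 0 t $$ (i, j)" using s2 by eventually_elim simp
  qed
  then have "mat_partial2 F 0 0 = mat d d (\<lambda>(i, j). deriv (\<lambda>w. G 0 w $$ (i, j)) 0)"
    using F0 by (intro eq_matI) (auto simp: mat_partial2_def mat_deriv_def)
  ultimately show ?thesis using GF that by blast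
qed

lemma positive_family_branches:
  assumes F: "herm_family d F" "F 0 0 = 0\<^sub>m d d" and P: "pos_def_mat P" "P \<in> carrier_mat d d"
    and PF: "\<And>i j. i < d \<Longrightarrow> j < d \<Longrightarrow> P $$ (i, j) = deriv (\<lambda>z. F z 0 $$ (i, j)) 0"
    and Q: "Q \<in> carrier_mat d d"
    and QF: "\<And>i j. i < d \<Longrightarrow> j < d \<Longrightarrow> Q $$ (i, j) = deriv (\<lambda>w. F 0 w $$ (i, j)) 0"
  obtains L where "branches d F L"
    "image_mset (\<lambda>l. complex_of_real (Re (deriv l 0))) L = eigenvalue_mset (- (inv_sqrt_mat P * Q * inv_sqrt_mat P))"
proof -
  define R where "R = inv_sqrt_mat P"
  have R: "R \<in> carrier_mat d d" "hermitian_mat R" "R * P * R = 1\<^sub>m d"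
    using inv_sqrt_mat_props[OF P] by (auto simp: R_def pos_def_mat_def)
  then have R': "mat_adjoint R = R" by (simp add: hermitian_mat_def)
  \<comment> \<open>\<open>P * R\<close> is the inverse of \<open>R\<close>, the witness that
    Sylvester's law asks for.\<close>
  have S: "P * R \<in> carrier_mat d d" "R * (P * R) = 1\<^sub>m d"
    using R P(2) by (auto simp: square_mult_assoc[where n = d] square_mult_closed)
  define G where "G z w = R * F z w * R" for z w
  note Fc = herm_family_carrier[OF F(1)]
  have G: "herm_family d G"
    using herm_family_congruence[OF F(1) R(1)] by (simp add: R' G_def[abs_def])
  have G0: "G 0 0 = 0\<^sub>m d d" using R(1) by (simp add: G_def F(2))
  have Gz: "((\<lambda>z. G z 0 $$ (i, j)) has_field_derivative (R * P * R) $$ (i, j)) (at 0)" if "i < d" "j < d" for i j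
    unfolding G_def
  proof (rule has_field_derivative_sandwich[OF R(1) R(1) Fc P(2) _ that])
    fix i j assume ij: "i < d" "j < d"
    show "((\<lambda>z. F z 0 $$ (i, j)) has_field_derivative P $$ (i, j)) (at 0)"
      unfolding PF[OF ij] by (intro analytic_has_deriv_at_0 hol2_restrict_fst herm_family_hol2[OF F(1) ij])
  qed
  have uG: "unit_deriv d G"
    unfolding unit_deriv_def
  proof (intro allI impI)
    fix i j assume ij: "i < d" "j < d"
    from DERIV_imp_deriv[OF Gz[OF ij]] ij show "deriv (\<lambda>z. G z 0 $$ (i, j)) 0 = (if i = j then 1 else 0)"
      by (simp add: R(3))
  qed
  define W where "W = R * Q * R"
  have W: "W \<in> carrier_mat d d" using R Q by (simp add: W_def square_mult_closed)
  have Gw: "((\<lambda>w. G 0 w $$ (i, j)) has_field_derivative W $$ (i, j)) (at 0)" if "i < d" "j < d" for i j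
    unfolding G_def W_def
  proof (rule has_field_derivative_sandwich[OF R(1) R(1) Fc Q _ that])
    fix i j assume ij: "i < d" "j < d"
    show "((\<lambda>w. F 0 w $$ (i, j)) has_field_derivative Q $$ (i, j)) (at 0)"
      unfolding QF[OF ij] by (intro analytic_has_deriv_at_0 hol2_restrict_snd herm_family_hol2[OF F(1) ij])
  qed
  have WG: "W $$ (i, j) = deriv (\<lambda>w. G 0 w $$ (i, j)) 0" if "i < d" "j < d" for i j
    using DERIV_imp_deriv[OF Gw[OF that]] by simp
  from analytic_branches[OF G G0 uG] obtain L where L: "branches d G L" ..
  have hW: "hermitian_mat W" and sl: "image_mset (\<lambda>l. Re (deriv l 0)) L = real_eigs (- W)"
    using slopes_eq[OF G G0 uG L W WG] by auto
  have "eigenvalue_mset (- W) = image_mset complex_of_real (real_eigs (- W))"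
    by (rule eigenvalue_mset_real_eigs[OF hermitian_mat_uminus[OF hW W]]) (use W in simp)
  then have sl': "image_mset (\<lambda>l. complex_of_real (Re (deriv l 0))) L = eigenvalue_mset (- W)"
    unfolding sl[symmetric] by (simp add: multiset.map_comp comp_def)
  have "\<forall>\<^sub>F (x, t) in nhds (0, 0). hermitian_mat (F (complex_of_real x) (complex_of_real t))"
    using F by (simp add: herm_family_def)
  moreover have "\<forall>\<^sub>F (x, t) in nhds (0, 0).
        neg_inertia (G (complex_of_real x) (complex_of_real t)) = size {#l \<in># L. Re (l (complex_of_real t)) > x#} \<and>
        neg_inertia (- G (complex_of_real x) (complex_of_real t)) = size {#l \<in># L. Re (l (complex_of_real t)) < x#}"
    using L by (simp add: branches_def)
  ultimately have "\<forall>\<^sub>F (x, t) in nhds (0, 0).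
        neg_inertia (F (complex_of_real x) (complex_of_real t)) = size {#l \<in># L. Re (l (complex_of_real t)) > x#} \<and>
        neg_inertia (- F (complex_of_real x) (complex_of_real t)) = size {#l \<in># L. Re (l (complex_of_real t)) < x#}"
  proof eventually_elim
    case (elim p)
    then have "hermitian_mat (F (complex_of_real (fst p)) (complex_of_real (snd p)))" by (simp add: split_beta')
    from neg_inertia_congruence[OF this Fc R(1) S] neg_inertia_congruence_uminus[OF this Fc R(1) S] elim
    show ?case by (simp add: split_beta' R' G_def)
  qed
  with L have "branches d F L" by (simp add: branches_def)
  then show ?thesis using sl' that by (simp add: W_def R_def)
qed

lemma tame_analytic:
  assumes "real_analytic_at g 0"
  shows "tame g"
proof -
  from real_analytic_complexification[OF assms] obtain l where
    l: "l analytic_on {0}" "\<forall>\<^sub>F t in nhds 0. l (complex_of_real t) = complex_of_real (g t)" .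
  from analytic_rate_dichotomy[OF l] show ?thesis
    unfolding tame_def has_rate_iff
    by (auto simp: eventually_at_filter elim: eventually_mono intro: tendsto_at_imp_at_right)
qed

lemma filterlim_shift_at_right_0:
  assumes "q \<ge> 1"
  shows "filterlim (\<lambda>t. (C * t ^ q, t)) (nhds (0, 0)) (at_right (0::real))"
proof -
  have "((\<lambda>t. C * t ^ q) \<longlongrightarrow> C * 0) (at_right (0::real))"
    using assms by (intro tendsto_mult tendsto_const tendsto_power_at_right_0) simp
  moreover have "((\<lambda>t::real. t) \<longlongrightarrow> 0) (at_right 0)" by (rule tendsto_ident_at)
  ultimately show ?thesis unfolding nhds_prod by (intro filterlim_Pair) auto
qed

lemma card_abs_gt:
  fixes f :: "'k \<Rightarrow> real"
  assumes "finite K" "c > 0"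
  shows "card {k \<in> K. \<bar>f k\<bar> > c} = card {k \<in> K. f k > c} + card {k \<in> K. f k < - c}"
proof -
  have "{k \<in> K. \<bar>f k\<bar> > c} = {k \<in> K. f k > c} \<union> {k \<in> K. f k < - c}" by (auto simp: abs_if)
  then show ?thesis using assms by (simp add: card_Un_disjnt disjnt_def disjoint_iff)
qed

text \<open>At x = C t^q, branches above \<open>x\<close> are compared with eigenvalues of F(0,t)
  below negative multiples of \<open>x\<close>, and branches below \<open>- x\<close> with
  eigenvalues above positive ones: a negative eigenvalue produces a positive branch. Adding both
  comparisons gives the inequalities in absolute values that \<open>card_rates_eq\<close>
  needs.\<close>

lemma card_rates_branches:
  fixes lam mu :: "'k \<Rightarrow> real \<Rightarrow> real"
  assumes F: "herm_family d F" and P: "pos_def_mat P" "P \<in> carrier_mat d d"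
    and PF: "\<And>i j. i < d \<Longrightarrow> j < d \<Longrightarrow> P $$ (i, j) = deriv (\<lambda>z. F z 0 $$ (i, j)) 0"
    and K: "finite K" and tame: "\<And>k. k \<in> K \<Longrightarrow> tame (lam k)" "\<And>k. k \<in> K \<Longrightarrow> tame (mu k)"
    and lam: "\<forall>\<^sub>F (x, t) in nhds (0, 0).
      neg_inertia (F (complex_of_real x) (complex_of_real t)) = card {k \<in> K. lam k t > x} \<and>
      neg_inertia (- F (complex_of_real x) (complex_of_real t)) = card {k \<in> K. lam k t < x}"
    and mu: "\<forall>\<^sub>F t in nhds 0. real_eigs (F 0 (complex_of_real t)) = image_mset (\<lambda>k. mu k t) (mset_set K)"
  shows "card {k \<in> K. has_rate (lam k) p} = card {k \<in> K. has_rate (mu k) p}"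
proof -
  obtain \<alpha> \<beta> where ab: "\<alpha> > 0" "\<beta> > 0" and sb: "\<forall>\<^sub>F (x, t) in nhds (0, 0).
    (x > 0 \<longrightarrow> size {#r \<in># real_eigs (F 0 (complex_of_real t)). r < - (\<beta> * x)#} \<le> neg_inertia (F (complex_of_real x) (complex_of_real t)) \<and>
      neg_inertia (F (complex_of_real x) (complex_of_real t)) \<le> size {#r \<in># real_eigs (F 0 (complex_of_real t)). r < - (\<alpha> * x)#} \<and>
      size {#r \<in># real_eigs (F 0 (complex_of_real t)). r > \<beta> * x#} \<le> neg_inertia (- F (complex_of_real (- x)) (complex_of_real t)) \<and>
      neg_inertia (- F (complex_of_real (- x)) (complex_of_real t)) \<le> size {#r \<in># real_eigs (F 0 (complex_of_real t)). r > \<alpha> * x#})"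
    by (rule inertia_shift_bounds[OF F P PF])
  show ?thesis
  proof (rule card_rates_eq[OF K tame ab])
    fix q :: nat and C :: real assume q: "q \<ge> 1" and C: "C > 0"
    note fl = filterlim_shift_at_right_0[OF q, of C]
    have fl': "filterlim (\<lambda>t. (- (C * t ^ q), t)) (nhds (0, 0)) (at_right (0::real))"
      using filterlim_shift_at_right_0[OF q, of "- C"] by simp
    have mu0: "\<forall>\<^sub>F t in at_right 0. real_eigs (F 0 (complex_of_real t)) = image_mset (\<lambda>k. mu k t) (mset_set K)"
      using mu unfolding eventually_at_filter by eventually_elim simp
    have pos: "\<forall>\<^sub>F t in at_right 0. t > (0::real)" by (rule eventually_at_right_less)
    show "\<forall>\<^sub>F t in at_right 0.
      card {k \<in> K. \<bar>mu k t\<bar> > \<beta> * C * t ^ q} \<le> card {k \<in> K. \<bar>lam k t\<bar> > C * t ^ q} \<and>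
      card {k \<in> K. \<bar>lam k t\<bar> > C * t ^ q} \<le> card {k \<in> K. \<bar>mu k t\<bar> > \<alpha> * C * t ^ q}"
      using mu0 pos eventually_compose_filterlim[OF sb fl] eventually_compose_filterlim[OF lam fl] eventually_compose_filterlim[OF lam fl']
    proof eventually_elim
      case (elim t)
      define x where "x = C * t ^ q"
      have x: "x > 0" using elim(2) C by (simp add: x_def)
      have sz: "size {#r \<in># real_eigs (F 0 (complex_of_real t)). R r#} = card {k \<in> K. R (mu k t)}" for R
        using K by (simp add: elim(1) filter_mset_image_mset comp_def filter_mset_mset_set)
      have *: "card {k \<in> K. mu k t < - (\<beta> * x)} \<le> card {k \<in> K. lam k t > x}"
        "card {k \<in> K. lam k t > x} \<le> card {k \<in> K. mu k t < - (\<alpha> * x)}"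
        "card {k \<in> K. mu k t > \<beta> * x} \<le> card {k \<in> K. lam k t < - x}"
        "card {k \<in> K. lam k t < - x} \<le> card {k \<in> K. mu k t > \<alpha> * x}"
        using elim(3-5) x by (simp_all add: sz flip: x_def)
      show ?case
        unfolding mult.assoc x_def[symmetric]
        using * card_abs_gt[OF K x, of "\<lambda>k. lam k t"]
          card_abs_gt[OF K mult_pos_pos[OF ab(1) x], of "\<lambda>k. mu k t"]
          card_abs_gt[OF K mult_pos_pos[OF ab(2) x], of "\<lambda>k. mu k t"] by simp
    qed
  qed
qed

theorem theorem6p1:
  fixes F :: "real \<Rightarrow> real \<Rightarrow> complex mat" and d :: nat and U :: "(real \<times> real) set"
  assumes "open U" and "(0, 0) \<in> U"
    and dim: "\<And>x t. (x, t) \<in> U \<Longrightarrow> F x t \<in> carrier_mat d d"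
    and analytic: "\<And>x t i j. (x, t) \<in> U \<Longrightarrow> i < d \<Longrightarrow> j < d \<Longrightarrow>
           real_analytic2_at (\<lambda>x t. F x t $$ (i, j)) x t"
    and hermitian: "\<And>x t. (x, t) \<in> U \<Longrightarrow> hermitian_mat (F x t)"
    and zero: "F 0 0 = 0\<^sub>m d d"
    and pos: "pos_def_mat (mat_partial1 F 0 0)"
  shows "\<exists>lam :: nat \<Rightarrow> real \<Rightarrow> real.
     (\<forall>k\<in>{1..d}. (\<forall>\<^sub>F t in nhds 0. real_analytic_at (lam k) t) \<and> lam k 0 = 0) \<and>
     (\<forall>\<^sub>F (x, t) in nhds (0, 0). det (F x t) = 0 \<longleftrightarrow> x \<in> {lam k t | k. k \<in> {1..d}}) \<and>
     \<comment> \<open>(a)\<close>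
     (\<forall>\<^sub>F t in at_right 0. card {k \<in> {1..d}. lam k t > 0} = neg_inertia (F 0 t)) \<and>
     \<comment> \<open>(b)\<close>
     (\<forall>k\<in>{1..d}. (\<forall>\<^sub>F t in nhds 0. lam k t = 0) \<or> (\<exists>p\<ge>1. has_rate (lam k) p)) \<and>
     (\<exists>mu. analytic_eigenvalue_labeling d (\<lambda>t. F 0 t) mu) \<and>
     (\<forall>mu. analytic_eigenvalue_labeling d (\<lambda>t. F 0 t) mu \<longrightarrow>
        (\<forall>p. card {k \<in> {1..d}. has_rate (lam k) p} = card {k \<in> {1..d}. has_rate (mu k) p})) \<and>
     \<comment> \<open>(c)\<close>
     {# complex_of_real (deriv (lam k) 0). k \<in># mset_set {1..d} #} =
        eigenvalue_mset (- (inv_sqrt_mat (mat_partial1 F 0 0) * mat_partial2 F 0 0 * inv_sqrt_mat (mat_partial1 F 0 0))) \<and>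
     {# complex_of_real (deriv (lam k) 0). k \<in># mset_set {1..d} #} =
        proots (pencil_poly (mat_partial1 F 0 0) (mat_partial2 F 0 0))"
proof -
  have inU: "\<forall>\<^sub>F p in nhds (0, 0). p \<in> U" using assms(1,2) by (rule eventually_nhds_in_open)
  have dimU: "\<forall>\<^sub>F (x, t) in nhds (0, 0). F x t \<in> carrier_mat d d"
    using inU by eventually_elim (use dim in auto)
  have hermU: "\<forall>\<^sub>F (x, t) in nhds (0, 0). hermitian_mat (F x t)"
    using inU by eventually_elim (use hermitian in auto)
  obtain G where G: "herm_family d G"
    and GF: "\<forall>\<^sub>F (x, t) in nhds (0, 0). G (complex_of_real x) (complex_of_real t) = F x t"
    and P_eq: "mat_partial1 F 0 0 = mat d d (\<lambda>(i, j). deriv (\<lambda>z. G z 0 $$ (i, j)) 0)"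
    and Q_eq: "mat_partial2 F 0 0 = mat d d (\<lambda>(i, j). deriv (\<lambda>w. G 0 w $$ (i, j)) 0)"
    by (rule mat_complexification[OF analytic[OF assms(2)] dimU hermU])
  define P where "P = mat_partial1 F 0 0"
  define Q where "Q = mat_partial2 F 0 0"
  have P: "pos_def_mat P" "P \<in> carrier_mat d d" using pos by (simp_all add: P_def, simp add: P_eq)
  have Q: "Q \<in> carrier_mat d d" by (simp add: Q_def Q_eq)
  have PG: "P $$ (i, j) = deriv (\<lambda>z. G z 0 $$ (i, j)) 0" if "i < d" "j < d" for i j
    using that by (simp add: P_def P_eq)
  have QG: "Q $$ (i, j) = deriv (\<lambda>w. G 0 w $$ (i, j)) 0" if "i < d" "j < d" for i j
    using that by (simp add: Q_def Q_eq)
  have G0: "G 0 0 = 0\<^sub>m d d" using eventually_nhds_x_imp_x[OF GF] zero by simp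
  note Gc = herm_family_carrier[OF G]
  have hG: "\<forall>\<^sub>F (x, t) in nhds (0, 0). hermitian_mat (G (complex_of_real x) (complex_of_real t))"
    using G by (simp add: herm_family_def)
  have GF0: "\<forall>\<^sub>F t in nhds 0. G 0 (complex_of_real t) = F 0 t" using eventually_nhds_00_slice[OF GF] by simp
  have hG0: "\<forall>\<^sub>F t in nhds 0. hermitian_mat (G 0 (complex_of_real t))" using eventually_nhds_00_slice[OF hG] by simp
  obtain L where L: "branches d G L"
    and slopes: "image_mset (\<lambda>l. complex_of_real (Re (deriv l 0))) L = eigenvalue_mset (- (inv_sqrt_mat P * Q * inv_sqrt_mat P))"
    by (rule positive_family_branches[OF G G0 P PG Q QG])
  obtain ls where ls: "mset ls = L" by (metis ex_mset)
  have len: "length ls = d" using L by (auto simp: branches_def simp flip: ls)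
  have l: "ls ! (k - 1) analytic_on {0}" "(ls ! (k - 1)) 0 = 0" "\<forall>\<^sub>F t in nhds 0. (ls ! (k - 1)) (complex_of_real t) \<in> \<real>"
    if "k \<in> {1..d}" for k
  proof -
    have "k - 1 < length ls" using that len by auto
    then have "ls ! (k - 1) \<in># L" by (simp flip: ls)
    then show "ls ! (k - 1) analytic_on {0}" "(ls ! (k - 1)) 0 = 0" "\<forall>\<^sub>F t in nhds 0. (ls ! (k - 1)) (complex_of_real t) \<in> \<real>"
      using L by (auto simp: branches_def)
  qed
  define lam where "lam k t = Re ((ls ! (k - 1)) (complex_of_real t))" for k t
  have lam_part: "\<forall>\<^sub>F t in nhds 0. real_analytic_at (lam k) t"
    "(\<forall>\<^sub>F t in nhds 0. lam k t = 0) \<or> (\<exists>p\<ge>1. has_rate (lam k) p)"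
    "(lam k has_real_derivative Re (deriv (ls ! (k - 1)) 0)) (at 0)" if "k \<in> {1..d}" for k
    unfolding lam_def[abs_def] by (rule branch_real_part[OF l[OF that]])+
  have lam0: "lam k 0 = 0" if "k \<in> {1..d}" for k using l(2)[OF that] by (simp add: lam_def)
  have cardL: "card {k \<in> {1..d}. R (lam k t)} = size {#l \<in># L. R (Re (l (complex_of_real t)))#}" for R t
    using card_nth[of ls "\<lambda>l. R (Re (l (complex_of_real t)))"] by (simp add: len ls lam_def)
  have "\<forall>\<^sub>F (x, t) in nhds (0, 0).
        neg_inertia (G (complex_of_real x) (complex_of_real t)) = size {#l \<in># L. Re (l (complex_of_real t)) > x#} \<and>
        neg_inertia (- G (complex_of_real x) (complex_of_real t)) = size {#l \<in># L. Re (l (complex_of_real t)) < x#}"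
    using L by (simp add: branches_def)
  then have lamG: "\<forall>\<^sub>F (x, t) in nhds (0, 0).
      neg_inertia (G (complex_of_real x) (complex_of_real t)) = card {k \<in> {1..d}. lam k t > x} \<and>
      neg_inertia (- G (complex_of_real x) (complex_of_real t)) = card {k \<in> {1..d}. lam k t < x}"
    by (simp only: cardL[of "\<lambda>y. y > x" t for x t] cardL[of "\<lambda>y. y < x" t for x t])
  have 1: "(\<forall>\<^sub>F t in nhds 0. real_analytic_at (lam k) t) \<and> lam k 0 = 0" if "k \<in> {1..d}" for k
    using lam_part(1)[OF that] lam0[OF that] by simp
  have 2: "\<forall>\<^sub>F (x, t) in nhds (0, 0). det (F x t) = 0 \<longleftrightarrow> x \<in> {lam k t | k. k \<in> {1..d}}"
    using GF lamG hG
  proof eventually_elim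
    case (elim p)
    obtain x t where p: "p = (x, t)" by (cases p)
    let ?A = "G (complex_of_real x) (complex_of_real t)"
    have A: "hermitian_mat ?A" "?A \<in> carrier_mat d d" using elim Gc[of "complex_of_real x" "complex_of_real t"] by (auto simp: p)
    \<comment> \<open>The branches not counted above or below \<open>x\<close> pass through
      \<open>(x, t)\<close>; by \<open>inertia_sum\<close> their number is the nullity.\<close>
    have "{1..d} = {k \<in> {1..d}. lam k t > x} \<union> ({k \<in> {1..d}. lam k t < x} \<union> {k \<in> {1..d}. lam k t = x})" by auto
    then have "d = card ({k \<in> {1..d}. lam k t > x} \<union> ({k \<in> {1..d}. lam k t < x} \<union> {k \<in> {1..d}. lam k t = x}))"
      by (metis card_atLeastAtMost diff_Suc_1)
    also have "\<dots> = card {k \<in> {1..d}. lam k t > x} + (card {k \<in> {1..d}. lam k t < x} + card {k \<in> {1..d}. lam k t = x})"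
      by (subst card_Un_disjnt; (subst card_Un_disjnt)?) (auto simp: disjnt_def)
    finally have "count (real_eigs ?A) 0 = card {k \<in> {1..d}. lam k t = x}"
      using inertia_sum[OF A] elim by (simp add: p)
    then have "det (F x t) = 0 \<longleftrightarrow> {k \<in> {1..d}. lam k t = x} \<noteq> {}"
      using det_zero_real_eigs[OF A] elim by (simp add: p card_eq_0_iff)
    then show ?case by (auto simp: p)
  qed
  have a: "\<forall>\<^sub>F t in at_right 0. card {k \<in> {1..d}. lam k t > 0} = neg_inertia (F 0 t)"
  proof -
    have "\<forall>\<^sub>F t in nhds 0. card {k \<in> {1..d}. lam k t > 0} = neg_inertia (F 0 t)"
      using eventually_nhds_00_slice[OF lamG] GF0 by eventually_elim simp
    then show ?thesis unfolding eventually_at_filter by eventually_elim simp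
  qed
  have b1: "(\<forall>\<^sub>F t in nhds 0. lam k t = 0) \<or> (\<exists>p\<ge>1. has_rate (lam k) p)" if "k \<in> {1..d}" for k
    by (rule lam_part(2)[OF that])
  have b2: "\<exists>mu. analytic_eigenvalue_labeling d (\<lambda>t. F 0 t) mu"
  proof -
    obtain M where M: "size M = d"
      "\<forall>l\<in>#M. l analytic_on {0} \<and> l 0 = 0 \<and> (\<forall>\<^sub>F t in nhds 0. l (complex_of_real t) \<in> \<real>)"
      "\<forall>\<^sub>F t in nhds 0. real_eigs (G 0 (complex_of_real t)) = image_mset (\<lambda>l. Re (l (complex_of_real t))) M"
      by (rule eigenvalue_branches[OF G G0])
    obtain ms where ms: "mset ms = M" by (metis ex_mset)
    have len: "length ms = d" using M(1) by (auto simp flip: ms)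
    define mu where "mu k t = Re ((ms ! (k - 1)) (complex_of_real t))" for k t
    have "\<forall>\<^sub>F t in nhds 0. real_analytic_at (mu k) t" if "k \<in> {1..d}" for k
    proof -
      have "k - 1 < length ms" using that len by auto
      then have "ms ! (k - 1) \<in># M" by (simp flip: ms)
      then show ?thesis unfolding mu_def[abs_def] using M(2) by (intro branch_real_part(1)) auto
    qed
    moreover have "\<forall>\<^sub>F t in nhds 0. eigenvalue_mset (F 0 t) = {# complex_of_real (mu k t). k \<in># mset_set {1..d} #}"
      using M(3) hG0 GF0
    proof eventually_elim
      case (elim t)
      then show ?case
        using eigenvalue_mset_real_eigs[OF elim(2) Gc]
          image_mset_nth[of "\<lambda>l. complex_of_real (Re (l (complex_of_real t)))" ms]
        by (simp add: len ms mu_def multiset.map_comp comp_def)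
    qed
    ultimately show ?thesis unfolding analytic_eigenvalue_labeling_def by blast
  qed
  have b3: "card {k \<in> {1..d}. has_rate (lam k) p} = card {k \<in> {1..d}. has_rate (mu k) p}"
    if mu: "analytic_eigenvalue_labeling d (\<lambda>t. F 0 t) mu" for mu p
  \<comment> \<open>The labelling \<open>mu\<close> is arbitrary; it enters through analyticity at 0
    and through the multiset of its values.\<close>
  proof (rule card_rates_branches[OF G P PG finite_atLeastAtMost _ _ lamG])
    have "real_analytic_at (mu k) 0" if "k \<in> {1..d}" for k
      using mu that by (auto simp: analytic_eigenvalue_labeling_def dest: eventually_nhds_x_imp_x)
    then show "tame (mu k)" if "k \<in> {1..d}" for k using that by (intro tame_analytic) auto
    have "real_analytic_at (lam k) 0" if "k \<in> {1..d}" for k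
      using 1[OF that] by (auto dest: eventually_nhds_x_imp_x)
    then show "tame (lam k)" if "k \<in> {1..d}" for k using that by (intro tame_analytic) auto
    have "\<forall>\<^sub>F t in nhds 0. eigenvalue_mset (F 0 t) = {# complex_of_real (mu k t). k \<in># mset_set {1..d} #}"
      using mu by (simp add: analytic_eigenvalue_labeling_def)
    then show "\<forall>\<^sub>F t in nhds 0. real_eigs (G 0 (complex_of_real t)) = image_mset (\<lambda>k. mu k t) (mset_set {1..d})"
      using GF0 by eventually_elim (simp add: real_eigs_def multiset.map_comp comp_def)
  qed
  have "deriv (lam k) 0 = Re (deriv (ls ! (k - 1)) 0)" if "k \<in> {1..d}" for k
    using lam_part(3)[OF that] by (rule DERIV_imp_deriv)
  then have "{# complex_of_real (deriv (lam k) 0). k \<in># mset_set {1..d} #} =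
      {# complex_of_real (Re (deriv (ls ! (k - 1)) 0)). k \<in># mset_set {1..d} #}"
    by (intro image_mset_cong) simp
  also have "\<dots> = image_mset (\<lambda>l. complex_of_real (Re (deriv l 0))) L"
    using image_mset_nth[of "\<lambda>l. complex_of_real (Re (deriv l 0))" ls] by (simp add: len ls)
  finally have c: "{# complex_of_real (deriv (lam k) 0). k \<in># mset_set {1..d} #} =
      eigenvalue_mset (- (inv_sqrt_mat P * Q * inv_sqrt_mat P))"
    unfolding slopes .
  note pencil = proots_pencil_poly[OF P(2) Q inv_sqrt_mat_props(1)[OF P] inv_sqrt_mat_props(3)[OF P]]
  show ?thesis
    using 1 2 a b1 b2 b3 c pencil unfolding P_def Q_def
    by (intro exI[of _ lam], intro conjI ballI allI impI) simp_all
qed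

end
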